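(* Let $(\mathcal{K},\mathcal{O},k)$ be a $p$-modular system. Let $G$ be a finite group, $N$ a normal subgroup of $G$, $G'$ a subgroup of $G$, and $N'$ a normal subgroup of $G'$ such that $N'=G'\cap N$ and $G=G'N$; write $\bar G:=G/N\simeq G'/N'$. Let $b\in Z(\mathcal{O}N)$ and $b'\in Z(\mathcal{O}N')$ be $\bar G$-invariant block idempotents, and put $B:=b\mathcal{O}N$, $B':=b'\mathcal{O}N'$, $C:=b\mathcal{O}NC_G(N)$, $C':=b'\mathcal{O}N'C_G(N)$ and $\bar C_G(N):=NC_G(N)/N$. Let $M$ be a $(B,B')$-bimodule. Assume that: (1) $C_G(N)\subseteq G'$; (2) $M$ induces a Morita equivalence between $B$ and $B'$; (3) $zm=mz$ for all $m\in M$ and $z\in Z(N)$. Then there is a $\bar C_G(N)$-graded Morita equivalence between $C$ and $C'$, induced by the $\bar C_G(N)$-graded $(C,C')$-bimodule $$C\otimes_B M\simeq M\otimes_{B'}C'\simeq (C\otimes_{\mathcal{O}} C'^{\mathrm{op}})\otimes_{\Delta(C\otimes C'^{\mathrm{op}})}M.$$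
   Context: Under hypothesis (1), $NC_G(N)/N\simeq N'C_G(N)/N'$ (via inclusion), and $C$, $C'$ are strongly $\bar C_G(N)$-graded algebras with identity components $B$, $B'$, the grading being by cosets of $N$, respectively $N'$. Also $Z(N)\subseteq C_G(N)\cap N\subseteq G'\cap N=N'$, so that (3) makes sense. The diagonal subalgebra is $\Delta(C\otimes C'^{\mathrm{op}}):=\bigoplus_{x\in\bar C_G(N)}C_x\otimes_{\mathcal{O}} C'_{x^{-1}}\subseteq C\otimes_{\mathcal{O}} C'^{\mathrm{op}}$; its identity component is $B\otimes_{\mathcal{O}} B'^{\mathrm{op}}$. A $\bar C_G(N)$-graded $(C,C')$-bimodule structure on $C\otimes_B M$ with identity component $M$ amounts to an extension of the $B\otimes_{\mathcal{O}}B'^{\mathrm{op}}$-module structure of $M$ to a $\Delta(C\otimes C'^{\mathrm{op}})$-module structure; this is the structure on $M$ referred to in the displayed isomorphisms, which are isomorphisms of $\bar C_G(N)$-graded $(C,C')$-bimodules. The assertion includes the existence of such a structure. For a finite group $\Gamma$ and strongly $\Gamma$-graded algebras $R,R'$, a $\Gamma$-graded $(R,R')$-bimodule $\tilde X$ induces a $\Gamma$-graded Morita equivalence between $R$ and $R'$ if $\tilde X\otimes_{R'}\tilde X^*\cong R$ as $\Gamma$-graded $(R,R)$-bimodules and $\tilde X^*\otimes_R\tilde X\cong R'$ as $\Gamma$-graded $(R',R')$-bimodules, where $\tilde X^*=\mathrm{Hom}_R(\tilde X,R)$ is regarded as a $\Gamma$-graded $(R',R)$-bimodule. *)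

theory Defs
  imports "HOL-Algebra.Algebra"
begin

section \<open>$p$-modular systems\<close>

locale discrete_valuation_ring = principal_domain R for R (structure) +
  assumes local: "\<exists>!I. maximalideal I R"
    and not_field: "\<not> field R"

text \<open>Completeness for the topology given by the maximal ideal $J(R)$; if \<open>t\<close> generates
  $J(R)$, then $J(R)^n$ is generated by $t^n$.\<close>

locale complete_discrete_valuation_ring = discrete_valuation_ring +
  assumes complete:
    "\<lbrakk>t \<in> carrier R; maximalideal (PIdl t) R; s \<in> UNIV \<rightarrow> carrier R;
      \<And>n::nat. s (Suc n) \<ominus> s n \<in> PIdl (t [^] n)\<rbrakk>
     \<Longrightarrow> \<exists>l\<in>carrier R. \<forall>n::nat. s n \<ominus> l \<in> PIdl (t [^] n)"

definition field_of_fractions ::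
    "('o, 'x) ring_scheme \<Rightarrow> ('K, 'y) ring_scheme \<Rightarrow> bool" where
  "field_of_fractions R K \<longleftrightarrow> field K \<and>
    (\<exists>\<iota>\<in>ring_hom R K. inj_on \<iota> (carrier R) \<and>
      (\<forall>x\<in>carrier K. \<exists>a\<in>carrier R. \<exists>d\<in>carrier R - {\<zero>\<^bsub>R\<^esub>}. x = \<iota> a \<otimes>\<^bsub>K\<^esub> inv\<^bsub>K\<^esub> (\<iota> d)))"

locale p_modular_system =
  complete_discrete_valuation_ring \<O> + K: field K + k: field k
  for p :: nat and K (structure) and \<O> (structure) and k (structure) +
  assumes prime: "Factorial_Ring.prime p"
    and fractions: "field_of_fractions \<O> K"
    and char_zero: "\<And>n::nat. 0 < n \<Longrightarrow> [n] \<cdot>\<^bsub>K\<^esub> \<one>\<^bsub>K\<^esub> \<noteq> \<zero>\<^bsub>K\<^esub>"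
    and residue_field: "\<And>J. maximalideal J \<O> \<Longrightarrow> \<O> Quot J \<simeq> k"
    and char_p: "[p] \<cdot>\<^bsub>k\<^esub> \<one>\<^bsub>k\<^esub> = \<zero>\<^bsub>k\<^esub>"


section \<open>Algebras, modules and bimodules\<close>

text \<open>The library's locales \<^locale>\<open>module\<close> and \<^locale>\<open>algebra\<close> only cover commutative
  rings. As in the library, the record of a module has \<open>mult\<close> and \<open>one\<close> fields, which are
  irrelevant for modules and bimodules.\<close>

locale assoc_algebra = module R A + ring A
  for R :: "('o, 'x) ring_scheme" (structure) and A :: "('o, 'a, 'y) module_scheme" (structure) +
  assumes smult_mult_left:
      "\<lbrakk>r \<in> carrier R; x \<in> carrier A; y \<in> carrier A\<rbrakk>
        \<Longrightarrow> (r \<odot>\<^bsub>A\<^esub> x) \<otimes>\<^bsub>A\<^esub> y = r \<odot>\<^bsub>A\<^esub> (x \<otimes>\<^bsub>A\<^esub> y)"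
    and smult_mult_right:
      "\<lbrakk>r \<in> carrier R; x \<in> carrier A; y \<in> carrier A\<rbrakk>
        \<Longrightarrow> x \<otimes>\<^bsub>A\<^esub> (r \<odot>\<^bsub>A\<^esub> y) = r \<odot>\<^bsub>A\<^esub> (x \<otimes>\<^bsub>A\<^esub> y)"

locale left_module = R: ring R + M: abelian_group M
  for R :: "('a, 'x) ring_scheme" (structure) and M :: "('a, 'm, 'y) module_scheme" (structure) +
  assumes smult_closed:
      "\<lbrakk>a \<in> carrier R; x \<in> carrier M\<rbrakk> \<Longrightarrow> a \<odot>\<^bsub>M\<^esub> x \<in> carrier M"
    and smult_l_distr:
      "\<lbrakk>a \<in> carrier R; b \<in> carrier R; x \<in> carrier M\<rbrakk>
        \<Longrightarrow> (a \<oplus>\<^bsub>R\<^esub> b) \<odot>\<^bsub>M\<^esub> x = a \<odot>\<^bsub>M\<^esub> x \<oplus>\<^bsub>M\<^esub> b \<odot>\<^bsub>M\<^esub> x"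
    and smult_r_distr:
      "\<lbrakk>a \<in> carrier R; x \<in> carrier M; y \<in> carrier M\<rbrakk>
        \<Longrightarrow> a \<odot>\<^bsub>M\<^esub> (x \<oplus>\<^bsub>M\<^esub> y) = a \<odot>\<^bsub>M\<^esub> x \<oplus>\<^bsub>M\<^esub> a \<odot>\<^bsub>M\<^esub> y"
    and smult_assoc:
      "\<lbrakk>a \<in> carrier R; b \<in> carrier R; x \<in> carrier M\<rbrakk>
        \<Longrightarrow> (a \<otimes>\<^bsub>R\<^esub> b) \<odot>\<^bsub>M\<^esub> x = a \<odot>\<^bsub>M\<^esub> (b \<odot>\<^bsub>M\<^esub> x)"
    and smult_one: "x \<in> carrier M \<Longrightarrow> \<one>\<^bsub>R\<^esub> \<odot>\<^bsub>M\<^esub> x = x"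

record ('a, 'b, 'm) bimodule = "('a, 'm) module" +
  rsmult :: "'m \<Rightarrow> 'b \<Rightarrow> 'm" (infixl \<open>\<odot>r\<index>\<close> 70)

text \<open>Bimodules over algebras over a commutative ring \<open>\<O>\<close>: the two actions of \<open>\<O>\<close> agree, so
  that an \<open>(R,S)\<close>-bimodule is the same as an $R\otimes_{\mathcal O}S^{op}$-module.\<close>

locale bimodule = R: assoc_algebra \<O> R + S: assoc_algebra \<O> S + left_module R M
  for \<O> :: "('o, 'z) ring_scheme" (structure) and R :: "('o, 'a, 'x) module_scheme" (structure)
    and S :: "('o, 'b, 'y) module_scheme" (structure)
    and M :: "('a, 'b, 'm, 'u) bimodule_scheme" (structure) +
  assumes rsmult_closed:
      "\<lbrakk>x \<in> carrier M; s \<in> carrier S\<rbrakk> \<Longrightarrow> x \<odot>r\<^bsub>M\<^esub> s \<in> carrier M"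
    and rsmult_r_distr:
      "\<lbrakk>x \<in> carrier M; s \<in> carrier S; t \<in> carrier S\<rbrakk>
        \<Longrightarrow> x \<odot>r\<^bsub>M\<^esub> (s \<oplus>\<^bsub>S\<^esub> t) = x \<odot>r\<^bsub>M\<^esub> s \<oplus>\<^bsub>M\<^esub> x \<odot>r\<^bsub>M\<^esub> t"
    and rsmult_l_distr:
      "\<lbrakk>x \<in> carrier M; y \<in> carrier M; s \<in> carrier S\<rbrakk>
        \<Longrightarrow> (x \<oplus>\<^bsub>M\<^esub> y) \<odot>r\<^bsub>M\<^esub> s = x \<odot>r\<^bsub>M\<^esub> s \<oplus>\<^bsub>M\<^esub> y \<odot>r\<^bsub>M\<^esub> s"
    and rsmult_assoc:
      "\<lbrakk>x \<in> carrier M; s \<in> carrier S; t \<in> carrier S\<rbrakk>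
        \<Longrightarrow> x \<odot>r\<^bsub>M\<^esub> (s \<otimes>\<^bsub>S\<^esub> t) = (x \<odot>r\<^bsub>M\<^esub> s) \<odot>r\<^bsub>M\<^esub> t"
    and rsmult_one: "x \<in> carrier M \<Longrightarrow> x \<odot>r\<^bsub>M\<^esub> \<one>\<^bsub>S\<^esub> = x"
    and smult_rsmult_assoc:
      "\<lbrakk>a \<in> carrier R; x \<in> carrier M; s \<in> carrier S\<rbrakk>
        \<Longrightarrow> (a \<odot>\<^bsub>M\<^esub> x) \<odot>r\<^bsub>M\<^esub> s = a \<odot>\<^bsub>M\<^esub> (x \<odot>r\<^bsub>M\<^esub> s)"
    and scalars_central:
      "\<lbrakk>r \<in> carrier \<O>; x \<in> carrier M\<rbrakk>
        \<Longrightarrow> (r \<odot>\<^bsub>R\<^esub> \<one>\<^bsub>R\<^esub>) \<odot>\<^bsub>M\<^esub> x = x \<odot>r\<^bsub>M\<^esub> (r \<odot>\<^bsub>S\<^esub> \<one>\<^bsub>S\<^esub>)"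

text \<open>Equip the additive group of \<open>A\<close> with a left action, or with a left and a right action.\<close>

definition module_of ::
    "('m, 'x) ring_scheme \<Rightarrow> ('a \<Rightarrow> 'm \<Rightarrow> 'm) \<Rightarrow> ('a, 'm) module" where
  "module_of A l =
    \<lparr>carrier = carrier A, monoid.mult = (\<otimes>\<^bsub>A\<^esub>), one = \<one>\<^bsub>A\<^esub>,
     ring.zero = \<zero>\<^bsub>A\<^esub>, ring.add = (\<oplus>\<^bsub>A\<^esub>), smult = l\<rparr>"

definition bimodule_of ::
    "('m, 'x) ring_scheme \<Rightarrow> ('a \<Rightarrow> 'm \<Rightarrow> 'm) \<Rightarrow> ('m \<Rightarrow> 'b \<Rightarrow> 'm) \<Rightarrow> ('a, 'b, 'm) bimodule" where
  "bimodule_of A l r =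
    \<lparr>carrier = carrier A, monoid.mult = (\<otimes>\<^bsub>A\<^esub>), one = \<one>\<^bsub>A\<^esub>,
     ring.zero = \<zero>\<^bsub>A\<^esub>, ring.add = (\<oplus>\<^bsub>A\<^esub>),
     smult = l, rsmult = r\<rparr>"

text \<open>A ring as a bimodule over itself, and hence over all of its subrings.\<close>

definition regular :: "('a, 'x) ring_scheme \<Rightarrow> ('a, 'a, 'a) bimodule" where
  "regular A = bimodule_of A (\<otimes>\<^bsub>A\<^esub>) (\<otimes>\<^bsub>A\<^esub>)"

definition bimodule_iso ::
    "('a, 'x) ring_scheme \<Rightarrow> ('b, 'y) ring_scheme \<Rightarrow> ('a, 'b, 'm, 'u) bimodule_scheme \<Rightarrow>
     ('a, 'b, 'n, 'v) bimodule_scheme \<Rightarrow> ('m \<Rightarrow> 'n) \<Rightarrow> bool" where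
  "bimodule_iso R S V W h \<longleftrightarrow>
    bij_betw h (carrier V) (carrier W) \<and>
    (\<forall>x\<in>carrier V. \<forall>y\<in>carrier V. h (x \<oplus>\<^bsub>V\<^esub> y) = h x \<oplus>\<^bsub>W\<^esub> h y) \<and>
    (\<forall>a\<in>carrier R. \<forall>x\<in>carrier V. h (a \<odot>\<^bsub>V\<^esub> x) = a \<odot>\<^bsub>W\<^esub> h x) \<and>
    (\<forall>x\<in>carrier V. \<forall>b\<in>carrier S. h (x \<odot>r\<^bsub>V\<^esub> b) = h x \<odot>r\<^bsub>W\<^esub> b)"

text \<open>\<open>dual R V\<close> is the $(S,R)$-bimodule $\mathrm{Hom}_R(V,R)$ for an $(R,S)$-bimodule \<open>V\<close>.
  Maps are extensional, so that they are determined by their values on \<open>V\<close>.\<close>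

definition dual ::
    "('a, 'x) ring_scheme \<Rightarrow> ('a, 'b, 'm, 'u) bimodule_scheme \<Rightarrow> ('b, 'a, 'm \<Rightarrow> 'a) bimodule" where
  "dual R V =
    \<lparr>carrier = {f \<in> carrier V \<rightarrow>\<^sub>E carrier R.
        (\<forall>x\<in>carrier V. \<forall>y\<in>carrier V. f (x \<oplus>\<^bsub>V\<^esub> y) = f x \<oplus>\<^bsub>R\<^esub> f y) \<and>
        (\<forall>a\<in>carrier R. \<forall>x\<in>carrier V. f (a \<odot>\<^bsub>V\<^esub> x) = a \<otimes>\<^bsub>R\<^esub> f x)},
     monoid.mult = undefined, one = undefined,
     ring.zero = (\<lambda>x\<in>carrier V. \<zero>\<^bsub>R\<^esub>),
     ring.add = (\<lambda>f g. \<lambda>x\<in>carrier V. f x \<oplus>\<^bsub>R\<^esub> g x),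
     smult = (\<lambda>b f. \<lambda>x\<in>carrier V. f (x \<odot>r\<^bsub>V\<^esub> b)),
     rsmult = (\<lambda>f a. \<lambda>x\<in>carrier V. f x \<otimes>\<^bsub>R\<^esub> a)\<rparr>"


section \<open>Tensor products\<close>

abbreviation tensor_free ::
    "('x, 'u) monoid_scheme \<Rightarrow> ('y, 'v) monoid_scheme \<Rightarrow> ('x \<times> 'y \<Rightarrow>\<^sub>0 int) monoid" where
  "tensor_free V W \<equiv> free_Abelian_group (carrier V \<times> carrier W)"

definition tensor_rel ::
    "('r, 'u) ring_scheme \<Rightarrow> ('a, 'r, 'x, 'v) bimodule_scheme \<Rightarrow> ('r, 'y, 'w) module_scheme \<Rightarrow>
     ('x \<times> 'y \<Rightarrow>\<^sub>0 int) set" where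
  "tensor_rel R V W = generate (tensor_free V W)
    ({frag_of (x \<oplus>\<^bsub>V\<^esub> x', y) - frag_of (x, y) - frag_of (x', y) | x x' y.
        x \<in> carrier V \<and> x' \<in> carrier V \<and> y \<in> carrier W} \<union>
     {frag_of (x, y \<oplus>\<^bsub>W\<^esub> y') - frag_of (x, y) - frag_of (x, y') | x y y'.
        x \<in> carrier V \<and> y \<in> carrier W \<and> y' \<in> carrier W} \<union>
     {frag_of (x \<odot>r\<^bsub>V\<^esub> r, y) - frag_of (x, r \<odot>\<^bsub>W\<^esub> y) | x r y.
        x \<in> carrier V \<and> r \<in> carrier R \<and> y \<in> carrier W})"

definition tensor_class ::
    "('r, 'u) ring_scheme \<Rightarrow> ('a, 'r, 'x, 'v) bimodule_scheme \<Rightarrow> ('r, 'y, 'w) module_scheme \<Rightarrow>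
     ('x \<times> 'y \<Rightarrow>\<^sub>0 int) \<Rightarrow> ('x \<times> 'y \<Rightarrow>\<^sub>0 int) set" where
  "tensor_class R V W t = tensor_rel R V W #>\<^bsub>tensor_free V W\<^esub> t"

text \<open>The abelian group $V\otimes_R W$ for a right \<open>R\<close>-module \<open>V\<close> and a left \<open>R\<close>-module \<open>W\<close>
  (the remaining actions on \<open>V\<close> and \<open>W\<close> are not used).\<close>

definition tensor ::
    "('r, 'u) ring_scheme \<Rightarrow> ('a, 'r, 'x, 'v) bimodule_scheme \<Rightarrow> ('r, 'y, 'w) module_scheme \<Rightarrow>
     ('x \<times> 'y \<Rightarrow>\<^sub>0 int) set ring" where
  "tensor R V W = (let Q = tensor_free V W Mod tensor_rel R V W in
    \<lparr>carrier = carrier Q, monoid.mult = undefined, one = undefined,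
     ring.zero = \<one>\<^bsub>Q\<^esub>, ring.add = (\<otimes>\<^bsub>Q\<^esub>)\<rparr>)"

definition pure_tensor ::
    "('r, 'u) ring_scheme \<Rightarrow> ('a, 'r, 'x, 'v) bimodule_scheme \<Rightarrow> ('r, 'y, 'w) module_scheme \<Rightarrow>
     'x \<Rightarrow> 'y \<Rightarrow> ('x \<times> 'y \<Rightarrow>\<^sub>0 int) set" where
  "pure_tensor R V W x y = tensor_class R V W (frag_of (x, y))"

text \<open>The endomorphism $f\otimes g$ of $V\otimes_R W$. As for products of cosets in the
  library, the union over all representatives is the class of any of them.\<close>

definition tensor_map ::
    "('r, 'u) ring_scheme \<Rightarrow> ('a, 'r, 'x, 'v) bimodule_scheme \<Rightarrow> ('r, 'y, 'w) module_scheme \<Rightarrow>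
     ('x \<Rightarrow> 'x) \<Rightarrow> ('y \<Rightarrow> 'y) \<Rightarrow> ('x \<times> 'y \<Rightarrow>\<^sub>0 int) set \<Rightarrow> ('x \<times> 'y \<Rightarrow>\<^sub>0 int) set" where
  "tensor_map R V W f g T =
    (\<Union>t\<in>T. tensor_class R V W (frag_extend (\<lambda>(x, y). frag_of (f x, g y)) t))"

definition tensor_lsmult where
  "tensor_lsmult R V W a T = tensor_map R V W (\<lambda>x. a \<odot>\<^bsub>V\<^esub> x) (\<lambda>y. y) T"

definition tensor_rsmult where
  "tensor_rsmult R V W T b = tensor_map R V W (\<lambda>x. x) (\<lambda>y. y \<odot>r\<^bsub>W\<^esub> b) T"

definition tensor_bimodule ::
    "('r, 'u) ring_scheme \<Rightarrow> ('a, 'r, 'x, 'v) bimodule_scheme \<Rightarrow> ('r, 'b, 'y, 'w) bimodule_scheme \<Rightarrow>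
     ('a, 'b, ('x \<times> 'y \<Rightarrow>\<^sub>0 int) set) bimodule" where
  "tensor_bimodule R V W =
    bimodule_of (tensor R V W) (tensor_lsmult R V W) (tensor_rsmult R V W)"

definition opposite :: "('a, 'x) monoid_scheme \<Rightarrow> ('a, 'x) monoid_scheme" where
  "opposite A = A\<lparr>monoid.mult := (\<lambda>x y. y \<otimes>\<^bsub>A\<^esub> x)\<rparr>"

definition scalar_bimodule :: "('o, 'a, 'x) module_scheme \<Rightarrow> ('o, 'o, 'a) bimodule" where
  "scalar_bimodule A = bimodule_of A (smult A) (\<lambda>x r. r \<odot>\<^bsub>A\<^esub> x)"

definition alg_tensor ::
    "('o, 'u) ring_scheme \<Rightarrow> ('o, 'x, 'v) module_scheme \<Rightarrow> ('o, 'y, 'w) module_scheme \<Rightarrow>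
     'x \<Rightarrow> 'y \<Rightarrow> ('x \<times> 'y \<Rightarrow>\<^sub>0 int) set" where
  "alg_tensor \<O> A A' = pure_tensor \<O> (scalar_bimodule A) A'"

text \<open>The \<open>\<O>\<close>-algebra $A\otimes_{\mathcal O}A'$.\<close>

definition tensor_algebra ::
    "('o, 'u) ring_scheme \<Rightarrow> ('o, 'x, 'v) module_scheme \<Rightarrow> ('o, 'y, 'w) module_scheme \<Rightarrow>
     ('o, ('x \<times> 'y \<Rightarrow>\<^sub>0 int) set) module" where
  "tensor_algebra \<O> A A' = (let V = scalar_bimodule A; T = tensor \<O> V A' in
    \<lparr>carrier = carrier T,
     monoid.mult = (\<lambda>S S'. \<Union>s\<in>S. \<Union>s'\<in>S'. tensor_class \<O> V A'
       (frag_extend (\<lambda>(x, y). frag_extend (\<lambda>(x', y'). frag_of (x \<otimes>\<^bsub>A\<^esub> x', y \<otimes>\<^bsub>A'\<^esub> y')) s') s)),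
     one = alg_tensor \<O> A A' \<one>\<^bsub>A\<^esub> \<one>\<^bsub>A'\<^esub>,
     ring.zero = \<zero>\<^bsub>T\<^esub>, ring.add = (\<oplus>\<^bsub>T\<^esub>),
     smult = tensor_lsmult \<O> V A'\<rparr>)"


section \<open>Graded algebras, graded bimodules and graded Morita equivalences\<close>

definition direct_sum :: "('a, 'x) ring_scheme \<Rightarrow> 'i set \<Rightarrow> ('i \<Rightarrow> 'a set) \<Rightarrow> bool" where
  "direct_sum A I \<A> \<longleftrightarrow> (\<forall>i\<in>I. additive_subgroup (\<A> i) A) \<and>
    (\<forall>a\<in>carrier A. \<exists>!f. f \<in> (\<Pi>\<^sub>E i\<in>I. \<A> i) \<and> a = (\<Oplus>\<^bsub>A\<^esub>i\<in>I. f i))"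

locale graded_algebra = assoc_algebra \<O> A + \<Gamma>: group \<Gamma>
  for \<O> :: "('o, 'x) ring_scheme" (structure) and \<Gamma> :: "('i, 'w) monoid_scheme" (structure)
    and A :: "('o, 'a, 'y) module_scheme" (structure) and \<A> :: "'i \<Rightarrow> 'a set" +
  assumes finite_grading: "finite (carrier \<Gamma>)"
    and direct_sum: "direct_sum A (carrier \<Gamma>) \<A>"
    and smult_comp:
      "\<lbrakk>x \<in> carrier \<Gamma>; r \<in> carrier \<O>; a \<in> \<A> x\<rbrakk> \<Longrightarrow> r \<odot>\<^bsub>A\<^esub> a \<in> \<A> x"
    and mult_comp:
      "\<lbrakk>x \<in> carrier \<Gamma>; y \<in> carrier \<Gamma>; a \<in> \<A> x; b \<in> \<A> y\<rbrakk> \<Longrightarrow> a \<otimes>\<^bsub>A\<^esub> b \<in> \<A> (x \<otimes>\<^bsub>\<Gamma>\<^esub> y)"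

locale strongly_graded_algebra = graded_algebra +
  assumes strong:
    "\<lbrakk>x \<in> carrier \<Gamma>; y \<in> carrier \<Gamma>\<rbrakk>
      \<Longrightarrow> \<A> (x \<otimes>\<^bsub>\<Gamma>\<^esub> y) = generate (add_monoid A) {a \<otimes>\<^bsub>A\<^esub> b | a b. a \<in> \<A> x \<and> b \<in> \<A> y}"

locale graded_bimodule = bimodule \<O> R S M +
  GR: graded_algebra \<O> \<Gamma> R \<A> + GS: graded_algebra \<O> \<Gamma> S \<D>
  for \<O> :: "('o, 'z) ring_scheme" (structure) and \<Gamma> :: "('i, 'w) monoid_scheme" (structure)
    and R :: "('o, 'a, 'x) module_scheme" (structure) and \<A> :: "'i \<Rightarrow> 'a set"
    and S :: "('o, 'b, 'y) module_scheme" (structure) and \<D> :: "'i \<Rightarrow> 'b set"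
    and M :: "('a, 'b, 'm, 'u) bimodule_scheme" (structure) and \<M> :: "'i \<Rightarrow> 'm set" +
  assumes direct_sum: "direct_sum M (carrier \<Gamma>) \<M>"
    and smult_comp:
      "\<lbrakk>x \<in> carrier \<Gamma>; y \<in> carrier \<Gamma>; a \<in> \<A> x; m \<in> \<M> y\<rbrakk> \<Longrightarrow> a \<odot>\<^bsub>M\<^esub> m \<in> \<M> (x \<otimes>\<^bsub>\<Gamma>\<^esub> y)"
    and rsmult_comp:
      "\<lbrakk>x \<in> carrier \<Gamma>; y \<in> carrier \<Gamma>; m \<in> \<M> x; b \<in> \<D> y\<rbrakk> \<Longrightarrow> m \<odot>r\<^bsub>M\<^esub> b \<in> \<M> (x \<otimes>\<^bsub>\<Gamma>\<^esub> y)"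

definition graded_bimodule_iso ::
    "('i, 'z) monoid_scheme \<Rightarrow> ('a, 'x) ring_scheme \<Rightarrow> ('b, 'y) ring_scheme \<Rightarrow>
     ('a, 'b, 'm, 'u) bimodule_scheme \<Rightarrow> ('i \<Rightarrow> 'm set) \<Rightarrow>
     ('a, 'b, 'n, 'v) bimodule_scheme \<Rightarrow> ('i \<Rightarrow> 'n set) \<Rightarrow> ('m \<Rightarrow> 'n) \<Rightarrow> bool" where
  "graded_bimodule_iso \<Gamma> R S V \<V> W \<W> h \<longleftrightarrow>
    bimodule_iso R S V W h \<and> (\<forall>x\<in>carrier \<Gamma>. h ` \<V> x = \<W> x)"

definition dual_grading ::
    "('i, 'z) monoid_scheme \<Rightarrow> ('a, 'x) ring_scheme \<Rightarrow> ('i \<Rightarrow> 'a set) \<Rightarrow>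
     ('a, 'b, 'm, 'u) bimodule_scheme \<Rightarrow> ('i \<Rightarrow> 'm set) \<Rightarrow> 'i \<Rightarrow> ('m \<Rightarrow> 'a) set" where
  "dual_grading \<Gamma> R \<A> V \<V> z =
    {f \<in> carrier (dual R V). \<forall>y\<in>carrier \<Gamma>. \<forall>x\<in>\<V> y. f x \<in> \<A> (y \<otimes>\<^bsub>\<Gamma>\<^esub> z)}"

definition tensor_grading ::
    "('i, 'z) monoid_scheme \<Rightarrow> ('r, 's) ring_scheme \<Rightarrow>
     ('a, 'r, 'x, 'u) bimodule_scheme \<Rightarrow> ('i \<Rightarrow> 'x set) \<Rightarrow>
     ('r, 'y, 'v) module_scheme \<Rightarrow> ('i \<Rightarrow> 'y set) \<Rightarrow> 'i \<Rightarrow> ('x \<times> 'y \<Rightarrow>\<^sub>0 int) set set" where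
  "tensor_grading \<Gamma> R V \<V> W \<W> z = generate (add_monoid (tensor R V W))
    {pure_tensor R V W x y | a b x y. a \<in> carrier \<Gamma> \<and> b \<in> carrier \<Gamma> \<and> a \<otimes>\<^bsub>\<Gamma>\<^esub> b = z \<and>
       x \<in> \<V> a \<and> y \<in> \<W> b}"

definition induces_Morita_equivalence ::
    "('o, 'z) ring_scheme \<Rightarrow> ('o, 'a, 'x) module_scheme \<Rightarrow> ('o, 'b, 'y) module_scheme \<Rightarrow>
     ('a, 'b, 'm, 'u) bimodule_scheme \<Rightarrow> bool" where
  "induces_Morita_equivalence \<O> R S V \<longleftrightarrow> bimodule \<O> R S V \<and>
    (\<exists>h. bimodule_iso R R (tensor_bimodule S V (dual R V)) (regular R) h) \<and>
    (\<exists>h. bimodule_iso S S (tensor_bimodule R (dual R V) V) (regular S) h)"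

definition induces_graded_Morita_equivalence ::
    "('o, 'z) ring_scheme \<Rightarrow> ('i, 'w) monoid_scheme \<Rightarrow>
     ('o, 'a, 'x) module_scheme \<Rightarrow> ('i \<Rightarrow> 'a set) \<Rightarrow>
     ('o, 'b, 'y) module_scheme \<Rightarrow> ('i \<Rightarrow> 'b set) \<Rightarrow>
     ('a, 'b, 'm, 'u) bimodule_scheme \<Rightarrow> ('i \<Rightarrow> 'm set) \<Rightarrow> bool" where
  "induces_graded_Morita_equivalence \<O> \<Gamma> R \<A> S \<D> V \<V> \<longleftrightarrow>
    strongly_graded_algebra \<O> \<Gamma> R \<A> \<and> strongly_graded_algebra \<O> \<Gamma> S \<D> \<and>
    graded_bimodule \<O> \<Gamma> R \<A> S \<D> V \<V> \<and>
    (let V' = dual R V; \<V>' = dual_grading \<Gamma> R \<A> V \<V> in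
      (\<exists>h. graded_bimodule_iso \<Gamma> R R
        (tensor_bimodule S V V') (tensor_grading \<Gamma> S V \<V> V' \<V>') (regular R) \<A> h) \<and>
      (\<exists>h. graded_bimodule_iso \<Gamma> S S
        (tensor_bimodule R V' V) (tensor_grading \<Gamma> R V' \<V>' V \<V>) (regular S) \<D> h))"


section \<open>Group algebras and blocks\<close>

text \<open>For a subgroup \<open>H\<close> of \<open>G\<close>, the elements of the group algebra of \<open>G\<lparr>carrier := H\<rparr>\<close> are
  the functions that vanish outside \<open>H\<close>; this makes it a subset of the group algebra of \<open>G\<close>.\<close>

definition group_algebra ::
    "('o, 'x) ring_scheme \<Rightarrow> ('g, 'y) monoid_scheme \<Rightarrow> ('o, 'g \<Rightarrow> 'o) module" where
  "group_algebra \<O> G =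
    \<lparr>carrier = {f. (\<forall>x\<in>carrier G. f x \<in> carrier \<O>) \<and> (\<forall>x. x \<notin> carrier G \<longrightarrow> f x = \<zero>\<^bsub>\<O>\<^esub>)},
     monoid.mult = (\<lambda>f g x. if x \<in> carrier G
       then (\<Oplus>\<^bsub>\<O>\<^esub>y\<in>carrier G. f y \<otimes>\<^bsub>\<O>\<^esub> g (inv\<^bsub>G\<^esub> y \<otimes>\<^bsub>G\<^esub> x)) else \<zero>\<^bsub>\<O>\<^esub>),
     one = (\<lambda>x. if x = \<one>\<^bsub>G\<^esub> then \<one>\<^bsub>\<O>\<^esub> else \<zero>\<^bsub>\<O>\<^esub>),
     ring.zero = (\<lambda>x. \<zero>\<^bsub>\<O>\<^esub>),
     ring.add = (\<lambda>f g x. f x \<oplus>\<^bsub>\<O>\<^esub> g x),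
     smult = (\<lambda>r f x. r \<otimes>\<^bsub>\<O>\<^esub> f x)\<rparr>"

definition group_element :: "('o, 'x) ring_scheme \<Rightarrow> 'g \<Rightarrow> 'g \<Rightarrow> 'o" where
  "group_element \<O> g = (\<lambda>x. if x = g then \<one>\<^bsub>\<O>\<^esub> else \<zero>\<^bsub>\<O>\<^esub>)"

text \<open>The centre of a group, or of (the multiplicative monoid of) a ring.\<close>

definition center :: "('a, 'x) monoid_scheme \<Rightarrow> 'a set" where
  "center A = {z \<in> carrier A. \<forall>x\<in>carrier A. z \<otimes>\<^bsub>A\<^esub> x = x \<otimes>\<^bsub>A\<^esub> z}"

definition centralizer :: "('g, 'x) monoid_scheme \<Rightarrow> 'g set \<Rightarrow> 'g set" where
  "centralizer G N = {g \<in> carrier G. \<forall>n\<in>N. g \<otimes>\<^bsub>G\<^esub> n = n \<otimes>\<^bsub>G\<^esub> g}"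

definition central_idempotent :: "('a, 'x) ring_scheme \<Rightarrow> 'a \<Rightarrow> bool" where
  "central_idempotent A e \<longleftrightarrow> e \<in> center A \<and> e \<otimes>\<^bsub>A\<^esub> e = e"

definition block_idempotent :: "('a, 'x) ring_scheme \<Rightarrow> 'a \<Rightarrow> bool" where
  "block_idempotent A b \<longleftrightarrow> central_idempotent A b \<and> b \<noteq> \<zero>\<^bsub>A\<^esub> \<and>
    (\<forall>e f. central_idempotent A e \<and> central_idempotent A f \<and> e \<otimes>\<^bsub>A\<^esub> f = \<zero>\<^bsub>A\<^esub> \<and> b = e \<oplus>\<^bsub>A\<^esub> f
      \<longrightarrow> e = \<zero>\<^bsub>A\<^esub> \<or> f = \<zero>\<^bsub>A\<^esub>)"

text \<open>Invariance of an element of the group algebra of a normal subgroup of \<open>G\<close> under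
  conjugation by \<open>G\<close>. On the centre of that algebra the normal subgroup acts trivially, so there
  this is invariance under the quotient group.\<close>

definition conj_invariant :: "('g, 'x) monoid_scheme \<Rightarrow> ('g \<Rightarrow> 'o) \<Rightarrow> bool" where
  "conj_invariant G f \<longleftrightarrow>
    (\<forall>g\<in>carrier G. \<forall>x\<in>carrier G. f (g \<otimes>\<^bsub>G\<^esub> x \<otimes>\<^bsub>G\<^esub> inv\<^bsub>G\<^esub> g) = f x)"

text \<open>The algebra $eA$ with identity element \<open>e\<close>, for a central idempotent \<open>e\<close> of \<open>A\<close>.\<close>

definition corner :: "'a \<Rightarrow> ('o, 'a) module \<Rightarrow> ('o, 'a) module" where
  "corner e A = A\<lparr>carrier := {e \<otimes>\<^bsub>A\<^esub> a | a. a \<in> carrier A}, one := e\<rparr>"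

definition centralizer_quotient ::
    "('g, 'x) monoid_scheme \<Rightarrow> 'g set \<Rightarrow> 'g set monoid" where
  "centralizer_quotient G N = G\<lparr>carrier := N <#>\<^bsub>G\<^esub> centralizer G N\<rparr> Mod N"

definition supported_on ::
    "('o, 'x) ring_scheme \<Rightarrow> ('g \<Rightarrow> 'o, 'y) monoid_scheme \<Rightarrow> 'g set \<Rightarrow> ('g \<Rightarrow> 'o) set" where
  "supported_on \<O> A U = {f \<in> carrier A. \<forall>x. x \<notin> U \<longrightarrow> f x = \<zero>\<^bsub>\<O>\<^esub>}"

text \<open>The isomorphism $NC_G(N)/N\simeq N'C_G(N)/N'$ through which algebras graded by
  the cosets of $N'$ are regarded as graded by the cosets of $N$.\<close>

lemma coset_restriction:
  assumes "group G" "N \<lhd> G" "subgroup G' G" "N' \<lhd> G\<lparr>carrier := G'\<rparr>" "N' = G' \<inter> N"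
    and C: "centralizer G N \<subseteq> G'"
  shows "(\<lambda>U. U \<inter> G') \<in> iso (centralizer_quotient G N)
    (G\<lparr>carrier := N' <#>\<^bsub>G\<^esub> centralizer G N\<rparr> Mod N')"
proof -
  interpret G: group G by fact
  interpret N: normal N G by fact
  interpret G': subgroup G' G by fact
  interpret N': normal N' "G\<lparr>carrier := G'\<rparr>" by fact
  have N'G: "subgroup N' G"
    using G.incl_subgroup G'.subgroup_axioms N'.subgroup_axioms by blast
  let ?C = "centralizer G N"
  have Csub: "c \<in> carrier G" "c \<in> G'" if "c \<in> ?C" for c
    using that C G'.subset by auto
  have N'sub: "n \<in> carrier G" "n \<in> G'" "n \<in> N" if "n \<in> N'" for n
    using that assms(5) G'.subset by auto
  have Cmult: "c \<otimes>\<^bsub>G\<^esub> d \<in> ?C" if "c \<in> ?C" "d \<in> ?C" for c d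
  proof -
    have "c \<otimes>\<^bsub>G\<^esub> d \<otimes>\<^bsub>G\<^esub> n = n \<otimes>\<^bsub>G\<^esub> (c \<otimes>\<^bsub>G\<^esub> d)" if n: "n \<in> N" for n
    proof -
      have nG: "n \<in> carrier G" using n by (rule N.mem_carrier)
      have cd: "c \<otimes>\<^bsub>G\<^esub> n = n \<otimes>\<^bsub>G\<^esub> c" "d \<otimes>\<^bsub>G\<^esub> n = n \<otimes>\<^bsub>G\<^esub> d"
        using \<open>c \<in> ?C\<close> \<open>d \<in> ?C\<close> n by (simp_all add: centralizer_def)
      have "c \<otimes>\<^bsub>G\<^esub> d \<otimes>\<^bsub>G\<^esub> n = c \<otimes>\<^bsub>G\<^esub> (n \<otimes>\<^bsub>G\<^esub> d)"
        using cd that Csub \<open>c \<in> ?C\<close> \<open>d \<in> ?C\<close> nG by (simp add: G.m_assoc)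
      also have "\<dots> = n \<otimes>\<^bsub>G\<^esub> (c \<otimes>\<^bsub>G\<^esub> d)"
        using cd(1) Csub \<open>c \<in> ?C\<close> \<open>d \<in> ?C\<close> nG
        by (simp add: G.m_assoc[symmetric])
      finally show ?thesis .
    qed
    moreover have "c \<otimes>\<^bsub>G\<^esub> d \<in> carrier G" using that by (simp add: Csub)
    ultimately show ?thesis unfolding centralizer_def by blast
  qed
  have restr: "(N #>\<^bsub>G\<^esub> c) \<inter> G' = N' #>\<^bsub>G\<^esub> c" if c: "c \<in> ?C" for c
  proof (intro equalityI subsetI)
    fix x assume "x \<in> (N #>\<^bsub>G\<^esub> c) \<inter> G'"
    then obtain n where n: "n \<in> N" "x = n \<otimes>\<^bsub>G\<^esub> c" and x: "x \<in> G'"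
      by (auto simp: r_coset_def)
    have "n = x \<otimes>\<^bsub>G\<^esub> inv\<^bsub>G\<^esub> c"
      using n c Csub by (simp add: G.m_assoc)
    then have "n \<in> G'"
      using x c Csub by (simp add: G'.m_closed G'.m_inv_closed)
    then show "x \<in> N' #>\<^bsub>G\<^esub> c" using n assms(5) by (auto simp: r_coset_def)
  next
    fix x assume "x \<in> N' #>\<^bsub>G\<^esub> c"
    then show "x \<in> (N #>\<^bsub>G\<^esub> c) \<inter> G'"
      using c Csub N'sub by (auto simp: r_coset_def)
  qed
  have car: "carrier (centralizer_quotient G N) = (\<lambda>c. N #>\<^bsub>G\<^esub> c) ` ?C"
  proof -
    have absorb: "N #>\<^bsub>G\<^esub> (n \<otimes>\<^bsub>G\<^esub> c) = N #>\<^bsub>G\<^esub> c" if "n \<in> N" "c \<in> ?C" for n c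
      using that Csub by (simp add: G.coset_mult_assoc[symmetric] N.subset N.subgroup_axioms G.coset_join2)
    have "(\<lambda>a. N #>\<^bsub>G\<^esub> a) ` (N <#>\<^bsub>G\<^esub> ?C) = (\<lambda>c. N #>\<^bsub>G\<^esub> c) ` ?C"
      (is "?L = ?R")
    proof (intro equalityI subsetI)
      fix U assume "U \<in> ?R"
      then obtain c where c: "c \<in> ?C" "U = N #>\<^bsub>G\<^esub> c" by auto
      then have "c \<in> N <#>\<^bsub>G\<^esub> ?C"
        using Csub N.one_closed unfolding set_mult_def by (force intro: G.l_one[symmetric])
      then show "U \<in> ?L" using c by auto
    qed (use absorb in \<open>auto simp: set_mult_def\<close>)
    moreover have "carrier (centralizer_quotient G N) = (\<lambda>a. N #>\<^bsub>G\<^esub> a) ` (N <#>\<^bsub>G\<^esub> ?C)"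
      by (auto simp: centralizer_quotient_def FactGroup_def RCOSETS_def r_coset_def)
    ultimately show ?thesis by simp
  qed
  have car': "carrier (G\<lparr>carrier := N' <#>\<^bsub>G\<^esub> ?C\<rparr> Mod N') = (\<lambda>c. N' #>\<^bsub>G\<^esub> c) ` ?C"
  proof -
    have absorb': "N' #>\<^bsub>G\<^esub> (n \<otimes>\<^bsub>G\<^esub> c) = N' #>\<^bsub>G\<^esub> c" if "n \<in> N'" "c \<in> ?C" for n c
      using that Csub N'sub N'G by (simp add: G.coset_mult_assoc[symmetric] subgroup.subset G.coset_join2)
    have oneN': "\<one>\<^bsub>G\<^esub> \<in> N'" using N'G by (rule subgroup.one_closed)
    have "(\<lambda>a. N' #>\<^bsub>G\<^esub> a) ` (N' <#>\<^bsub>G\<^esub> ?C) = (\<lambda>c. N' #>\<^bsub>G\<^esub> c) ` ?C"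
      (is "?L = ?R")
    proof (intro equalityI subsetI)
      fix U assume "U \<in> ?R"
      then obtain c where c: "c \<in> ?C" "U = N' #>\<^bsub>G\<^esub> c" by auto
      then have "c \<in> N' <#>\<^bsub>G\<^esub> ?C"
        using Csub oneN' unfolding set_mult_def by (force intro: G.l_one[symmetric])
      then show "U \<in> ?L" using c by auto
    qed (use absorb' in \<open>auto simp: set_mult_def\<close>)
    moreover have "carrier (G\<lparr>carrier := N' <#>\<^bsub>G\<^esub> ?C\<rparr> Mod N')
        = (\<lambda>a. N' #>\<^bsub>G\<^esub> a) ` (N' <#>\<^bsub>G\<^esub> ?C)"
      by (auto simp: FactGroup_def RCOSETS_def r_coset_def)
    ultimately show ?thesis by simp
  qed
  have prod: "(N #>\<^bsub>G\<^esub> c) <#>\<^bsub>G\<^esub> (N #>\<^bsub>G\<^esub> d) = N #>\<^bsub>G\<^esub> (c \<otimes>\<^bsub>G\<^esub> d)"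
    if "c \<in> ?C" "d \<in> ?C" for c d
    using that Csub by (simp add: N.rcos_sum)
  have prod': "(N' #>\<^bsub>G\<^esub> c) <#>\<^bsub>G\<^esub> (N' #>\<^bsub>G\<^esub> d) = N' #>\<^bsub>G\<^esub> (c \<otimes>\<^bsub>G\<^esub> d)"
    if "c \<in> ?C" "d \<in> ?C" for c d
    using N'.rcos_sum[of c d] that Csub by (simp add: set_mult_def r_coset_def)
  have inj: "N #>\<^bsub>G\<^esub> c = N #>\<^bsub>G\<^esub> d" if "c \<in> ?C" "d \<in> ?C" "N' #>\<^bsub>G\<^esub> c = N' #>\<^bsub>G\<^esub> d" for c d
  proof -
    have "c \<in> N' #>\<^bsub>G\<^esub> c"
      using Csub(1)[OF that(1)] N'G by (rule G.rcos_self)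
    then have "c \<in> N #>\<^bsub>G\<^esub> d" using that(3) restr[OF that(2)] by blast
    then show ?thesis
      using G.repr_independence[OF _ Csub(1)[OF that(2)] N.subgroup_axioms] by simp
  qed
  have quot_mult: "monoid.mult (centralizer_quotient G N) = (<#>\<^bsub>G\<^esub>)"
      "monoid.mult (G\<lparr>carrier := N' <#>\<^bsub>G\<^esub> ?C\<rparr> Mod N') = (<#>\<^bsub>G\<^esub>)"
    by (auto simp: centralizer_quotient_def FactGroup_def set_mult_def fun_eq_iff)
  have "inj_on (\<lambda>U. U \<inter> G') ((\<lambda>c. N #>\<^bsub>G\<^esub> c) ` ?C)"
  proof (rule inj_onI)
    fix U V
    assume "U \<in> (\<lambda>c. N #>\<^bsub>G\<^esub> c) ` ?C" "V \<in> (\<lambda>c. N #>\<^bsub>G\<^esub> c) ` ?C" and eq: "U \<inter> G' = V \<inter> G'"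
    then obtain c d where cd: "c \<in> ?C" "U = N #>\<^bsub>G\<^esub> c" "d \<in> ?C" "V = N #>\<^bsub>G\<^esub> d"
      by blast
    then have "N' #>\<^bsub>G\<^esub> c = N' #>\<^bsub>G\<^esub> d" using eq restr by metis
    then show "U = V" using cd inj by metis
  qed
  moreover have "(\<lambda>U. U \<inter> G') ` (\<lambda>c. N #>\<^bsub>G\<^esub> c) ` ?C = (\<lambda>c. N' #>\<^bsub>G\<^esub> c) ` ?C"
    unfolding image_image by (rule image_cong) (simp_all add: restr)
  moreover have "(U <#>\<^bsub>G\<^esub> V) \<inter> G' = (U \<inter> G') <#>\<^bsub>G\<^esub> (V \<inter> G')"
    if UV: "U \<in> (\<lambda>c. N #>\<^bsub>G\<^esub> c) ` ?C" "V \<in> (\<lambda>c. N #>\<^bsub>G\<^esub> c) ` ?C" for U V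
  proof -
    obtain c d where "c \<in> ?C" "U = N #>\<^bsub>G\<^esub> c" "d \<in> ?C" "V = N #>\<^bsub>G\<^esub> d"
      using UV by blast
    then show ?thesis using prod prod' restr Cmult by metis
  qed
  ultimately show ?thesis
    unfolding iso_def hom_def car car' quot_mult bij_betw_def
    by (intro CollectI conjI ballI) (auto simp only:)
qed


section \<open>The diagonal subalgebra and the induced bimodules\<close>

definition diagonal ::
    "('o, 'z) ring_scheme \<Rightarrow> ('i, 'w) monoid_scheme \<Rightarrow>
     ('o, 'a, 'x) module_scheme \<Rightarrow> ('i \<Rightarrow> 'a set) \<Rightarrow>
     ('o, 'b, 'y) module_scheme \<Rightarrow> ('i \<Rightarrow> 'b set) \<Rightarrow> ('o, ('a \<times> 'b \<Rightarrow>\<^sub>0 int) set) module" where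
  "diagonal \<O> \<Gamma> C \<C> C' \<C>' = (let T = tensor_algebra \<O> C (opposite C') in
    T\<lparr>carrier := generate (add_monoid T)
      {alg_tensor \<O> C (opposite C') c c' | x c c'. x \<in> carrier \<Gamma> \<and> c \<in> \<C> x \<and> c' \<in> \<C>' (inv\<^bsub>\<Gamma>\<^esub> x)}\<rparr>)"

text \<open>A $\Delta(C\otimes C'^{op})$-module structure \<open>d\<close> on the additive group of \<open>M\<close>
  which extends the $B\otimes_{\mathcal O}B'^{op}$-module structure of the bimodule \<open>M\<close>.\<close>

definition diagonal_extension where
  "diagonal_extension \<O> \<Gamma> C \<C> C' \<C>' B B' M d \<longleftrightarrow>
    left_module (diagonal \<O> \<Gamma> C \<C> C' \<C>') (module_of M d) \<and>
    (\<forall>c\<in>carrier B. \<forall>c'\<in>carrier B'. \<forall>m\<in>carrier M.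
      d (alg_tensor \<O> C (opposite C') c c') m = (c \<odot>\<^bsub>M\<^esub> m) \<odot>r\<^bsub>M\<^esub> c')"

text \<open>The graded bimodule \<open>V\<close> has identity component \<open>M\<close>, embedded by \<open>j\<close>, and induces the
  $\Delta(C\otimes C'^{op})$-module structure \<open>d\<close> on it.\<close>

definition identity_component where
  "identity_component \<O> \<Gamma> C \<C> C' \<C>' M d V \<V> j \<longleftrightarrow>
    bij_betw j (carrier M) (\<V> \<one>\<^bsub>\<Gamma>\<^esub>) \<and>
    (\<forall>m\<in>carrier M. \<forall>n\<in>carrier M. j (m \<oplus>\<^bsub>M\<^esub> n) = j m \<oplus>\<^bsub>V\<^esub> j n) \<and>
    (\<forall>x\<in>carrier \<Gamma>. \<forall>c\<in>\<C> x. \<forall>c'\<in>\<C>' (inv\<^bsub>\<Gamma>\<^esub> x). \<forall>m\<in>carrier M.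
      (c \<odot>\<^bsub>V\<^esub> j m) \<odot>r\<^bsub>V\<^esub> c' = j (d (alg_tensor \<O> C (opposite C') c c') m))"

text \<open>$C\otimes_B M$, with right $C'$-action \<open>r\<close>, and $M\otimes_{B'}C'$, with left
  $C$-action \<open>l\<close>.\<close>

definition left_induced ::
    "('a, 'x) ring_scheme \<Rightarrow> ('a, 'y) ring_scheme \<Rightarrow> ('a, 'b, 'm, 'u) bimodule_scheme \<Rightarrow>
     (('a \<times> 'm \<Rightarrow>\<^sub>0 int) set \<Rightarrow> 'b \<Rightarrow> ('a \<times> 'm \<Rightarrow>\<^sub>0 int) set) \<Rightarrow>
     ('a, 'b, ('a \<times> 'm \<Rightarrow>\<^sub>0 int) set) bimodule" where
  "left_induced C B M r =
    bimodule_of (tensor B (regular C) M) (tensor_lsmult B (regular C) M) r"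

definition left_induced_grading where
  "left_induced_grading C \<C> B M x = generate (add_monoid (tensor B (regular C) M))
    {pure_tensor B (regular C) M c m | c m. c \<in> \<C> x \<and> m \<in> carrier M}"

definition right_induced ::
    "('b, 'x) ring_scheme \<Rightarrow> ('b, 'y) ring_scheme \<Rightarrow> ('a, 'b, 'm, 'u) bimodule_scheme \<Rightarrow>
     ('a \<Rightarrow> ('m \<times> 'b \<Rightarrow>\<^sub>0 int) set \<Rightarrow> ('m \<times> 'b \<Rightarrow>\<^sub>0 int) set) \<Rightarrow>
     ('a, 'b, ('m \<times> 'b \<Rightarrow>\<^sub>0 int) set) bimodule" where
  "right_induced C' B' M l =
    bimodule_of (tensor B' M (regular C')) l (tensor_rsmult B' M (regular C'))"

definition right_induced_grading where
  "right_induced_grading C' \<C>' B' M x = generate (add_monoid (tensor B' M (regular C')))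
    {pure_tensor B' M (regular C') m c' | m c'. m \<in> carrier M \<and> c' \<in> \<C>' x}"

text \<open>$(C\otimes_{\mathcal O}C'^{op})\otimes_{\Delta(C\otimes C'^{op})}M$ as a
  $(C,C')$-bimodule; the component of degree \<open>z\<close> is spanned by the $(c\otimes c')\otimes m$ with
  $c\in C_x$, $c'\in C'_y$ and $xy=z$.\<close>

definition diagonal_induced ::
    "('o, 'z) ring_scheme \<Rightarrow> ('i, 'w) monoid_scheme \<Rightarrow>
     ('o, 'a, 'x) module_scheme \<Rightarrow> ('i \<Rightarrow> 'a set) \<Rightarrow>
     ('o, 'b, 'y) module_scheme \<Rightarrow> ('i \<Rightarrow> 'b set) \<Rightarrow>
     ('m, 'u) ring_scheme \<Rightarrow> (('a \<times> 'b \<Rightarrow>\<^sub>0 int) set \<Rightarrow> 'm \<Rightarrow> 'm) \<Rightarrow>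
     ('a, 'b, (('a \<times> 'b \<Rightarrow>\<^sub>0 int) set \<times> 'm \<Rightarrow>\<^sub>0 int) set) bimodule" where
  "diagonal_induced \<O> \<Gamma> C \<C> C' \<C>' M d =
    (let \<Delta> = diagonal \<O> \<Gamma> C \<C> C' \<C>';
         V = regular (tensor_algebra \<O> C (opposite C'));
         W = module_of M d
     in bimodule_of (tensor \<Delta> V W)
          (\<lambda>c. tensor_lsmult \<Delta> V W (alg_tensor \<O> C (opposite C') c \<one>\<^bsub>C'\<^esub>))
          (\<lambda>t c'. tensor_lsmult \<Delta> V W (alg_tensor \<O> C (opposite C') \<one>\<^bsub>C\<^esub> c') t))"

definition diagonal_induced_grading where
  "diagonal_induced_grading \<O> \<Gamma> C \<C> C' \<C>' M d z =
    (let \<Delta> = diagonal \<O> \<Gamma> C \<C> C' \<C>';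
         V = regular (tensor_algebra \<O> C (opposite C'));
         W = module_of M d
     in generate (add_monoid (tensor \<Delta> V W))
          {pure_tensor \<Delta> V W (alg_tensor \<O> C (opposite C') c c') m | x y c c' m.
             x \<in> carrier \<Gamma> \<and> y \<in> carrier \<Gamma> \<and> x \<otimes>\<^bsub>\<Gamma>\<^esub> y = z \<and>
             c \<in> \<C> x \<and> c' \<in> \<C>' y \<and> m \<in> carrier M})"

end

theory Submission
  imports Defs
begin

text \<open>For $g\in C_G(N)$ the elements $u(g)=bg$ and $u'(g)=b'g$ are units of \<open>C\<close> and \<open>C'\<close> which
  commute with \<open>B\<close> and \<open>B'\<close>, and every degree of $\bar C_G(N)$ contains one of them; so
  $C=\bigoplus B\,u(g)$ and $C'=\bigoplus B'u'(g)$, with \<open>g\<close> running over representatives. The right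
  action of \<open>C'\<close> on $C\otimes_BM$ is $(c\otimes m)\cdot\beta' u'(g)=c\,u(g)\otimes m\beta'$; it does not
  depend on the representative \<open>g\<close>, since two representatives differ by an element of $Z(N)$,
  whose two actions on \<open>M\<close> agree by (3). Writing $c=\beta u(g)$ identifies $C\otimes_BM$ with
  $M\otimes_{B'}C'$, and the element $u(g)\otimes u'(g^{-1})$ of $\Delta$ acts trivially on \<open>M\<close>,
  which gives the third description. The evaluation maps of $C\otimes_BM$ and its dual extend those
  of \<open>M\<close> and hit the identity in degree one, so they are surjective, and therefore
  isomorphisms.\<close>

text \<open>The abbreviation \<open>add_monoid\<close> fills the unit extension field with \<open>undefined\<close>; this simproc
  would rewrite it to \<open>()\<close>, after which library facts no longer match.\<close>
declare [[simproc del: unit_eq]]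

section \<open>Additive maps and additive spans\<close>

text \<open>The Morita hypothesis only provides some isomorphisms with \<open>B\<close> and
  \<open>B'\<close>; they need not be the evaluation maps, and nothing is known of their relation to
  each other. They are therefore first traded for four facts that do not mention them: the values of
  functionals on \<open>M\<close> generate \<open>B\<close>, one in \<open>B'\<close> is a sum of
  elements acting with rank one, every \<open>B\<close>-linear endomorphism of \<open>M\<close> is
  right multiplication by an element of \<open>B'\<close>, and that element is unique. Facts of this
  kind lift. A functional on \<open>M\<close> extends \<open>C\<close>-linearly in degree one, which
  handles the first two. For endomorphisms the obstacle is that a \<open>C\<close>-linear map need
  not be homogeneous: it is cut into its homogeneous parts on the copy of \<open>M\<close>, and the
  unit of degree inverse to \<open>x\<close> brings the part of degree \<open>x\<close> back into
  \<open>M\<close>, where the known fact applies. In this way the dual of the induced bimodule never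
  has to be computed. All this takes place in an abstract pair of crossed products over one group;
  blocks enter only to show that they form such a pair.\<close>

abbreviation add_hom :: "('a, 'x) ring_scheme \<Rightarrow> ('b, 'y) ring_scheme \<Rightarrow> ('a \<Rightarrow> 'b) set" where
  "add_hom A B \<equiv> hom (add_monoid A) (add_monoid B)"

text \<open>Tensor products, graded components and the diagonal subalgebra are all spans of this
  kind, so maps on them can be compared on generators.\<close>

abbreviation add_span :: "('a, 'x) ring_scheme \<Rightarrow> 'a set \<Rightarrow> 'a set" where
  "add_span A S \<equiv> generate (add_monoid A) S"

lemma add_homI:
  assumes "\<And>x. x \<in> carrier A \<Longrightarrow> f x \<in> carrier B"
    and "\<And>x y. \<lbrakk>x \<in> carrier A; y \<in> carrier A\<rbrakk> \<Longrightarrow> f (x \<oplus>\<^bsub>A\<^esub> y) = f x \<oplus>\<^bsub>B\<^esub> f y"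
  shows "f \<in> add_hom A B"
  using assms by (auto intro: homI)

lemma add_hom_closed: "f \<in> add_hom A B \<Longrightarrow> x \<in> carrier A \<Longrightarrow> f x \<in> carrier B"
  by (auto simp: hom_def)

lemma add_hom_add:
  "\<lbrakk>f \<in> add_hom A B; x \<in> carrier A; y \<in> carrier A\<rbrakk> \<Longrightarrow> f (x \<oplus>\<^bsub>A\<^esub> y) = f x \<oplus>\<^bsub>B\<^esub> f y"
  by (auto simp: hom_def)

lemma add_hom_group_hom:
  assumes "f \<in> add_hom A B" "abelian_group A" "abelian_group B"
  shows "group_hom (add_monoid A) (add_monoid B) f"
  using assms by (simp add: group_hom_def group_hom_axioms_def abelian_group.a_group)

lemma add_hom_zero:
  assumes "f \<in> add_hom A B" "abelian_group A" "abelian_group B"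
  shows "f \<zero>\<^bsub>A\<^esub> = \<zero>\<^bsub>B\<^esub>"
  using group_hom.hom_one[OF add_hom_group_hom[OF assms]] by simp

lemma add_hom_minus:
  assumes "f \<in> add_hom A B" "abelian_group A" "abelian_group B" "x \<in> carrier A"
  shows "f (\<ominus>\<^bsub>A\<^esub> x) = \<ominus>\<^bsub>B\<^esub> f x"
  using group_hom.hom_inv[OF add_hom_group_hom[OF assms(1-3)]] assms(4) by (simp add: a_inv_def)

lemma add_hom_id: "(\<lambda>x. x) \<in> add_hom A A"
  by (auto simp: hom_def)

lemma add_hom_inv_into:
  assumes f: "f \<in> add_hom A B" "bij_betw f (carrier A) (carrier B)"
    and A: "abelian_group A"
  shows "inv_into (carrier A) f \<in> add_hom B A"
proof (rule add_homI)
  interpret A: abelian_group A by fact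
  let ?g = "inv_into (carrier A) f"
  show cl: "?g y \<in> carrier A" if "y \<in> carrier B" for y
    using that f(2) by (metis bij_betw_imp_surj_on inv_into_into)
  fix x y assume xy: "x \<in> carrier B" "y \<in> carrier B"
  have *: "f (?g z) = z" if "z \<in> carrier B" for z
    using that f(2) by (metis bij_betw_inv_into_right)
  have "f (?g x \<oplus>\<^bsub>A\<^esub> ?g y) = x \<oplus>\<^bsub>B\<^esub> y"
    using xy cl * by (simp add: add_hom_add[OF f(1)])
  then show "?g (x \<oplus>\<^bsub>B\<^esub> y) = ?g x \<oplus>\<^bsub>A\<^esub> ?g y"
    using xy cl f(2) by (metis A.a_closed bij_betw_inv_into_left)
qed

lemma add_span_incl: "x \<in> S \<Longrightarrow> x \<in> add_span A S"
  by (rule generate.incl)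

lemma (in abelian_group) add_span_closed: "S \<subseteq> carrier G \<Longrightarrow> add_span G S \<subseteq> carrier G"
  using group.generate_incl[OF a_group, of S] by simp

lemma (in abelian_group) add_span_subgroup:
  "S \<subseteq> carrier G \<Longrightarrow> subgroup (add_span G S) (add_monoid G)"
  using group.generate_is_subgroup[OF a_group, of S] by simp

text \<open>\<open>generate\<close> inverts generators only, whereas the properties proved below are
  stable under all negatives. Asking for the latter allows every hypothesis to come with membership
  in the carrier.\<close>

lemma (in abelian_group) add_span_induct [consumes 2, case_names zero gen add minus]:
  assumes "t \<in> add_span G S" "S \<subseteq> carrier G"
    and "P \<zero>" and "\<And>x. x \<in> S \<Longrightarrow> P x"
    and "\<And>x y. \<lbrakk>x \<in> carrier G; y \<in> carrier G; P x; P y\<rbrakk> \<Longrightarrow> P (x \<oplus> y)"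
    and "\<And>x. \<lbrakk>x \<in> carrier G; P x\<rbrakk> \<Longrightarrow> P (\<ominus> x)"
  shows "P t"
  using assms(1)
proof (induction t rule: generate.induct)
  case (eng h1 h2)
  then have "h1 \<in> carrier G" "h2 \<in> carrier G"
    using add_span_closed[OF assms(2)] by auto
  with eng show ?case using assms(5) by simp
qed (use assms in \<open>auto simp: a_inv_def[symmetric]\<close>)

lemma (in abelian_group) add_span_zero: "\<zero> \<in> add_span G S"
  using generate.one[of "add_monoid G" S] by simp

lemma (in abelian_group) add_span_add:
  "x \<in> add_span G S \<Longrightarrow> y \<in> add_span G S \<Longrightarrow> x \<oplus> y \<in> add_span G S"
  using generate.eng[of x "add_monoid G" S y] by simp

lemma (in abelian_group) add_span_minus:
  "S \<subseteq> carrier G \<Longrightarrow> x \<in> add_span G S \<Longrightarrow> \<ominus> x \<in> add_span G S"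
  using subgroup.m_inv_closed[OF add_span_subgroup, of S x] by (simp add: a_inv_def)

text \<open>Identities between maps out of a tensor product or a graded algebra are reduced to
  generators through this rule.\<close>

lemma add_hom_eq_on_span:
  assumes "f \<in> add_hom A B" "g \<in> add_hom A B" "abelian_group A" "abelian_group B"
    and S: "S \<subseteq> carrier A" and "\<And>x. x \<in> S \<Longrightarrow> f x = g x" and t: "t \<in> add_span A S"
  shows "f t = g t"
  using abelian_group.add_span_induct[OF assms(3) t S, of "\<lambda>t. f t = g t"] assms
  by (simp add: add_hom_zero[of _ A B] add_hom_add[of _ A B] add_hom_minus[of _ A B])

text \<open>Graded components are spans, so this computes the image of a component under an
  isomorphism from the images of its generators.\<close>

lemma add_hom_span_image:
  assumes "f \<in> add_hom A B" "abelian_group A" "abelian_group B" "S \<subseteq> carrier A"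
  shows "f ` add_span A S = add_span B (f ` S)"
  using group_hom.generate_img[OF add_hom_group_hom[OF assms(1-3)], of S] assms(4) by simp


section \<open>Tensor products\<close>

lemma add_monoid_tensor: "add_monoid (tensor R V W) = tensor_free V W Mod tensor_rel R V W"
  \<comment> \<open>The two records still differ in their extension fields, both of which are of
    type unit.\<close>
  by (simp add: tensor_def Let_def FactGroup_def) (rule unit_eq)

lemma UN_eq_const: "\<lbrakk>t \<in> S; \<And>s. s \<in> S \<Longrightarrow> f s = A\<rbrakk> \<Longrightarrow> (\<Union>s\<in>S. f s) = A"
  by auto

text \<open>Beyond the two additive groups, the universal property rests on closure under the
  actions, which keeps the relations inside the free group. The same locale thus covers tensor
  products over \<open>B\<close>, over the scalars and over the diagonal subalgebra.\<close>

locale tensor_pair = V: abelian_group V + W: abelian_group W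
  for R :: "('r, 'u) ring_scheme" and V :: "('a, 'r, 'x, 'v) bimodule_scheme"
    and W :: "('r, 'y, 'w) module_scheme" +
  assumes right_closed: "\<lbrakk>x \<in> carrier V; r \<in> carrier R\<rbrakk> \<Longrightarrow> x \<odot>r\<^bsub>V\<^esub> r \<in> carrier V"
    and left_closed: "\<lbrakk>r \<in> carrier R; y \<in> carrier W\<rbrakk> \<Longrightarrow> r \<odot>\<^bsub>W\<^esub> y \<in> carrier W"
begin

abbreviation T where "T \<equiv> tensor R V W"
abbreviation pt (infixl \<open>\<otimes>\<otimes>\<close> 75) where "x \<otimes>\<otimes> y \<equiv> pure_tensor R V W x y"

section \<open>Balanced maps and the universal property\<close>

definition balanced :: "('z, 'q) ring_scheme \<Rightarrow> ('x \<Rightarrow> 'y \<Rightarrow> 'z) \<Rightarrow> bool" where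
  "balanced A F \<longleftrightarrow>
    (\<forall>x\<in>carrier V. \<forall>y\<in>carrier W. F x y \<in> carrier A) \<and>
    (\<forall>x\<in>carrier V. \<forall>x'\<in>carrier V. \<forall>y\<in>carrier W. F (x \<oplus>\<^bsub>V\<^esub> x') y = F x y \<oplus>\<^bsub>A\<^esub> F x' y) \<and>
    (\<forall>x\<in>carrier V. \<forall>y\<in>carrier W. \<forall>y'\<in>carrier W. F x (y \<oplus>\<^bsub>W\<^esub> y') = F x y \<oplus>\<^bsub>A\<^esub> F x y') \<and>
    (\<forall>x\<in>carrier V. \<forall>r\<in>carrier R. \<forall>y\<in>carrier W. F (x \<odot>r\<^bsub>V\<^esub> r) y = F x (r \<odot>\<^bsub>W\<^esub> y))"

lemma balancedI:
  assumes "\<And>x y. \<lbrakk>x \<in> carrier V; y \<in> carrier W\<rbrakk> \<Longrightarrow> F x y \<in> carrier A"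
    and "\<And>x x' y. \<lbrakk>x \<in> carrier V; x' \<in> carrier V; y \<in> carrier W\<rbrakk>
      \<Longrightarrow> F (x \<oplus>\<^bsub>V\<^esub> x') y = F x y \<oplus>\<^bsub>A\<^esub> F x' y"
    and "\<And>x y y'. \<lbrakk>x \<in> carrier V; y \<in> carrier W; y' \<in> carrier W\<rbrakk>
      \<Longrightarrow> F x (y \<oplus>\<^bsub>W\<^esub> y') = F x y \<oplus>\<^bsub>A\<^esub> F x y'"
    and "\<And>x r y. \<lbrakk>x \<in> carrier V; r \<in> carrier R; y \<in> carrier W\<rbrakk>
      \<Longrightarrow> F (x \<odot>r\<^bsub>V\<^esub> r) y = F x (r \<odot>\<^bsub>W\<^esub> y)"
  shows "balanced A F"
  unfolding balanced_def by (intro conjI ballI; rule assms; assumption)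

lemma free_diff:
  "\<lbrakk>s \<in> carrier (tensor_free V W); t \<in> carrier (tensor_free V W)\<rbrakk>
    \<Longrightarrow> s - t \<in> carrier (tensor_free V W)"
  using order_trans[OF keys_diff Un_least] by simp

lemma free_add:
  "\<lbrakk>s \<in> carrier (tensor_free V W); t \<in> carrier (tensor_free V W)\<rbrakk>
    \<Longrightarrow> s + t \<in> carrier (tensor_free V W)"
  using order_trans[OF keys_add Un_least] by simp

lemma rel_gens:
  "({frag_of (x \<oplus>\<^bsub>V\<^esub> x', y) - frag_of (x, y) - frag_of (x', y) | x x' y.
        x \<in> carrier V \<and> x' \<in> carrier V \<and> y \<in> carrier W} \<union>
     {frag_of (x, y \<oplus>\<^bsub>W\<^esub> y') - frag_of (x, y) - frag_of (x, y') | x y y'.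
        x \<in> carrier V \<and> y \<in> carrier W \<and> y' \<in> carrier W} \<union>
     {frag_of (x \<odot>r\<^bsub>V\<^esub> r, y) - frag_of (x, r \<odot>\<^bsub>W\<^esub> y) | x r y.
        x \<in> carrier V \<and> r \<in> carrier R \<and> y \<in> carrier W}) \<subseteq> carrier (tensor_free V W)"
proof -
  show ?thesis
    by (intro Un_least subsetI; (elim CollectE exE conjE)?; simp only:)
       (auto intro!: free_diff right_closed left_closed simp del: carrier_free_Abelian_group_iff)
qed

lemma rel_subgroup: "subgroup (tensor_rel R V W) (tensor_free V W)"
  unfolding tensor_rel_def by (rule group.generate_is_subgroup[OF group_free_Abelian_group rel_gens])

lemma rel_normal: "tensor_rel R V W \<lhd> tensor_free V W"
  using rel_subgroup comm_group.normal_iff_subgroup[OF abelian_free_Abelian_group] by blast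

lemma rel_sub: "t \<in> tensor_rel R V W \<Longrightarrow> t \<in> carrier (tensor_free V W)"
  using rel_subgroup subgroup.subset by blast

lemma class_carrier:
  "t \<in> carrier (tensor_free V W) \<Longrightarrow> tensor_class R V W t \<in> carrier T"
  by (auto simp: tensor_def Let_def FactGroup_def RCOSETS_def tensor_class_def)

lemma carrierE:
  assumes "x \<in> carrier T"
  obtains t where "t \<in> carrier (tensor_free V W)" "x = tensor_class R V W t"
  using assms by (auto simp: tensor_def Let_def FactGroup_def RCOSETS_def tensor_class_def)

lemma class_self: "t \<in> carrier (tensor_free V W) \<Longrightarrow> t \<in> tensor_class R V W t"
  unfolding tensor_class_def by (rule group.rcos_self[OF group_free_Abelian_group _ rel_subgroup])

lemma class_mem:
  assumes "s \<in> tensor_class R V W t"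
  obtains \<rho> where "\<rho> \<in> tensor_rel R V W" "s = \<rho> + t"
  using assms by (auto simp: tensor_class_def r_coset_def)

lemma class_add:
  "\<lbrakk>s \<in> carrier (tensor_free V W); t \<in> carrier (tensor_free V W)\<rbrakk>
    \<Longrightarrow> tensor_class R V W (s + t) = tensor_class R V W s \<oplus>\<^bsub>T\<^esub> tensor_class R V W t"
  using normal.rcos_sum[OF rel_normal, of s t]
  by (simp add: tensor_class_def tensor_def Let_def FactGroup_def)

lemma abelian_group_T: "abelian_group T"
proof -
  have "comm_group (add_monoid T)"
    unfolding add_monoid_tensor
    using comm_group.abelian_FactGroup[OF abelian_free_Abelian_group rel_subgroup] .
  then show ?thesis
    by (simp add: abelian_group_def abelian_group_axioms_def abelian_monoid_def comm_group_def)
qed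

sublocale T: abelian_group T
  by (rule abelian_group_T)

lemma class_hom: "tensor_class R V W \<in> hom (tensor_free V W) (add_monoid T)"
  using class_carrier class_add by (intro homI) auto

lemma class_rel:
  assumes "\<rho> \<in> tensor_rel R V W" shows "tensor_class R V W \<rho> = \<zero>\<^bsub>T\<^esub>"
  using group.coset_join2[OF group_free_Abelian_group rel_sub[OF assms] rel_subgroup assms]
  by (simp add: tensor_class_def tensor_def Let_def FactGroup_def)

lemma class_diff:
  assumes "s \<in> carrier (tensor_free V W)" "t \<in> carrier (tensor_free V W)"
  shows "tensor_class R V W (s - t) = tensor_class R V W s \<ominus>\<^bsub>T\<^esub> tensor_class R V W t"
proof -
  interpret h: group_hom "tensor_free V W" "add_monoid T" "tensor_class R V W"
    by (intro group_hom.intro group_hom_axioms.intro group_free_Abelian_group T.a_group class_hom)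
  have "tensor_class R V W (s + - t) = tensor_class R V W s \<oplus>\<^bsub>T\<^esub> tensor_class R V W (- t)"
    using assms by (intro class_add) auto
  also have "tensor_class R V W (- t) = \<ominus>\<^bsub>T\<^esub> tensor_class R V W t"
    using assms h.hom_inv[of t] by (simp add: a_inv_def)
  finally show ?thesis by (simp add: a_minus_def)
qed

text \<open>Stated for any homomorphism \<open>k\<close> on the free group, since it serves three
  times: for the universal map, for the induced map \<open>tensor_map\<close> and for the product of
  two tensors, where \<open>k\<close> is an explicit expression in
  \<open>frag_extend\<close>.\<close>

lemma rel_kernel:
  assumes k: "k \<in> hom (tensor_free V W) (add_monoid A)" and A: "abelian_group A"
    and F: "balanced A F"
    and kF: "\<And>x y. \<lbrakk>x \<in> carrier V; y \<in> carrier W\<rbrakk> \<Longrightarrow> k (frag_of (x, y)) = F x y"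
    and "\<rho> \<in> tensor_rel R V W"
  shows "k \<rho> = \<zero>\<^bsub>A\<^esub>"
proof -
  interpret A: abelian_group A by fact
  interpret h: group_hom "tensor_free V W" "add_monoid A" k
    using k by (simp add: group_hom_def group_hom_axioms_def A.a_group)
  have diff: "k (s - t) = k s \<ominus>\<^bsub>A\<^esub> k t"
    if "s \<in> carrier (tensor_free V W)" "t \<in> carrier (tensor_free V W)" for s t
  proof -
    have "k (s + - t) = k s \<oplus>\<^bsub>A\<^esub> k (- t)" using h.hom_mult[of s "- t"] that by simp
    also have "k (- t) = \<ominus>\<^bsub>A\<^esub> k t" using that h.hom_inv[of t] by (simp add: a_inv_def)
    finally show ?thesis by (simp add: a_minus_def)
  qed
  have cl: "F x y \<in> carrier A" if "x \<in> carrier V" "y \<in> carrier W" for x y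
    using F that by (auto simp: balanced_def)
  \<comment> \<open>The kernel is a subgroup, so it contains the relations once it contains the
    three families that generate them.\<close>
  have "tensor_rel R V W \<subseteq> kernel (tensor_free V W) (add_monoid A) k"
    unfolding tensor_rel_def
  proof (rule group.generate_subgroup_incl[OF group_free_Abelian_group _ h.subgroup_kernel],
      intro Un_least subsetI; elim CollectE exE conjE; hypsubst)
    fix x x' y assume m: "x \<in> carrier V" "x' \<in> carrier V" "y \<in> carrier W"
    have "k (frag_of (x \<oplus>\<^bsub>V\<^esub> x', y) - frag_of (x, y) - frag_of (x', y)) = \<zero>\<^bsub>A\<^esub>"
      using m F cl by (simp add: diff free_diff kF balanced_def A.minus_eq A.minus_add A.a_ac A.r_neg A.r_neg1
        del: carrier_free_Abelian_group_iff)
    then show "frag_of (x \<oplus>\<^bsub>V\<^esub> x', y) - frag_of (x, y) - frag_of (x', y)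
        \<in> kernel (tensor_free V W) (add_monoid A) k"
      using m by (auto simp: kernel_def free_diff simp del: carrier_free_Abelian_group_iff)
  next
    fix x y y' assume m: "x \<in> carrier V" "y \<in> carrier W" "y' \<in> carrier W"
    have "k (frag_of (x, y \<oplus>\<^bsub>W\<^esub> y') - frag_of (x, y) - frag_of (x, y')) = \<zero>\<^bsub>A\<^esub>"
      using m F cl by (simp add: diff free_diff kF balanced_def A.minus_eq A.minus_add A.a_ac A.r_neg A.r_neg1
        del: carrier_free_Abelian_group_iff)
    then show "frag_of (x, y \<oplus>\<^bsub>W\<^esub> y') - frag_of (x, y) - frag_of (x, y')
        \<in> kernel (tensor_free V W) (add_monoid A) k"
      using m by (auto simp: kernel_def free_diff simp del: carrier_free_Abelian_group_iff)
  next
    fix x r y assume m: "x \<in> carrier V" "r \<in> carrier R" "y \<in> carrier W"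
    have "k (frag_of (x \<odot>r\<^bsub>V\<^esub> r, y) - frag_of (x, r \<odot>\<^bsub>W\<^esub> y)) = \<zero>\<^bsub>A\<^esub>"
      using m F cl by (simp add: diff free_diff kF balanced_def right_closed left_closed A.minus_eq A.r_neg
        del: carrier_free_Abelian_group_iff)
    then show "frag_of (x \<odot>r\<^bsub>V\<^esub> r, y) - frag_of (x, r \<odot>\<^bsub>W\<^esub> y)
        \<in> kernel (tensor_free V W) (add_monoid A) k"
      using m by (auto simp: kernel_def free_diff right_closed left_closed simp del: carrier_free_Abelian_group_iff)
  qed
  then show ?thesis using assms(5) by (auto simp: kernel_def)
qed

text \<open>The free group on pairs yields a homomorphism; being balanced, \<open>F\<close> makes it
  vanish on the relations, so it descends to the quotient.\<close>

lemma universal: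
  assumes A: "abelian_group A" and F: "balanced A F"
  obtains h where "h \<in> add_hom T A"
    "\<And>x y. \<lbrakk>x \<in> carrier V; y \<in> carrier W\<rbrakk> \<Longrightarrow> h (x \<otimes>\<otimes> y) = F x y"
proof -
  interpret A: abelian_group A by fact
  obtain k where k: "k \<in> hom (tensor_free V W) (add_monoid A)"
    "\<And>z. z \<in> carrier V \<times> carrier W \<Longrightarrow> k (frag_of z) = (\<lambda>(x, y). F x y) z"
    using comm_group.free_Abelian_group_universal[OF A.a_comm_group,
      of "\<lambda>(x, y). F x y" "carrier V \<times> carrier W"] F
    by (auto simp: balanced_def image_subset_iff)
  interpret h: group_hom "tensor_free V W" "add_monoid A" k
    using k by (simp add: group_hom_def group_hom_axioms_def A.a_group)
  have "tensor_rel R V W \<subseteq> kernel (tensor_free V W) (add_monoid A) k"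
    using rel_kernel[OF k(1) A F] k(2) rel_sub by (intro subsetI) (simp add: kernel_def)
  then obtain g where g: "g \<in> hom (tensor_free V W Mod tensor_rel R V W) (add_monoid A)"
    "\<And>x. x \<in> carrier (tensor_free V W) \<Longrightarrow> g (tensor_rel R V W #>\<^bsub>tensor_free V W\<^esub> x) = k x"
    using h.FactGroup_universal_kernel[OF rel_normal] by metis
  show thesis
    by (rule that[of g]) (use g k(2) in \<open>auto simp: add_monoid_tensor pure_tensor_def tensor_class_def\<close>)
qed

lemma pt_closed [simp]: "\<lbrakk>x \<in> carrier V; y \<in> carrier W\<rbrakk> \<Longrightarrow> x \<otimes>\<otimes> y \<in> carrier T"
  by (simp add: pure_tensor_def class_carrier)

lemma diff_zeroD: "\<lbrakk>a \<in> carrier T; b \<in> carrier T; a \<ominus>\<^bsub>T\<^esub> b = \<zero>\<^bsub>T\<^esub>\<rbrakk> \<Longrightarrow> a = b"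
  by (metis T.minus_closed T.minus_eq T.a_inv_closed T.a_assoc T.l_neg T.l_zero T.r_zero)

lemma diff_diff_zeroD:
  assumes "a \<in> carrier T" "b \<in> carrier T" "c \<in> carrier T" "a \<ominus>\<^bsub>T\<^esub> b \<ominus>\<^bsub>T\<^esub> c = \<zero>\<^bsub>T\<^esub>"
  shows "a = b \<oplus>\<^bsub>T\<^esub> c"
proof (rule diff_zeroD)
  have "a \<ominus>\<^bsub>T\<^esub> (b \<oplus>\<^bsub>T\<^esub> c) = a \<ominus>\<^bsub>T\<^esub> b \<ominus>\<^bsub>T\<^esub> c"
    using assms(1-3) by (simp add: T.minus_eq T.minus_add T.a_assoc)
  then show "a \<ominus>\<^bsub>T\<^esub> (b \<oplus>\<^bsub>T\<^esub> c) = \<zero>\<^bsub>T\<^esub>" using assms(4) by simp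
qed (use assms in auto)

lemma pt_balanced: "balanced T (\<otimes>\<otimes>)"
proof (rule balancedI)
  let ?c = "tensor_class R V W"
  fix x x' y assume m: "x \<in> carrier V" "x' \<in> carrier V" "y \<in> carrier W"
  have "frag_of (x \<oplus>\<^bsub>V\<^esub> x', y) - frag_of (x, y) - frag_of (x', y) \<in> tensor_rel R V W"
    unfolding tensor_rel_def using m by (intro generate.incl) blast
  from class_rel[OF this] have "(x \<oplus>\<^bsub>V\<^esub> x') \<otimes>\<otimes> y \<ominus>\<^bsub>T\<^esub> x \<otimes>\<otimes> y \<ominus>\<^bsub>T\<^esub> x' \<otimes>\<otimes> y = \<zero>\<^bsub>T\<^esub>"
    using m by (simp add: class_diff free_diff pure_tensor_def del: carrier_free_Abelian_group_iff)
  then show "(x \<oplus>\<^bsub>V\<^esub> x') \<otimes>\<otimes> y = x \<otimes>\<otimes> y \<oplus>\<^bsub>T\<^esub> x' \<otimes>\<otimes> y"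
    using m by (rule_tac diff_diff_zeroD) auto
next
  let ?c = "tensor_class R V W"
  fix x y y' assume m: "x \<in> carrier V" "y \<in> carrier W" "y' \<in> carrier W"
  have "frag_of (x, y \<oplus>\<^bsub>W\<^esub> y') - frag_of (x, y) - frag_of (x, y') \<in> tensor_rel R V W"
    unfolding tensor_rel_def using m by (intro generate.incl) blast
  from class_rel[OF this] have "x \<otimes>\<otimes> (y \<oplus>\<^bsub>W\<^esub> y') \<ominus>\<^bsub>T\<^esub> x \<otimes>\<otimes> y \<ominus>\<^bsub>T\<^esub> x \<otimes>\<otimes> y' = \<zero>\<^bsub>T\<^esub>"
    using m by (simp add: class_diff free_diff pure_tensor_def del: carrier_free_Abelian_group_iff)
  then show "x \<otimes>\<otimes> (y \<oplus>\<^bsub>W\<^esub> y') = x \<otimes>\<otimes> y \<oplus>\<^bsub>T\<^esub> x \<otimes>\<otimes> y'"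
    using m by (rule_tac diff_diff_zeroD) auto
next
  fix x r y assume m: "x \<in> carrier V" "r \<in> carrier R" "y \<in> carrier W"
  have "frag_of (x \<odot>r\<^bsub>V\<^esub> r, y) - frag_of (x, r \<odot>\<^bsub>W\<^esub> y) \<in> tensor_rel R V W"
    unfolding tensor_rel_def using m by (intro generate.incl) blast
  from class_rel[OF this] have "(x \<odot>r\<^bsub>V\<^esub> r) \<otimes>\<otimes> y \<ominus>\<^bsub>T\<^esub> x \<otimes>\<otimes> (r \<odot>\<^bsub>W\<^esub> y) = \<zero>\<^bsub>T\<^esub>"
    using m by (simp add: class_diff pure_tensor_def right_closed left_closed del: carrier_free_Abelian_group_iff)
  then show "(x \<odot>r\<^bsub>V\<^esub> r) \<otimes>\<otimes> y = x \<otimes>\<otimes> (r \<odot>\<^bsub>W\<^esub> y)"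
    using m by (rule_tac diff_zeroD) (auto simp: right_closed left_closed)
qed simp

lemma pt_add_l: "\<lbrakk>x \<in> carrier V; x' \<in> carrier V; y \<in> carrier W\<rbrakk>
    \<Longrightarrow> (x \<oplus>\<^bsub>V\<^esub> x') \<otimes>\<otimes> y = x \<otimes>\<otimes> y \<oplus>\<^bsub>T\<^esub> x' \<otimes>\<otimes> y"
  and pt_add_r: "\<lbrakk>x \<in> carrier V; y \<in> carrier W; y' \<in> carrier W\<rbrakk>
    \<Longrightarrow> x \<otimes>\<otimes> (y \<oplus>\<^bsub>W\<^esub> y') = x \<otimes>\<otimes> y \<oplus>\<^bsub>T\<^esub> x \<otimes>\<otimes> y'"
  and pt_move: "\<lbrakk>x \<in> carrier V; r \<in> carrier R; y \<in> carrier W\<rbrakk>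
    \<Longrightarrow> (x \<odot>r\<^bsub>V\<^esub> r) \<otimes>\<otimes> y = x \<otimes>\<otimes> (r \<odot>\<^bsub>W\<^esub> y)"
  using pt_balanced by (auto simp: balanced_def)

lemma pt_hom_l: "y \<in> carrier W \<Longrightarrow> (\<lambda>x. x \<otimes>\<otimes> y) \<in> add_hom V T"
  and pt_hom_r: "x \<in> carrier V \<Longrightarrow> (\<lambda>y. x \<otimes>\<otimes> y) \<in> add_hom W T"
  by (rule add_homI; simp add: pt_add_l pt_add_r)+

lemma T_span: "carrier T = add_span T {x \<otimes>\<otimes> y | x y. x \<in> carrier V \<and> y \<in> carrier W}" (is "_ = ?S")
proof
  show "?S \<subseteq> carrier T" by (rule T.add_span_closed) auto
  show "carrier T \<subseteq> ?S"
  proof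
    fix z assume "z \<in> carrier T"
    then obtain t where t: "t \<in> carrier (tensor_free V W)" "z = tensor_class R V W t" by (rule carrierE)
    have "tensor_class R V W 0 = \<zero>\<^bsub>T\<^esub>"
      using class_rel[OF subgroup.one_closed[OF rel_subgroup]] by simp
    moreover have "tensor_class R V W (x - y) \<in> ?S"
      if "Poly_Mapping.keys x \<subseteq> carrier V \<times> carrier W" "Poly_Mapping.keys y \<subseteq> carrier V \<times> carrier W"
        "tensor_class R V W x \<in> ?S" "tensor_class R V W y \<in> ?S" for x y
    proof -
      have "\<ominus>\<^bsub>T\<^esub> tensor_class R V W y \<in> ?S" by (rule T.add_span_minus) (use that in auto)
      then show ?thesis using that by (simp add: class_diff T.minus_eq T.add_span_add)
    qed
    moreover have "tensor_class R V W (frag_of a) \<in> ?S" if "a \<in> carrier V \<times> carrier W" for a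
      using that by (intro add_span_incl) (auto simp: pure_tensor_def)
    ultimately have "tensor_class R V W t \<in> ?S"
      using t(1)[unfolded carrier_free_Abelian_group_iff]
      by (rule_tac free_Abelian_group_induct[where S = "carrier V \<times> carrier W"])
         (simp_all add: T.add_span_zero)
    then show "z \<in> ?S" using t by simp
  qed
qed

lemma T_induct [consumes 1, case_names pure add minus]:
  assumes "t \<in> carrier T"
    and pure: "\<And>x y. \<lbrakk>x \<in> carrier V; y \<in> carrier W\<rbrakk> \<Longrightarrow> P (x \<otimes>\<otimes> y)"
    and add: "\<And>s t. \<lbrakk>s \<in> carrier T; t \<in> carrier T; P s; P t\<rbrakk> \<Longrightarrow> P (s \<oplus>\<^bsub>T\<^esub> t)"
    and minus: "\<And>t. \<lbrakk>t \<in> carrier T; P t\<rbrakk> \<Longrightarrow> P (\<ominus>\<^bsub>T\<^esub> t)"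
  shows "P t"
proof (rule T.add_span_induct)
  show "t \<in> add_span T {x \<otimes>\<otimes> y | x y. x \<in> carrier V \<and> y \<in> carrier W}"
    using assms(1) T_span by simp
  \<comment> \<open>Zero has no case of its own in this rule: it is a pure tensor plus its
    negative.\<close>
  have p: "P (\<zero>\<^bsub>V\<^esub> \<otimes>\<otimes> \<zero>\<^bsub>W\<^esub>)" by (simp add: pure)
  have "P (\<zero>\<^bsub>V\<^esub> \<otimes>\<otimes> \<zero>\<^bsub>W\<^esub> \<oplus>\<^bsub>T\<^esub> \<ominus>\<^bsub>T\<^esub> (\<zero>\<^bsub>V\<^esub> \<otimes>\<otimes> \<zero>\<^bsub>W\<^esub>))"
    by (intro add minus p) auto
  then show "P \<zero>\<^bsub>T\<^esub>" by (simp add: T.r_neg)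
qed (use assms in auto)

lemma hom_eq:
  assumes "f \<in> add_hom T A" "g \<in> add_hom T A" "abelian_group A"
    and "\<And>x y. \<lbrakk>x \<in> carrier V; y \<in> carrier W\<rbrakk> \<Longrightarrow> f (x \<otimes>\<otimes> y) = g (x \<otimes>\<otimes> y)"
    and t: "t \<in> carrier T"
  shows "f t = g t"
  by (rule add_hom_eq_on_span[OF assms(1,2) abelian_group_T assms(3), where
        S = "{x \<otimes>\<otimes> y | x y. x \<in> carrier V \<and> y \<in> carrier W}"])
     (use assms(4) T_span t in auto)

text \<open>A union over all representatives is a single class only if the choice of the
  representative is immaterial. Two of them differ by a relation, and \<open>rel_kernel\<close>
  shows that the induced map on the free group sends relations to zero.\<close>

lemma tensor_map:
  assumes f: "f \<in> add_hom V V" and g: "g \<in> add_hom W W"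
    and fr: "\<And>x r. \<lbrakk>x \<in> carrier V; r \<in> carrier R\<rbrakk> \<Longrightarrow> f (x \<odot>r\<^bsub>V\<^esub> r) = f x \<odot>r\<^bsub>V\<^esub> r"
    and gr: "\<And>r y. \<lbrakk>r \<in> carrier R; y \<in> carrier W\<rbrakk> \<Longrightarrow> g (r \<odot>\<^bsub>W\<^esub> y) = r \<odot>\<^bsub>W\<^esub> g y"
  shows "tensor_map R V W f g \<in> add_hom T T" (is ?A)
    and "\<And>x y. \<lbrakk>x \<in> carrier V; y \<in> carrier W\<rbrakk> \<Longrightarrow> tensor_map R V W f g (x \<otimes>\<otimes> y) = f x \<otimes>\<otimes> g y"
      (is "\<And>x y. _ \<Longrightarrow> _ \<Longrightarrow> ?B x y")
proof -
  let ?\<phi> = "frag_extend (\<lambda>(x, y). frag_of (f x, g y))"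
  let ?k = "\<lambda>t. tensor_class R V W (?\<phi> t)"
  have fc: "f x \<in> carrier V" if "x \<in> carrier V" for x using f that by (rule add_hom_closed)
  have gc: "g x \<in> carrier W" if "x \<in> carrier W" for x using g that by (rule add_hom_closed)
  have \<phi>c: "?\<phi> t \<in> carrier (tensor_free V W)" if "t \<in> carrier (tensor_free V W)" for t
    using that keys_frag_extend[of "\<lambda>(x, y). frag_of (f x, g y)" t]
    by (fastforce simp: fc gc)
  have k: "?k \<in> hom (tensor_free V W) (add_monoid T)"
    using \<phi>c by (intro homI)
      (simp_all add: frag_extend_add class_add class_carrier del: carrier_free_Abelian_group_iff)
  have bal: "balanced T (\<lambda>x y. f x \<otimes>\<otimes> g y)"
    by (rule balancedI) (simp_all add: fc gc fr gr add_hom_add[OF f] add_hom_add[OF g] pt_add_l pt_add_r pt_move)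
  have eq: "tensor_map R V W f g (tensor_class R V W t) = ?k t" if t: "t \<in> carrier (tensor_free V W)" for t
  proof -
    have "?k s = ?k t" if s: "s \<in> tensor_class R V W t" for s
    proof -
      obtain \<rho> where r: "\<rho> \<in> tensor_rel R V W" "s = \<rho> + t" using s by (rule class_mem)
      have "?k \<rho> = \<zero>\<^bsub>T\<^esub>"
        by (rule rel_kernel[OF k abelian_group_T bal _ r(1)]) (simp add: pure_tensor_def)
      then show ?thesis
        using \<phi>c[OF rel_sub[OF r(1)]] \<phi>c[OF t] r(2)
        by (simp add: frag_extend_add class_add class_carrier del: carrier_free_Abelian_group_iff)
    qed
    then show ?thesis unfolding tensor_map_def by (intro UN_eq_const[OF class_self[OF t]])
  qed
  show ?A
  proof (rule add_homI)
    fix a b assume "a \<in> carrier T" "b \<in> carrier T"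
    then obtain s t where st: "s \<in> carrier (tensor_free V W)" "a = tensor_class R V W s"
      "t \<in> carrier (tensor_free V W)" "b = tensor_class R V W t" by (metis carrierE)
    have stc: "s + t \<in> carrier (tensor_free V W)"
      using st(1,3) by (rule free_add)
    have "tensor_map R V W f g (a \<oplus>\<^bsub>T\<^esub> b) = tensor_map R V W f g (tensor_class R V W (s + t))"
      using st by (simp only: class_add)
    also have "\<dots> = ?k (s + t)" by (rule eq[OF stc])
    also have "\<dots> = ?k s \<oplus>\<^bsub>T\<^esub> ?k t"
      using \<phi>c[OF st(1)] \<phi>c[OF st(3)] by (simp only: frag_extend_add class_add)
    finally show "tensor_map R V W f g (a \<oplus>\<^bsub>T\<^esub> b) = tensor_map R V W f g a \<oplus>\<^bsub>T\<^esub> tensor_map R V W f g b"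
      using st eq by simp
  next
    fix a assume "a \<in> carrier T"
    then obtain s where "s \<in> carrier (tensor_free V W)" "a = tensor_class R V W s" by (rule carrierE)
    then show "tensor_map R V W f g a \<in> carrier T" using \<phi>c
      by (simp add: eq class_carrier del: carrier_free_Abelian_group_iff)
  qed
  show "?B x y" if "x \<in> carrier V" "y \<in> carrier W" for x y
    using eq[of "frag_of (x, y)"] that by (simp add: pure_tensor_def)
qed

lemma lsmult:
  assumes "(\<lambda>x. a \<odot>\<^bsub>V\<^esub> x) \<in> add_hom V V"
    and "\<And>x r. \<lbrakk>x \<in> carrier V; r \<in> carrier R\<rbrakk> \<Longrightarrow> a \<odot>\<^bsub>V\<^esub> (x \<odot>r\<^bsub>V\<^esub> r) = (a \<odot>\<^bsub>V\<^esub> x) \<odot>r\<^bsub>V\<^esub> r"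
  shows "tensor_lsmult R V W a \<in> add_hom T T"
    and "\<And>x y. \<lbrakk>x \<in> carrier V; y \<in> carrier W\<rbrakk>
      \<Longrightarrow> tensor_lsmult R V W a (x \<otimes>\<otimes> y) = (a \<odot>\<^bsub>V\<^esub> x) \<otimes>\<otimes> y"
proof -
  have eq: "tensor_lsmult R V W a = tensor_map R V W (\<lambda>x. a \<odot>\<^bsub>V\<^esub> x) (\<lambda>y. y)"
    by (simp add: tensor_lsmult_def fun_eq_iff)
  show "tensor_lsmult R V W a \<in> add_hom T T"
    unfolding eq by (rule tensor_map(1)) (use assms add_hom_id in auto)
  show "tensor_lsmult R V W a (x \<otimes>\<otimes> y) = (a \<odot>\<^bsub>V\<^esub> x) \<otimes>\<otimes> y"
    if "x \<in> carrier V" "y \<in> carrier W" for x y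
    unfolding eq by (rule tensor_map(2)) (use assms add_hom_id that in auto)
qed

end

text \<open>A right action on the second factor requires a bimodule record for \<open>W\<close>,
  while the locale fixes a module record; hence the statement outside it.\<close>

lemma rsmult:
  fixes W :: "('r, 'c, 'y, 'w) bimodule_scheme" and V :: "('a, 'r, 'x, 'v) bimodule_scheme"
  assumes "tensor_pair R V W" and "(\<lambda>y. y \<odot>r\<^bsub>W\<^esub> b) \<in> add_hom W W"
    and "\<And>r y. \<lbrakk>r \<in> carrier R; y \<in> carrier W\<rbrakk> \<Longrightarrow> (r \<odot>\<^bsub>W\<^esub> y) \<odot>r\<^bsub>W\<^esub> b = r \<odot>\<^bsub>W\<^esub> (y \<odot>r\<^bsub>W\<^esub> b)"
  shows tensor_rsmult_hom: "(\<lambda>t. tensor_rsmult R V W t b) \<in> add_hom (tensor R V W) (tensor R V W)"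
    and tensor_rsmult_pt: "\<And>x y. \<lbrakk>x \<in> carrier V; y \<in> carrier W\<rbrakk>
      \<Longrightarrow> tensor_rsmult R V W (pure_tensor R V W x y) b = pure_tensor R V W x (y \<odot>r\<^bsub>W\<^esub> b)"
proof -
  interpret tensor_pair R V W by fact
  have eq: "(\<lambda>t. tensor_rsmult R V W t b) = tensor_map R V W (\<lambda>x. x) (\<lambda>y. y \<odot>r\<^bsub>W\<^esub> b)"
    by (simp add: tensor_rsmult_def fun_eq_iff)
  show "(\<lambda>t. tensor_rsmult R V W t b) \<in> add_hom T T"
    unfolding eq by (rule tensor_map(1)) (use assms add_hom_id in auto)
  show "tensor_rsmult R V W (x \<otimes>\<otimes> y) b = x \<otimes>\<otimes> (y \<odot>r\<^bsub>W\<^esub> b)"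
    if "x \<in> carrier V" "y \<in> carrier W" for x y
    using fun_cong[OF eq, of "x \<otimes>\<otimes> y"] tensor_map(2)[of "\<lambda>x. x" "\<lambda>y. y \<odot>r\<^bsub>W\<^esub> b", of x y] assms add_hom_id that
    by auto
qed


section \<open>Algebras, bimodules and their tensor products\<close>

text \<open>Records such as \<open>bimodule_of A l r\<close> and \<open>opposite A\<close> keep the
  additive group of \<open>A\<close> but are different records, so facts on that group have to be
  carried across.\<close>

lemma abelian_group_cong:
  assumes "carrier A = carrier B" "add A = add B" "ring.zero A = ring.zero B" "abelian_group A"
  shows "abelian_group B"
proof -
  interpret A: abelian_group A by fact
  show ?thesis
    unfolding assms(1-3)[symmetric]
    by (rule abelian_groupI; unfold assms(1-3)[symmetric]) (use A.a_ac A.l_neg in auto)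
qed

lemma a_inv_cong:
  assumes "carrier A = carrier B" "add A = add B" "ring.zero A = ring.zero B"
  shows "a_inv A = a_inv B"
  by (simp add: fun_eq_iff a_inv_def m_inv_def assms)

lemma add_span_cong_subset:
  assumes eq: "carrier A = carrier B" "add A = add B" "ring.zero A = ring.zero B"
    and t: "t \<in> add_span A S"
  shows "t \<in> add_span B S"
  using t
proof (induction t rule: generate.induct)
  case one
  then show ?case using generate.one[of "add_monoid B" S] by (simp add: eq)
next
  case (inv h)
  have "inv\<^bsub>add_monoid A\<^esub> h = inv\<^bsub>add_monoid B\<^esub> h"
    using a_inv_cong[OF eq] by (simp add: a_inv_def fun_eq_iff)
  then show ?case using inv generate.inv[of h S "add_monoid B"] by simp
next
  case (eng h1 h2)
  then show ?case using generate.eng[of h1 "add_monoid B" S h2] by (simp add: eq)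
qed (rule generate.incl)

lemma add_span_cong:
  assumes "carrier A = carrier B" "add A = add B" "ring.zero A = ring.zero B"
  shows "add_span A S = add_span B S"
  by (intro equalityI subsetI;
      rule add_span_cong_subset[OF assms] add_span_cong_subset[OF assms(1-3)[symmetric]]; assumption)

lemma bimodule_of_simps [simp]:
  "carrier (bimodule_of A l r) = carrier A" "\<zero>\<^bsub>bimodule_of A l r\<^esub> = \<zero>\<^bsub>A\<^esub>"
  "x \<oplus>\<^bsub>bimodule_of A l r\<^esub> y = x \<oplus>\<^bsub>A\<^esub> y"
  "a \<odot>\<^bsub>bimodule_of A l r\<^esub> x = l a x" "x \<odot>r\<^bsub>bimodule_of A l r\<^esub> b = r x b"
  by (simp_all add: bimodule_of_def)

lemma add_bimodule_of [simp]: "add (bimodule_of A l r) = add A"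
  by (simp add: bimodule_of_def)

lemma abelian_group_bimodule_of: "abelian_group (bimodule_of A l r) \<longleftrightarrow> abelian_group A"
  using abelian_group_cong[of A "bimodule_of A l r"] abelian_group_cong[of "bimodule_of A l r" A] by (simp, blast)

lemma add_span_bimodule_of [simp]: "add_span (bimodule_of A l r) S = add_span A S"
  by (rule add_span_cong) simp_all

lemma module_of_simps [simp]:
  "carrier (module_of A l) = carrier A" "\<zero>\<^bsub>module_of A l\<^esub> = \<zero>\<^bsub>A\<^esub>"
  "x \<oplus>\<^bsub>module_of A l\<^esub> y = x \<oplus>\<^bsub>A\<^esub> y" "a \<odot>\<^bsub>module_of A l\<^esub> x = l a x"
  by (simp_all add: module_of_def)

lemma add_module_of [simp]: "add (module_of A l) = add A"
  by (simp add: module_of_def)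

lemma abelian_group_module_of: "abelian_group (module_of A l) \<longleftrightarrow> abelian_group A"
  using abelian_group_cong[of A "module_of A l"] abelian_group_cong[of "module_of A l" A] by (simp, blast)

lemma opposite_simps [simp]:
  fixes A :: "('o, 'a, 'x) module_scheme"
  shows "carrier (opposite A) = carrier A" "\<zero>\<^bsub>opposite A\<^esub> = \<zero>\<^bsub>A\<^esub>" "\<one>\<^bsub>opposite A\<^esub> = \<one>\<^bsub>A\<^esub>"
    "x \<oplus>\<^bsub>opposite A\<^esub> y = x \<oplus>\<^bsub>A\<^esub> y" "x \<otimes>\<^bsub>opposite A\<^esub> y = y \<otimes>\<^bsub>A\<^esub> x"
    "r \<odot>\<^bsub>opposite A\<^esub> x = r \<odot>\<^bsub>A\<^esub> x" "add (opposite A) = add A"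
  by (simp_all add: opposite_def)

lemma (in assoc_algebra) opposite: "assoc_algebra R (opposite A)"
proof -
  have ag: "abelian_group (opposite A)"
    by (rule abelian_group_cong[OF _ _ _ abelian_group_axioms]) simp_all
  have "ring (opposite A)"
    by (intro ringI ag monoidI) (simp_all add: m_assoc l_distr r_distr l_distr)
  moreover have "module R (opposite A)"
    by (intro module.intro R.is_cring ag module_axioms.intro)
       (simp_all add: smult_l_distr smult_r_distr smult_assoc1)
  ultimately show ?thesis
    by (intro assoc_algebra.intro assoc_algebra_axioms.intro)
       (simp_all add: smult_mult_left smult_mult_right)
qed

context bimodule
begin

lemma smult_hom: "a \<in> carrier R \<Longrightarrow> (\<lambda>x. a \<odot>\<^bsub>M\<^esub> x) \<in> add_hom M M"
  by (rule add_homI) (simp_all add: smult_closed smult_r_distr)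

lemma rsmult_hom: "b \<in> carrier S \<Longrightarrow> (\<lambda>x. x \<odot>r\<^bsub>M\<^esub> b) \<in> add_hom M M"
  by (rule add_homI) (simp_all add: rsmult_closed rsmult_l_distr)

lemma smult_hom_ring: "x \<in> carrier M \<Longrightarrow> (\<lambda>a. a \<odot>\<^bsub>M\<^esub> x) \<in> add_hom R M"
  by (rule add_homI) (simp_all add: smult_closed smult_l_distr)

lemma rsmult_hom_ring: "x \<in> carrier M \<Longrightarrow> (\<lambda>b. x \<odot>r\<^bsub>M\<^esub> b) \<in> add_hom S M"
  by (rule add_homI) (simp_all add: rsmult_closed rsmult_r_distr)

lemmas zero_smult = add_hom_zero[OF smult_hom_ring R.abelian_group_axioms M.abelian_group_axioms]
  and zero_rsmult = add_hom_zero[OF rsmult_hom_ring S.abelian_group_axioms M.abelian_group_axioms]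
  and minus_rsmult = add_hom_minus[OF rsmult_hom_ring S.abelian_group_axioms M.abelian_group_axioms]

text \<open>A scalar acts as a multiple of one, and such multiples change sides by
  \<open>scalars_central\<close>. In this form the axiom says that \<open>(a x) b\<close> is
  balanced over the scalars in \<open>a\<close> and \<open>b\<close>, as an action of the tensor
  algebra requires.\<close>

lemma scalar_move:
  assumes "r \<in> carrier \<O>" "a \<in> carrier R" "b \<in> carrier S" "x \<in> carrier M"
  shows "((r \<odot>\<^bsub>R\<^esub> a) \<odot>\<^bsub>M\<^esub> x) \<odot>r\<^bsub>M\<^esub> b = (a \<odot>\<^bsub>M\<^esub> x) \<odot>r\<^bsub>M\<^esub> (r \<odot>\<^bsub>S\<^esub> b)"
proof -
  have "(r \<odot>\<^bsub>R\<^esub> a) = (r \<odot>\<^bsub>R\<^esub> \<one>\<^bsub>R\<^esub>) \<otimes>\<^bsub>R\<^esub> a" "(r \<odot>\<^bsub>S\<^esub> b) = (r \<odot>\<^bsub>S\<^esub> \<one>\<^bsub>S\<^esub>) \<otimes>\<^bsub>S\<^esub> b"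
    using assms by (simp_all add: R.smult_mult_left S.smult_mult_left)
  then show ?thesis
    using assms by (simp add: smult_assoc scalars_central rsmult_assoc smult_closed rsmult_closed)
qed

end

text \<open>Every element of \<open>W\<close> is some \<open>h v\<close>, on which the laws are
  those of \<open>V\<close>; of \<open>W\<close> itself only the additive group has to be
  understood.\<close>

lemma bimodule_transport:
  assumes V: "bimodule \<O> R S V"
    and h: "bij_betw h (carrier V) (carrier W)"
      "\<And>x y. \<lbrakk>x \<in> carrier V; y \<in> carrier V\<rbrakk> \<Longrightarrow> h (x \<oplus>\<^bsub>V\<^esub> y) = h x \<oplus>\<^bsub>W\<^esub> h y"
      "\<And>a x. \<lbrakk>a \<in> carrier R; x \<in> carrier V\<rbrakk> \<Longrightarrow> h (a \<odot>\<^bsub>V\<^esub> x) = a \<odot>\<^bsub>W\<^esub> h x"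
      "\<And>x b. \<lbrakk>x \<in> carrier V; b \<in> carrier S\<rbrakk> \<Longrightarrow> h (x \<odot>r\<^bsub>V\<^esub> b) = h x \<odot>r\<^bsub>W\<^esub> b"
    and W: "abelian_group W"
  shows "bimodule \<O> R S W"
proof -
  interpret V: bimodule \<O> R S V by fact
  interpret W: abelian_group W by fact
  have hc: "h x \<in> carrier W" if "x \<in> carrier V" for x
    using h(1) that by (auto simp: bij_betw_def)
  have ex: "\<exists>x\<in>carrier V. y = h x" if "y \<in> carrier W" for y
    using h(1) that by (auto simp: bij_betw_def)
  have lc: "a \<odot>\<^bsub>W\<^esub> h x \<in> carrier W" if "a \<in> carrier R" "x \<in> carrier V" for a x
    using that by (simp add: h(3)[symmetric] hc V.smult_closed)
  have rc: "h x \<odot>r\<^bsub>W\<^esub> b \<in> carrier W" if "b \<in> carrier S" "x \<in> carrier V" for b x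
    using that by (simp add: h(4)[symmetric] hc V.rsmult_closed)
  note s = h(2-4)[symmetric] V.smult_closed V.rsmult_closed
  show ?thesis
  proof (intro bimodule.intro left_module.intro left_module_axioms.intro bimodule_axioms.intro
      V.R.assoc_algebra_axioms V.S.assoc_algebra_axioms V.R.ring_axioms W.abelian_group_axioms)
    fix a x assume "a \<in> carrier R" "x \<in> carrier W"
    then show "a \<odot>\<^bsub>W\<^esub> x \<in> carrier W" using ex lc by blast
  next
    fix a b x assume m: "a \<in> carrier R" "b \<in> carrier R" "x \<in> carrier W"
    then obtain v where v: "v \<in> carrier V" "x = h v" using ex by blast
    show "(a \<oplus>\<^bsub>R\<^esub> b) \<odot>\<^bsub>W\<^esub> x = a \<odot>\<^bsub>W\<^esub> x \<oplus>\<^bsub>W\<^esub> b \<odot>\<^bsub>W\<^esub> x"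
      using m(1,2) v by (simp add: s V.smult_l_distr)
    show "a \<otimes>\<^bsub>R\<^esub> b \<odot>\<^bsub>W\<^esub> x = a \<odot>\<^bsub>W\<^esub> (b \<odot>\<^bsub>W\<^esub> x)"
      using m(1,2) v by (simp add: s V.smult_assoc)
  next
    fix a x y assume m: "a \<in> carrier R" "x \<in> carrier W" "y \<in> carrier W"
    then obtain v w where v: "v \<in> carrier V" "x = h v" "w \<in> carrier V" "y = h w" using ex by blast
    show "a \<odot>\<^bsub>W\<^esub> (x \<oplus>\<^bsub>W\<^esub> y) = a \<odot>\<^bsub>W\<^esub> x \<oplus>\<^bsub>W\<^esub> a \<odot>\<^bsub>W\<^esub> y"
      using m(1) v by (simp add: s V.smult_r_distr)
  next
    fix x assume "x \<in> carrier W"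
    then obtain v where v: "v \<in> carrier V" "x = h v" using ex by blast
    show "\<one>\<^bsub>R\<^esub> \<odot>\<^bsub>W\<^esub> x = x" using v by (simp add: s V.smult_one)
    show "x \<odot>r\<^bsub>W\<^esub> \<one>\<^bsub>S\<^esub> = x" using v by (simp add: s V.rsmult_one)
  next
    fix x b assume "x \<in> carrier W" "b \<in> carrier S"
    then show "x \<odot>r\<^bsub>W\<^esub> b \<in> carrier W" using ex rc by blast
  next
    fix x a b assume m: "x \<in> carrier W" "a \<in> carrier S" "b \<in> carrier S"
    then obtain v where v: "v \<in> carrier V" "x = h v" using ex by blast
    show "x \<odot>r\<^bsub>W\<^esub> (a \<oplus>\<^bsub>S\<^esub> b) = x \<odot>r\<^bsub>W\<^esub> a \<oplus>\<^bsub>W\<^esub> x \<odot>r\<^bsub>W\<^esub> b"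
      using m(2,3) v by (simp add: s V.rsmult_r_distr)
    show "x \<odot>r\<^bsub>W\<^esub> (a \<otimes>\<^bsub>S\<^esub> b) = x \<odot>r\<^bsub>W\<^esub> a \<odot>r\<^bsub>W\<^esub> b"
      using m(2,3) v by (simp add: s V.rsmult_assoc)
  next
    fix x y b assume m: "x \<in> carrier W" "y \<in> carrier W" "b \<in> carrier S"
    then obtain v w where v: "v \<in> carrier V" "x = h v" "w \<in> carrier V" "y = h w" using ex by blast
    show "(x \<oplus>\<^bsub>W\<^esub> y) \<odot>r\<^bsub>W\<^esub> b = x \<odot>r\<^bsub>W\<^esub> b \<oplus>\<^bsub>W\<^esub> y \<odot>r\<^bsub>W\<^esub> b"
      using m(3) v by (simp add: s V.rsmult_l_distr)
  next
    fix a x b assume m: "a \<in> carrier R" "x \<in> carrier W" "b \<in> carrier S"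
    then obtain v where v: "v \<in> carrier V" "x = h v" using ex by blast
    show "a \<odot>\<^bsub>W\<^esub> x \<odot>r\<^bsub>W\<^esub> b = a \<odot>\<^bsub>W\<^esub> (x \<odot>r\<^bsub>W\<^esub> b)"
      using m(1,3) v by (simp add: s V.smult_rsmult_assoc)
  next
    fix r x assume m: "r \<in> carrier \<O>" "x \<in> carrier W"
    then obtain v where v: "v \<in> carrier V" "x = h v" using ex by blast
    show "r \<odot>\<^bsub>R\<^esub> \<one>\<^bsub>R\<^esub> \<odot>\<^bsub>W\<^esub> x = x \<odot>r\<^bsub>W\<^esub> (r \<odot>\<^bsub>S\<^esub> \<one>\<^bsub>S\<^esub>)"
      using m(1) v by (simp add: s V.scalars_central)
  qed
qed

lemma frag_extend_fun_add:
  "frag_extend (\<lambda>x. f x + g x) c = frag_extend f c + frag_extend g c"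
  by (rule frag_induction[of c UNIV]) (auto simp: frag_extend_diff)

lemma frag_extend_fun_diff:
  "frag_extend (\<lambda>x. f x - g x) c = frag_extend f c - frag_extend g c"
  by (rule frag_induction[of c UNIV]) (auto simp: frag_extend_diff)

section \<open>The algebra structure on a tensor product of algebras\<close>

locale algebra_pair = A: assoc_algebra \<O> A + A': assoc_algebra \<O> A'
  for \<O> :: "('o, 'u) ring_scheme" and A :: "('o, 'x, 'v) module_scheme"
    and A' :: "('o, 'y, 'w) module_scheme"
begin

abbreviation AT where "AT \<equiv> tensor_algebra \<O> A A'"
abbreviation at (infixl \<open>\<otimes>\<otimes>\<close> 75) where "x \<otimes>\<otimes> y \<equiv> alg_tensor \<O> A A' x y"

lemma scalar_bimodule_simps [simp]:
  "carrier (scalar_bimodule A) = carrier A" "x \<oplus>\<^bsub>scalar_bimodule A\<^esub> y = x \<oplus>\<^bsub>A\<^esub> y"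
  "r \<odot>\<^bsub>scalar_bimodule A\<^esub> x = r \<odot>\<^bsub>A\<^esub> x" "x \<odot>r\<^bsub>scalar_bimodule A\<^esub> r = r \<odot>\<^bsub>A\<^esub> x"
  "\<zero>\<^bsub>scalar_bimodule A\<^esub> = \<zero>\<^bsub>A\<^esub>"
  by (simp_all only: scalar_bimodule_def bimodule_of_simps)

sublocale P: tensor_pair \<O> "scalar_bimodule A" A'
proof (intro tensor_pair.intro tensor_pair_axioms.intro A'.abelian_group_axioms)
  show "abelian_group (scalar_bimodule A)"
    using A.abelian_group_axioms by (simp add: scalar_bimodule_def abelian_group_bimodule_of)
qed (simp_all add: A.smult_closed A'.smult_closed)

lemma AT_simps:
  "carrier AT = carrier P.T" "x \<oplus>\<^bsub>AT\<^esub> y = x \<oplus>\<^bsub>P.T\<^esub> y" "\<zero>\<^bsub>AT\<^esub> = \<zero>\<^bsub>P.T\<^esub>"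
  "\<one>\<^bsub>AT\<^esub> = \<one>\<^bsub>A\<^esub> \<otimes>\<otimes> \<one>\<^bsub>A'\<^esub>" "add AT = add P.T"
  by (simp_all add: tensor_algebra_def Let_def)

abbreviation frag_mult where
  "frag_mult s s' \<equiv> frag_extend (\<lambda>(x, y). frag_extend (\<lambda>(x', y'). frag_of (x \<otimes>\<^bsub>A\<^esub> x', y \<otimes>\<^bsub>A'\<^esub> y')) s') s"

lemma frag_mult_diff_r: "frag_mult s (s' - t') = frag_mult s s' - frag_mult s t'"
  by (simp add: frag_extend_diff case_prod_unfold frag_extend_fun_diff)

lemma frag_mult_add_r: "frag_mult s (s' + t') = frag_mult s s' + frag_mult s t'"
  by (simp add: frag_extend_add case_prod_unfold frag_extend_fun_add)

lemma frag_mult_zero_r: "frag_mult s 0 = 0"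
  by (simp add: frag_extend_eq_0 case_prod_unfold)

lemma frag_mult_closed:
  assumes "s \<in> carrier (tensor_free A A')" "s' \<in> carrier (tensor_free A A')"
  shows "frag_mult s s' \<in> carrier (tensor_free A A')"
proof -
  have "Poly_Mapping.keys (frag_mult s s') \<subseteq> carrier A \<times> carrier A'"
  proof (rule order_trans[OF keys_frag_extend], rule UN_least, clarify)
    fix x y a b assume 1: "(x, y) \<in> Poly_Mapping.keys s"
      and 2: "(a, b) \<in> Poly_Mapping.keys (frag_extend (\<lambda>(x', y'). frag_of (x \<otimes>\<^bsub>A\<^esub> x', y \<otimes>\<^bsub>A'\<^esub> y')) s')"
    obtain x' y' where "(x', y') \<in> Poly_Mapping.keys s'"
      "(a, b) \<in> Poly_Mapping.keys (frag_of (x \<otimes>\<^bsub>A\<^esub> x', y \<otimes>\<^bsub>A'\<^esub> y'))"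
      using subsetD[OF keys_frag_extend 2] by auto
    then show "a \<in> carrier A \<and> b \<in> carrier A'" using 1 assms by auto
  qed
  then show ?thesis by simp
qed

text \<open>The product is a union over the representatives of both factors, so it has to be shown
  that a relation times anything, on either side, has class zero. With a basis element in the other
  place the product is a balanced map and \<open>rel_kernel\<close> applies; arbitrary elements in
  the other place follow by induction over the free group.\<close>

lemma class_frag_mult:
  assumes "s \<in> carrier (tensor_free A A')" "s' \<in> carrier (tensor_free A A')"
  shows "tensor_class \<O> (scalar_bimodule A) A' s \<otimes>\<^bsub>AT\<^esub> tensor_class \<O> (scalar_bimodule A) A' s' =
    tensor_class \<O> (scalar_bimodule A) A' (frag_mult s s')"
proof -
  let ?c = "tensor_class \<O> (scalar_bimodule A) A'"
  note [simp del] = carrier_free_Abelian_group_iff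
  have zero: "?c 0 = \<zero>\<^bsub>P.T\<^esub>"
    using P.class_rel[OF subgroup.one_closed[OF P.rel_subgroup]] by simp
  have relc: "\<rho> \<in> carrier (tensor_free A A')" if "\<rho> \<in> tensor_rel \<O> (scalar_bimodule A) A'" for \<rho>
    using P.rel_sub[OF that] by simp
  have l: "?c (frag_mult \<rho> s') = \<zero>\<^bsub>P.T\<^esub>"
    if "\<rho> \<in> tensor_rel \<O> (scalar_bimodule A) A'" and s': "s' \<in> carrier (tensor_free A A')" for \<rho> s'
    using s'[unfolded carrier_free_Abelian_group_iff]
  proof (rule free_Abelian_group_induct[where S = "carrier A \<times> carrier A'"])
    show "?c (frag_mult \<rho> 0) = \<zero>\<^bsub>P.T\<^esub>" by (simp only: frag_mult_zero_r zero)
  next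
    fix x y assume m: "Poly_Mapping.keys x \<subseteq> carrier A \<times> carrier A'"
      "Poly_Mapping.keys y \<subseteq> carrier A \<times> carrier A'"
      "?c (frag_mult \<rho> x) = \<zero>\<^bsub>P.T\<^esub>" "?c (frag_mult \<rho> y) = \<zero>\<^bsub>P.T\<^esub>"
    then show "?c (frag_mult \<rho> (x - y)) = \<zero>\<^bsub>P.T\<^esub>"
      using frag_mult_closed[OF relc[OF that(1)], of x] frag_mult_closed[OF relc[OF that(1)], of y]
      unfolding frag_mult_diff_r
      by (simp add: P.class_diff carrier_free_Abelian_group_iff[symmetric] P.T.minus_eq P.T.r_neg)
  next
    fix a assume "a \<in> carrier A \<times> carrier A'"
    then obtain x' y' where a: "a = (x', y')" "x' \<in> carrier A" "y' \<in> carrier A'" by auto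
    have ac: "frag_of a \<in> carrier (tensor_free A A')" using a by (simp add: carrier_free_Abelian_group_iff)
    show "?c (frag_mult \<rho> (frag_of a)) = \<zero>\<^bsub>P.T\<^esub>"
    proof (rule P.rel_kernel[where k = "\<lambda>s. ?c (frag_mult s (frag_of a))" and
          F = "\<lambda>x y. pure_tensor \<O> (scalar_bimodule A) A' (x \<otimes>\<^bsub>A\<^esub> x') (y \<otimes>\<^bsub>A'\<^esub> y')"])
      show "(\<lambda>s. ?c (frag_mult s (frag_of a)))
          \<in> hom (tensor_free (scalar_bimodule A) A') (add_monoid P.T)"
        using frag_mult_closed[OF _ ac]
        by (intro homI) (simp_all add: frag_extend_add P.class_add P.class_carrier)
      show "P.balanced P.T (\<lambda>x y. pure_tensor \<O> (scalar_bimodule A) A' (x \<otimes>\<^bsub>A\<^esub> x') (y \<otimes>\<^bsub>A'\<^esub> y'))"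
      proof (rule P.balancedI, goal_cases)
        case (4 x r y)
        then show ?case using a P.pt_move[of "x \<otimes>\<^bsub>A\<^esub> x'" r "y \<otimes>\<^bsub>A'\<^esub> y'"]
          by (simp add: A.smult_mult_left A'.smult_mult_left)
      qed (use a P.pt_add_l P.pt_add_r in \<open>simp_all add: A.l_distr A'.l_distr P.pt_closed\<close>)
    qed (use that(1) a P.abelian_group_T in \<open>simp_all add: pure_tensor_def\<close>)
  qed
  have r: "?c (frag_mult s \<rho>) = \<zero>\<^bsub>P.T\<^esub>"
    if "\<rho> \<in> tensor_rel \<O> (scalar_bimodule A) A'" and s: "s \<in> carrier (tensor_free A A')" for \<rho> s
    using s[unfolded carrier_free_Abelian_group_iff]
  proof (rule free_Abelian_group_induct[where S = "carrier A \<times> carrier A'"])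
    show "?c (frag_mult 0 \<rho>) = \<zero>\<^bsub>P.T\<^esub>" by (simp add: zero)
  next
    fix x y assume m: "Poly_Mapping.keys x \<subseteq> carrier A \<times> carrier A'"
      "Poly_Mapping.keys y \<subseteq> carrier A \<times> carrier A'"
      "?c (frag_mult x \<rho>) = \<zero>\<^bsub>P.T\<^esub>" "?c (frag_mult y \<rho>) = \<zero>\<^bsub>P.T\<^esub>"
    then show "?c (frag_mult (x - y) \<rho>) = \<zero>\<^bsub>P.T\<^esub>"
      using frag_mult_closed[OF _ relc[OF that(1)], of x] frag_mult_closed[OF _ relc[OF that(1)], of y]
      unfolding frag_extend_diff
      by (simp add: P.class_diff carrier_free_Abelian_group_iff[symmetric] P.T.minus_eq P.T.r_neg)
  next
    fix a assume "a \<in> carrier A \<times> carrier A'"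
    then obtain x' y' where a: "a = (x', y')" "x' \<in> carrier A" "y' \<in> carrier A'" by auto
    have ac: "frag_of a \<in> carrier (tensor_free A A')" using a by (simp add: carrier_free_Abelian_group_iff)
    show "?c (frag_mult (frag_of a) \<rho>) = \<zero>\<^bsub>P.T\<^esub>"
    proof (rule P.rel_kernel[where k = "\<lambda>s. ?c (frag_mult (frag_of a) s)" and
          F = "\<lambda>x y. pure_tensor \<O> (scalar_bimodule A) A' (x' \<otimes>\<^bsub>A\<^esub> x) (y' \<otimes>\<^bsub>A'\<^esub> y)"])
      show "(\<lambda>s. ?c (frag_mult (frag_of a) s))
          \<in> hom (tensor_free (scalar_bimodule A) A') (add_monoid P.T)"
        using frag_mult_closed[OF ac]
        by (intro homI) (simp_all add: frag_mult_add_r P.class_add P.class_carrier del: frag_extend_of)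
      show "P.balanced P.T (\<lambda>x y. pure_tensor \<O> (scalar_bimodule A) A' (x' \<otimes>\<^bsub>A\<^esub> x) (y' \<otimes>\<^bsub>A'\<^esub> y))"
      proof (rule P.balancedI, goal_cases)
        case (4 x r y)
        then show ?case using a P.pt_move[of "x' \<otimes>\<^bsub>A\<^esub> x" r "y' \<otimes>\<^bsub>A'\<^esub> y"]
          by (simp add: A.smult_mult_right A'.smult_mult_right)
      qed (use a P.pt_add_l P.pt_add_r in \<open>simp_all add: A.r_distr A'.r_distr P.pt_closed\<close>)
    qed (use that(1) a P.abelian_group_T in \<open>simp_all add: pure_tensor_def\<close>)
  qed
  \<comment> \<open>The left representative is replaced first, with the right one still arbitrary,
    so that only one relation has to be dealt with at a time.\<close>
  have eq: "?c (frag_mult t t') = ?c (frag_mult s s')" if t: "t \<in> ?c s" "t' \<in> ?c s'" for t t'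
  proof -
    obtain \<rho> \<rho>' where \<rho>: "\<rho> \<in> tensor_rel \<O> (scalar_bimodule A) A'" "t = \<rho> + s"
        "\<rho>' \<in> tensor_rel \<O> (scalar_bimodule A) A'" "t' = \<rho>' + s'"
      using t P.class_mem by metis
    have t'c: "t' \<in> carrier (tensor_free A A')"
      using \<rho> assms(2) P.free_add[of \<rho>' s'] by (simp add: relc)
    have "?c (frag_mult t t') = ?c (frag_mult \<rho> t') \<oplus>\<^bsub>P.T\<^esub> ?c (frag_mult s t')"
      unfolding \<rho>(2) frag_extend_add
      using frag_mult_closed[OF relc[OF \<rho>(1)] t'c] frag_mult_closed[OF assms(1) t'c] by (simp add: P.class_add)
    also have "\<dots> = ?c (frag_mult s t')"
      using l[OF \<rho>(1) t'c] frag_mult_closed[OF assms(1) t'c] by (simp add: P.class_carrier)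
    also have "\<dots> = ?c (frag_mult s \<rho>') \<oplus>\<^bsub>P.T\<^esub> ?c (frag_mult s s')"
      unfolding \<rho>(4) frag_mult_add_r
      using frag_mult_closed[OF assms(1) relc[OF \<rho>(3)]] frag_mult_closed[OF assms(1,2)]
      by (simp add: P.class_add)
    also have "\<dots> = ?c (frag_mult s s')"
      using r[OF \<rho>(3) assms(1)] frag_mult_closed[OF assms(1,2)] by (simp add: P.class_carrier)
    finally show ?thesis .
  qed
  have self: "s \<in> ?c s" "s' \<in> ?c s'" using assms by (simp_all add: P.class_self)
  have "?c s \<otimes>\<^bsub>AT\<^esub> ?c s' = (\<Union>t\<in>?c s. \<Union>t'\<in>?c s'. ?c (frag_mult t t'))"
    by (simp add: tensor_algebra_def Let_def)
  also have "\<dots> = ?c (frag_mult s s')"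
    by (intro UN_eq_const[OF self(1)] UN_eq_const[OF self(2)] eq)
  finally show ?thesis .
qed

lemma carrier_ATE:
  assumes "x \<in> carrier AT"
  obtains t where "t \<in> carrier (tensor_free A A')" "x = tensor_class \<O> (scalar_bimodule A) A' t"
  using P.carrierE[of x] assms by (auto simp: AT_simps)

lemma at_closed [simp]: "\<lbrakk>x \<in> carrier A; y \<in> carrier A'\<rbrakk> \<Longrightarrow> x \<otimes>\<otimes> y \<in> carrier AT"
  by (simp add: alg_tensor_def AT_simps P.pt_closed)

lemma at_mult: "\<lbrakk>x \<in> carrier A; y \<in> carrier A'; x' \<in> carrier A; y' \<in> carrier A'\<rbrakk>
  \<Longrightarrow> (x \<otimes>\<otimes> y) \<otimes>\<^bsub>AT\<^esub> (x' \<otimes>\<otimes> y') = (x \<otimes>\<^bsub>A\<^esub> x') \<otimes>\<otimes> (y \<otimes>\<^bsub>A'\<^esub> y')"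
  using class_frag_mult[of "frag_of (x, y)" "frag_of (x', y')"]
  by (simp add: alg_tensor_def pure_tensor_def)

lemma AT_mult_closed:
  assumes "s \<in> carrier AT" "t \<in> carrier AT" shows "s \<otimes>\<^bsub>AT\<^esub> t \<in> carrier AT"
proof -
  obtain x where x: "x \<in> carrier (tensor_free A A')" "s = tensor_class \<O> (scalar_bimodule A) A' x"
    using assms(1) by (rule carrier_ATE)
  obtain y where y: "y \<in> carrier (tensor_free A A')" "t = tensor_class \<O> (scalar_bimodule A) A' y"
    using assms(2) by (rule carrier_ATE)
  show ?thesis
    unfolding x(2) y(2) class_frag_mult[OF x(1) y(1)] AT_simps(1)
    using frag_mult_closed[OF x(1) y(1)] by (intro P.class_carrier) simp
qed

lemma abelian_group_AT: "abelian_group AT"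
  by (rule abelian_group_cong[OF _ _ _ P.abelian_group_T]) (simp_all add: AT_simps)

lemma AT_l_distr:
  assumes "a \<in> carrier AT" "b \<in> carrier AT" "t \<in> carrier AT"
  shows "(a \<oplus>\<^bsub>AT\<^esub> b) \<otimes>\<^bsub>AT\<^esub> t = a \<otimes>\<^bsub>AT\<^esub> t \<oplus>\<^bsub>AT\<^esub> b \<otimes>\<^bsub>AT\<^esub> t"
proof -
  let ?c = "tensor_class \<O> (scalar_bimodule A) A'"
  obtain x y z where x: "x \<in> carrier (tensor_free A A')" "a = ?c x"
    and y: "y \<in> carrier (tensor_free A A')" "b = ?c y"
    and z: "z \<in> carrier (tensor_free A A')" "t = ?c z"
    using assms by (metis carrier_ATE)
  have "a \<oplus>\<^bsub>AT\<^esub> b = ?c (x + y)" using x y P.class_add[of x y] by (simp add: AT_simps)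
  then have "(a \<oplus>\<^bsub>AT\<^esub> b) \<otimes>\<^bsub>AT\<^esub> t = ?c (frag_mult (x + y) z)"
    using class_frag_mult[of "x + y" z] x y z P.free_add[of x y] by simp
  also have "\<dots> = ?c (frag_mult x z) \<oplus>\<^bsub>P.T\<^esub> ?c (frag_mult y z)"
    unfolding frag_extend_add using x y z frag_mult_closed[of x z] frag_mult_closed[of y z]
    by (intro P.class_add) simp_all
  finally show ?thesis using x y z by (simp add: class_frag_mult AT_simps)
qed

lemma AT_r_distr:
  assumes "a \<in> carrier AT" "b \<in> carrier AT" "t \<in> carrier AT"
  shows "t \<otimes>\<^bsub>AT\<^esub> (a \<oplus>\<^bsub>AT\<^esub> b) = t \<otimes>\<^bsub>AT\<^esub> a \<oplus>\<^bsub>AT\<^esub> t \<otimes>\<^bsub>AT\<^esub> b"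
proof -
  let ?c = "tensor_class \<O> (scalar_bimodule A) A'"
  obtain x y z where x: "x \<in> carrier (tensor_free A A')" "a = ?c x"
    and y: "y \<in> carrier (tensor_free A A')" "b = ?c y"
    and z: "z \<in> carrier (tensor_free A A')" "t = ?c z"
    using assms by (metis carrier_ATE)
  have "a \<oplus>\<^bsub>AT\<^esub> b = ?c (x + y)" using x y P.class_add[of x y] by (simp add: AT_simps)
  then have "t \<otimes>\<^bsub>AT\<^esub> (a \<oplus>\<^bsub>AT\<^esub> b) = ?c (frag_mult z (x + y))"
    using class_frag_mult[of z "x + y"] x y z P.free_add[of x y] by simp
  also have "\<dots> = ?c (frag_mult z x) \<oplus>\<^bsub>P.T\<^esub> ?c (frag_mult z y)"
    unfolding frag_mult_add_r using x y z frag_mult_closed[of z x] frag_mult_closed[of z y]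
    by (intro P.class_add) simp_all
  finally show ?thesis using x y z by (simp add: class_frag_mult AT_simps)
qed

lemma AT_mult_hom:
  "t \<in> carrier AT \<Longrightarrow> (\<lambda>s. s \<otimes>\<^bsub>AT\<^esub> t) \<in> add_hom AT AT"
  "t \<in> carrier AT \<Longrightarrow> (\<lambda>s. t \<otimes>\<^bsub>AT\<^esub> s) \<in> add_hom AT AT"
  by (rule add_homI; simp add: AT_mult_closed AT_l_distr AT_r_distr)+

lemma AT_span: "carrier AT = add_span AT {x \<otimes>\<otimes> y | x y. x \<in> carrier A \<and> y \<in> carrier A'}"
  using P.T_span add_span_cong[of AT P.T] by (simp add: AT_simps alg_tensor_def)

lemma AT_hom_eq:
  assumes "f \<in> add_hom AT B" "g \<in> add_hom AT B" "abelian_group B"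
    and "\<And>x y. \<lbrakk>x \<in> carrier A; y \<in> carrier A'\<rbrakk> \<Longrightarrow> f (x \<otimes>\<otimes> y) = g (x \<otimes>\<otimes> y)"
    and "t \<in> carrier AT"
  shows "f t = g t"
  by (rule add_hom_eq_on_span[OF assms(1,2) abelian_group_AT assms(3), where
        S = "{x \<otimes>\<otimes> y | x y. x \<in> carrier A \<and> y \<in> carrier A'}"])
     (use assms(4,5) AT_span in auto)

text \<open>Both sides are additive in each factor, so the factors are reduced to pure tensors one
  by one: \<open>t\<close> first, then \<open>b\<close>, then \<open>a\<close>.\<close>

lemma AT_assoc:
  assumes a: "a \<in> carrier AT" and b: "b \<in> carrier AT" and t: "t \<in> carrier AT"
  shows "a \<otimes>\<^bsub>AT\<^esub> b \<otimes>\<^bsub>AT\<^esub> t = a \<otimes>\<^bsub>AT\<^esub> (b \<otimes>\<^bsub>AT\<^esub> t)"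
proof -
  have 1: "(x \<otimes>\<otimes> y) \<otimes>\<^bsub>AT\<^esub> (x' \<otimes>\<otimes> y') \<otimes>\<^bsub>AT\<^esub> t = (x \<otimes>\<otimes> y) \<otimes>\<^bsub>AT\<^esub> ((x' \<otimes>\<otimes> y') \<otimes>\<^bsub>AT\<^esub> t)"
    if "x \<in> carrier A" "y \<in> carrier A'" "x' \<in> carrier A" "y' \<in> carrier A'" for x y x' y'
    by (rule AT_hom_eq[where f = "\<lambda>t. (x \<otimes>\<otimes> y) \<otimes>\<^bsub>AT\<^esub> (x' \<otimes>\<otimes> y') \<otimes>\<^bsub>AT\<^esub> t" and
          g = "\<lambda>t. (x \<otimes>\<otimes> y) \<otimes>\<^bsub>AT\<^esub> ((x' \<otimes>\<otimes> y') \<otimes>\<^bsub>AT\<^esub> t)", OF add_homI add_homI abelian_group_AT _ t])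
       (use that in \<open>simp_all add: AT_mult_closed at_mult A.m_assoc A'.m_assoc AT_l_distr AT_r_distr\<close>)
  have 2: "(x \<otimes>\<otimes> y) \<otimes>\<^bsub>AT\<^esub> b \<otimes>\<^bsub>AT\<^esub> t = (x \<otimes>\<otimes> y) \<otimes>\<^bsub>AT\<^esub> (b \<otimes>\<^bsub>AT\<^esub> t)"
    if "x \<in> carrier A" "y \<in> carrier A'" for x y
    by (rule AT_hom_eq[where f = "\<lambda>b. (x \<otimes>\<otimes> y) \<otimes>\<^bsub>AT\<^esub> b \<otimes>\<^bsub>AT\<^esub> t" and
          g = "\<lambda>b. (x \<otimes>\<otimes> y) \<otimes>\<^bsub>AT\<^esub> (b \<otimes>\<^bsub>AT\<^esub> t)", OF add_homI add_homI abelian_group_AT _ b])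
       (use that t in \<open>simp_all add: AT_mult_closed 1 AT_l_distr AT_r_distr\<close>)
  show ?thesis
    by (rule AT_hom_eq[where f = "\<lambda>a. a \<otimes>\<^bsub>AT\<^esub> b \<otimes>\<^bsub>AT\<^esub> t" and
          g = "\<lambda>a. a \<otimes>\<^bsub>AT\<^esub> (b \<otimes>\<^bsub>AT\<^esub> t)", OF add_homI add_homI abelian_group_AT _ a])
       (use t b in \<open>simp_all add: AT_mult_closed 2 AT_l_distr AT_r_distr\<close>)
qed

lemma AT_one:
  assumes t: "t \<in> carrier AT"
  shows "\<one>\<^bsub>AT\<^esub> \<otimes>\<^bsub>AT\<^esub> t = t" "t \<otimes>\<^bsub>AT\<^esub> \<one>\<^bsub>AT\<^esub> = t"
proof -
  have o: "\<one>\<^bsub>AT\<^esub> \<in> carrier AT" by (simp add: AT_simps(4))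
  show "\<one>\<^bsub>AT\<^esub> \<otimes>\<^bsub>AT\<^esub> t = t"
    by (rule AT_hom_eq[where f = "\<lambda>t. \<one>\<^bsub>AT\<^esub> \<otimes>\<^bsub>AT\<^esub> t" and g = "\<lambda>t. t",
          OF AT_mult_hom(2)[OF o] add_hom_id abelian_group_AT _ t]) (simp add: AT_simps(4) at_mult)
  show "t \<otimes>\<^bsub>AT\<^esub> \<one>\<^bsub>AT\<^esub> = t"
    by (rule AT_hom_eq[where f = "\<lambda>t. t \<otimes>\<^bsub>AT\<^esub> \<one>\<^bsub>AT\<^esub>" and g = "\<lambda>t. t",
          OF AT_mult_hom(1)[OF o] add_hom_id abelian_group_AT _ t]) (simp add: AT_simps(4) at_mult)
qed

lemma AT_ring: "ring AT"
proof (rule ringI[OF abelian_group_AT])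
  show "Group.monoid AT"
    by (rule monoidI) (simp_all add: AT_mult_closed AT_assoc AT_one, simp add: AT_simps(4))
qed (simp_all add: AT_l_distr AT_r_distr)

end

text \<open>For a fixed \<open>v\<close> the expression \<open>(c v) c'\<close> is balanced in
  \<open>c\<close> and \<open>c'\<close>, hence an additive map on the tensor algebra. Choosing such
  a map for every \<open>v\<close> gives the action, and the module laws are then tested on pure
  tensors.\<close>

lemma bimodule_tensor_module:
  assumes V: "bimodule \<O> R S V"
  obtains act where "left_module (tensor_algebra \<O> R (opposite S)) (module_of V act)"
    "\<And>c c' v. \<lbrakk>c \<in> carrier R; c' \<in> carrier S; v \<in> carrier V\<rbrakk>
      \<Longrightarrow> act (alg_tensor \<O> R (opposite S) c c') v = (c \<odot>\<^bsub>V\<^esub> v) \<odot>r\<^bsub>V\<^esub> c'"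
proof -
  interpret V: bimodule \<O> R S V by fact
  interpret A: algebra_pair \<O> R "opposite S"
    by (intro algebra_pair.intro V.R.assoc_algebra_axioms V.S.opposite)
  note VA = V.M.abelian_group_axioms
  have ex: "\<exists>h\<in>add_hom A.AT V. \<forall>c\<in>carrier R. \<forall>c'\<in>carrier S. h (A.at c c') = (c \<odot>\<^bsub>V\<^esub> v) \<odot>r\<^bsub>V\<^esub> c'"
    if v: "v \<in> carrier V" for v
  proof -
    have "A.P.balanced V (\<lambda>c c'. (c \<odot>\<^bsub>V\<^esub> v) \<odot>r\<^bsub>V\<^esub> c')"
      by (rule A.P.balancedI)
         (use v in \<open>simp_all add: V.smult_closed V.rsmult_closed V.smult_l_distr V.rsmult_l_distr
           V.rsmult_r_distr V.scalar_move\<close>)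
    from A.P.universal[OF VA this] obtain h where "h \<in> add_hom A.P.T V"
      "\<And>x y. \<lbrakk>x \<in> carrier R; y \<in> carrier S\<rbrakk> \<Longrightarrow> h (A.at x y) = (x \<odot>\<^bsub>V\<^esub> v) \<odot>r\<^bsub>V\<^esub> y"
      by (auto simp: alg_tensor_def)
    moreover have "add_hom A.AT V = add_hom A.P.T V" by (simp add: hom_def A.AT_simps)
    ultimately show ?thesis by auto
  qed
  define H where "H v = (SOME h. h \<in> add_hom A.AT V \<and>
    (\<forall>c\<in>carrier R. \<forall>c'\<in>carrier S. h (A.at c c') = (c \<odot>\<^bsub>V\<^esub> v) \<odot>r\<^bsub>V\<^esub> c'))" for v
  have "H v \<in> add_hom A.AT V \<and>
      (\<forall>c\<in>carrier R. \<forall>c'\<in>carrier S. H v (A.at c c') = (c \<odot>\<^bsub>V\<^esub> v) \<odot>r\<^bsub>V\<^esub> c')" if "v \<in> carrier V" for v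
    unfolding H_def by (rule someI_ex[OF ex[OF that, unfolded Bex_def]])
  then have H: "\<And>v. v \<in> carrier V \<Longrightarrow> H v \<in> add_hom A.AT V"
    "\<And>v c c'. \<lbrakk>v \<in> carrier V; c \<in> carrier R; c' \<in> carrier S\<rbrakk>
      \<Longrightarrow> H v (A.at c c') = (c \<odot>\<^bsub>V\<^esub> v) \<odot>r\<^bsub>V\<^esub> c'"
    by simp_all
  have Hc: "H v t \<in> carrier V" if "v \<in> carrier V" "t \<in> carrier A.AT" for v t
    using that by (intro add_hom_closed[OF H(1)])
  have Hadd: "H (v \<oplus>\<^bsub>V\<^esub> w) t = H v t \<oplus>\<^bsub>V\<^esub> H w t"
    if "v \<in> carrier V" "w \<in> carrier V" "t \<in> carrier A.AT" for v w t
  proof (rule A.AT_hom_eq[where f = "H (v \<oplus>\<^bsub>V\<^esub> w)" and g = "\<lambda>t. H v t \<oplus>\<^bsub>V\<^esub> H w t", OF H(1) _ VA _ that(3)])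
    show "(\<lambda>t. H v t \<oplus>\<^bsub>V\<^esub> H w t) \<in> add_hom A.AT V"
      by (rule add_homI) (use that in \<open>simp_all add: Hc add_hom_add[OF H(1)] V.M.a_ac\<close>)
  qed (use that in \<open>simp_all add: H(2) V.smult_r_distr V.rsmult_l_distr V.smult_closed\<close>)
  have HH: "(\<lambda>v. H v t) \<in> add_hom V V" if "t \<in> carrier A.AT" for t
    using that by (intro add_homI Hc Hadd)
  have Hmult: "H v (s \<otimes>\<^bsub>A.AT\<^esub> t) = H (H v t) s"
    if v: "v \<in> carrier V" and s: "s \<in> carrier A.AT" and t: "t \<in> carrier A.AT" for v s t
  proof -
    have 1: "H v (A.at c c' \<otimes>\<^bsub>A.AT\<^esub> t) = H (H v t) (A.at c c')"
      if c: "c \<in> carrier R" "c' \<in> carrier S" for c c'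
    proof (rule A.AT_hom_eq[where f = "\<lambda>t. H v (A.at c c' \<otimes>\<^bsub>A.AT\<^esub> t)" and g = "\<lambda>t. H (H v t) (A.at c c')",
          OF add_homI add_homI VA _ t])
      \<comment> \<open>On pure tensors the reversed product of \<open>opposite S\<close> matches
        the associativity of the right action.\<close>
      fix x y assume "x \<in> carrier R" "y \<in> carrier (opposite S)"
      then show "H v (A.at c c' \<otimes>\<^bsub>A.AT\<^esub> A.at x y) = H (H v (A.at x y)) (A.at c c')"
        using v c by (simp add: A.at_mult H V.smult_closed V.rsmult_closed V.smult_assoc V.rsmult_assoc
            V.smult_rsmult_assoc)
    qed (use c v in \<open>simp_all add: Hc A.AT_mult_closed A.AT_r_distr add_hom_add[OF H(1)] Hadd\<close>)
    show ?thesis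
      by (rule A.AT_hom_eq[where f = "\<lambda>s. H v (s \<otimes>\<^bsub>A.AT\<^esub> t)" and g = "\<lambda>s. H (H v t) s",
            OF add_homI add_homI VA _ s])
         (use v t in \<open>simp_all add: 1 Hc A.AT_mult_closed A.AT_l_distr add_hom_add[OF H(1)]\<close>)
  qed
  show thesis
  proof (rule that[of "\<lambda>t v. H v t"])
    show "left_module A.AT (module_of V (\<lambda>t v. H v t))"
      by (intro left_module.intro left_module_axioms.intro A.AT_ring)
         (use VA in \<open>simp_all add: abelian_group_module_of Hc add_hom_add[OF H(1)] Hadd Hmult A.AT_simps(4)
           H(2) V.smult_one V.rsmult_one\<close>)
  qed (simp add: H(2))
qed


lemma add_span_mono: "S \<subseteq> S' \<Longrightarrow> add_span A S \<subseteq> add_span A S'"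
proof
  fix t assume S: "S \<subseteq> S'" and "t \<in> add_span A S"
  from this(2) show "t \<in> add_span A S'"
  proof (induction t rule: generate.induct)
    case one show ?case by (rule generate.one)
  next
    case (incl h) then show ?case using S by (intro generate.incl) auto
  next
    case (inv h) then show ?case using S by (intro generate.inv) auto
  next
    case (eng h1 h2) then show ?case by (intro generate.eng)
  qed
qed

text \<open>The existential form is the one that \<open>SOME\<close> can use, by which maps out of
  tensor products get their names below.\<close>

lemma (in tensor_pair) universal_ex:
  assumes "abelian_group A" "balanced A F"
  shows "\<exists>h. h \<in> add_hom T A \<and> (\<forall>x\<in>carrier V. \<forall>y\<in>carrier W. h (x \<otimes>\<otimes> y) = F x y)"
proof (rule universal[OF assms])
  fix h assume "h \<in> add_hom T A" "\<And>x y. \<lbrakk>x \<in> carrier V; y \<in> carrier W\<rbrakk> \<Longrightarrow> h (x \<otimes>\<otimes> y) = F x y"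
  then show ?thesis by (intro exI[of _ h]) simp
qed

section \<open>Dual bimodules and Morita equivalences\<close>

context bimodule
begin

abbreviation D where "D \<equiv> dual R M"

lemma dual_simps:
  "carrier D = {f \<in> carrier M \<rightarrow>\<^sub>E carrier R.
        (\<forall>x\<in>carrier M. \<forall>y\<in>carrier M. f (x \<oplus>\<^bsub>M\<^esub> y) = f x \<oplus>\<^bsub>R\<^esub> f y) \<and>
        (\<forall>a\<in>carrier R. \<forall>x\<in>carrier M. f (a \<odot>\<^bsub>M\<^esub> x) = a \<otimes>\<^bsub>R\<^esub> f x)}"
  "\<zero>\<^bsub>D\<^esub> = (\<lambda>x\<in>carrier M. \<zero>\<^bsub>R\<^esub>)"
  "f \<oplus>\<^bsub>D\<^esub> g = (\<lambda>x\<in>carrier M. f x \<oplus>\<^bsub>R\<^esub> g x)"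
  "b \<odot>\<^bsub>D\<^esub> f = (\<lambda>x\<in>carrier M. f (x \<odot>r\<^bsub>M\<^esub> b))"
  "f \<odot>r\<^bsub>D\<^esub> a = (\<lambda>x\<in>carrier M. f x \<otimes>\<^bsub>R\<^esub> a)"
  by (simp_all add: dual_def)

lemma dualI:
  assumes "\<And>x. x \<in> carrier M \<Longrightarrow> f x \<in> carrier R"
    and "\<And>x y. \<lbrakk>x \<in> carrier M; y \<in> carrier M\<rbrakk> \<Longrightarrow> f (x \<oplus>\<^bsub>M\<^esub> y) = f x \<oplus>\<^bsub>R\<^esub> f y"
    and "\<And>a x. \<lbrakk>a \<in> carrier R; x \<in> carrier M\<rbrakk> \<Longrightarrow> f (a \<odot>\<^bsub>M\<^esub> x) = a \<otimes>\<^bsub>R\<^esub> f x"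
  shows "(\<lambda>x\<in>carrier M. f x) \<in> carrier D"
  using assms by (auto simp: dual_simps smult_closed)

lemma dual_closed: "\<lbrakk>f \<in> carrier D; x \<in> carrier M\<rbrakk> \<Longrightarrow> f x \<in> carrier R"
  and dual_add: "\<lbrakk>f \<in> carrier D; x \<in> carrier M; y \<in> carrier M\<rbrakk>
    \<Longrightarrow> f (x \<oplus>\<^bsub>M\<^esub> y) = f x \<oplus>\<^bsub>R\<^esub> f y"
  and dual_smult: "\<lbrakk>f \<in> carrier D; a \<in> carrier R; x \<in> carrier M\<rbrakk>
    \<Longrightarrow> f (a \<odot>\<^bsub>M\<^esub> x) = a \<otimes>\<^bsub>R\<^esub> f x"
  by (auto simp: dual_simps)

text \<open>Functionals are extensional, so outside \<open>M\<close> their values are fixed.\<close>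

lemma dual_eqI:
  assumes "f \<in> carrier D" "g \<in> carrier D" "\<And>x. x \<in> carrier M \<Longrightarrow> f x = g x"
  shows "f = g"
proof -
  have "f \<in> extensional (carrier M)" "g \<in> extensional (carrier M)"
    using assms(1,2) by (auto simp: dual_simps PiE_def)
  then show ?thesis using assms(3) by (rule extensionalityI)
qed

lemma dual_apply:
  assumes "x \<in> carrier M"
  shows "(f \<oplus>\<^bsub>D\<^esub> g) x = f x \<oplus>\<^bsub>R\<^esub> g x" "\<zero>\<^bsub>D\<^esub> x = \<zero>\<^bsub>R\<^esub>"
    "(b \<odot>\<^bsub>D\<^esub> f) x = f (x \<odot>r\<^bsub>M\<^esub> b)" "(f \<odot>r\<^bsub>D\<^esub> a) x = f x \<otimes>\<^bsub>R\<^esub> a"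
  using assms by (simp_all add: dual_simps)

lemma dual_add_closed: "\<lbrakk>f \<in> carrier D; g \<in> carrier D\<rbrakk> \<Longrightarrow> f \<oplus>\<^bsub>D\<^esub> g \<in> carrier D"
  unfolding dual_simps(3)
  by (rule dualI) (simp_all add: dual_closed dual_add dual_smult R.a_ac R.r_distr)

lemma dual_left_closed: "\<lbrakk>b \<in> carrier S; f \<in> carrier D\<rbrakk> \<Longrightarrow> b \<odot>\<^bsub>D\<^esub> f \<in> carrier D"
  unfolding dual_simps(4)
  by (rule dualI) (simp_all add: dual_closed dual_add dual_smult rsmult_closed rsmult_l_distr smult_rsmult_assoc)

lemma dual_right_closed: "\<lbrakk>a \<in> carrier R; f \<in> carrier D\<rbrakk> \<Longrightarrow> f \<odot>r\<^bsub>D\<^esub> a \<in> carrier D"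
  unfolding dual_simps(5)
  by (rule dualI) (simp_all add: dual_closed dual_add dual_smult R.l_distr R.m_assoc)

lemma dual_zero_closed: "\<zero>\<^bsub>D\<^esub> \<in> carrier D"
  unfolding dual_simps(2) by (rule dualI) simp_all

lemma abelian_group_dual: "abelian_group D"
proof (rule abelian_groupI)
  fix f assume f: "f \<in> carrier D"
  have "(\<lambda>x\<in>carrier M. \<ominus>\<^bsub>R\<^esub> f x) \<in> carrier D"
    by (rule dualI) (use f in \<open>simp_all add: dual_closed dual_add dual_smult R.minus_add R.r_minus\<close>)
  moreover have "(\<lambda>x\<in>carrier M. \<ominus>\<^bsub>R\<^esub> f x) \<oplus>\<^bsub>D\<^esub> f = \<zero>\<^bsub>D\<^esub>"
    using f by (auto simp: dual_simps(2,3) fun_eq_iff dual_closed R.l_neg)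
  ultimately show "\<exists>g\<in>carrier D. g \<oplus>\<^bsub>D\<^esub> f = \<zero>\<^bsub>D\<^esub>" by blast
  show "\<zero>\<^bsub>D\<^esub> \<oplus>\<^bsub>D\<^esub> f = f"
    by (rule dual_eqI) (use f in \<open>simp_all add: dual_add_closed dual_zero_closed dual_apply dual_closed\<close>)
next
  fix f g h assume m: "f \<in> carrier D" "g \<in> carrier D" "h \<in> carrier D"
  show "f \<oplus>\<^bsub>D\<^esub> g \<oplus>\<^bsub>D\<^esub> h = f \<oplus>\<^bsub>D\<^esub> (g \<oplus>\<^bsub>D\<^esub> h)"
    by (rule dual_eqI) (use m in \<open>simp_all add: dual_add_closed dual_apply dual_closed R.a_assoc\<close>)
next
  fix f g assume m: "f \<in> carrier D" "g \<in> carrier D"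
  show "f \<oplus>\<^bsub>D\<^esub> g = g \<oplus>\<^bsub>D\<^esub> f"
    by (rule dual_eqI) (use m in \<open>simp_all add: dual_add_closed dual_apply dual_closed R.a_comm\<close>)
qed (simp_all add: dual_add_closed dual_zero_closed)

sublocale D: abelian_group D
  by (rule abelian_group_dual)

lemma dual_hom: "f \<in> carrier D \<Longrightarrow> f \<in> add_hom M R"
  by (rule add_homI) (simp_all add: dual_closed dual_add)

text \<open>\<open>MD\<close> and \<open>DM\<close> are the two tensor products of a Morita context:
  the bimodule with its dual over \<open>S\<close>, and the dual with the bimodule over
  \<open>R\<close>.\<close>

sublocale MD: tensor_pair S M D
  by (intro tensor_pair.intro tensor_pair_axioms.intro M.abelian_group_axioms abelian_group_dual
      rsmult_closed dual_left_closed)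

sublocale DM: tensor_pair R D M
  by (intro tensor_pair.intro tensor_pair_axioms.intro M.abelian_group_axioms abelian_group_dual
      smult_closed dual_right_closed)

lemma MD_lsmult:
  assumes "a \<in> carrier R"
  shows "tensor_lsmult S M D a \<in> add_hom MD.T MD.T"
    and "\<And>x f. \<lbrakk>x \<in> carrier M; f \<in> carrier D\<rbrakk>
      \<Longrightarrow> tensor_lsmult S M D a (pure_tensor S M D x f) = pure_tensor S M D (a \<odot>\<^bsub>M\<^esub> x) f"
proof -
  have *: "a \<odot>\<^bsub>M\<^esub> (x \<odot>r\<^bsub>M\<^esub> s) = (a \<odot>\<^bsub>M\<^esub> x) \<odot>r\<^bsub>M\<^esub> s" if "x \<in> carrier M" "s \<in> carrier S" for x s
    using assms that by (simp add: smult_rsmult_assoc)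
  show "tensor_lsmult S M D a \<in> add_hom MD.T MD.T"
    by (rule MD.lsmult(1)[OF smult_hom[OF assms] *])
  show "tensor_lsmult S M D a (pure_tensor S M D x f) = pure_tensor S M D (a \<odot>\<^bsub>M\<^esub> x) f"
    if "x \<in> carrier M" "f \<in> carrier D" for x f
    by (rule MD.lsmult(2)[OF smult_hom[OF assms] * that])
qed

lemma MD_rsmult:
  assumes "a \<in> carrier R"
  shows "(\<lambda>t. tensor_rsmult S M D t a) \<in> add_hom MD.T MD.T"
    and "\<And>x f. \<lbrakk>x \<in> carrier M; f \<in> carrier D\<rbrakk>
      \<Longrightarrow> tensor_rsmult S M D (pure_tensor S M D x f) a = pure_tensor S M D x (f \<odot>r\<^bsub>D\<^esub> a)"
proof -
  have 1: "(\<lambda>f. f \<odot>r\<^bsub>D\<^esub> a) \<in> add_hom D D"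
    by (intro add_homI dual_right_closed[OF assms] dual_eqI)
       (simp_all add: assms dual_right_closed dual_apply dual_add_closed dual_closed R.l_distr)
  have 2: "(s \<odot>\<^bsub>D\<^esub> f) \<odot>r\<^bsub>D\<^esub> a = s \<odot>\<^bsub>D\<^esub> (f \<odot>r\<^bsub>D\<^esub> a)" if "s \<in> carrier S" "f \<in> carrier D" for s f
    by (rule dual_eqI) (use that assms in \<open>simp_all add: dual_left_closed dual_right_closed dual_apply rsmult_closed\<close>)
  show "(\<lambda>t. tensor_rsmult S M D t a) \<in> add_hom MD.T MD.T"
    by (rule tensor_rsmult_hom[OF MD.tensor_pair_axioms 1 2])
  show "tensor_rsmult S M D (pure_tensor S M D x f) a = pure_tensor S M D x (f \<odot>r\<^bsub>D\<^esub> a)"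
    if "x \<in> carrier M" "f \<in> carrier D" for x f
    by (rule tensor_rsmult_pt[OF MD.tensor_pair_axioms 1 2 that])
qed

lemma DM_lsmult:
  assumes "s \<in> carrier S"
  shows "tensor_lsmult R D M s \<in> add_hom DM.T DM.T"
    and "\<And>f x. \<lbrakk>f \<in> carrier D; x \<in> carrier M\<rbrakk>
      \<Longrightarrow> tensor_lsmult R D M s (pure_tensor R D M f x) = pure_tensor R D M (s \<odot>\<^bsub>D\<^esub> f) x"
proof -
  have 1: "(\<lambda>f. s \<odot>\<^bsub>D\<^esub> f) \<in> add_hom D D"
    by (intro add_homI dual_left_closed[OF assms] dual_eqI)
       (simp_all add: assms dual_left_closed dual_apply dual_add_closed dual_closed rsmult_closed)
  have 2: "s \<odot>\<^bsub>D\<^esub> (f \<odot>r\<^bsub>D\<^esub> a) = (s \<odot>\<^bsub>D\<^esub> f) \<odot>r\<^bsub>D\<^esub> a" if "f \<in> carrier D" "a \<in> carrier R" for a f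
    by (rule dual_eqI) (use that assms in \<open>simp_all add: dual_left_closed dual_right_closed dual_apply rsmult_closed\<close>)
  show "tensor_lsmult R D M s \<in> add_hom DM.T DM.T"
    by (rule DM.lsmult(1)[OF 1 2])
  show "tensor_lsmult R D M s (pure_tensor R D M f x) = pure_tensor R D M (s \<odot>\<^bsub>D\<^esub> f) x"
    if "f \<in> carrier D" "x \<in> carrier M" for x f
    by (rule DM.lsmult(2)[OF 1 2 that])
qed

lemma DM_rsmult:
  assumes "s \<in> carrier S"
  shows "(\<lambda>t. tensor_rsmult R D M t s) \<in> add_hom DM.T DM.T"
    and "\<And>f x. \<lbrakk>f \<in> carrier D; x \<in> carrier M\<rbrakk>
      \<Longrightarrow> tensor_rsmult R D M (pure_tensor R D M f x) s = pure_tensor R D M f (x \<odot>r\<^bsub>M\<^esub> s)"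
proof -
  have 2: "(a \<odot>\<^bsub>M\<^esub> x) \<odot>r\<^bsub>M\<^esub> s = a \<odot>\<^bsub>M\<^esub> (x \<odot>r\<^bsub>M\<^esub> s)" if "a \<in> carrier R" "x \<in> carrier M" for a x
    using assms that by (simp add: smult_rsmult_assoc)
  show "(\<lambda>t. tensor_rsmult R D M t s) \<in> add_hom DM.T DM.T"
    by (rule tensor_rsmult_hom[OF DM.tensor_pair_axioms rsmult_hom[OF assms] 2])
  show "tensor_rsmult R D M (pure_tensor R D M f x) s = pure_tensor R D M f (x \<odot>r\<^bsub>M\<^esub> s)"
    if "f \<in> carrier D" "x \<in> carrier M" for x f
    by (rule tensor_rsmult_pt[OF DM.tensor_pair_axioms rsmult_hom[OF assms] 2 that])
qed

end

text \<open>Let \<open>\<alpha>\<close> and \<open>\<beta>\<close> be the given isomorphisms $M\otimes_SM^*\simeq R$ and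
  $M^*\otimes_RM\simeq S$. Both $x\cdot\beta(g\otimes q)$ and $\alpha(x\otimes g)\cdot u(q)$ are left
  \<open>R\<close>-linear in $x\otimes g$, and they agree if $u(q)$ is the value of the first one at
  $\alpha^{-1}(1)$. Hence right multiplication by $\beta(g\otimes q)$ is an endomorphism of
  rank one.\<close>

context bimodule
begin

context
  fixes \<alpha> \<beta>
  assumes \<alpha>: "bimodule_iso R R (tensor_bimodule S M D) (regular R) \<alpha>"
    and \<beta>: "bimodule_iso S S (tensor_bimodule R D M) (regular S) \<beta>"
begin

lemma \<alpha>_facts:
  shows \<alpha>_bij: "bij_betw \<alpha> (carrier MD.T) (carrier R)"
    and \<alpha>_hom: "\<alpha> \<in> add_hom MD.T R"
    and \<alpha>_l: "\<lbrakk>a \<in> carrier R; t \<in> carrier MD.T\<rbrakk> \<Longrightarrow> \<alpha> (tensor_lsmult S M D a t) = a \<otimes>\<^bsub>R\<^esub> \<alpha> t"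
    and \<alpha>_r: "\<lbrakk>a \<in> carrier R; t \<in> carrier MD.T\<rbrakk> \<Longrightarrow> \<alpha> (tensor_rsmult S M D t a) = \<alpha> t \<otimes>\<^bsub>R\<^esub> a"
  using \<alpha> by (auto simp: bimodule_iso_def tensor_bimodule_def regular_def bij_betw_def intro!: add_homI)

lemma \<beta>_facts:
  shows \<beta>_bij: "bij_betw \<beta> (carrier DM.T) (carrier S)"
    and \<beta>_hom: "\<beta> \<in> add_hom DM.T S"
    and \<beta>_l: "\<lbrakk>a \<in> carrier S; t \<in> carrier DM.T\<rbrakk> \<Longrightarrow> \<beta> (tensor_lsmult R D M a t) = a \<otimes>\<^bsub>S\<^esub> \<beta> t"
    and \<beta>_r: "\<lbrakk>a \<in> carrier S; t \<in> carrier DM.T\<rbrakk> \<Longrightarrow> \<beta> (tensor_rsmult R D M t a) = \<beta> t \<otimes>\<^bsub>S\<^esub> a"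
  using \<beta> by (auto simp: bimodule_iso_def tensor_bimodule_def regular_def bij_betw_def intro!: add_homI)

text \<open>With \<open>an\<close>, this is the pair of pairings of a Morita context, taken through
  the given isomorphisms. In particular \<open>br x f\<close> need not be
  \<open>f x\<close>.\<close>

definition br where "br x f = \<alpha> (pure_tensor S M D x f)"
definition an where "an f x = \<beta> (pure_tensor R D M f x)"

lemma br_closed: "\<lbrakk>x \<in> carrier M; f \<in> carrier D\<rbrakk> \<Longrightarrow> br x f \<in> carrier R"
  unfolding br_def by (intro add_hom_closed[OF \<alpha>_hom] MD.pt_closed)

lemma br_dual:
  assumes f: "f \<in> carrier D"
  shows "(\<lambda>x\<in>carrier M. br x f) \<in> carrier D"
proof (rule dualI)
  fix a x assume m: "a \<in> carrier R" "x \<in> carrier M"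
  show "br (a \<odot>\<^bsub>M\<^esub> x) f = a \<otimes>\<^bsub>R\<^esub> br x f"
    using \<alpha>_l[OF m(1) MD.pt_closed[OF m(2) f]] by (simp add: MD_lsmult m f br_def)
qed (use f in \<open>simp_all add: br_closed\<close>, simp add: br_def MD.pt_add_l add_hom_add[OF \<alpha>_hom])

lemma an_closed: "\<lbrakk>x \<in> carrier M; f \<in> carrier D\<rbrakk> \<Longrightarrow> an f x \<in> carrier S"
  unfolding an_def by (intro add_hom_closed[OF \<beta>_hom] DM.pt_closed)

lemma an_add_l: "\<lbrakk>x \<in> carrier M; f \<in> carrier D; g \<in> carrier D\<rbrakk> \<Longrightarrow> an (f \<oplus>\<^bsub>D\<^esub> g) x = an f x \<oplus>\<^bsub>S\<^esub> an g x"
  and an_add_r: "\<lbrakk>x \<in> carrier M; y \<in> carrier M; f \<in> carrier D\<rbrakk> \<Longrightarrow> an f (x \<oplus>\<^bsub>M\<^esub> y) = an f x \<oplus>\<^bsub>S\<^esub> an f y"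
  and an_move: "\<lbrakk>x \<in> carrier M; a \<in> carrier R; f \<in> carrier D\<rbrakk> \<Longrightarrow> an (f \<odot>r\<^bsub>D\<^esub> a) x = an f (a \<odot>\<^bsub>M\<^esub> x)"
  by (simp_all add: an_def DM.pt_add_l DM.pt_add_r DM.pt_move add_hom_add[OF \<beta>_hom])

lemma an_l: "\<lbrakk>x \<in> carrier M; s \<in> carrier S; f \<in> carrier D\<rbrakk> \<Longrightarrow> an (s \<odot>\<^bsub>D\<^esub> f) x = s \<otimes>\<^bsub>S\<^esub> an f x"
  using \<beta>_l[of s "pure_tensor R D M f x"] by (simp add: DM_lsmult an_def)

lemma an_r: "\<lbrakk>x \<in> carrier M; s \<in> carrier S; f \<in> carrier D\<rbrakk> \<Longrightarrow> an f (x \<odot>r\<^bsub>M\<^esub> s) = an f x \<otimes>\<^bsub>S\<^esub> s"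
  using \<beta>_r[of s "pure_tensor R D M f x"] by (simp add: DM_rsmult an_def)

text \<open>Although \<open>\<alpha>\<close> need not be evaluation, its value at a pure tensor is a
  value of a functional, namely of the one in \<open>br_dual\<close>; and \<open>\<alpha>\<close> is
  surjective.\<close>

lemma one_R_span: "\<one>\<^bsub>R\<^esub> \<in> add_span R {f x | f x. f \<in> carrier D \<and> x \<in> carrier M}"
proof -
  let ?P = "{pure_tensor S M D x f | x f. x \<in> carrier M \<and> f \<in> carrier D}"
  have "\<alpha> ` carrier MD.T = carrier R" using \<alpha>_bij by (simp add: bij_betw_def)
  then have "\<one>\<^bsub>R\<^esub> \<in> \<alpha> ` add_span MD.T ?P" using MD.T_span by auto
  also have "\<dots> = add_span R (\<alpha> ` ?P)"
    by (rule add_hom_span_image[OF \<alpha>_hom MD.abelian_group_T R.abelian_group_axioms]) auto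
  also have "\<dots> \<subseteq> add_span R {f x | f x. f \<in> carrier D \<and> x \<in> carrier M}"
  proof (rule add_span_mono, clarify)
    fix x f assume m: "x \<in> carrier M" "f \<in> carrier D"
    have "\<alpha> (pure_tensor S M D x f) = (\<lambda>x\<in>carrier M. br x f) x" using m by (simp add: br_def)
    then show "\<exists>g y. \<alpha> (pure_tensor S M D x f) = g y \<and> g \<in> carrier D \<and> y \<in> carrier M"
      using br_dual[OF m(2)] m(1) by blast
  qed
  finally show ?thesis .
qed

lemma one_S_span_an: "\<one>\<^bsub>S\<^esub> \<in> add_span S {an f x | f x. f \<in> carrier D \<and> x \<in> carrier M}"
proof -
  let ?P = "{pure_tensor R D M f x | f x. f \<in> carrier D \<and> x \<in> carrier M}"
  have "\<beta> ` carrier DM.T = carrier S" using \<beta>_bij by (simp add: bij_betw_def)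
  then have "\<one>\<^bsub>S\<^esub> \<in> \<beta> ` add_span DM.T ?P" using DM.T_span by auto
  also have "\<dots> = add_span S (\<beta> ` ?P)"
    by (rule add_hom_span_image[OF \<beta>_hom DM.abelian_group_T S.abelian_group_axioms]) auto
  also have "\<beta> ` ?P = {an f x | f x. f \<in> carrier D \<and> x \<in> carrier M}" by (auto simp: an_def)
  finally show ?thesis .
qed

lemma ex_u:
  "\<exists>u. u \<in> add_hom M M \<and> (\<forall>a\<in>carrier R. \<forall>q\<in>carrier M. u (a \<odot>\<^bsub>M\<^esub> q) = a \<odot>\<^bsub>M\<^esub> u q) \<and>
    (\<forall>x\<in>carrier M. \<forall>g\<in>carrier D. \<forall>q\<in>carrier M. x \<odot>r\<^bsub>M\<^esub> an g q = br x g \<odot>\<^bsub>M\<^esub> u q)"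
proof -
  note MA = M.abelian_group_axioms
  have ex: "\<exists>h. h \<in> add_hom MD.T M \<and> (\<forall>x\<in>carrier M. \<forall>g\<in>carrier D. h (pure_tensor S M D x g) = x \<odot>r\<^bsub>M\<^esub> an g q)"
    if q: "q \<in> carrier M" for q
  proof -
    have "MD.balanced M (\<lambda>x g. x \<odot>r\<^bsub>M\<^esub> an g q)"
      by (rule MD.balancedI)
         (use q in \<open>simp_all add: an_closed rsmult_closed rsmult_l_distr rsmult_r_distr an_add_l an_l rsmult_assoc\<close>)
    then show ?thesis by (rule MD.universal_ex[OF MA])
  qed
  define \<gamma> where "\<gamma> q = (SOME h. h \<in> add_hom MD.T M \<and>
    (\<forall>x\<in>carrier M. \<forall>g\<in>carrier D. h (pure_tensor S M D x g) = x \<odot>r\<^bsub>M\<^esub> an g q))" for q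
  have "\<gamma> q \<in> add_hom MD.T M \<and>
    (\<forall>x\<in>carrier M. \<forall>g\<in>carrier D. \<gamma> q (pure_tensor S M D x g) = x \<odot>r\<^bsub>M\<^esub> an g q)" if "q \<in> carrier M" for q
    unfolding \<gamma>_def by (rule someI_ex[OF ex[OF that]])
  then have \<gamma>: "\<And>q. q \<in> carrier M \<Longrightarrow> \<gamma> q \<in> add_hom MD.T M"
    "\<And>q x g. \<lbrakk>q \<in> carrier M; x \<in> carrier M; g \<in> carrier D\<rbrakk> \<Longrightarrow> \<gamma> q (pure_tensor S M D x g) = x \<odot>r\<^bsub>M\<^esub> an g q"
    by simp_all
  have \<gamma>_l: "\<gamma> q (tensor_lsmult S M D a t) = a \<odot>\<^bsub>M\<^esub> \<gamma> q t"
    if "q \<in> carrier M" "a \<in> carrier R" "t \<in> carrier MD.T" for q a t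
  proof (rule MD.hom_eq[where f = "\<lambda>t. \<gamma> q (tensor_lsmult S M D a t)" and g = "\<lambda>t. a \<odot>\<^bsub>M\<^esub> \<gamma> q t",
        OF add_homI add_homI MA _ that(3)])
  qed (use that in \<open>simp_all add: add_hom_closed[OF \<gamma>(1)] add_hom_closed[OF MD_lsmult(1)]
      add_hom_add[OF \<gamma>(1)] add_hom_add[OF MD_lsmult(1)] smult_closed smult_r_distr \<gamma>(2) MD_lsmult(2)
      smult_rsmult_assoc an_closed\<close>)
  \<comment> \<open>Multiplying the tensor by \<open>a\<close> on the right moves over to
    \<open>q\<close>; this is \<open>an_move\<close>, the balancedness of the second pairing over
    \<open>R\<close>.\<close>
  have \<gamma>_r: "\<gamma> q (tensor_rsmult S M D t a) = \<gamma> (a \<odot>\<^bsub>M\<^esub> q) t"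
    if "q \<in> carrier M" "a \<in> carrier R" "t \<in> carrier MD.T" for q a t
  proof (rule MD.hom_eq[where f = "\<lambda>t. \<gamma> q (tensor_rsmult S M D t a)" and g = "\<lambda>t. \<gamma> (a \<odot>\<^bsub>M\<^esub> q) t",
        OF add_homI \<gamma>(1) MA _ that(3)])
  qed (use that in \<open>simp_all add: add_hom_closed[OF \<gamma>(1)] add_hom_closed[OF MD_rsmult(1)]
      add_hom_add[OF \<gamma>(1)] add_hom_add[OF MD_rsmult(1)] smult_closed \<gamma>(2) MD_rsmult(2)
      an_closed dual_right_closed an_move\<close>)
  have \<gamma>_add: "\<gamma> (q \<oplus>\<^bsub>M\<^esub> q') t = \<gamma> q t \<oplus>\<^bsub>M\<^esub> \<gamma> q' t"
    if "q \<in> carrier M" "q' \<in> carrier M" "t \<in> carrier MD.T" for q q' t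
  proof (rule MD.hom_eq[where f = "\<gamma> (q \<oplus>\<^bsub>M\<^esub> q')" and g = "\<lambda>t. \<gamma> q t \<oplus>\<^bsub>M\<^esub> \<gamma> q' t",
        OF \<gamma>(1) add_homI MA _ that(3)])
  qed (use that in \<open>simp_all add: add_hom_closed[OF \<gamma>(1)] add_hom_add[OF \<gamma>(1)] \<gamma>(2)
      an_closed an_add_r rsmult_r_distr rsmult_closed M.a_ac\<close>)
  obtain \<tau> where \<tau>: "\<tau> \<in> carrier MD.T" "\<alpha> \<tau> = \<one>\<^bsub>R\<^esub>"
    using \<alpha>_bij R.one_closed unfolding bij_betw_def by (metis imageE)
  have \<alpha>_inj: "s = t" if "\<alpha> s = \<alpha> t" "s \<in> carrier MD.T" "t \<in> carrier MD.T" for s t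
    using \<alpha>_bij that unfolding bij_betw_def by (meson inj_onD)
  show ?thesis
  proof (intro exI[of _ "\<lambda>q. \<gamma> q \<tau>"] conjI ballI)
    show "(\<lambda>q. \<gamma> q \<tau>) \<in> add_hom M M"
      by (rule add_homI) (use \<tau> in \<open>simp_all add: \<gamma>_add add_hom_closed[OF \<gamma>(1)]\<close>)
    fix a q assume m: "a \<in> carrier R" "q \<in> carrier M"
    \<comment> \<open>\<open>\<tau>\<close> is central: both actions of \<open>a\<close> on it are
      sent to \<open>a\<close> by \<open>\<alpha>\<close>. This makes the map linear over
      \<open>R\<close>.\<close>
    have "tensor_rsmult S M D \<tau> a = tensor_lsmult S M D a \<tau>"
      by (rule \<alpha>_inj) (use m \<tau> in \<open>simp_all add: \<alpha>_l \<alpha>_r add_hom_closed[OF MD_rsmult(1)] add_hom_closed[OF MD_lsmult(1)]\<close>)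
    then show "\<gamma> (a \<odot>\<^bsub>M\<^esub> q) \<tau> = a \<odot>\<^bsub>M\<^esub> \<gamma> q \<tau>"
      using \<gamma>_l[OF m(2,1) \<tau>(1)] \<gamma>_r[OF m(2,1) \<tau>(1)] by simp
  next
    fix x g q assume m: "x \<in> carrier M" "g \<in> carrier D" "q \<in> carrier M"
    \<comment> \<open>By injectivity of \<open>\<alpha>\<close>, every pure tensor is the multiple
      of \<open>\<tau>\<close> by its value, and \<open>\<gamma> q\<close> is linear on the
      left.\<close>
    have "tensor_lsmult S M D (br x g) \<tau> = pure_tensor S M D x g"
      by (rule \<alpha>_inj) (use m \<tau> in \<open>simp_all add: \<alpha>_l br_closed add_hom_closed[OF MD_lsmult(1)]\<close>, simp add: br_def add_hom_closed[OF \<alpha>_hom])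
    then show "x \<odot>r\<^bsub>M\<^esub> an g q = br x g \<odot>\<^bsub>M\<^esub> \<gamma> q \<tau>"
      using \<gamma>_l[OF m(3) br_closed[OF m(1,2)] \<tau>(1)] \<gamma>(2)[OF m(3,1,2)] by simp
  qed
qed

text \<open>If \<open>s\<close> kills \<open>M\<close>, then \<open>an f x\<close> times
  \<open>s\<close> is \<open>an f\<close> at \<open>x s\<close>, hence zero; and one is in the span
  of the values of \<open>an\<close>.\<close>

lemma Morita_faithful:
  assumes s: "s \<in> carrier S" and z: "\<And>x. x \<in> carrier M \<Longrightarrow> x \<odot>r\<^bsub>M\<^esub> s = \<zero>\<^bsub>M\<^esub>"
  shows "s = \<zero>\<^bsub>S\<^esub>"
proof -
  have "\<one>\<^bsub>S\<^esub> \<otimes>\<^bsub>S\<^esub> s = \<zero>\<^bsub>S\<^esub>"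
    using one_S_span_an
  proof (rule S.add_span_induct)
    fix t assume "t \<in> {an f x | f x. f \<in> carrier D \<and> x \<in> carrier M}"
    then obtain f x where t: "t = an f x" "f \<in> carrier D" "x \<in> carrier M" by blast
    have "an f x \<otimes>\<^bsub>S\<^esub> s = an f \<zero>\<^bsub>M\<^esub>" using an_r[of x s f] t s z by simp
    also have "\<dots> = \<zero>\<^bsub>S\<^esub>"
      using an_add_r[of "\<zero>\<^bsub>M\<^esub>" "\<zero>\<^bsub>M\<^esub>" f] t an_closed[of "\<zero>\<^bsub>M\<^esub>" f] S.add.l_cancel_one by simp
    finally show "t \<otimes>\<^bsub>S\<^esub> s = \<zero>\<^bsub>S\<^esub>" using t by simp
  qed (use s in \<open>auto simp: an_closed S.l_distr S.l_minus\<close>)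
  then show ?thesis using s by simp
qed

text \<open>By \<open>ex_u\<close>, right multiplication by \<open>an f q\<close> has rank one, with
  the functional given by \<open>br\<close> and \<open>f\<close> and the vector
  \<open>u q\<close>.\<close>

lemma Morita_one_S:
  "\<one>\<^bsub>S\<^esub> \<in> add_span S {s \<in> carrier S. \<exists>f\<in>carrier D. \<exists>y\<in>carrier M. \<forall>x\<in>carrier M. x \<odot>r\<^bsub>M\<^esub> s = f x \<odot>\<^bsub>M\<^esub> y}"
proof (rule subsetD[OF add_span_mono one_S_span_an], clarify)
  obtain u where u: "u \<in> add_hom M M"
    "\<forall>a\<in>carrier R. \<forall>q\<in>carrier M. u (a \<odot>\<^bsub>M\<^esub> q) = a \<odot>\<^bsub>M\<^esub> u q"
    "\<forall>x\<in>carrier M. \<forall>g\<in>carrier D. \<forall>q\<in>carrier M. x \<odot>r\<^bsub>M\<^esub> an g q = br x g \<odot>\<^bsub>M\<^esub> u q"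
    using ex_u by blast
  fix f q assume m: "f \<in> carrier D" "q \<in> carrier M"
  have "\<forall>x\<in>carrier M. x \<odot>r\<^bsub>M\<^esub> an f q = (\<lambda>x\<in>carrier M. br x f) x \<odot>\<^bsub>M\<^esub> u q"
    using u(3) m by simp
  then show "an f q \<in> carrier S \<and> (\<exists>f'\<in>carrier D. \<exists>y\<in>carrier M. \<forall>x\<in>carrier M. x \<odot>r\<^bsub>M\<^esub> an f q = f' x \<odot>\<^bsub>M\<^esub> y)"
    using br_dual[OF m(1)] add_hom_closed[OF u(1) m(2)] an_closed m by blast
qed

text \<open>Following \<open>an g q\<close> by \<open>e\<close> replaces the vector
  \<open>u q\<close> by \<open>e (u q)\<close>. If this is again a value \<open>u y\<close>, the
  composite is right multiplication by \<open>an g y\<close>, and summing over a decomposition of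
  one gives \<open>e\<close>. Hence \<open>u\<close> has to be surjective, which follows from the
  same decomposition: \<open>x\<close> times \<open>an g q\<close> is \<open>u\<close> of
  \<open>br x g\<close> times \<open>q\<close>.\<close>

lemma Morita_full:
  assumes e: "e \<in> add_hom M M" "\<And>a x. \<lbrakk>a \<in> carrier R; x \<in> carrier M\<rbrakk> \<Longrightarrow> e (a \<odot>\<^bsub>M\<^esub> x) = a \<odot>\<^bsub>M\<^esub> e x"
  shows "\<exists>s\<in>carrier S. \<forall>x\<in>carrier M. e x = x \<odot>r\<^bsub>M\<^esub> s"
proof -
  obtain u where u: "u \<in> add_hom M M"
    "\<forall>a\<in>carrier R. \<forall>q\<in>carrier M. u (a \<odot>\<^bsub>M\<^esub> q) = a \<odot>\<^bsub>M\<^esub> u q"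
    "\<forall>x\<in>carrier M. \<forall>g\<in>carrier D. \<forall>q\<in>carrier M. x \<odot>r\<^bsub>M\<^esub> an g q = br x g \<odot>\<^bsub>M\<^esub> u q"
    using ex_u by blast
  note uc = add_hom_closed[OF u(1)] and ec = add_hom_closed[OF e(1)] and MA = M.abelian_group_axioms
  have sub: "{an f x | f x. f \<in> carrier D \<and> x \<in> carrier M} \<subseteq> carrier S"
    by (auto simp: an_closed)
  have "\<forall>x\<in>carrier M. \<exists>y\<in>carrier M. x \<odot>r\<^bsub>M\<^esub> \<one>\<^bsub>S\<^esub> = u y"
    using one_S_span_an sub
  proof (rule S.add_span_induct; intro ballI)
    fix x assume x: "x \<in> carrier M"
    show "\<exists>y\<in>carrier M. x \<odot>r\<^bsub>M\<^esub> \<zero>\<^bsub>S\<^esub> = u y"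
      using x by (intro bexI[of _ "\<zero>\<^bsub>M\<^esub>"]) (simp_all add: zero_rsmult add_hom_zero[OF u(1) MA MA])
    fix s assume "s \<in> {an f x | f x. f \<in> carrier D \<and> x \<in> carrier M}"
    then obtain g q where s: "s = an g q" "g \<in> carrier D" "q \<in> carrier M" by blast
    show "\<exists>y\<in>carrier M. x \<odot>r\<^bsub>M\<^esub> s = u y"
      using s x by (intro bexI[of _ "br x g \<odot>\<^bsub>M\<^esub> q"]) (simp_all add: u smult_closed br_closed)
  next
    fix s t x assume st: "s \<in> carrier S" "t \<in> carrier S" and x: "x \<in> carrier M"
      and "\<forall>x\<in>carrier M. \<exists>y\<in>carrier M. x \<odot>r\<^bsub>M\<^esub> s = u y" "\<forall>x\<in>carrier M. \<exists>y\<in>carrier M. x \<odot>r\<^bsub>M\<^esub> t = u y"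
    then obtain y z where yz: "y \<in> carrier M" "z \<in> carrier M" "x \<odot>r\<^bsub>M\<^esub> s = u y" "x \<odot>r\<^bsub>M\<^esub> t = u z" by meson
    then show "\<exists>y\<in>carrier M. x \<odot>r\<^bsub>M\<^esub> (s \<oplus>\<^bsub>S\<^esub> t) = u y"
      using st x by (intro bexI[of _ "y \<oplus>\<^bsub>M\<^esub> z"]) (simp_all add: add_hom_add[OF u(1)] rsmult_r_distr)
  next
    fix s x assume st: "s \<in> carrier S" and x: "x \<in> carrier M"
      and "\<forall>x\<in>carrier M. \<exists>y\<in>carrier M. x \<odot>r\<^bsub>M\<^esub> s = u y"
    then obtain y where yz: "y \<in> carrier M" "x \<odot>r\<^bsub>M\<^esub> s = u y" by meson
    then show "\<exists>y\<in>carrier M. x \<odot>r\<^bsub>M\<^esub> (\<ominus>\<^bsub>S\<^esub> s) = u y"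
      using st x by (intro bexI[of _ "\<ominus>\<^bsub>M\<^esub> y"]) (simp_all add: add_hom_minus[OF u(1) MA MA] minus_rsmult)
  qed
  then have surj: "\<exists>y\<in>carrier M. x = u y" if "x \<in> carrier M" for x
    using that rsmult_one by simp
  have "\<exists>s\<in>carrier S. \<forall>x\<in>carrier M. e (x \<odot>r\<^bsub>M\<^esub> \<one>\<^bsub>S\<^esub>) = x \<odot>r\<^bsub>M\<^esub> s"
    using one_S_span_an sub
  proof (rule S.add_span_induct)
    show "\<exists>s\<in>carrier S. \<forall>x\<in>carrier M. e (x \<odot>r\<^bsub>M\<^esub> \<zero>\<^bsub>S\<^esub>) = x \<odot>r\<^bsub>M\<^esub> s"
      by (intro bexI[of _ "\<zero>\<^bsub>S\<^esub>"]) (simp_all add: zero_rsmult add_hom_zero[OF e(1) MA MA])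
    fix r assume "r \<in> {an f x | f x. f \<in> carrier D \<and> x \<in> carrier M}"
    then obtain g q where r: "r = an g q" "g \<in> carrier D" "q \<in> carrier M" by blast
    obtain y where y: "y \<in> carrier M" "e (u q) = u y" using surj[OF ec[OF uc[OF r(3)]]] by blast
    show "\<exists>s\<in>carrier S. \<forall>x\<in>carrier M. e (x \<odot>r\<^bsub>M\<^esub> r) = x \<odot>r\<^bsub>M\<^esub> s"
      using r y by (intro bexI[of _ "an g y"]) (simp_all add: u(3) e(2) br_closed uc an_closed)
  next
    fix s t assume st: "s \<in> carrier S" "t \<in> carrier S"
      and "\<exists>s'\<in>carrier S. \<forall>x\<in>carrier M. e (x \<odot>r\<^bsub>M\<^esub> s) = x \<odot>r\<^bsub>M\<^esub> s'"
      and "\<exists>s'\<in>carrier S. \<forall>x\<in>carrier M. e (x \<odot>r\<^bsub>M\<^esub> t) = x \<odot>r\<^bsub>M\<^esub> s'"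
    then obtain s' t' where s: "s' \<in> carrier S" "\<forall>x\<in>carrier M. e (x \<odot>r\<^bsub>M\<^esub> s) = x \<odot>r\<^bsub>M\<^esub> s'"
      "t' \<in> carrier S" "\<forall>x\<in>carrier M. e (x \<odot>r\<^bsub>M\<^esub> t) = x \<odot>r\<^bsub>M\<^esub> t'" by meson
    show "\<exists>s'\<in>carrier S. \<forall>x\<in>carrier M. e (x \<odot>r\<^bsub>M\<^esub> (s \<oplus>\<^bsub>S\<^esub> t)) = x \<odot>r\<^bsub>M\<^esub> s'"
      using s st by (intro bexI[of _ "s' \<oplus>\<^bsub>S\<^esub> t'"]) (simp_all add: rsmult_r_distr rsmult_closed add_hom_add[OF e(1)])
  next
    fix s assume st: "s \<in> carrier S"
      and "\<exists>s'\<in>carrier S. \<forall>x\<in>carrier M. e (x \<odot>r\<^bsub>M\<^esub> s) = x \<odot>r\<^bsub>M\<^esub> s'"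
    then obtain s' where s: "s' \<in> carrier S" "\<forall>x\<in>carrier M. e (x \<odot>r\<^bsub>M\<^esub> s) = x \<odot>r\<^bsub>M\<^esub> s'" by meson
    show "\<exists>s'\<in>carrier S. \<forall>x\<in>carrier M. e (x \<odot>r\<^bsub>M\<^esub> (\<ominus>\<^bsub>S\<^esub> s)) = x \<odot>r\<^bsub>M\<^esub> s'"
      using s st by (intro bexI[of _ "\<ominus>\<^bsub>S\<^esub> s'"]) (simp_all add: minus_rsmult rsmult_closed add_hom_minus[OF e(1) MA MA])
  qed
  then show ?thesis by (simp add: rsmult_one)
qed

end

end


section \<open>Evaluation maps of a graded bimodule and its dual\<close>

lemma direct_sum_closed: "direct_sum A I \<A> \<Longrightarrow> i \<in> I \<Longrightarrow> a \<in> \<A> i \<Longrightarrow> a \<in> carrier A"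
  using additive_subgroup.a_Hcarr by (fastforce simp: direct_sum_def)

lemma (in graded_algebra) comp_closed: "x \<in> carrier \<Gamma> \<Longrightarrow> a \<in> \<A> x \<Longrightarrow> a \<in> carrier A"
  using direct_sum_closed[OF direct_sum] .

lemma (in graded_bimodule) comp_closed: "x \<in> carrier \<Gamma> \<Longrightarrow> m \<in> \<M> x \<Longrightarrow> m \<in> carrier M"
  using direct_sum_closed[OF direct_sum] .

lemma (in abelian_group) add_span_subset:
  assumes "additive_subgroup H G" "S \<subseteq> H" shows "add_span G S \<subseteq> H"
proof -
  have "subgroup H (add_monoid G)" using assms(1) by (simp add: additive_subgroup_def)
  then show ?thesis using group.generate_subgroup_incl[OF a_group assms(2)] by simp
qed

lemma (in bimodule) S_eqI:
  assumes iv: "\<And>s. \<lbrakk>s \<in> carrier S; \<forall>x\<in>carrier M. x \<odot>r\<^bsub>M\<^esub> s = \<zero>\<^bsub>M\<^esub>\<rbrakk> \<Longrightarrow> s = \<zero>\<^bsub>S\<^esub>"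
    and s: "s \<in> carrier S" "t \<in> carrier S" "\<And>x. x \<in> carrier M \<Longrightarrow> x \<odot>r\<^bsub>M\<^esub> s = x \<odot>r\<^bsub>M\<^esub> t"
  shows "s = t"
proof -
  have "s \<oplus>\<^bsub>S\<^esub> \<ominus>\<^bsub>S\<^esub> t = \<zero>\<^bsub>S\<^esub>"
    by (rule iv) (use s in \<open>simp_all add: rsmult_r_distr minus_rsmult rsmult_closed M.r_neg\<close>)
  then show ?thesis
    using s S.r_right_minus_eq[of s t] by (simp add: S.minus_eq)
qed

lemma add_hom_injI:
  assumes f: "f \<in> add_hom A B" and A: "abelian_group A" and B: "abelian_group B"
    and k: "\<And>x. \<lbrakk>x \<in> carrier A; f x = \<zero>\<^bsub>B\<^esub>\<rbrakk> \<Longrightarrow> x = \<zero>\<^bsub>A\<^esub>"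
  shows "inj_on f (carrier A)"
proof -
  interpret group_hom "add_monoid A" "add_monoid B" f by (rule add_hom_group_hom[OF f A B])
  have "f \<one>\<^bsub>add_monoid A\<^esub> = \<one>\<^bsub>add_monoid B\<^esub>" by (rule hom_one)
  moreover have "\<zero>\<^bsub>A\<^esub> \<in> carrier A"
    using A by (simp add: abelian_group_def abelian_monoid.zero_closed)
  ultimately have "\<zero>\<^bsub>A\<^esub> \<in> kernel (add_monoid A) (add_monoid B) f" by (simp add: kernel_def)
  moreover have "kernel (add_monoid A) (add_monoid B) f \<subseteq> {\<zero>\<^bsub>A\<^esub>}"
  proof (intro subsetI singletonI, unfold singleton_iff)
    fix x assume "x \<in> kernel (add_monoid A) (add_monoid B) f"
    then show "x = \<zero>\<^bsub>A\<^esub>" by (intro k) (simp_all add: kernel_def)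
  qed
  ultimately have "kernel (add_monoid A) (add_monoid B) f = {\<one>\<^bsub>add_monoid A\<^esub>}" by auto
  then show ?thesis using inj_on_one_iff k by simp
qed

text \<open>Surjectivity of the evaluation pairing and of the map sending $f\otimes y$ to the element
  of \<open>S\<close> that acts as $x\mapsto f(x)y$, on the components of degree one, makes both of them
  graded isomorphisms: injectivity follows from $t\cdot f(p) = \mathrm{ev}(t)\,(p\otimes f)$ and
  its analogue for the second map.\<close>

context graded_bimodule
begin

abbreviation dg where "dg \<equiv> dual_grading \<Gamma> R \<A> M \<M>"

lemma dg_closed: "f \<in> dg z \<Longrightarrow> f \<in> carrier D"
  and dg_apply: "\<lbrakk>f \<in> dg z; y \<in> carrier \<Gamma>; x \<in> \<M> y\<rbrakk> \<Longrightarrow> f x \<in> \<A> (y \<otimes>\<^bsub>\<Gamma>\<^esub> z)"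
  by (auto simp: dual_grading_def)

context
  assumes one_R: "\<one>\<^bsub>R\<^esub> \<in> add_span R {f x | f x. f \<in> dg \<one>\<^bsub>\<Gamma>\<^esub> \<and> x \<in> \<M> \<one>\<^bsub>\<Gamma>\<^esub>}"
    and rank_one: "\<And>f y. \<lbrakk>f \<in> carrier D; y \<in> carrier M\<rbrakk>
      \<Longrightarrow> \<exists>s\<in>carrier S. \<forall>x\<in>carrier M. x \<odot>r\<^bsub>M\<^esub> s = f x \<odot>\<^bsub>M\<^esub> y"
begin

lemma evaluation_iso:
  "\<exists>h. graded_bimodule_iso \<Gamma> R R (tensor_bimodule S M D) (tensor_grading \<Gamma> S M \<M> D dg) (regular R) \<A> h"
proof -
  let ?pt = "pure_tensor S M D"
  note RA = R.abelian_group_axioms and TA = MD.abelian_group_T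
  have "MD.balanced R (\<lambda>x f. f x)"
    by (rule MD.balancedI) (simp_all add: dual_closed dual_add dual_apply)
  from MD.universal_ex[OF RA this] obtain ev where ev: "ev \<in> add_hom MD.T R"
    "\<forall>x\<in>carrier M. \<forall>f\<in>carrier D. ev (?pt x f) = f x" by blast
  note evc = add_hom_closed[OF ev(1)]
  have ev_l: "ev (tensor_lsmult S M D a t) = a \<otimes>\<^bsub>R\<^esub> ev t" if "a \<in> carrier R" "t \<in> carrier MD.T" for a t
    by (rule MD.hom_eq[where f = "\<lambda>t. ev (tensor_lsmult S M D a t)" and g = "\<lambda>t. a \<otimes>\<^bsub>R\<^esub> ev t",
          OF add_homI add_homI RA _ that(2)])
       (use that in \<open>simp_all add: evc add_hom_add[OF ev(1)] add_hom_closed[OF MD_lsmult(1)]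
         add_hom_add[OF MD_lsmult(1)] MD_lsmult(2) ev(2) smult_closed dual_smult R.r_distr dual_closed\<close>)
  have ev_r: "ev (tensor_rsmult S M D t a) = ev t \<otimes>\<^bsub>R\<^esub> a" if "a \<in> carrier R" "t \<in> carrier MD.T" for a t
    by (rule MD.hom_eq[where f = "\<lambda>t. ev (tensor_rsmult S M D t a)" and g = "\<lambda>t. ev t \<otimes>\<^bsub>R\<^esub> a",
          OF add_homI add_homI RA _ that(2)])
       (use that in \<open>simp_all add: evc add_hom_add[OF ev(1)] add_hom_closed[OF MD_rsmult(1)]
         add_hom_add[OF MD_rsmult(1)] MD_rsmult(2) ev(2) dual_right_closed dual_apply R.l_distr dual_closed\<close>)
  have rs_hom: "(\<lambda>a. tensor_rsmult S M D t a) \<in> add_hom R MD.T" if t: "t \<in> carrier MD.T" for t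
  proof (rule add_homI)
    fix a b assume ab: "a \<in> carrier R" "b \<in> carrier R"
    have d: "f \<odot>r\<^bsub>D\<^esub> (a \<oplus>\<^bsub>R\<^esub> b) = f \<odot>r\<^bsub>D\<^esub> a \<oplus>\<^bsub>D\<^esub> f \<odot>r\<^bsub>D\<^esub> b" if "f \<in> carrier D" for f
      by (rule dual_eqI) (use that ab in \<open>simp_all add: dual_right_closed dual_add_closed dual_apply dual_closed R.r_distr\<close>)
    show "tensor_rsmult S M D t (a \<oplus>\<^bsub>R\<^esub> b) = tensor_rsmult S M D t a \<oplus>\<^bsub>MD.T\<^esub> tensor_rsmult S M D t b"
      by (rule MD.hom_eq[where f = "\<lambda>t. tensor_rsmult S M D t (a \<oplus>\<^bsub>R\<^esub> b)" and
            g = "\<lambda>t. tensor_rsmult S M D t a \<oplus>\<^bsub>MD.T\<^esub> tensor_rsmult S M D t b", OF add_homI add_homI TA _ t])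
         (use ab in \<open>simp_all add: add_hom_closed[OF MD_rsmult(1)] add_hom_add[OF MD_rsmult(1)] MD_rsmult(2)
           d MD.pt_add_r dual_right_closed MD.T.a_ac\<close>)
  qed (rule add_hom_closed[OF MD_rsmult(1) t])
  have key: "tensor_rsmult S M D t (f p) = ?pt (ev t \<odot>\<^bsub>M\<^esub> p) f"
    if m: "f \<in> carrier D" "p \<in> carrier M" and t: "t \<in> carrier MD.T" for f p t
  proof (rule MD.hom_eq[where f = "\<lambda>t. tensor_rsmult S M D t (f p)" and
            g = "\<lambda>t. ?pt (ev t \<odot>\<^bsub>M\<^esub> p) f", OF MD_rsmult(1) add_homI TA _ t])
    fix x h assume xh: "x \<in> carrier M" "h \<in> carrier D"
    \<comment> \<open>The rank one element \<open>s\<close> carries a scalar across the tensor sign: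
      in the dual, \<open>h\<close> times \<open>f p\<close> equals \<open>s\<close> times
      \<open>f\<close>, whereas \<open>x s\<close> is \<open>h x\<close> times
      \<open>p\<close>.\<close>
    obtain s where s: "s \<in> carrier S" "\<forall>y\<in>carrier M. y \<odot>r\<^bsub>M\<^esub> s = h y \<odot>\<^bsub>M\<^esub> p"
      using rank_one[OF xh(2) m(2)] by blast
    have "h \<odot>r\<^bsub>D\<^esub> f p = s \<odot>\<^bsub>D\<^esub> f"
      by (rule dual_eqI) (use m xh s in \<open>simp_all add: dual_right_closed dual_left_closed dual_closed dual_apply dual_smult\<close>)
    then have "tensor_rsmult S M D (?pt x h) (f p) = ?pt (x \<odot>r\<^bsub>M\<^esub> s) f"
      using m xh s(1) by (simp add: MD_rsmult(2) dual_closed MD.pt_move)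
    then show "tensor_rsmult S M D (?pt x h) (f p) = ?pt (ev (?pt x h) \<odot>\<^bsub>M\<^esub> p) f"
      using m xh s by (simp add: ev(2))
  qed (use m in \<open>simp_all add: evc smult_closed add_hom_add[OF ev(1)] smult_l_distr MD.pt_add_l dual_closed\<close>)
  have rs_one: "tensor_rsmult S M D t \<one>\<^bsub>R\<^esub> = t" if "t \<in> carrier MD.T" for t
  proof (rule MD.hom_eq[where f = "\<lambda>t. tensor_rsmult S M D t \<one>\<^bsub>R\<^esub>" and g = "\<lambda>t. t",
          OF MD_rsmult(1)[OF R.one_closed] add_hom_id TA _ that])
    fix x f assume "x \<in> carrier M" "f \<in> carrier D"
    moreover have "f \<odot>r\<^bsub>D\<^esub> \<one>\<^bsub>R\<^esub> = f"
      by (rule dual_eqI) (use calculation in \<open>simp_all add: dual_right_closed dual_apply dual_closed\<close>)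
    ultimately show "tensor_rsmult S M D (?pt x f) \<one>\<^bsub>R\<^esub> = ?pt x f" by (simp add: MD_rsmult(2))
  qed
  let ?G = "{f x | f x. f \<in> dg \<one>\<^bsub>\<Gamma>\<^esub> \<and> x \<in> \<M> \<one>\<^bsub>\<Gamma>\<^esub>}"
  have G: "?G \<subseteq> carrier R" using comp_closed[OF GR.\<Gamma>.one_closed] dg_closed by (auto simp: dual_closed)
  have inj: "inj_on ev (carrier MD.T)"
  proof (rule add_hom_injI[OF ev(1) TA RA])
    fix t assume t: "t \<in> carrier MD.T" "ev t = \<zero>\<^bsub>R\<^esub>"
    have "tensor_rsmult S M D t \<one>\<^bsub>R\<^esub> = \<zero>\<^bsub>MD.T\<^esub>"
      using one_R G
    proof (rule R.add_span_induct)
      fix r assume "r \<in> ?G"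
      then obtain f p where r: "r = f p" "f \<in> carrier D" "p \<in> carrier M"
        using comp_closed[OF GR.\<Gamma>.one_closed] dg_closed by blast
      then have "tensor_rsmult S M D t r = ?pt \<zero>\<^bsub>M\<^esub> f" using key[OF r(2,3) t(1)] t(2) by (simp add: zero_smult)
      also have "\<dots> = \<zero>\<^bsub>MD.T\<^esub>" by (rule add_hom_zero[OF MD.pt_hom_l[OF r(2)] M.abelian_group_axioms TA])
      finally show "tensor_rsmult S M D t r = \<zero>\<^bsub>MD.T\<^esub>" .
    qed (use add_hom_zero[OF rs_hom[OF t(1)] RA TA] add_hom_add[OF rs_hom[OF t(1)]]
        add_hom_minus[OF rs_hom[OF t(1)] RA TA] in simp_all)
    then show "t = \<zero>\<^bsub>MD.T\<^esub>" using rs_one t by simp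
  qed
  have surj: "ev ` carrier MD.T = carrier R"
  proof
    show "ev ` carrier MD.T \<subseteq> carrier R" using evc by blast
    show "carrier R \<subseteq> ev ` carrier MD.T"
    proof
      fix r assume r: "r \<in> carrier R"
      have "\<exists>t\<in>carrier MD.T. r \<otimes>\<^bsub>R\<^esub> \<one>\<^bsub>R\<^esub> = ev t"
        using one_R G
      proof (rule R.add_span_induct)
        show "\<exists>t\<in>carrier MD.T. r \<otimes>\<^bsub>R\<^esub> \<zero>\<^bsub>R\<^esub> = ev t"
          using r add_hom_zero[OF ev(1) TA RA] by (intro bexI[of _ "\<zero>\<^bsub>MD.T\<^esub>"]) simp_all
        fix s assume "s \<in> ?G"
        then obtain f p where s: "s = f p" "f \<in> carrier D" "p \<in> carrier M"
          using comp_closed[OF GR.\<Gamma>.one_closed] dg_closed by blast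
        then show "\<exists>t\<in>carrier MD.T. r \<otimes>\<^bsub>R\<^esub> s = ev t"
          using r by (intro bexI[of _ "?pt (r \<odot>\<^bsub>M\<^esub> p) f"]) (simp_all add: ev(2) smult_closed dual_smult)
      next
        fix x y assume "x \<in> carrier R" "y \<in> carrier R" "\<exists>t\<in>carrier MD.T. r \<otimes>\<^bsub>R\<^esub> x = ev t"
          "\<exists>t\<in>carrier MD.T. r \<otimes>\<^bsub>R\<^esub> y = ev t"
        then show "\<exists>t\<in>carrier MD.T. r \<otimes>\<^bsub>R\<^esub> (x \<oplus>\<^bsub>R\<^esub> y) = ev t"
          using r by (metis R.r_distr add_hom_add[OF ev(1)] MD.T.a_closed)
      next
        fix x assume "x \<in> carrier R" "\<exists>t\<in>carrier MD.T. r \<otimes>\<^bsub>R\<^esub> x = ev t"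
        then show "\<exists>t\<in>carrier MD.T. r \<otimes>\<^bsub>R\<^esub> (\<ominus>\<^bsub>R\<^esub> x) = ev t"
          using r by (metis R.r_minus add_hom_minus[OF ev(1) TA RA] MD.T.a_inv_closed)
      qed
      then show "r \<in> ev ` carrier MD.T" using r by auto
    qed
  qed
  have grade: "ev ` tensor_grading \<Gamma> S M \<M> D dg z = \<A> z" if z: "z \<in> carrier \<Gamma>" for z
  proof -
    let ?P = "{?pt x y | a b x y. a \<in> carrier \<Gamma> \<and> b \<in> carrier \<Gamma> \<and> a \<otimes>\<^bsub>\<Gamma>\<^esub> b = z \<and> x \<in> \<M> a \<and> y \<in> dg b}"
    let ?Q = "{f x | a b x f. a \<in> carrier \<Gamma> \<and> b \<in> carrier \<Gamma> \<and> a \<otimes>\<^bsub>\<Gamma>\<^esub> b = z \<and> x \<in> \<M> a \<and> f \<in> dg b}"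
    have "ev ` tensor_grading \<Gamma> S M \<M> D dg z = add_span R (ev ` ?P)"
      unfolding tensor_grading_def
      by (rule add_hom_span_image[OF ev(1) TA RA]) (use comp_closed dg_closed in auto)
    also have "ev ` ?P = ?Q"
    proof (intro equalityI subsetI)
      fix r assume "r \<in> ev ` ?P"
      then obtain a b x y where "r = ev (?pt x y)" "a \<in> carrier \<Gamma>" "b \<in> carrier \<Gamma>" "a \<otimes>\<^bsub>\<Gamma>\<^esub> b = z"
        "x \<in> \<M> a" "y \<in> dg b" by blast
      moreover from this have "r = y x" using ev(2) comp_closed dg_closed by simp
      ultimately show "r \<in> ?Q" by blast
    next
      fix r assume "r \<in> ?Q"
      then obtain a b x y where "r = y x" "a \<in> carrier \<Gamma>" "b \<in> carrier \<Gamma>" "a \<otimes>\<^bsub>\<Gamma>\<^esub> b = z"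
        "x \<in> \<M> a" "y \<in> dg b" by blast
      moreover from this have "r = ev (?pt x y)" using ev(2) comp_closed dg_closed by simp
      ultimately show "r \<in> ev ` ?P" by blast
    qed
    also have "add_span R ?Q = \<A> z"
    proof
      have Qc: "?Q \<subseteq> carrier R" using comp_closed dg_closed by (auto simp: dual_closed)
      show "add_span R ?Q \<subseteq> \<A> z"
        by (rule R.add_span_subset) (use GR.direct_sum z in \<open>auto simp: direct_sum_def dg_apply\<close>)
      show "\<A> z \<subseteq> add_span R ?Q"
      proof
        fix r assume r: "r \<in> \<A> z"
        have rc: "r \<in> carrier R" using GR.comp_closed[OF z r] .
        \<comment> \<open>One is generated in degree one, so multiplying by \<open>r\<close> puts
          the whole degree \<open>z\<close> on the argument: \<open>r\<close> times
          \<open>f p\<close> is \<open>f\<close> at \<open>r p\<close>, and \<open>r p\<close> has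
          degree \<open>z\<close>.\<close>
        have "r \<otimes>\<^bsub>R\<^esub> \<one>\<^bsub>R\<^esub> \<in> add_span R ?Q"
          using one_R G
        proof (rule R.add_span_induct)
          fix s assume "s \<in> ?G"
          then obtain f p where s: "s = f p" "f \<in> dg \<one>\<^bsub>\<Gamma>\<^esub>" "p \<in> \<M> \<one>\<^bsub>\<Gamma>\<^esub>" by blast
          have "r \<odot>\<^bsub>M\<^esub> p \<in> \<M> z" using smult_comp[OF z GR.\<Gamma>.one_closed r s(3)] z by simp
          moreover have "r \<otimes>\<^bsub>R\<^esub> s = f (r \<odot>\<^bsub>M\<^esub> p)"
            using s rc comp_closed[OF GR.\<Gamma>.one_closed s(3)] by (simp add: dual_smult[OF dg_closed])
          ultimately show "r \<otimes>\<^bsub>R\<^esub> s \<in> add_span R ?Q"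
            using s z by (intro add_span_incl CollectI exI[of _ z] exI[of _ "\<one>\<^bsub>\<Gamma>\<^esub>"] exI[of _ "r \<odot>\<^bsub>M\<^esub> p"] exI[of _ f]) simp
        qed (use rc R.add_span_zero R.add_span_add R.add_span_minus[OF Qc] in \<open>simp_all add: R.r_distr R.r_minus\<close>)
        then show "r \<in> add_span R ?Q" using rc by simp
      qed
    qed
    finally show ?thesis .
  qed
  show ?thesis
    by (rule exI[of _ ev])
       (use inj surj grade evc ev_l ev_r in \<open>simp add: graded_bimodule_iso_def bimodule_iso_def tensor_bimodule_def
         regular_def bij_betw_def add_hom_add[OF ev(1)]\<close>)
qed

end

context
  assumes one_S: "\<one>\<^bsub>S\<^esub> \<in> add_span S {s \<in> carrier S. \<exists>f\<in>dg \<one>\<^bsub>\<Gamma>\<^esub>. \<exists>y\<in>\<M> \<one>\<^bsub>\<Gamma>\<^esub>. \<forall>x\<in>carrier M. x \<odot>r\<^bsub>M\<^esub> s = f x \<odot>\<^bsub>M\<^esub> y}"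
    and rank_one: "\<And>f y. \<lbrakk>f \<in> carrier D; y \<in> carrier M\<rbrakk>
      \<Longrightarrow> \<exists>s\<in>carrier S. \<forall>x\<in>carrier M. x \<odot>r\<^bsub>M\<^esub> s = f x \<odot>\<^bsub>M\<^esub> y"
    and rank_one_grade: "\<And>a b f y s. \<lbrakk>a \<in> carrier \<Gamma>; b \<in> carrier \<Gamma>; f \<in> dg a; y \<in> \<M> b; s \<in> carrier S;
        \<forall>x\<in>carrier M. x \<odot>r\<^bsub>M\<^esub> s = f x \<odot>\<^bsub>M\<^esub> y\<rbrakk> \<Longrightarrow> s \<in> \<D> (a \<otimes>\<^bsub>\<Gamma>\<^esub> b)"
    and faithful: "\<And>s. \<lbrakk>s \<in> carrier S; \<forall>x\<in>carrier M. x \<odot>r\<^bsub>M\<^esub> s = \<zero>\<^bsub>M\<^esub>\<rbrakk> \<Longrightarrow> s = \<zero>\<^bsub>S\<^esub>"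
begin

text \<open>Here the values of the map are known only through their action on \<open>M\<close>. So
  \<open>faithful\<close> is what makes the map balanced and linear, and
  \<open>rank_one_grade\<close> is what locates its values in the grading of
  \<open>S\<close>.\<close>

lemma coevaluation_iso:
  "\<exists>h. graded_bimodule_iso \<Gamma> S S (tensor_bimodule R D M) (tensor_grading \<Gamma> R D dg M \<M>) (regular S) \<D> h"
proof -
  let ?pt = "pure_tensor R D M"
  note SA = S.abelian_group_axioms and TA = DM.abelian_group_T
  \<comment> \<open>This is the value of the map at \<open>f\<close> tensor \<open>y\<close>;
    uniqueness follows from \<open>faithful\<close>.\<close>
  define \<nu> where "\<nu> f y = (SOME s. s \<in> carrier S \<and> (\<forall>x\<in>carrier M. x \<odot>r\<^bsub>M\<^esub> s = f x \<odot>\<^bsub>M\<^esub> y))" for f y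
  have "\<nu> f y \<in> carrier S \<and> (\<forall>x\<in>carrier M. x \<odot>r\<^bsub>M\<^esub> \<nu> f y = f x \<odot>\<^bsub>M\<^esub> y)"
    if "f \<in> carrier D" "y \<in> carrier M" for f y
    unfolding \<nu>_def by (rule someI_ex[OF rank_one[OF that, unfolded Bex_def]])
  then have \<nu>: "\<And>f y. \<lbrakk>f \<in> carrier D; y \<in> carrier M\<rbrakk> \<Longrightarrow> \<nu> f y \<in> carrier S"
    "\<And>f y x. \<lbrakk>f \<in> carrier D; y \<in> carrier M; x \<in> carrier M\<rbrakk> \<Longrightarrow> x \<odot>r\<^bsub>M\<^esub> \<nu> f y = f x \<odot>\<^bsub>M\<^esub> y" by simp_all
  note eqI = S_eqI[OF faithful]
  have "DM.balanced S \<nu>"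
  proof (rule DM.balancedI, goal_cases)
    case (2 f g y) show ?case by (rule eqI)
      (use 2 in \<open>simp_all add: \<nu> dual_add_closed rsmult_r_distr dual_apply dual_closed smult_l_distr\<close>)
  next
    case (3 f y z) show ?case by (rule eqI)
      (use 3 in \<open>simp_all add: \<nu> rsmult_r_distr dual_closed smult_r_distr\<close>)
  next
    case (4 f a y) show ?case by (rule eqI)
      (use 4 in \<open>simp_all add: \<nu> dual_right_closed smult_closed dual_apply dual_closed smult_assoc\<close>)
  qed (rule \<nu>)
  from DM.universal_ex[OF SA this] obtain ev where ev: "ev \<in> add_hom DM.T S"
    "\<forall>f\<in>carrier D. \<forall>x\<in>carrier M. ev (?pt f x) = \<nu> f x" by blast
  note evc = add_hom_closed[OF ev(1)]
  have \<nu>_l: "\<nu> (a \<odot>\<^bsub>D\<^esub> f) x = a \<otimes>\<^bsub>S\<^esub> \<nu> f x" if "a \<in> carrier S" "f \<in> carrier D" "x \<in> carrier M" for a f x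
    by (rule eqI) (use that in \<open>simp_all add: \<nu> dual_left_closed rsmult_assoc rsmult_closed dual_apply\<close>)
  have \<nu>_r: "\<nu> f (x \<odot>r\<^bsub>M\<^esub> a) = \<nu> f x \<otimes>\<^bsub>S\<^esub> a" if "a \<in> carrier S" "f \<in> carrier D" "x \<in> carrier M" for a f x
    by (rule eqI) (use that in \<open>simp_all add: \<nu> rsmult_assoc rsmult_closed dual_closed smult_rsmult_assoc\<close>)
  have ev_l: "ev (tensor_lsmult R D M a t) = a \<otimes>\<^bsub>S\<^esub> ev t" if "a \<in> carrier S" "t \<in> carrier DM.T" for a t
    by (rule DM.hom_eq[where f = "\<lambda>t. ev (tensor_lsmult R D M a t)" and g = "\<lambda>t. a \<otimes>\<^bsub>S\<^esub> ev t",
          OF add_homI add_homI SA _ that(2)])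
       (use that in \<open>simp_all add: evc add_hom_add[OF ev(1)] add_hom_closed[OF DM_lsmult(1)]
         add_hom_add[OF DM_lsmult(1)] DM_lsmult(2) ev(2) dual_left_closed \<nu>_l S.r_distr \<nu>(1)\<close>)
  have ev_r: "ev (tensor_rsmult R D M t a) = ev t \<otimes>\<^bsub>S\<^esub> a" if "a \<in> carrier S" "t \<in> carrier DM.T" for a t
    by (rule DM.hom_eq[where f = "\<lambda>t. ev (tensor_rsmult R D M t a)" and g = "\<lambda>t. ev t \<otimes>\<^bsub>S\<^esub> a",
          OF add_homI add_homI SA _ that(2)])
       (use that in \<open>simp_all add: evc add_hom_add[OF ev(1)] add_hom_closed[OF DM_rsmult(1)]
         add_hom_add[OF DM_rsmult(1)] DM_rsmult(2) ev(2) rsmult_closed \<nu>_r S.l_distr \<nu>(1)\<close>)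
  have rs_hom: "(\<lambda>a. tensor_rsmult R D M t a) \<in> add_hom S DM.T" if t: "t \<in> carrier DM.T" for t
  proof (rule add_homI)
    fix a b assume ab: "a \<in> carrier S" "b \<in> carrier S"
    show "tensor_rsmult R D M t (a \<oplus>\<^bsub>S\<^esub> b) = tensor_rsmult R D M t a \<oplus>\<^bsub>DM.T\<^esub> tensor_rsmult R D M t b"
      by (rule DM.hom_eq[where f = "\<lambda>t. tensor_rsmult R D M t (a \<oplus>\<^bsub>S\<^esub> b)" and
            g = "\<lambda>t. tensor_rsmult R D M t a \<oplus>\<^bsub>DM.T\<^esub> tensor_rsmult R D M t b", OF add_homI add_homI TA _ t])
         (use ab in \<open>simp_all add: add_hom_closed[OF DM_rsmult(1)] add_hom_add[OF DM_rsmult(1)] DM_rsmult(2)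
           rsmult_r_distr DM.pt_add_r rsmult_closed DM.T.a_ac\<close>)
  qed (rule add_hom_closed[OF DM_rsmult(1) t])
  have key: "tensor_rsmult R D M t (\<nu> g q) = ?pt (ev t \<odot>\<^bsub>D\<^esub> g) q"
    if m: "g \<in> carrier D" "q \<in> carrier M" and t: "t \<in> carrier DM.T" for g q t
  proof (rule DM.hom_eq[where f = "\<lambda>t. tensor_rsmult R D M t (\<nu> g q)" and
            g = "\<lambda>t. ?pt (ev t \<odot>\<^bsub>D\<^esub> g) q", OF DM_rsmult(1) add_homI TA _ t])
    fix f y assume xh: "f \<in> carrier D" "y \<in> carrier M"
    \<comment> \<open>Both functionals send \<open>x\<close> to \<open>f x\<close> times
      \<open>g y\<close>.\<close>
    have "\<nu> f y \<odot>\<^bsub>D\<^esub> g = f \<odot>r\<^bsub>D\<^esub> g y"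
      by (rule dual_eqI) (use m xh in \<open>simp_all add: dual_right_closed dual_left_closed dual_closed dual_apply dual_smult \<nu>\<close>)
    then show "tensor_rsmult R D M (?pt f y) (\<nu> g q) = ?pt (ev (?pt f y) \<odot>\<^bsub>D\<^esub> g) q"
      using m xh by (simp add: DM_rsmult(2) ev(2) \<nu> dual_closed DM.pt_move)
  next
    fix s t assume st: "s \<in> carrier DM.T" "t \<in> carrier DM.T"
    have "ev (s \<oplus>\<^bsub>DM.T\<^esub> t) \<odot>\<^bsub>D\<^esub> g = ev s \<odot>\<^bsub>D\<^esub> g \<oplus>\<^bsub>D\<^esub> ev t \<odot>\<^bsub>D\<^esub> g"
      by (rule dual_eqI) (use m st in \<open>simp_all add: dual_left_closed dual_add_closed evc dual_apply add_hom_add[OF ev(1)]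
        rsmult_r_distr dual_add rsmult_closed\<close>)
    then show "?pt (ev (s \<oplus>\<^bsub>DM.T\<^esub> t) \<odot>\<^bsub>D\<^esub> g) q = ?pt (ev s \<odot>\<^bsub>D\<^esub> g) q \<oplus>\<^bsub>DM.T\<^esub> ?pt (ev t \<odot>\<^bsub>D\<^esub> g) q"
      using m st by (simp add: DM.pt_add_l dual_left_closed evc)
  qed (use m in \<open>simp_all add: evc dual_left_closed \<nu>\<close>)
  have rs_one: "tensor_rsmult R D M t \<one>\<^bsub>S\<^esub> = t" if "t \<in> carrier DM.T" for t
    by (rule DM.hom_eq[where f = "\<lambda>t. tensor_rsmult R D M t \<one>\<^bsub>S\<^esub>" and g = "\<lambda>t. t",
          OF DM_rsmult(1)[OF S.one_closed] add_hom_id TA _ that]) (simp add: DM_rsmult(2) rsmult_one)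
  let ?G = "{s \<in> carrier S. \<exists>f\<in>dg \<one>\<^bsub>\<Gamma>\<^esub>. \<exists>y\<in>\<M> \<one>\<^bsub>\<Gamma>\<^esub>. \<forall>x\<in>carrier M. x \<odot>r\<^bsub>M\<^esub> s = f x \<odot>\<^bsub>M\<^esub> y}"
  have G: "?G \<subseteq> carrier S" by blast
  have GE: "\<exists>f\<in>dg \<one>\<^bsub>\<Gamma>\<^esub>. \<exists>y\<in>\<M> \<one>\<^bsub>\<Gamma>\<^esub>. r = \<nu> f y" if r: "r \<in> ?G" for r
  proof -
    obtain f y where fy: "f \<in> dg \<one>\<^bsub>\<Gamma>\<^esub>" "y \<in> \<M> \<one>\<^bsub>\<Gamma>\<^esub>" "\<forall>x\<in>carrier M. x \<odot>r\<^bsub>M\<^esub> r = f x \<odot>\<^bsub>M\<^esub> y" using r by blast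
    have "r = \<nu> f y" by (rule eqI) (use r fy comp_closed[OF GR.\<Gamma>.one_closed fy(2)] in \<open>simp_all add: \<nu> dg_closed\<close>)
    then show ?thesis using fy by blast
  qed
  have inj: "inj_on ev (carrier DM.T)"
  proof (rule add_hom_injI[OF ev(1) TA SA])
    fix t assume t: "t \<in> carrier DM.T" "ev t = \<zero>\<^bsub>S\<^esub>"
    have "tensor_rsmult R D M t \<one>\<^bsub>S\<^esub> = \<zero>\<^bsub>DM.T\<^esub>"
      using one_S G
    proof (rule S.add_span_induct)
      fix r assume "r \<in> ?G"
      then obtain g q where r: "r = \<nu> g q" "g \<in> carrier D" "q \<in> carrier M"
        using GE comp_closed[OF GR.\<Gamma>.one_closed] dg_closed by blast
      have "\<zero>\<^bsub>S\<^esub> \<odot>\<^bsub>D\<^esub> g = \<zero>\<^bsub>D\<^esub>"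
        by (rule dual_eqI) (use r add_hom_zero[OF dual_hom[OF r(2)] M.abelian_group_axioms R.abelian_group_axioms]
          in \<open>simp_all add: dual_left_closed dual_zero_closed dual_apply zero_rsmult\<close>)
      then have "tensor_rsmult R D M t r = ?pt \<zero>\<^bsub>D\<^esub> q" using key[OF r(2,3) t(1)] t(2) r(1) by simp
      also have "\<dots> = \<zero>\<^bsub>DM.T\<^esub>" by (rule add_hom_zero[OF DM.pt_hom_l[OF r(3)] abelian_group_dual TA])
      finally show "tensor_rsmult R D M t r = \<zero>\<^bsub>DM.T\<^esub>" .
    qed (use add_hom_zero[OF rs_hom[OF t(1)] SA TA] add_hom_add[OF rs_hom[OF t(1)]]
        add_hom_minus[OF rs_hom[OF t(1)] SA TA] in simp_all)
    then show "t = \<zero>\<^bsub>DM.T\<^esub>" using rs_one t by simp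
  qed
  have surj: "ev ` carrier DM.T = carrier S"
  proof
    show "ev ` carrier DM.T \<subseteq> carrier S" using evc by blast
    show "carrier S \<subseteq> ev ` carrier DM.T"
    proof
      fix r assume r: "r \<in> carrier S"
      have "\<exists>t\<in>carrier DM.T. \<one>\<^bsub>S\<^esub> \<otimes>\<^bsub>S\<^esub> r = ev t"
        using one_S G
      proof (rule S.add_span_induct)
        show "\<exists>t\<in>carrier DM.T. \<zero>\<^bsub>S\<^esub> \<otimes>\<^bsub>S\<^esub> r = ev t"
          using r add_hom_zero[OF ev(1) TA SA] by (intro bexI[of _ "\<zero>\<^bsub>DM.T\<^esub>"]) simp_all
        fix s assume "s \<in> ?G"
        then obtain f p where s: "s = \<nu> f p" "f \<in> carrier D" "p \<in> carrier M"
          using GE comp_closed[OF GR.\<Gamma>.one_closed] dg_closed by blast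
        then show "\<exists>t\<in>carrier DM.T. s \<otimes>\<^bsub>S\<^esub> r = ev t"
          using r by (intro bexI[of _ "?pt f (p \<odot>r\<^bsub>M\<^esub> r)"]) (simp_all add: ev(2) rsmult_closed \<nu>_r)
      next
        fix x y assume "x \<in> carrier S" "y \<in> carrier S" "\<exists>t\<in>carrier DM.T. x \<otimes>\<^bsub>S\<^esub> r = ev t"
          "\<exists>t\<in>carrier DM.T. y \<otimes>\<^bsub>S\<^esub> r = ev t"
        then show "\<exists>t\<in>carrier DM.T. (x \<oplus>\<^bsub>S\<^esub> y) \<otimes>\<^bsub>S\<^esub> r = ev t"
          using r by (metis S.l_distr add_hom_add[OF ev(1)] DM.T.a_closed)
      next
        fix x assume "x \<in> carrier S" "\<exists>t\<in>carrier DM.T. x \<otimes>\<^bsub>S\<^esub> r = ev t"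
        then show "\<exists>t\<in>carrier DM.T. (\<ominus>\<^bsub>S\<^esub> x) \<otimes>\<^bsub>S\<^esub> r = ev t"
          using r by (metis S.l_minus add_hom_minus[OF ev(1) TA SA] DM.T.a_inv_closed)
      qed
      then show "r \<in> ev ` carrier DM.T" using r by auto
    qed
  qed
  have grade: "ev ` tensor_grading \<Gamma> R D dg M \<M> z = \<D> z" if z: "z \<in> carrier \<Gamma>" for z
  proof -
    let ?P = "{?pt x y | a b x y. a \<in> carrier \<Gamma> \<and> b \<in> carrier \<Gamma> \<and> a \<otimes>\<^bsub>\<Gamma>\<^esub> b = z \<and> x \<in> dg a \<and> y \<in> \<M> b}"
    let ?Q = "{\<nu> f y | a b f y. a \<in> carrier \<Gamma> \<and> b \<in> carrier \<Gamma> \<and> a \<otimes>\<^bsub>\<Gamma>\<^esub> b = z \<and> f \<in> dg a \<and> y \<in> \<M> b}"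
    have "ev ` tensor_grading \<Gamma> R D dg M \<M> z = add_span S (ev ` ?P)"
      unfolding tensor_grading_def
      by (rule add_hom_span_image[OF ev(1) TA SA]) (use comp_closed dg_closed in auto)
    also have "ev ` ?P = ?Q"
    proof (intro equalityI subsetI)
      fix r assume "r \<in> ev ` ?P"
      then obtain a b x y where "r = ev (?pt x y)" "a \<in> carrier \<Gamma>" "b \<in> carrier \<Gamma>" "a \<otimes>\<^bsub>\<Gamma>\<^esub> b = z"
        "x \<in> dg a" "y \<in> \<M> b" by blast
      moreover from this have "r = \<nu> x y" using ev(2) comp_closed dg_closed by simp
      ultimately show "r \<in> ?Q" by blast
    next
      fix r assume "r \<in> ?Q"
      then obtain a b x y where "r = \<nu> x y" "a \<in> carrier \<Gamma>" "b \<in> carrier \<Gamma>" "a \<otimes>\<^bsub>\<Gamma>\<^esub> b = z"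
        "x \<in> dg a" "y \<in> \<M> b" by blast
      moreover from this have "r = ev (?pt x y)" using ev(2) comp_closed dg_closed by simp
      ultimately show "r \<in> ev ` ?P" by blast
    qed
    also have "add_span S ?Q = \<D> z"
    proof
      have Qc: "?Q \<subseteq> carrier S" using comp_closed dg_closed by (auto simp: \<nu>)
      have "?Q \<subseteq> \<D> z"
      proof clarify
        fix a b f y assume m: "a \<in> carrier \<Gamma>" "b \<in> carrier \<Gamma>" "z = a \<otimes>\<^bsub>\<Gamma>\<^esub> b" "f \<in> dg a" "y \<in> \<M> b"
        show "\<nu> f y \<in> \<D> (a \<otimes>\<^bsub>\<Gamma>\<^esub> b)"
          by (rule rank_one_grade[OF m(1,2,4,5)]) (use m comp_closed dg_closed in \<open>simp_all add: \<nu>\<close>)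
      qed
      then show "add_span S ?Q \<subseteq> \<D> z"
        using GS.direct_sum z by (intro S.add_span_subset) (auto simp: direct_sum_def)
      show "\<D> z \<subseteq> add_span S ?Q"
      proof
        fix r assume r: "r \<in> \<D> z"
        have rc: "r \<in> carrier S" using GS.comp_closed[OF z r] .
        have "\<one>\<^bsub>S\<^esub> \<otimes>\<^bsub>S\<^esub> r \<in> add_span S ?Q"
          using one_S G
        proof (rule S.add_span_induct)
          fix s assume "s \<in> ?G"
          then obtain f p where s: "s = \<nu> f p" "f \<in> dg \<one>\<^bsub>\<Gamma>\<^esub>" "p \<in> \<M> \<one>\<^bsub>\<Gamma>\<^esub>" using GE by blast
          have "p \<odot>r\<^bsub>M\<^esub> r \<in> \<M> z" using rsmult_comp[OF GR.\<Gamma>.one_closed z s(3) r] z by simp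
          moreover have "s \<otimes>\<^bsub>S\<^esub> r = \<nu> f (p \<odot>r\<^bsub>M\<^esub> r)"
            using s rc comp_closed[OF GR.\<Gamma>.one_closed s(3)] by (simp add: \<nu>_r dg_closed)
          ultimately show "s \<otimes>\<^bsub>S\<^esub> r \<in> add_span S ?Q"
            using s z by (intro add_span_incl CollectI exI[of _ z] exI[of _ "\<one>\<^bsub>\<Gamma>\<^esub>"] exI[of _ "p \<odot>r\<^bsub>M\<^esub> r"] exI[of _ f]) simp
        qed (use rc S.add_span_zero S.add_span_add S.add_span_minus[OF Qc] in \<open>simp_all add: S.l_distr S.l_minus\<close>)
        then show "r \<in> add_span S ?Q" using rc by simp
      qed
    qed
    finally show ?thesis .
  qed
  show ?thesis
    by (rule exI[of _ ev])
       (use inj surj grade evc ev_l ev_r in \<open>simp add: graded_bimodule_iso_def bimodule_iso_def tensor_bimodule_def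
         regular_def bij_betw_def add_hom_add[OF ev(1)]\<close>)
qed

end

end


section \<open>Direct sum decompositions\<close>

lemma add_hom_finsum:
  assumes h: "h \<in> add_hom A B" and A: "abelian_group A" and B: "abelian_group B"
    and "finite I" "f \<in> I \<rightarrow> carrier A"
  shows "h (\<Oplus>\<^bsub>A\<^esub>i\<in>I. f i) = (\<Oplus>\<^bsub>B\<^esub>i\<in>I. h (f i))"
  using assms(4,5)
proof (induction I rule: finite_induct)
  case empty
  then show ?case
    using A B by (simp add: abelian_group_def abelian_monoid.finsum_empty add_hom_zero[OF h A B])
next
  case (insert i I)
  interpret A: abelian_group A by fact
  interpret B: abelian_group B by fact
  have "(\<lambda>i. h (f i)) \<in> I \<rightarrow> carrier B" "h (f i) \<in> carrier B"
    using insert.prems by (auto intro: add_hom_closed[OF h])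
  then show ?case
    using insert by (simp add: A.finsum_insert B.finsum_insert add_hom_add[OF h] Pi_iff)
qed

lemma add_hom_finsum_hom:
  assumes B: "abelian_group B" and h: "\<And>i. i \<in> I \<Longrightarrow> h i \<in> add_hom A B"
  shows "(\<lambda>x. \<Oplus>\<^bsub>B\<^esub>i\<in>I. h i x) \<in> add_hom A B"
proof -
  interpret B: abelian_group B by fact
  have hc: "h i x \<in> carrier B" if "i \<in> I" "x \<in> carrier A" for i x
    using h[OF that(1)] that(2) by (rule add_hom_closed)
  show ?thesis
  proof (rule add_homI)
    fix x y assume xy: "x \<in> carrier A" "y \<in> carrier A"
    have "(\<Oplus>\<^bsub>B\<^esub>i\<in>I. h i (x \<oplus>\<^bsub>A\<^esub> y)) = (\<Oplus>\<^bsub>B\<^esub>i\<in>I. h i x \<oplus>\<^bsub>B\<^esub> h i y)"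
      by (rule B.finsum_cong') (use xy hc in \<open>simp_all add: add_hom_add[OF h] Pi_iff\<close>)
    also have "\<dots> = (\<Oplus>\<^bsub>B\<^esub>i\<in>I. h i x) \<oplus>\<^bsub>B\<^esub> (\<Oplus>\<^bsub>B\<^esub>i\<in>I. h i y)"
      by (rule B.finsum_addf) (use xy hc in \<open>simp_all add: Pi_iff\<close>)
    finally show "(\<Oplus>\<^bsub>B\<^esub>i\<in>I. h i (x \<oplus>\<^bsub>A\<^esub> y)) = (\<Oplus>\<^bsub>B\<^esub>i\<in>I. h i x) \<oplus>\<^bsub>B\<^esub> (\<Oplus>\<^bsub>B\<^esub>i\<in>I. h i y)" .
  qed (simp add: B.finsum_closed Pi_iff hc)
qed

locale decomposition = abelian_group A for A :: "('a, 'x) ring_scheme" (structure) +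
  fixes I :: "'i set" and \<A> :: "'i \<Rightarrow> 'a set"
  assumes fin: "finite I" and ds: "direct_sum A I \<A>"
begin

definition dec where "dec a = (THE f. f \<in> (\<Pi>\<^sub>E i\<in>I. \<A> i) \<and> a = (\<Oplus>i\<in>I. f i))"

definition pr where "pr i a = dec a i"

lemma part_subgroup: "i \<in> I \<Longrightarrow> additive_subgroup (\<A> i) A"
  using ds by (simp add: direct_sum_def)

lemma part_closed: "i \<in> I \<Longrightarrow> a \<in> \<A> i \<Longrightarrow> a \<in> carrier A"
  by (rule direct_sum_closed[OF ds])

lemma dec: "a \<in> carrier A \<Longrightarrow> dec a \<in> (\<Pi>\<^sub>E i\<in>I. \<A> i) \<and> a = (\<Oplus>i\<in>I. dec a i)"
  using theI'[of "\<lambda>f. f \<in> (\<Pi>\<^sub>E i\<in>I. \<A> i) \<and> a = (\<Oplus>i\<in>I. f i)"] ds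
  unfolding dec_def by (simp only: direct_sum_def)

lemma dec_unique:
  assumes "a \<in> carrier A" "f \<in> (\<Pi>\<^sub>E i\<in>I. \<A> i)" "a = (\<Oplus>i\<in>I. f i)" shows "dec a = f"
proof -
  have "\<exists>!f. f \<in> (\<Pi>\<^sub>E i\<in>I. \<A> i) \<and> a = (\<Oplus>i\<in>I. f i)"
    using ds assms(1) by (simp add: direct_sum_def)
  then show ?thesis using dec[OF assms(1)] assms(2,3) by (elim ex1E) metis
qed

lemma pr_in: "i \<in> I \<Longrightarrow> a \<in> carrier A \<Longrightarrow> pr i a \<in> \<A> i"
  using dec by (auto simp: pr_def)

lemma pr_sum: "a \<in> carrier A \<Longrightarrow> (\<Oplus>i\<in>I. pr i a) = a"
  using dec by (simp add: pr_def)

lemma pr_closed: "i \<in> I \<Longrightarrow> a \<in> carrier A \<Longrightarrow> pr i a \<in> carrier A"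
  using pr_in part_closed by blast

lemma pr_hom:
  assumes i: "i \<in> I" shows "pr i \<in> add_hom A A"
proof (rule add_homI)
  fix a b assume ab: "a \<in> carrier A" "b \<in> carrier A"
  let ?f = "\<lambda>i\<in>I. pr i a \<oplus> pr i b"
  have "(\<Oplus>i\<in>I. ?f i) = (\<Oplus>i\<in>I. pr i a \<oplus> pr i b)"
    by (rule finsum_cong') (use ab pr_closed in \<open>simp_all add: Pi_iff\<close>)
  also have "\<dots> = a \<oplus> b"
    using ab pr_closed by (subst finsum_addf) (simp_all add: Pi_iff pr_sum)
  finally have "dec (a \<oplus> b) = ?f"
    using ab part_subgroup pr_in
    by (intro dec_unique) (auto intro: additive_subgroup.a_closed)
  then show "pr i (a \<oplus> b) = pr i a \<oplus> pr i b" using i by (simp add: pr_def)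
qed (rule pr_closed[OF i])

lemma pr_part:
  assumes i: "i \<in> I" and j: "j \<in> I" and a: "a \<in> \<A> j"
  shows "pr i a = (if i = j then a else \<zero>)"
proof -
  let ?f = "\<lambda>i\<in>I. if j = i then a else \<zero>"
  have ac: "a \<in> carrier A" using part_closed[OF j a] .
  have "(\<Oplus>i\<in>I. ?f i) = (\<Oplus>i\<in>I. if j = i then a else \<zero>)"
    by (rule finsum_cong') (use ac in \<open>simp_all add: Pi_iff\<close>)
  also have "\<dots> = a" using finsum_singleton[OF j fin, of "\<lambda>_. a"] ac by simp
  finally have "dec a = ?f"
    using ac a additive_subgroup.zero_closed[OF part_subgroup] by (intro dec_unique) auto
  then show ?thesis using i by (auto simp: pr_def)
qed

lemma parts_span: "carrier A = add_span A (\<Union>i\<in>I. \<A> i)"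
proof
  show "add_span A (\<Union>i\<in>I. \<A> i) \<subseteq> carrier A"
    by (rule add_span_closed) (use part_closed in auto)
  show "carrier A \<subseteq> add_span A (\<Union>i\<in>I. \<A> i)"
  proof
    fix a assume a: "a \<in> carrier A"
    have "finsum A f J \<in> add_span A (\<Union>i\<in>I. \<A> i)"
      if "finite J" "J \<subseteq> I" "\<And>i. i \<in> J \<Longrightarrow> f i \<in> \<A> i" for f J
      using that
    proof (induction J rule: finite_induct)
      case empty
      then show ?case by (simp add: add_span_zero)
    next
      case (insert i J)
      have "f i \<in> carrier A" "f \<in> J \<rightarrow> carrier A"
        using insert.prems part_closed by auto
      moreover have "f i \<in> add_span A (\<Union>i\<in>I. \<A> i)"
        by (rule add_span_incl) (use insert.prems in auto)
      ultimately show ?case using insert by (auto simp: finsum_insert intro!: add_span_add)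
    qed
    from this[OF fin, of "\<lambda>i. pr i a"] show "a \<in> add_span A (\<Union>i\<in>I. \<A> i)"
      using a pr_in pr_sum by simp
  qed
qed

lemma parts_induct [consumes 1, case_names part add minus zero]:
  assumes "a \<in> carrier A" and part: "\<And>i a. \<lbrakk>i \<in> I; a \<in> \<A> i\<rbrakk> \<Longrightarrow> P a"
    and add: "\<And>s t. \<lbrakk>s \<in> carrier A; t \<in> carrier A; P s; P t\<rbrakk> \<Longrightarrow> P (s \<oplus> t)"
    and minus: "\<And>t. \<lbrakk>t \<in> carrier A; P t\<rbrakk> \<Longrightarrow> P (\<ominus> t)"
    and zero: "P \<zero>"
  shows "P a"
  by (rule add_span_induct[of a "\<Union>i\<in>I. \<A> i"]) (use assms part_closed parts_span in auto)

lemma parts_hom_eq: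
  assumes "f \<in> add_hom A B" "g \<in> add_hom A B" "abelian_group B"
    and "\<And>i x. \<lbrakk>i \<in> I; x \<in> \<A> i\<rbrakk> \<Longrightarrow> f x = g x" and "t \<in> carrier A"
  shows "f t = g t"
  by (rule add_hom_eq_on_span[OF assms(1,2) abelian_group_axioms assms(3), where S = "\<Union>i\<in>I. \<A> i"])
     (use assms(4,5) parts_span part_closed in auto)

text \<open>The sum over \<open>i\<close> of \<open>h i\<close> after the \<open>i\<close>-th
  projection glues maps that are given on the components. Additivity forces \<open>h i\<close> to
  vanish at zero, which removes the other summands on a homogeneous element.\<close>

lemma parts_universal:
  assumes B: "abelian_group B"
    and h: "\<And>i a. \<lbrakk>i \<in> I; a \<in> \<A> i\<rbrakk> \<Longrightarrow> h i a \<in> carrier B"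
      "\<And>i a b. \<lbrakk>i \<in> I; a \<in> \<A> i; b \<in> \<A> i\<rbrakk> \<Longrightarrow> h i (a \<oplus> b) = h i a \<oplus>\<^bsub>B\<^esub> h i b"
  shows "\<exists>k. k \<in> add_hom A B \<and> (\<forall>i\<in>I. \<forall>a\<in>\<A> i. k a = h i a)"
proof -
  interpret B: abelian_group B by fact
  let ?k = "\<lambda>a. \<Oplus>\<^bsub>B\<^esub>i\<in>I. h i (pr i a)"
  have h0: "h i \<zero> = \<zero>\<^bsub>B\<^esub>" if "i \<in> I" for i
  proof -
    have z: "\<zero> \<in> \<A> i" using part_subgroup[OF that] by (rule additive_subgroup.zero_closed)
    have "h i \<zero> \<oplus>\<^bsub>B\<^esub> h i \<zero> = h i \<zero>" using h(2)[OF that z z] by simp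
    then show ?thesis using h(1)[OF that z] by (simp add: B.add.l_cancel_one)
  qed
  have "?k \<in> add_hom A B"
  proof (rule add_hom_finsum_hom[OF B])
    fix i assume i: "i \<in> I"
    show "(\<lambda>a. h i (pr i a)) \<in> add_hom A B"
      by (rule add_homI) (use i pr_in in \<open>simp_all add: h add_hom_add[OF pr_hom]\<close>)
  qed
  moreover have "?k a = h i a" if i: "i \<in> I" and a: "a \<in> \<A> i" for i a
  proof -
    have "?k a = (\<Oplus>\<^bsub>B\<^esub>j\<in>I. if i = j then h j a else \<zero>\<^bsub>B\<^esub>)"
      by (rule B.finsum_cong') (use i a h h0 in \<open>auto simp: pr_part\<close>)
    also have "\<dots> = (\<Oplus>\<^bsub>B\<^esub>j\<in>I. if i = j then h i a else \<zero>\<^bsub>B\<^esub>)"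
      by (rule B.finsum_cong') (use i a h in auto)
    also have "\<dots> = h i a" using B.finsum_singleton[OF i fin, of "\<lambda>_. h i a"] h(1)[OF i a] by simp
    finally show ?thesis .
  qed
  ultimately show ?thesis by blast
qed

end

text \<open>Existence: the sum of the \<open>p i\<close> agrees with the identity on the parts,
  which span. Uniqueness: \<open>p i\<close> applied to any decomposition recovers its
  \<open>i\<close>-th summand.\<close>

lemma direct_sumI:
  assumes A: "abelian_group A" and fin: "finite I"
    and sub: "\<And>i. i \<in> I \<Longrightarrow> additive_subgroup (\<A> i) A"
    and span: "carrier A \<subseteq> add_span A (\<Union>i\<in>I. \<A> i)"
    and p: "\<And>i. i \<in> I \<Longrightarrow> p i \<in> add_hom A A"
    and pA: "\<And>i j a. \<lbrakk>i \<in> I; j \<in> I; a \<in> \<A> j\<rbrakk> \<Longrightarrow> p i a = (if i = j then a else \<zero>\<^bsub>A\<^esub>)"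
  shows "direct_sum A I \<A>"
  unfolding direct_sum_def
proof (intro conjI ballI)
  interpret A: abelian_group A by fact
  have cl: "a \<in> carrier A" if "i \<in> I" "a \<in> \<A> i" for i a
    using additive_subgroup.a_Hcarr[OF sub[OF that(1)] that(2)] .
  fix a assume a: "a \<in> carrier A"
  have S: "(\<Union>i\<in>I. \<A> i) \<subseteq> carrier A" using cl by auto
  have pin: "p i a \<in> \<A> i" if i: "i \<in> I" and a: "a \<in> carrier A" for i a
  proof (rule A.add_span_induct[of a "\<Union>i\<in>I. \<A> i"])
    interpret Ai: additive_subgroup "\<A> i" A using sub[OF i] .
    show "p i \<zero>\<^bsub>A\<^esub> \<in> \<A> i" by (simp add: add_hom_zero[OF p[OF i] A A])
    show "p i x \<in> \<A> i" if "x \<in> (\<Union>i\<in>I. \<A> i)" for x using that i by (auto simp: pA)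
    show "p i (x \<oplus>\<^bsub>A\<^esub> y) \<in> \<A> i" if "x \<in> carrier A" "y \<in> carrier A" "p i x \<in> \<A> i" "p i y \<in> \<A> i" for x y
      using that by (simp add: add_hom_add[OF p[OF i]])
    show "p i (\<ominus>\<^bsub>A\<^esub> x) \<in> \<A> i" if "x \<in> carrier A" "p i x \<in> \<A> i" for x
      using that by (simp add: add_hom_minus[OF p[OF i] A A])
  qed (use a span S in auto)
  have sum: "(\<Oplus>\<^bsub>A\<^esub>i\<in>I. p i a) = a"
  proof (rule add_hom_eq_on_span[OF add_hom_finsum_hom[OF A p] add_hom_id A A S])
    fix x assume "x \<in> (\<Union>i\<in>I. \<A> i)"
    then obtain j where j: "j \<in> I" "x \<in> \<A> j" by blast
    have "(\<Oplus>\<^bsub>A\<^esub>i\<in>I. p i x) = (\<Oplus>\<^bsub>A\<^esub>i\<in>I. if j = i then x else \<zero>\<^bsub>A\<^esub>)"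
      by (rule A.finsum_cong') (use j cl in \<open>auto simp: pA\<close>)
    also have "\<dots> = x" using A.finsum_singleton[OF j(1) fin, of "\<lambda>_. x"] cl[OF j] by simp
    finally show "(\<Oplus>\<^bsub>A\<^esub>i\<in>I. p i x) = x" .
  qed (use a span in auto)
  show "\<exists>!f. f \<in> (\<Pi>\<^sub>E i\<in>I. \<A> i) \<and> a = (\<Oplus>\<^bsub>A\<^esub>i\<in>I. f i)"
  proof (rule ex1I[of _ "\<lambda>i\<in>I. p i a"], intro conjI)
    show "(\<lambda>i\<in>I. p i a) \<in> (\<Pi>\<^sub>E i\<in>I. \<A> i)" using pin a by auto
    have "(\<Oplus>\<^bsub>A\<^esub>i\<in>I. (\<lambda>i\<in>I. p i a) i) = (\<Oplus>\<^bsub>A\<^esub>i\<in>I. p i a)"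
      by (rule A.finsum_cong') (use a pin cl in auto)
    then show "a = (\<Oplus>\<^bsub>A\<^esub>i\<in>I. (\<lambda>i\<in>I. p i a) i)" using sum by simp
    fix f assume f: "f \<in> (\<Pi>\<^sub>E i\<in>I. \<A> i) \<and> a = (\<Oplus>\<^bsub>A\<^esub>i\<in>I. f i)"
    have fc: "f \<in> I \<rightarrow> carrier A" using f cl by (auto simp: PiE_def Pi_iff)
    show "f = (\<lambda>i\<in>I. p i a)"
    proof (rule extensionalityI[of _ I])
      fix i assume i: "i \<in> I"
      have "p i a = (\<Oplus>\<^bsub>A\<^esub>j\<in>I. p i (f j))"
        using add_hom_finsum[OF p[OF i] A A fin fc] f by simp
      also have "\<dots> = (\<Oplus>\<^bsub>A\<^esub>j\<in>I. if i = j then f i else \<zero>\<^bsub>A\<^esub>)"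
      proof (rule A.finsum_cong')
        show "p i (f j) = (if i = j then f i else \<zero>\<^bsub>A\<^esub>)" if "j \<in> I" for j
          using f pA[OF i that, of "f j"] that by (auto simp: PiE_def Pi_iff)
      qed (use fc i in auto)
      also have "\<dots> = f i" using A.finsum_singleton[OF i fin, of "\<lambda>_. f i"] fc i by auto
      finally show "f i = (\<lambda>i\<in>I. p i a) i" using i by simp
    qed (use f in \<open>auto simp: PiE_def\<close>)
  qed
qed (rule sub)


section \<open>Crossed products with a centralising set of units\<close>

text \<open>\<open>C\<close> is strongly graded with identity component \<open>B\<close>, and each degree contains a unit
  \<open>u g\<close> that commutes with \<open>B\<close>. For blocks, \<open>H\<close> is $C_G(N)$ and \<open>u g\<close> is $bg$.\<close>

locale crossed_product = graded_algebra \<O> \<Gamma> C \<C> + B: assoc_algebra \<O> B + H: group H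
  for \<O> :: "('o, 'x) ring_scheme" and \<Gamma> :: "('i, 'w) monoid_scheme"
    and C :: "('o, 'a, 'y) module_scheme" and \<C> :: "'i \<Rightarrow> 'a set"
    and B :: "('o, 'a, 'z) module_scheme" and H :: "('g, 'h) monoid_scheme"
    and u :: "'g \<Rightarrow> 'a" and deg :: "'g \<Rightarrow> 'i" +
  assumes B_carrier: "carrier B = \<C> \<one>\<^bsub>\<Gamma>\<^esub>"
    and B_zero: "\<zero>\<^bsub>B\<^esub> = \<zero>\<^bsub>C\<^esub>" and B_one: "\<one>\<^bsub>B\<^esub> = \<one>\<^bsub>C\<^esub>"
    and B_add: "\<lbrakk>x \<in> carrier B; y \<in> carrier B\<rbrakk> \<Longrightarrow> x \<oplus>\<^bsub>B\<^esub> y = x \<oplus>\<^bsub>C\<^esub> y"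
    and B_mult: "\<lbrakk>x \<in> carrier B; y \<in> carrier B\<rbrakk> \<Longrightarrow> x \<otimes>\<^bsub>B\<^esub> y = x \<otimes>\<^bsub>C\<^esub> y"
    and B_smult: "\<lbrakk>r \<in> carrier \<O>; x \<in> carrier B\<rbrakk> \<Longrightarrow> r \<odot>\<^bsub>B\<^esub> x = r \<odot>\<^bsub>C\<^esub> x"
    and deg_hom: "deg \<in> hom H \<Gamma>" and deg_surj: "deg ` carrier H = carrier \<Gamma>"
    and u_deg: "g \<in> carrier H \<Longrightarrow> u g \<in> \<C> (deg g)"
    and u_mult: "\<lbrakk>g \<in> carrier H; h \<in> carrier H\<rbrakk> \<Longrightarrow> u (g \<otimes>\<^bsub>H\<^esub> h) = u g \<otimes>\<^bsub>C\<^esub> u h"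
    and u_one: "u \<one>\<^bsub>H\<^esub> = \<one>\<^bsub>C\<^esub>"
    and u_comm: "\<lbrakk>g \<in> carrier H; x \<in> carrier B\<rbrakk> \<Longrightarrow> u g \<otimes>\<^bsub>C\<^esub> x = x \<otimes>\<^bsub>C\<^esub> u g"
begin

sublocale dec: decomposition C "carrier \<Gamma>" \<C>
  by (intro decomposition.intro decomposition_axioms.intro abelian_group_axioms finite_grading direct_sum)

lemma B_closed: "x \<in> carrier B \<Longrightarrow> x \<in> carrier C"
  using comp_closed[OF \<Gamma>.one_closed] by (simp add: B_carrier)

lemma B_hom: "(\<lambda>x. x) \<in> add_hom B C"
  by (rule add_homI) (simp_all add: B_closed B_add)

lemma deg_closed: "g \<in> carrier H \<Longrightarrow> deg g \<in> carrier \<Gamma>"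
  using deg_surj by blast

lemma deg_ex: "x \<in> carrier \<Gamma> \<Longrightarrow> \<exists>g\<in>carrier H. deg g = x"
  unfolding deg_surj[symmetric] by (erule imageE) blast

lemma deg_mult: "\<lbrakk>g \<in> carrier H; h \<in> carrier H\<rbrakk> \<Longrightarrow> deg (g \<otimes>\<^bsub>H\<^esub> h) = deg g \<otimes>\<^bsub>\<Gamma>\<^esub> deg h"
  using deg_hom by (rule hom_mult)

lemma deg_group_hom: "group_hom H \<Gamma> deg"
  by (intro group_hom.intro group_hom_axioms.intro H.group_axioms \<Gamma>.group_axioms deg_hom)

lemma deg_inv: "g \<in> carrier H \<Longrightarrow> deg (inv\<^bsub>H\<^esub> g) = inv\<^bsub>\<Gamma>\<^esub> deg g"
  using group_hom.hom_inv[OF deg_group_hom] .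

lemma u_closed: "g \<in> carrier H \<Longrightarrow> u g \<in> carrier C"
  using comp_closed u_deg deg_closed by blast

lemma u_inv: "g \<in> carrier H \<Longrightarrow> u g \<otimes>\<^bsub>C\<^esub> u (inv\<^bsub>H\<^esub> g) = \<one>\<^bsub>C\<^esub>"
  "g \<in> carrier H \<Longrightarrow> u (inv\<^bsub>H\<^esub> g) \<otimes>\<^bsub>C\<^esub> u g = \<one>\<^bsub>C\<^esub>"
  by (simp_all add: u_mult[symmetric] u_one)

lemma u_kernel: "\<lbrakk>z \<in> carrier H; deg z = \<one>\<^bsub>\<Gamma>\<^esub>\<rbrakk> \<Longrightarrow> u z \<in> carrier B"
  using u_deg[of z] by (simp add: B_carrier)

lemma B_u_comp: "\<lbrakk>x \<in> carrier B; g \<in> carrier H\<rbrakk> \<Longrightarrow> x \<otimes>\<^bsub>C\<^esub> u g \<in> \<C> (deg g)"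
  using mult_comp[OF \<Gamma>.one_closed deg_closed _ u_deg, of g x] by (simp add: B_carrier deg_closed)

lemma comp_u_inv: "\<lbrakk>g \<in> carrier H; c \<in> \<C> (deg g)\<rbrakk> \<Longrightarrow> c \<otimes>\<^bsub>C\<^esub> u (inv\<^bsub>H\<^esub> g) \<in> carrier B"
  using mult_comp[OF deg_closed deg_closed _ u_deg, of g "inv\<^bsub>H\<^esub> g" c]
  by (simp add: B_carrier deg_closed deg_inv)

lemma comp_decomp:
  assumes "g \<in> carrier H" "c \<in> \<C> (deg g)" shows "c = (c \<otimes>\<^bsub>C\<^esub> u (inv\<^bsub>H\<^esub> g)) \<otimes>\<^bsub>C\<^esub> u g"
  using assms comp_closed[OF deg_closed assms(2)] by (simp add: m_assoc u_closed u_inv)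

lemma compE:
  assumes "x \<in> carrier \<Gamma>" "c \<in> \<C> x"
  obtains \<beta> g where "\<beta> \<in> carrier B" "g \<in> carrier H" "deg g = x" "c = \<beta> \<otimes>\<^bsub>C\<^esub> u g"
proof -
  obtain g where g: "g \<in> carrier H" "deg g = x" using deg_ex[OF assms(1)] by blast
  then show thesis using that[OF comp_u_inv g(1,2) comp_decomp] assms(2) by simp
qed

text \<open>Dividing by a unit of its degree shows that each homogeneous element has the form
  \<open>\<beta>\<close> times \<open>u h\<close>; all laws for actions of \<open>C\<close> and
  \<open>C'\<close> are tested on such products.\<close>

lemma C_hom_eq:
  assumes "f \<in> add_hom C A" "f' \<in> add_hom C A" "abelian_group A"
    and "\<And>\<beta> h. \<lbrakk>\<beta> \<in> carrier B; h \<in> carrier H\<rbrakk> \<Longrightarrow> f (\<beta> \<otimes>\<^bsub>C\<^esub> u h) = f' (\<beta> \<otimes>\<^bsub>C\<^esub> u h)" and "t \<in> carrier C"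
  shows "f t = f' t"
proof (rule dec.parts_hom_eq[OF assms(1-3) _ assms(5)])
  fix i x assume "i \<in> carrier \<Gamma>" "x \<in> \<C> i"
  then obtain \<beta> g where "\<beta> \<in> carrier B" "g \<in> carrier H" "x = \<beta> \<otimes>\<^bsub>C\<^esub> u g" by (rule compE)
  then show "f x = f' x" using assms(4) by simp
qed

lemma B_u_mult:
  assumes "\<beta> \<in> carrier B" "\<gamma> \<in> carrier B" "g \<in> carrier H" "h \<in> carrier H"
  shows "(\<beta> \<otimes>\<^bsub>C\<^esub> u g) \<otimes>\<^bsub>C\<^esub> (\<gamma> \<otimes>\<^bsub>C\<^esub> u h) = (\<beta> \<otimes>\<^bsub>B\<^esub> \<gamma>) \<otimes>\<^bsub>C\<^esub> u (g \<otimes>\<^bsub>H\<^esub> h)"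
proof -
  have "(\<beta> \<otimes>\<^bsub>C\<^esub> u g) \<otimes>\<^bsub>C\<^esub> (\<gamma> \<otimes>\<^bsub>C\<^esub> u h) = \<beta> \<otimes>\<^bsub>C\<^esub> (u g \<otimes>\<^bsub>C\<^esub> \<gamma>) \<otimes>\<^bsub>C\<^esub> u h"
    using assms by (simp add: m_assoc B_closed u_closed)
  also have "\<dots> = \<beta> \<otimes>\<^bsub>C\<^esub> \<gamma> \<otimes>\<^bsub>C\<^esub> (u g \<otimes>\<^bsub>C\<^esub> u h)"
    using assms by (simp only: u_comm) (simp add: m_assoc B_closed u_closed)
  finally show ?thesis using assms by (simp add: B_mult u_mult)
qed

text \<open>\<open>B\<close> has degree one, so multiplication by it preserves each component.
  Linearity over \<open>B\<close> lets the projections act on the tensor product over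
  \<open>B\<close>.\<close>

lemma pr_B_mult:
  assumes "x \<in> carrier \<Gamma>" "c \<in> carrier C" "\<beta> \<in> carrier B"
  shows "dec.pr x (c \<otimes>\<^bsub>C\<^esub> \<beta>) = dec.pr x c \<otimes>\<^bsub>C\<^esub> \<beta>" "dec.pr x (\<beta> \<otimes>\<^bsub>C\<^esub> c) = \<beta> \<otimes>\<^bsub>C\<^esub> dec.pr x c"
proof -
  have m: "a \<otimes>\<^bsub>C\<^esub> \<beta> \<in> \<C> y" "\<beta> \<otimes>\<^bsub>C\<^esub> a \<in> \<C> y" if "y \<in> carrier \<Gamma>" "a \<in> \<C> y" for a y
    using mult_comp[OF that(1) \<Gamma>.one_closed that(2)] mult_comp[OF \<Gamma>.one_closed that(1) _ that(2)] that assms(3)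
    by (simp_all add: B_carrier)
  show "dec.pr x (c \<otimes>\<^bsub>C\<^esub> \<beta>) = dec.pr x c \<otimes>\<^bsub>C\<^esub> \<beta>"
    by (rule dec.parts_hom_eq[where f = "\<lambda>c. dec.pr x (c \<otimes>\<^bsub>C\<^esub> \<beta>)" and g = "\<lambda>c. dec.pr x c \<otimes>\<^bsub>C\<^esub> \<beta>",
          OF add_homI add_homI abelian_group_axioms _ assms(2)])
       (use assms in \<open>simp_all add: B_closed l_distr add_hom_add[OF dec.pr_hom] dec.pr_closed dec.pr_part[OF _ _ m(1)] dec.pr_part\<close>)
  show "dec.pr x (\<beta> \<otimes>\<^bsub>C\<^esub> c) = \<beta> \<otimes>\<^bsub>C\<^esub> dec.pr x c"
    by (rule dec.parts_hom_eq[where f = "\<lambda>c. dec.pr x (\<beta> \<otimes>\<^bsub>C\<^esub> c)" and g = "\<lambda>c. \<beta> \<otimes>\<^bsub>C\<^esub> dec.pr x c",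
          OF add_homI add_homI abelian_group_axioms _ assms(2)])
       (use assms in \<open>simp_all add: B_closed r_distr add_hom_add[OF dec.pr_hom] dec.pr_closed dec.pr_part[OF _ _ m(2)] dec.pr_part\<close>)
qed

text \<open>Each degree contains a unit: for \<open>g\<close> of degree \<open>y\<close>, an element
  \<open>c\<close> of degree \<open>x y\<close> is the product of \<open>c\<close> with the inverse
  of \<open>u g\<close>, which has degree \<open>x\<close>, and of \<open>u g\<close>.\<close>

lemma strongly_graded: "strongly_graded_algebra \<O> \<Gamma> C \<C>"
proof (rule strongly_graded_algebra.intro[OF graded_algebra_axioms], rule strongly_graded_algebra_axioms.intro)
  fix x y assume x: "x \<in> carrier \<Gamma>" and y: "y \<in> carrier \<Gamma>"
  let ?S = "{a \<otimes>\<^bsub>C\<^esub> b | a b. a \<in> \<C> x \<and> b \<in> \<C> y}"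
  show "\<C> (x \<otimes>\<^bsub>\<Gamma>\<^esub> y) = add_span C ?S"
  proof
    show "add_span C ?S \<subseteq> \<C> (x \<otimes>\<^bsub>\<Gamma>\<^esub> y)"
      by (rule add_span_subset[OF dec.part_subgroup]) (use x y mult_comp in auto)
    show "\<C> (x \<otimes>\<^bsub>\<Gamma>\<^esub> y) \<subseteq> add_span C ?S"
    proof
      fix c assume c: "c \<in> \<C> (x \<otimes>\<^bsub>\<Gamma>\<^esub> y)"
      have xy: "x \<otimes>\<^bsub>\<Gamma>\<^esub> y \<in> carrier \<Gamma>" using x y by simp
      obtain g where g: "g \<in> carrier H" "deg g = y" using deg_ex[OF y] by blast
      have gi: "u (inv\<^bsub>H\<^esub> g) \<in> \<C> (inv\<^bsub>\<Gamma>\<^esub> y)" using u_deg[of "inv\<^bsub>H\<^esub> g"] g by (simp add: deg_inv)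
      have "c \<otimes>\<^bsub>C\<^esub> u (inv\<^bsub>H\<^esub> g) \<in> \<C> (x \<otimes>\<^bsub>\<Gamma>\<^esub> y \<otimes>\<^bsub>\<Gamma>\<^esub> inv\<^bsub>\<Gamma>\<^esub> y)"
        by (rule mult_comp[OF xy _ c gi]) (use y in simp)
      moreover have "x \<otimes>\<^bsub>\<Gamma>\<^esub> y \<otimes>\<^bsub>\<Gamma>\<^esub> inv\<^bsub>\<Gamma>\<^esub> y = x" using x y by (simp add: \<Gamma>.m_assoc)
      moreover have "c = (c \<otimes>\<^bsub>C\<^esub> u (inv\<^bsub>H\<^esub> g)) \<otimes>\<^bsub>C\<^esub> u g"
        using g comp_closed[OF xy c] by (simp add: m_assoc u_closed u_inv)
      ultimately show "c \<in> add_span C ?S"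
        using u_deg[OF g(1)] g(2) by (intro add_span_incl) auto
    qed
  qed
qed

end


section \<open>The induced bimodule\<close>

lemma regular_simps [simp]:
  "carrier (regular A) = carrier A" "\<zero>\<^bsub>regular A\<^esub> = \<zero>\<^bsub>A\<^esub>" "x \<oplus>\<^bsub>regular A\<^esub> y = x \<oplus>\<^bsub>A\<^esub> y"
  "a \<odot>\<^bsub>regular A\<^esub> x = a \<otimes>\<^bsub>A\<^esub> x" "x \<odot>r\<^bsub>regular A\<^esub> a = x \<otimes>\<^bsub>A\<^esub> a" "add (regular A) = add A"
  by (simp_all add: regular_def)

lemma abelian_group_regular: "abelian_group (regular A) \<longleftrightarrow> abelian_group A"
  by (simp add: regular_def abelian_group_bimodule_of)

text \<open>A single group \<open>H\<close> with a single degree map indexes the units on both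
  sides, which is what links the two algebras. For blocks the elements of \<open>H\<close> of degree
  one are those of Z(N), and \<open>central\<close> is the agreement of their two actions.\<close>

locale crossed_pair =
  L: crossed_product \<O> \<Gamma> C \<C> B H u deg + R: crossed_product \<O> \<Gamma> C' \<C>' B' H u' deg +
  M: bimodule \<O> B B' M
  for \<O> :: "('o, 'x) ring_scheme" and \<Gamma> :: "('i, 'w) monoid_scheme"
    and C :: "('o, 'a, 'y) module_scheme" and \<C> :: "'i \<Rightarrow> 'a set"
    and B :: "('o, 'a, 'z) module_scheme" and H :: "('g, 'h) monoid_scheme"
    and u :: "'g \<Rightarrow> 'a" and deg :: "'g \<Rightarrow> 'i"
    and C' :: "('o, 'b, 'v) module_scheme" and \<C>' :: "'i \<Rightarrow> 'b set"
    and B' :: "('o, 'b, 't) module_scheme" and u' :: "'g \<Rightarrow> 'b"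
    and M :: "('a, 'b, 'm, 's) bimodule_scheme" +
  assumes central: "\<lbrakk>z \<in> carrier H; deg z = \<one>\<^bsub>\<Gamma>\<^esub>; m \<in> carrier M\<rbrakk> \<Longrightarrow> u z \<odot>\<^bsub>M\<^esub> m = m \<odot>r\<^bsub>M\<^esub> u' z"
begin

sublocale V: tensor_pair B "regular C" M
  by (intro tensor_pair.intro tensor_pair_axioms.intro M.M.abelian_group_axioms
      abelian_group_regular[THEN iffD2] L.abelian_group_axioms)
     (simp_all add: L.B_closed M.smult_closed)

abbreviation TV where "TV \<equiv> tensor B (regular C) M"
abbreviation pt (infixl \<open>\<otimes>\<otimes>\<close> 75) where "c \<otimes>\<otimes> m \<equiv> pure_tensor B (regular C) M c m"

lemmas TA = V.abelian_group_T
lemmas MA = M.M.abelian_group_axioms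
lemmas V_balancedI = V.balancedI[simplified]
lemmas V_universal = V.universal_ex[simplified]
lemmas V_induct [consumes 1, case_names pure add minus] = V.T_induct[simplified]
lemmas V_hom_eq = V.hom_eq[simplified]

lemma pt_closed [simp]: "\<lbrakk>c \<in> carrier C; m \<in> carrier M\<rbrakk> \<Longrightarrow> c \<otimes>\<otimes> m \<in> carrier TV"
  and pt_add_l: "\<lbrakk>c \<in> carrier C; d \<in> carrier C; m \<in> carrier M\<rbrakk>
    \<Longrightarrow> (c \<oplus>\<^bsub>C\<^esub> d) \<otimes>\<otimes> m = c \<otimes>\<otimes> m \<oplus>\<^bsub>TV\<^esub> d \<otimes>\<otimes> m"
  and pt_add_r: "\<lbrakk>c \<in> carrier C; m \<in> carrier M; n \<in> carrier M\<rbrakk>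
    \<Longrightarrow> c \<otimes>\<otimes> (m \<oplus>\<^bsub>M\<^esub> n) = c \<otimes>\<otimes> m \<oplus>\<^bsub>TV\<^esub> c \<otimes>\<otimes> n"
  and pt_move: "\<lbrakk>c \<in> carrier C; \<beta> \<in> carrier B; m \<in> carrier M\<rbrakk>
    \<Longrightarrow> (c \<otimes>\<^bsub>C\<^esub> \<beta>) \<otimes>\<otimes> m = c \<otimes>\<otimes> (\<beta> \<odot>\<^bsub>M\<^esub> m)"
  using V.pt_closed[of c m] V.pt_add_l[of c d m] V.pt_add_r[of c m n] V.pt_move[of c \<beta> m] by simp_all

lemma pt_unit: "\<lbrakk>\<beta> \<in> carrier B; g \<in> carrier H; m \<in> carrier M\<rbrakk>
    \<Longrightarrow> (\<beta> \<otimes>\<^bsub>C\<^esub> u g) \<otimes>\<otimes> m = u g \<otimes>\<otimes> (\<beta> \<odot>\<^bsub>M\<^esub> m)"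
  by (simp add: L.u_comm[symmetric] pt_move L.u_closed)

lemma pt_B: "\<lbrakk>\<beta> \<in> carrier B; m \<in> carrier M\<rbrakk> \<Longrightarrow> \<beta> \<otimes>\<otimes> m = \<one>\<^bsub>C\<^esub> \<otimes>\<otimes> (\<beta> \<odot>\<^bsub>M\<^esub> m)"
  using pt_move[of "\<one>\<^bsub>C\<^esub>" \<beta> m] by (simp add: L.B_closed)

abbreviation lact where "lact \<equiv> tensor_lsmult B (regular C) M"

lemma lact_hom: "a \<in> carrier C \<Longrightarrow> lact a \<in> add_hom TV TV"
  and lact_pt: "\<lbrakk>a \<in> carrier C; c \<in> carrier C; m \<in> carrier M\<rbrakk> \<Longrightarrow> lact a (c \<otimes>\<otimes> m) = (a \<otimes>\<^bsub>C\<^esub> c) \<otimes>\<otimes> m"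
proof -
  assume a: "a \<in> carrier C"
  have 1: "(\<lambda>x. a \<odot>\<^bsub>regular C\<^esub> x) \<in> add_hom (regular C) (regular C)"
    by (rule add_homI) (use a in \<open>simp_all add: L.r_distr\<close>)
  have 2: "a \<odot>\<^bsub>regular C\<^esub> (x \<odot>r\<^bsub>regular C\<^esub> r) = (a \<odot>\<^bsub>regular C\<^esub> x) \<odot>r\<^bsub>regular C\<^esub> r"
    if "x \<in> carrier (regular C)" "r \<in> carrier B" for x r
    using a that by (simp add: L.m_assoc L.B_closed)
  show "lact a \<in> add_hom TV TV" by (rule V.lsmult(1)[OF 1 2])
  show "lact a (c \<otimes>\<otimes> m) = (a \<otimes>\<^bsub>C\<^esub> c) \<otimes>\<otimes> m" if "c \<in> carrier C" "m \<in> carrier M"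
    using V.lsmult(2)[OF 1 2, of c m] that by simp
qed

lemmas lact_closed = add_hom_closed[OF lact_hom]
  and lact_add = add_hom_add[OF lact_hom]

lemma lact_hom_l: "t \<in> carrier TV \<Longrightarrow> (\<lambda>a. lact a t) \<in> add_hom C TV"
proof (rule add_homI)
  fix a b assume ab: "a \<in> carrier C" "b \<in> carrier C" and t: "t \<in> carrier TV"
  show "lact (a \<oplus>\<^bsub>C\<^esub> b) t = lact a t \<oplus>\<^bsub>TV\<^esub> lact b t"
    by (rule V_hom_eq[where f = "lact (a \<oplus>\<^bsub>C\<^esub> b)" and g = "\<lambda>t. lact a t \<oplus>\<^bsub>TV\<^esub> lact b t", OF lact_hom add_homI TA _ t])
       (use ab in \<open>simp_all add: lact_closed lact_add V.T.a_ac lact_pt L.l_distr pt_add_l\<close>)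
qed (rule lact_closed)

lemma lact_assoc:
  assumes "a \<in> carrier C" "b \<in> carrier C" "t \<in> carrier TV"
  shows "lact (a \<otimes>\<^bsub>C\<^esub> b) t = lact a (lact b t)"
  by (rule V_hom_eq[where f = "lact (a \<otimes>\<^bsub>C\<^esub> b)" and g = "\<lambda>t. lact a (lact b t)", OF lact_hom add_homI TA _ assms(3)])
     (use assms in \<open>simp_all add: lact_closed lact_add lact_pt L.m_assoc\<close>)

lemma lact_one: "t \<in> carrier TV \<Longrightarrow> lact \<one>\<^bsub>C\<^esub> t = t"
  by (rule V_hom_eq[where f = "lact \<one>\<^bsub>C\<^esub>" and g = "\<lambda>t. t", OF lact_hom add_hom_id TA]) (simp_all add: lact_pt)

text \<open>Right multiplication by $\beta\,u'(g)$ is $c\otimes m\mapsto c\,u(g)\otimes m\beta$. By the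
  hypothesis on central elements this depends on the product $\beta\,u'(g)$ only.\<close>

definition rho where
  "rho g \<beta> = (SOME h. h \<in> add_hom TV TV \<and>
    (\<forall>c\<in>carrier C. \<forall>m\<in>carrier M. h (c \<otimes>\<otimes> m) = (c \<otimes>\<^bsub>C\<^esub> u g) \<otimes>\<otimes> (m \<odot>r\<^bsub>M\<^esub> \<beta>)))"

lemma rho:
  assumes "g \<in> carrier H" "\<beta> \<in> carrier B'"
  shows "rho g \<beta> \<in> add_hom TV TV \<and>
    (\<forall>c\<in>carrier C. \<forall>m\<in>carrier M. rho g \<beta> (c \<otimes>\<otimes> m) = (c \<otimes>\<^bsub>C\<^esub> u g) \<otimes>\<otimes> (m \<odot>r\<^bsub>M\<^esub> \<beta>))"
proof -
  have "V.balanced TV (\<lambda>c m. (c \<otimes>\<^bsub>C\<^esub> u g) \<otimes>\<otimes> (m \<odot>r\<^bsub>M\<^esub> \<beta>))"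
  proof (rule V_balancedI, goal_cases)
    case (4 c r m)
    \<comment> \<open>Right multiplication by \<open>u g\<close> respects the tensor product over
      \<open>B\<close> because \<open>u g\<close> commutes with \<open>B\<close>.\<close>
    have "(c \<otimes>\<^bsub>C\<^esub> r \<otimes>\<^bsub>C\<^esub> u g) = (c \<otimes>\<^bsub>C\<^esub> u g) \<otimes>\<^bsub>C\<^esub> r"
      using 4 assms by (simp add: L.m_assoc L.B_closed L.u_closed L.u_comm)
    then show ?case
      using 4 assms by (simp add: pt_move L.u_closed M.rsmult_closed M.smult_rsmult_assoc)
  qed (use assms in \<open>simp_all add: L.u_closed M.rsmult_closed pt_add_l pt_add_r L.l_distr M.rsmult_l_distr\<close>)
  from someI_ex[OF V_universal[OF TA this]] show ?thesis unfolding rho_def .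
qed

lemma rho_hom: "\<lbrakk>g \<in> carrier H; \<beta> \<in> carrier B'\<rbrakk> \<Longrightarrow> rho g \<beta> \<in> add_hom TV TV"
  and rho_pt: "\<lbrakk>g \<in> carrier H; \<beta> \<in> carrier B'; c \<in> carrier C; m \<in> carrier M\<rbrakk>
    \<Longrightarrow> rho g \<beta> (c \<otimes>\<otimes> m) = (c \<otimes>\<^bsub>C\<^esub> u g) \<otimes>\<otimes> (m \<odot>r\<^bsub>M\<^esub> \<beta>)"
  using rho by blast+

lemmas rho_closed = add_hom_closed[OF rho_hom]
  and rho_add = add_hom_add[OF rho_hom]

lemma rho_add_r:
  assumes "g \<in> carrier H" "\<beta> \<in> carrier B'" "\<gamma> \<in> carrier B'" "t \<in> carrier TV"
  shows "rho g (\<beta> \<oplus>\<^bsub>B'\<^esub> \<gamma>) t = rho g \<beta> t \<oplus>\<^bsub>TV\<^esub> rho g \<gamma> t"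
  by (rule V_hom_eq[where f = "rho g (\<beta> \<oplus>\<^bsub>B'\<^esub> \<gamma>)" and g = "\<lambda>t. rho g \<beta> t \<oplus>\<^bsub>TV\<^esub> rho g \<gamma> t", OF rho_hom add_homI TA _ assms(4)])
     (use assms in \<open>simp_all add: rho_closed rho_add V.T.a_ac rho_pt M.rsmult_r_distr pt_add_r L.u_closed M.rsmult_closed\<close>)

text \<open>The coefficients of one element of \<open>C'\<close> with respect to \<open>u' g\<close>
  and \<open>u' h\<close> differ by \<open>u' z\<close>, where \<open>z\<close> is \<open>g\<close>
  times the inverse of \<open>h\<close> and has degree one. By \<open>central\<close> the factor
  \<open>u' z\<close> on the right of \<open>m\<close> may be written as \<open>u z\<close> on its
  left, which crosses the tensor sign and turns \<open>u h\<close> into \<open>u g\<close>.\<close>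

lemma rho_change:
  assumes g: "g \<in> carrier H" and h: "h \<in> carrier H" and gh: "deg g = deg h"
    and \<beta>: "\<beta> \<in> carrier B'" and t: "t \<in> carrier TV"
  shows "rho h ((\<beta> \<otimes>\<^bsub>C'\<^esub> u' g) \<otimes>\<^bsub>C'\<^esub> u' (inv\<^bsub>H\<^esub> h)) t = rho g \<beta> t"
proof -
  define z where "z = g \<otimes>\<^bsub>H\<^esub> inv\<^bsub>H\<^esub> h"
  have z: "z \<in> carrier H" "deg z = \<one>\<^bsub>\<Gamma>\<^esub>" "z \<otimes>\<^bsub>H\<^esub> h = g"
    using g h gh L.deg_closed[OF h] by (simp_all add: z_def L.deg_mult L.deg_inv L.H.m_assoc)
  have uz: "u z \<in> carrier B" "u' z \<in> carrier B'" using z L.u_kernel R.u_kernel by simp_all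
  have eq: "(\<beta> \<otimes>\<^bsub>C'\<^esub> u' g) \<otimes>\<^bsub>C'\<^esub> u' (inv\<^bsub>H\<^esub> h) = u' z \<otimes>\<^bsub>B'\<^esub> \<beta>"
  proof -
    have "(\<beta> \<otimes>\<^bsub>C'\<^esub> u' g) \<otimes>\<^bsub>C'\<^esub> u' (inv\<^bsub>H\<^esub> h) = \<beta> \<otimes>\<^bsub>C'\<^esub> u' z"
      using g h \<beta> by (simp add: z_def R.u_mult R.m_assoc R.u_closed R.B_closed)
    also have "\<dots> = u' z \<otimes>\<^bsub>C'\<^esub> \<beta>" using \<beta> z(1) by (simp add: R.u_comm)
    finally show ?thesis using \<beta> uz by (simp add: R.B_mult)
  qed
  have "rho h (u' z \<otimes>\<^bsub>B'\<^esub> \<beta>) t = rho g \<beta> t"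
  proof (rule V_hom_eq[where f = "rho h (u' z \<otimes>\<^bsub>B'\<^esub> \<beta>)" and g = "rho g \<beta>", OF rho_hom rho_hom TA _ t])
    fix c m assume m: "c \<in> carrier C" "m \<in> carrier M"
    have "c \<otimes>\<^bsub>C\<^esub> u h \<otimes>\<^bsub>C\<^esub> u z = c \<otimes>\<^bsub>C\<^esub> u g"
      using m h z(1,3) L.u_comm[OF h uz(1)] L.u_mult[OF z(1) h] by (simp add: L.m_assoc L.u_closed)
    then show "rho h (u' z \<otimes>\<^bsub>B'\<^esub> \<beta>) (c \<otimes>\<otimes> m) = rho g \<beta> (c \<otimes>\<otimes> m)"
      using m g h \<beta> uz z
      by (simp add: rho_pt M.rsmult_assoc central[symmetric] M.smult_rsmult_assoc M.rsmult_closed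
          pt_move[symmetric] L.u_closed)
  qed (use g h \<beta> uz in simp_all)
  then show ?thesis by (simp add: eq)
qed

text \<open>An arbitrary representative of each degree; \<open>ract_unit\<close> shows that the
  right action does not depend on it.\<close>

definition rep where "rep x = (SOME g. g \<in> carrier H \<and> deg g = x)"

lemma rep: "x \<in> carrier \<Gamma> \<Longrightarrow> rep x \<in> carrier H \<and> deg (rep x) = x"
  using someI_ex[OF L.deg_ex[unfolded Bex_def]] unfolding rep_def .

text \<open>An additive map on \<open>C'\<close> may be prescribed degree by degree. In degree
  \<open>x\<close> the element is divided by the chosen unit, which leaves a coefficient in
  \<open>B'\<close>.\<close>

definition ract where
  "ract t = (SOME k. k \<in> add_hom C' TV \<and>
    (\<forall>x\<in>carrier \<Gamma>. \<forall>c\<in>\<C>' x. k c = rho (rep x) (c \<otimes>\<^bsub>C'\<^esub> u' (inv\<^bsub>H\<^esub> rep x)) t))"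

lemma ract:
  assumes t: "t \<in> carrier TV"
  shows "ract t \<in> add_hom C' TV \<and>
    (\<forall>x\<in>carrier \<Gamma>. \<forall>c\<in>\<C>' x. ract t c = rho (rep x) (c \<otimes>\<^bsub>C'\<^esub> u' (inv\<^bsub>H\<^esub> rep x)) t)"
proof -
  have "\<exists>k. k \<in> add_hom C' TV \<and>
    (\<forall>x\<in>carrier \<Gamma>. \<forall>c\<in>\<C>' x. k c = rho (rep x) (c \<otimes>\<^bsub>C'\<^esub> u' (inv\<^bsub>H\<^esub> rep x)) t)"
  proof (rule R.dec.parts_universal[OF TA])
  have cl: "c \<otimes>\<^bsub>C'\<^esub> u' (inv\<^bsub>H\<^esub> rep x) \<in> carrier B'" if "x \<in> carrier \<Gamma>" "c \<in> \<C>' x" for x c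
    using R.comp_u_inv[of "rep x" c] rep[OF that(1)] that(2) by simp
  fix x c assume xc: "x \<in> carrier \<Gamma>" "c \<in> \<C>' x"
  show "rho (rep x) (c \<otimes>\<^bsub>C'\<^esub> u' (inv\<^bsub>H\<^esub> rep x)) t \<in> carrier TV"
    using rep[OF xc(1)] cl[OF xc] t by (simp add: rho_closed)
  fix d assume d: "d \<in> \<C>' x"
  have "(c \<oplus>\<^bsub>C'\<^esub> d) \<otimes>\<^bsub>C'\<^esub> u' (inv\<^bsub>H\<^esub> rep x) =
      c \<otimes>\<^bsub>C'\<^esub> u' (inv\<^bsub>H\<^esub> rep x) \<oplus>\<^bsub>B'\<^esub> d \<otimes>\<^bsub>C'\<^esub> u' (inv\<^bsub>H\<^esub> rep x)"
    using rep[OF xc(1)] R.comp_closed[OF xc] R.comp_closed[OF xc(1) d] cl[OF xc] cl[OF xc(1) d]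
    by (simp add: R.B_add R.l_distr R.u_closed)
  then show "rho (rep x) ((c \<oplus>\<^bsub>C'\<^esub> d) \<otimes>\<^bsub>C'\<^esub> u' (inv\<^bsub>H\<^esub> rep x)) t =
      rho (rep x) (c \<otimes>\<^bsub>C'\<^esub> u' (inv\<^bsub>H\<^esub> rep x)) t \<oplus>\<^bsub>TV\<^esub> rho (rep x) (d \<otimes>\<^bsub>C'\<^esub> u' (inv\<^bsub>H\<^esub> rep x)) t"
    using rep[OF xc(1)] cl[OF xc] cl[OF xc(1) d] t by (simp add: rho_add_r)
  qed
  from someI_ex[OF this] show ?thesis unfolding ract_def .
qed

lemma ract_hom: "t \<in> carrier TV \<Longrightarrow> ract t \<in> add_hom C' TV"
  using ract by blast

text \<open>The definition only sees the chosen representatives. \<open>rho_change\<close> extends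
  the formula to every \<open>g\<close>, so that the laws of the action can be tested on all
  products \<open>\<beta>\<close> times \<open>u' g\<close>, which are closed under
  multiplication.\<close>

lemma ract_unit:
  assumes "t \<in> carrier TV" "\<beta> \<in> carrier B'" "g \<in> carrier H"
  shows "ract t (\<beta> \<otimes>\<^bsub>C'\<^esub> u' g) = rho g \<beta> t"
proof -
  have x: "deg g \<in> carrier \<Gamma>" using assms by (simp add: L.deg_closed)
  have "ract t (\<beta> \<otimes>\<^bsub>C'\<^esub> u' g) = rho (rep (deg g)) ((\<beta> \<otimes>\<^bsub>C'\<^esub> u' g) \<otimes>\<^bsub>C'\<^esub> u' (inv\<^bsub>H\<^esub> rep (deg g))) t"
    using ract[OF assms(1)] x R.B_u_comp[OF assms(2,3)] by simp
  also have "\<dots> = rho g \<beta> t"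
    by (rule rho_change) (use assms rep[OF x] in simp_all)
  finally show ?thesis .
qed

lemmas ract_closed = add_hom_closed[OF ract_hom]
  and ract_add_r = add_hom_add[OF ract_hom]

lemma ract_unit_pt: "\<lbrakk>c \<in> carrier C; m \<in> carrier M; \<beta> \<in> carrier B'; g \<in> carrier H\<rbrakk>
    \<Longrightarrow> ract (c \<otimes>\<otimes> m) (\<beta> \<otimes>\<^bsub>C'\<^esub> u' g) = (c \<otimes>\<^bsub>C\<^esub> u g) \<otimes>\<otimes> (m \<odot>r\<^bsub>M\<^esub> \<beta>)"
  by (simp add: ract_unit rho_pt)

lemma ract_B: "\<lbrakk>c \<in> carrier C; m \<in> carrier M; \<beta> \<in> carrier B'\<rbrakk> \<Longrightarrow> ract (c \<otimes>\<otimes> m) \<beta> = c \<otimes>\<otimes> (m \<odot>r\<^bsub>M\<^esub> \<beta>)"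
  using ract_unit_pt[of c m \<beta> "\<one>\<^bsub>H\<^esub>"] by (simp add: L.u_one R.u_one R.B_closed)

lemma ract_add:
  assumes "s \<in> carrier TV" "t \<in> carrier TV" "c \<in> carrier C'"
  shows "ract (s \<oplus>\<^bsub>TV\<^esub> t) c = ract s c \<oplus>\<^bsub>TV\<^esub> ract t c"
  by (rule R.C_hom_eq[where f = "ract (s \<oplus>\<^bsub>TV\<^esub> t)" and f' = "\<lambda>c. ract s c \<oplus>\<^bsub>TV\<^esub> ract t c", OF ract_hom add_homI TA _ assms(3)])
     (use assms in \<open>simp_all add: ract_closed ract_add_r V.T.a_ac ract_unit rho_add\<close>)

lemma ract_hom_l: "c \<in> carrier C' \<Longrightarrow> (\<lambda>t. ract t c) \<in> add_hom TV TV"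
  by (rule add_homI) (simp_all add: ract_closed ract_add)

text \<open>The units collect to the right of \<open>c\<close> and the coefficients to the right of
  \<open>m\<close>, both in the order of the product in \<open>C'\<close>; the two sequences do not
  interfere.\<close>

lemma rho_rho:
  assumes "g \<in> carrier H" "h \<in> carrier H" "\<beta> \<in> carrier B'" "\<gamma> \<in> carrier B'" "t \<in> carrier TV"
  shows "rho (g \<otimes>\<^bsub>H\<^esub> h) (\<beta> \<otimes>\<^bsub>B'\<^esub> \<gamma>) t = rho h \<gamma> (rho g \<beta> t)"
  by (rule V_hom_eq[where f = "rho (g \<otimes>\<^bsub>H\<^esub> h) (\<beta> \<otimes>\<^bsub>B'\<^esub> \<gamma>)" and g = "\<lambda>t. rho h \<gamma> (rho g \<beta> t)", OF rho_hom add_homI TA _ assms(5)])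
     (use assms in \<open>simp_all add: rho_closed rho_add rho_pt L.u_mult L.m_assoc L.u_closed M.rsmult_assoc M.rsmult_closed\<close>)

lemma ract_assoc:
  assumes t: "t \<in> carrier TV" and c: "c \<in> carrier C'" and d: "d \<in> carrier C'"
  shows "ract t (c \<otimes>\<^bsub>C'\<^esub> d) = ract (ract t c) d"
proof -
  have 1: "ract t (c \<otimes>\<^bsub>C'\<^esub> (\<gamma> \<otimes>\<^bsub>C'\<^esub> u' h)) = ract (ract t c) (\<gamma> \<otimes>\<^bsub>C'\<^esub> u' h)"
    if "\<gamma> \<in> carrier B'" "h \<in> carrier H" for \<gamma> h
    by (rule R.C_hom_eq[where f = "\<lambda>c. ract t (c \<otimes>\<^bsub>C'\<^esub> (\<gamma> \<otimes>\<^bsub>C'\<^esub> u' h))" and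
          f' = "\<lambda>c. ract (ract t c) (\<gamma> \<otimes>\<^bsub>C'\<^esub> u' h)", OF add_homI add_homI TA _ c])
       (use t that in \<open>simp_all add: ract_closed ract_add_r ract_add R.l_distr R.B_closed R.u_closed
         R.B_u_mult ract_unit rho_closed rho_add rho_rho\<close>)
  show ?thesis
    by (rule R.C_hom_eq[where f = "\<lambda>d. ract t (c \<otimes>\<^bsub>C'\<^esub> d)" and f' = "ract (ract t c)", OF add_homI ract_hom TA _ d])
       (use t c in \<open>simp_all add: ract_closed ract_add_r R.r_distr 1\<close>)
qed

lemma lact_ract:
  assumes a: "a \<in> carrier C" and t: "t \<in> carrier TV" and c: "c \<in> carrier C'"
  shows "ract (lact a t) c = lact a (ract t c)"
proof -
  have "rho g \<beta> (lact a t) = lact a (rho g \<beta> t)" if "g \<in> carrier H" "\<beta> \<in> carrier B'" for g \<beta>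
    by (rule V_hom_eq[where f = "\<lambda>t. rho g \<beta> (lact a t)" and g = "\<lambda>t. lact a (rho g \<beta> t)", OF add_homI add_homI TA _ t])
       (use a that in \<open>simp_all add: rho_closed rho_add lact_closed lact_add rho_pt lact_pt L.m_assoc L.u_closed M.rsmult_closed\<close>)
  then show ?thesis
    by (intro R.C_hom_eq[where f = "ract (lact a t)" and f' = "\<lambda>c. lact a (ract t c)", OF ract_hom add_homI TA _ c])
       (use a t in \<open>simp_all add: ract_closed ract_add_r lact_closed lact_add ract_unit\<close>)
qed

lemma ract_one: "t \<in> carrier TV \<Longrightarrow> ract t \<one>\<^bsub>C'\<^esub> = t"
  by (rule V_hom_eq[where f = "\<lambda>t. ract t \<one>\<^bsub>C'\<^esub>" and g = "\<lambda>t. t", OF ract_hom_l add_hom_id TA])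
     (use ract_B[OF _ _ R.B.one_closed] M.rsmult_one in \<open>simp_all add: R.B_one\<close>)

text \<open>Scalar multiples of one lie in \<open>B\<close> and in \<open>B'\<close>, and they are
  central in \<open>C\<close>. So they can be moved to \<open>M\<close>, where the scalar axiom of a
  bimodule takes them to the other side.\<close>

lemma lact_scalar:
  assumes r: "r \<in> carrier \<O>" and t: "t \<in> carrier TV"
  shows "lact (r \<odot>\<^bsub>C\<^esub> \<one>\<^bsub>C\<^esub>) t = ract t (r \<odot>\<^bsub>C'\<^esub> \<one>\<^bsub>C'\<^esub>)"
proof -
  have rB: "r \<odot>\<^bsub>B\<^esub> \<one>\<^bsub>B\<^esub> = r \<odot>\<^bsub>C\<^esub> \<one>\<^bsub>C\<^esub>" "r \<odot>\<^bsub>B\<^esub> \<one>\<^bsub>B\<^esub> \<in> carrier B"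
    using L.B_smult[OF r L.B.one_closed] L.B.smult_closed[OF r L.B.one_closed] by (simp_all add: L.B_one)
  have rB': "r \<odot>\<^bsub>B'\<^esub> \<one>\<^bsub>B'\<^esub> = r \<odot>\<^bsub>C'\<^esub> \<one>\<^bsub>C'\<^esub>" "r \<odot>\<^bsub>B'\<^esub> \<one>\<^bsub>B'\<^esub> \<in> carrier B'"
    using R.B_smult[OF r R.B.one_closed] R.B.smult_closed[OF r R.B.one_closed] by (simp_all add: R.B_one)
  show ?thesis
  proof (rule V_hom_eq[where f = "lact (r \<odot>\<^bsub>C\<^esub> \<one>\<^bsub>C\<^esub>)" and g = "\<lambda>t. ract t (r \<odot>\<^bsub>C'\<^esub> \<one>\<^bsub>C'\<^esub>)",
        OF lact_hom ract_hom_l TA _ t])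
    fix c m assume m: "c \<in> carrier C" "m \<in> carrier M"
    have "lact (r \<odot>\<^bsub>C\<^esub> \<one>\<^bsub>C\<^esub>) (c \<otimes>\<otimes> m) = (c \<otimes>\<^bsub>C\<^esub> (r \<odot>\<^bsub>B\<^esub> \<one>\<^bsub>B\<^esub>)) \<otimes>\<otimes> m"
      using r m by (simp add: lact_pt rB L.smult_mult_left L.smult_mult_right)
    also have "\<dots> = c \<otimes>\<otimes> (m \<odot>r\<^bsub>M\<^esub> (r \<odot>\<^bsub>B'\<^esub> \<one>\<^bsub>B'\<^esub>))"
      using r m rB(2) by (simp add: pt_move M.scalars_central)
    also have "\<dots> = ract (c \<otimes>\<otimes> m) (r \<odot>\<^bsub>B'\<^esub> \<one>\<^bsub>B'\<^esub>)"
      using m rB'(2) by (simp add: ract_B)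
    finally show "lact (r \<odot>\<^bsub>C\<^esub> \<one>\<^bsub>C\<^esub>) (c \<otimes>\<otimes> m) = ract (c \<otimes>\<otimes> m) (r \<odot>\<^bsub>C'\<^esub> \<one>\<^bsub>C'\<^esub>)"
      by (simp add: rB')
  qed (use r in simp_all)
qed

abbreviation VV where "VV \<equiv> left_induced C B M ract"

lemma VV_simps [simp]:
  "carrier VV = carrier TV" "\<zero>\<^bsub>VV\<^esub> = \<zero>\<^bsub>TV\<^esub>" "x \<oplus>\<^bsub>VV\<^esub> y = x \<oplus>\<^bsub>TV\<^esub> y"
  "a \<odot>\<^bsub>VV\<^esub> x = lact a x" "x \<odot>r\<^bsub>VV\<^esub> c = ract x c" "add VV = add TV"
  by (simp_all add: left_induced_def)

lemma VV_span: "add_span VV S = add_span TV S"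
  by (simp only: left_induced_def add_span_bimodule_of)

lemma VV_hom: "add_hom VV A = add_hom TV A" "add_hom A VV = add_hom A TV"
  by (simp_all add: hom_def)

lemma VV_abelian: "abelian_group VV"
  by (simp add: left_induced_def abelian_group_bimodule_of TA)

lemma VV_bimodule: "bimodule \<O> C C' VV"
  by (intro bimodule.intro L.assoc_algebra_axioms R.assoc_algebra_axioms left_module.intro L.ring_axioms
      VV_abelian left_module_axioms.intro bimodule_axioms.intro)
     (simp_all add: lact_closed add_hom_add[OF lact_hom_l] lact_add lact_assoc lact_one ract_closed ract_add_r
       ract_add ract_assoc lact_ract lact_scalar ract_one)


subsection \<open>The grading and the identity component\<close>

abbreviation \<V> where "\<V> \<equiv> left_induced_grading C \<C> B M"

lemma \<V>_gens: "x \<in> carrier \<Gamma> \<Longrightarrow> {c \<otimes>\<otimes> m | c m. c \<in> \<C> x \<and> m \<in> carrier M} \<subseteq> carrier TV"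
  using L.comp_closed by auto

lemma \<V>_pt: "\<lbrakk>c \<in> \<C> x; m \<in> carrier M\<rbrakk> \<Longrightarrow> c \<otimes>\<otimes> m \<in> \<V> x"
  unfolding left_induced_grading_def by (rule add_span_incl) blast

lemma \<V>_closed: "x \<in> carrier \<Gamma> \<Longrightarrow> v \<in> \<V> x \<Longrightarrow> v \<in> carrier TV"
  unfolding left_induced_grading_def using V.T.add_span_closed[OF \<V>_gens] by blast

lemma \<V>_subgroup_T: "x \<in> carrier \<Gamma> \<Longrightarrow> additive_subgroup (\<V> x) TV"
  unfolding left_induced_grading_def by (intro additive_subgroup.intro V.T.add_span_subgroup \<V>_gens)

lemma \<V>_subgroup: "x \<in> carrier \<Gamma> \<Longrightarrow> additive_subgroup (\<V> x) VV"
proof -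
  assume x: "x \<in> carrier \<Gamma>"
  have "subgroup (add_span VV {c \<otimes>\<otimes> m | c m. c \<in> \<C> x \<and> m \<in> carrier M}) (add_monoid VV)"
    by (rule abelian_group.add_span_subgroup[OF VV_abelian]) (simp only: VV_simps(1) \<V>_gens[OF x])
  then show ?thesis
    unfolding VV_span left_induced_grading_def by (rule additive_subgroup.intro)
qed

lemma \<V>_induct [consumes 2, case_names pure add minus zero]:
  assumes x: "x \<in> carrier \<Gamma>" and v: "v \<in> \<V> x"
    and "\<And>c m. \<lbrakk>c \<in> \<C> x; m \<in> carrier M\<rbrakk> \<Longrightarrow> P (c \<otimes>\<otimes> m)"
    and "\<And>s t. \<lbrakk>s \<in> carrier TV; t \<in> carrier TV; P s; P t\<rbrakk> \<Longrightarrow> P (s \<oplus>\<^bsub>TV\<^esub> t)"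
    and "\<And>t. \<lbrakk>t \<in> carrier TV; P t\<rbrakk> \<Longrightarrow> P (\<ominus>\<^bsub>TV\<^esub> t)" and "P \<zero>\<^bsub>TV\<^esub>"
  shows "P v"
proof (rule V.T.add_span_induct)
  show "v \<in> add_span TV {c \<otimes>\<otimes> m | c m. c \<in> \<C> x \<and> m \<in> carrier M}"
    using v by (simp only: left_induced_grading_def)
  show "P t" if "t \<in> {c \<otimes>\<otimes> m | c m. c \<in> \<C> x \<and> m \<in> carrier M}" for t
    using that assms(3) by blast
qed (use assms \<V>_gens[OF x] in simp_all)

text \<open>The projections of \<open>C\<close> are right linear over \<open>B\<close>, so they act
  on the first factor; the resulting maps show that the sum of the components is direct.\<close>

lemma ex_proj:
  assumes x: "x \<in> carrier \<Gamma>"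
  shows "\<exists>h. h \<in> add_hom TV TV \<and> (\<forall>c\<in>carrier C. \<forall>m\<in>carrier M. h (c \<otimes>\<otimes> m) = L.dec.pr x c \<otimes>\<otimes> m)"
  by (rule V_universal[OF TA], rule V_balancedI)
     (use x in \<open>simp_all add: L.dec.pr_closed add_hom_add[OF L.dec.pr_hom] pt_add_l pt_add_r L.pr_B_mult pt_move\<close>)

definition proj where
  "proj x = (SOME h. h \<in> add_hom TV TV \<and> (\<forall>c\<in>carrier C. \<forall>m\<in>carrier M. h (c \<otimes>\<otimes> m) = L.dec.pr x c \<otimes>\<otimes> m))"

lemma proj_hom: "x \<in> carrier \<Gamma> \<Longrightarrow> proj x \<in> add_hom TV TV"
  and proj_pt: "\<lbrakk>x \<in> carrier \<Gamma>; c \<in> carrier C; m \<in> carrier M\<rbrakk> \<Longrightarrow> proj x (c \<otimes>\<otimes> m) = L.dec.pr x c \<otimes>\<otimes> m"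
  using someI_ex[OF ex_proj[of x]] unfolding proj_def by simp_all

lemmas proj_closed = add_hom_closed[OF proj_hom]

lemma zero_pt: "m \<in> carrier M \<Longrightarrow> \<zero>\<^bsub>C\<^esub> \<otimes>\<otimes> m = \<zero>\<^bsub>TV\<^esub>"
  using add_hom_zero[OF V.pt_hom_l[of m] V.V.abelian_group_axioms TA] by simp

lemma proj_part:
  assumes x: "x \<in> carrier \<Gamma>" and y: "y \<in> carrier \<Gamma>" and v: "v \<in> \<V> y"
  shows "proj x v = (if x = y then v else \<zero>\<^bsub>TV\<^esub>)"
  using y v
proof (induction v rule: \<V>_induct)
  case (pure c m)
  then show ?case
    using x y L.comp_closed[OF y] by (simp add: proj_pt L.dec.pr_part[OF x y] zero_pt)
next
  case (add s t)
  then show ?case by (simp add: add_hom_add[OF proj_hom[OF x]])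
next
  case (minus t)
  then show ?case by (simp add: add_hom_minus[OF proj_hom[OF x] TA TA])
qed (simp add: add_hom_zero[OF proj_hom[OF x] TA TA])

lemma VV_direct_sum: "direct_sum VV (carrier \<Gamma>) \<V>"
proof (rule direct_sumI[where p = proj, OF VV_abelian L.finite_grading \<V>_subgroup])
  have S: "(\<Union>x\<in>carrier \<Gamma>. \<V> x) \<subseteq> carrier TV" using \<V>_closed by auto
  have 1: "c \<otimes>\<otimes> m \<in> add_span TV (\<Union>x\<in>carrier \<Gamma>. \<V> x)" if "c \<in> carrier C" "m \<in> carrier M" for c m
    using that(1)
  proof (induction c rule: L.dec.parts_induct)
    case (part i a)
    then show ?case using \<V>_pt[OF part(2) that(2)] by (intro add_span_incl) auto
  next
    case (add s t)
    then show ?case using that(2) by (simp add: pt_add_l V.T.add_span_add)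
  next
    case (minus t)
    then show ?case
      using add_hom_minus[OF V.pt_hom_l[OF that(2)] V.V.abelian_group_axioms TA, of t]
        a_inv_cong[of "regular C" C] by (simp add: V.T.add_span_minus[OF S])
  next
    case zero
    then show ?case using that(2) by (simp add: zero_pt V.T.add_span_zero)
  qed
  have "carrier TV \<subseteq> add_span TV (\<Union>x\<in>carrier \<Gamma>. \<V> x)"
  proof
    fix t assume "t \<in> carrier TV"
    then show "t \<in> add_span TV (\<Union>x\<in>carrier \<Gamma>. \<V> x)"
      by (induction t rule: V_induct) (simp_all add: 1 V.T.add_span_add V.T.add_span_minus[OF S])
  qed
  then show "carrier VV \<subseteq> add_span VV (\<Union>x\<in>carrier \<Gamma>. \<V> x)" unfolding VV_span by (simp only: VV_simps(1))
  show "proj x \<in> add_hom VV VV" if "x \<in> carrier \<Gamma>" for x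
    unfolding VV_hom using that by (rule proj_hom)
qed (simp_all add: proj_part)

lemma lact_grade:
  assumes x: "x \<in> carrier \<Gamma>" and y: "y \<in> carrier \<Gamma>" and a: "a \<in> \<C> x" and v: "v \<in> \<V> y"
  shows "lact a v \<in> \<V> (x \<otimes>\<^bsub>\<Gamma>\<^esub> y)"
  using y v
proof (induction v rule: \<V>_induct)
  interpret S: additive_subgroup "\<V> (x \<otimes>\<^bsub>\<Gamma>\<^esub> y)" TV by (rule \<V>_subgroup_T) (use x y in simp)
  note ac = L.comp_closed[OF x a]
  { case (pure c m)
    then show ?case using ac L.comp_closed[OF y] L.mult_comp[OF x y a] by (simp add: lact_pt \<V>_pt)
  next
    case (add s t)
    then show ?case using ac by (simp add: lact_add)
  next
    case (minus t)
    then show ?case using ac by (simp add: add_hom_minus[OF lact_hom TA TA])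
  next
    case zero
    then show ?case using ac by (simp add: add_hom_zero[OF lact_hom TA TA]) }
qed

text \<open>An element of degree \<open>y\<close> is \<open>\<beta>\<close> times
  \<open>u' g\<close>, and it acts on \<open>c\<close> through \<open>u g\<close>, which has the
  same degree \<open>y\<close> in \<open>C\<close>.\<close>

lemma ract_grade:
  assumes x: "x \<in> carrier \<Gamma>" and y: "y \<in> carrier \<Gamma>" and v: "v \<in> \<V> x" and a: "a \<in> \<C>' y"
  shows "ract v a \<in> \<V> (x \<otimes>\<^bsub>\<Gamma>\<^esub> y)"
  using x v
proof (induction v rule: \<V>_induct)
  interpret S: additive_subgroup "\<V> (x \<otimes>\<^bsub>\<Gamma>\<^esub> y)" TV by (rule \<V>_subgroup_T) (use x y in simp)
  note ac = R.comp_closed[OF y a]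
  { case (pure c m)
    obtain \<beta> g where g: "\<beta> \<in> carrier B'" "g \<in> carrier H" "deg g = y" "a = \<beta> \<otimes>\<^bsub>C'\<^esub> u' g"
      by (rule R.compE[OF y a])
    then show ?case
      using pure L.comp_closed[OF x] L.mult_comp[OF x y pure(1)] L.u_deg[OF g(2)]
      by (simp add: ract_unit_pt \<V>_pt M.rsmult_closed)
  next
    case (add s t)
    then show ?case using ac by (simp add: ract_add)
  next
    case (minus t)
    then show ?case using ac by (simp add: add_hom_minus[OF ract_hom_l TA TA])
  next
    case zero
    then show ?case using ac by (simp add: add_hom_zero[OF ract_hom_l TA TA]) }
qed

lemma VV_graded: "graded_bimodule \<O> \<Gamma> C \<C> C' \<C>' VV \<V>"
  by (intro graded_bimodule.intro VV_bimodule L.graded_algebra_axioms R.graded_algebra_axioms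
      graded_bimodule_axioms.intro VV_direct_sum)
     (simp_all add: lact_grade ract_grade)

abbreviation j where "j m \<equiv> \<one>\<^bsub>C\<^esub> \<otimes>\<otimes> m"

lemma j_closed: "m \<in> carrier M \<Longrightarrow> j m \<in> carrier TV"
  by simp

lemma j_hom: "j \<in> add_hom M TV"
  using V.pt_hom_r[of "\<one>\<^bsub>C\<^esub>"] by simp

lemma j_grade: "m \<in> carrier M \<Longrightarrow> j m \<in> \<V> \<one>\<^bsub>\<Gamma>\<^esub>"
  by (rule \<V>_pt) (use L.B.one_closed in \<open>simp_all add: L.B_one L.B_carrier[symmetric]\<close>)

text \<open>Projecting \<open>C\<close> to its component \<open>B\<close> and letting the result act
  on \<open>M\<close> gives a left inverse of \<open>j\<close>. It is what shows that
  \<open>M\<close> embeds into the induced module.\<close>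

lemma ex_retraction:
  "\<exists>h. h \<in> add_hom TV M \<and> (\<forall>c\<in>carrier C. \<forall>m\<in>carrier M. h (c \<otimes>\<otimes> m) = L.dec.pr \<one>\<^bsub>\<Gamma>\<^esub> c \<odot>\<^bsub>M\<^esub> m)"
proof (rule V_universal[OF MA], rule V_balancedI)
  have p: "L.dec.pr \<one>\<^bsub>\<Gamma>\<^esub> c \<in> carrier B" if "c \<in> carrier C" for c
    using L.dec.pr_in[OF L.\<Gamma>.one_closed that] by (simp add: L.B_carrier)
  fix c d \<beta> m n assume m: "c \<in> carrier C" "m \<in> carrier M"
  show "L.dec.pr \<one>\<^bsub>\<Gamma>\<^esub> c \<odot>\<^bsub>M\<^esub> m \<in> carrier M" using m p by (simp add: M.smult_closed)
  show "L.dec.pr \<one>\<^bsub>\<Gamma>\<^esub> (c \<oplus>\<^bsub>C\<^esub> d) \<odot>\<^bsub>M\<^esub> m = L.dec.pr \<one>\<^bsub>\<Gamma>\<^esub> c \<odot>\<^bsub>M\<^esub> m \<oplus>\<^bsub>M\<^esub> L.dec.pr \<one>\<^bsub>\<Gamma>\<^esub> d \<odot>\<^bsub>M\<^esub> m"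
    if "d \<in> carrier C"
    using m that p by (simp add: add_hom_add[OF L.dec.pr_hom] L.B_add[symmetric] M.smult_l_distr)
  show "L.dec.pr \<one>\<^bsub>\<Gamma>\<^esub> c \<odot>\<^bsub>M\<^esub> (m \<oplus>\<^bsub>M\<^esub> n) = L.dec.pr \<one>\<^bsub>\<Gamma>\<^esub> c \<odot>\<^bsub>M\<^esub> m \<oplus>\<^bsub>M\<^esub> L.dec.pr \<one>\<^bsub>\<Gamma>\<^esub> c \<odot>\<^bsub>M\<^esub> n"
    if "n \<in> carrier M"
    using m that p by (simp add: M.smult_r_distr)
  show "L.dec.pr \<one>\<^bsub>\<Gamma>\<^esub> (c \<otimes>\<^bsub>C\<^esub> \<beta>) \<odot>\<^bsub>M\<^esub> m = L.dec.pr \<one>\<^bsub>\<Gamma>\<^esub> c \<odot>\<^bsub>M\<^esub> (\<beta> \<odot>\<^bsub>M\<^esub> m)"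
    if "\<beta> \<in> carrier B"
    using m that p by (simp add: L.pr_B_mult L.B_mult[symmetric] M.smult_assoc)
qed

lemma j_inj:
  assumes "m \<in> carrier M" "n \<in> carrier M" "j m = j n" shows "m = n"
proof -
  obtain h where h: "\<forall>c\<in>carrier C. \<forall>m\<in>carrier M. h (c \<otimes>\<otimes> m) = L.dec.pr \<one>\<^bsub>\<Gamma>\<^esub> c \<odot>\<^bsub>M\<^esub> m"
    using ex_retraction by blast
  have o: "\<one>\<^bsub>C\<^esub> \<in> \<C> \<one>\<^bsub>\<Gamma>\<^esub>" using L.B.one_closed by (simp add: L.B_one L.B_carrier)
  have "L.dec.pr \<one>\<^bsub>\<Gamma>\<^esub> \<one>\<^bsub>C\<^esub> = \<one>\<^bsub>B\<^esub>" using L.dec.pr_part[OF _ _ o] by (simp add: L.B_one)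
  then have "h (j k) = k" if "k \<in> carrier M" for k
    using h that by (simp add: M.smult_one)
  then show ?thesis using assms by metis
qed

lemma j_surj:
  assumes "v \<in> \<V> \<one>\<^bsub>\<Gamma>\<^esub>" shows "\<exists>m\<in>carrier M. v = j m"
  using L.\<Gamma>.one_closed assms
proof (induction v rule: \<V>_induct)
  case (pure c m)
  then have "c \<in> carrier B" by (simp add: L.B_carrier)
  then show ?case using pure pt_B[of c m] M.smult_closed[of c m] by blast
next
  case (add s t)
  from add(3) obtain m where m: "m \<in> carrier M" "s = j m" by (elim bexE)
  from add(4) obtain n where n: "n \<in> carrier M" "t = j n" by (elim bexE)
  from m n show ?case by (intro bexI[of _ "m \<oplus>\<^bsub>M\<^esub> n"]) (simp_all add: pt_add_r)
next
  case (minus t)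
  from minus(2) obtain m where "m \<in> carrier M" "t = j m" by (elim bexE)
  then show ?case by (intro bexI[of _ "\<ominus>\<^bsub>M\<^esub> m"]) (simp_all add: add_hom_minus[OF j_hom MA TA])
next
  case zero
  then show ?case by (intro bexI[of _ "\<zero>\<^bsub>M\<^esub>"]) (simp_all add: add_hom_zero[OF j_hom MA TA])
qed

lemma j_bij: "bij_betw j (carrier M) (\<V> \<one>\<^bsub>\<Gamma>\<^esub>)"
  unfolding bij_betw_def
proof
  show "inj_on j (carrier M)" by (rule inj_onI) (rule j_inj)
  show "j ` carrier M = \<V> \<one>\<^bsub>\<Gamma>\<^esub>"
  proof (intro equalityI subsetI)
    fix v assume "v \<in> j ` carrier M"
    then show "v \<in> \<V> \<one>\<^bsub>\<Gamma>\<^esub>" by (elim imageE) (simp add: j_grade)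
  next
    fix v assume "v \<in> \<V> \<one>\<^bsub>\<Gamma>\<^esub>"
    from j_surj[OF this] show "v \<in> j ` carrier M" by (elim bexE) auto
  qed
qed

end


section \<open>Transport along graded isomorphisms\<close>

lemma graded_bimodule_transport:
  assumes V: "graded_bimodule \<O> \<Gamma> R \<A> S \<D> V \<V>" and h: "graded_bimodule_iso \<Gamma> R S V \<V> W \<W> h"
    and W: "abelian_group W"
  shows "graded_bimodule \<O> \<Gamma> R \<A> S \<D> W \<W>"
proof -
  interpret V: graded_bimodule \<O> \<Gamma> R \<A> S \<D> V \<V> by fact
  interpret D: decomposition V "carrier \<Gamma>" \<V>
    by (intro decomposition.intro decomposition_axioms.intro V.M.abelian_group_axioms V.GR.finite_grading V.direct_sum)
  note VA = V.M.abelian_group_axioms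
  have bij: "bij_betw h (carrier V) (carrier W)"
    and hom: "h \<in> add_hom V W"
    and l: "\<And>a x. \<lbrakk>a \<in> carrier R; x \<in> carrier V\<rbrakk> \<Longrightarrow> h (a \<odot>\<^bsub>V\<^esub> x) = a \<odot>\<^bsub>W\<^esub> h x"
    and r: "\<And>x b. \<lbrakk>x \<in> carrier V; b \<in> carrier S\<rbrakk> \<Longrightarrow> h (x \<odot>r\<^bsub>V\<^esub> b) = h x \<odot>r\<^bsub>W\<^esub> b"
    and gr: "\<And>x. x \<in> carrier \<Gamma> \<Longrightarrow> h ` \<V> x = \<W> x"
    using h by (auto simp: graded_bimodule_iso_def bimodule_iso_def bij_betw_def intro!: add_homI)
  interpret H: group_hom "add_monoid V" "add_monoid W" h
    by (rule add_hom_group_hom[OF hom VA W])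
  let ?k = "inv_into (carrier V) h"
  have k: "?k \<in> add_hom W V" by (rule add_hom_inv_into[OF hom bij VA])
  have kh: "?k (h x) = x" if "x \<in> carrier V" for x
    using bij that by (rule bij_betw_inv_into_left)
  have WE: "\<exists>v\<in>\<V> x. v \<in> carrier V \<and> w = h v" if "x \<in> carrier \<Gamma>" "w \<in> \<W> x" for x w
  proof -
    have "w \<in> h ` \<V> x" using that gr by simp
    then show ?thesis using V.comp_closed[OF that(1)] by blast
  qed
  have bimod: "bimodule \<O> R S W"
    by (rule bimodule_transport[OF V.bimodule_axioms bij add_hom_add[OF hom] l r W])
  have "direct_sum W (carrier \<Gamma>) \<W>"
  \<comment> \<open>The projections of \<open>W\<close> are those of \<open>V\<close>, conjugated by
    \<open>h\<close>.\<close>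
  proof (rule direct_sumI[where p = "\<lambda>x w. h (D.pr x (?k w))", OF W V.GR.finite_grading])
    fix x assume x: "x \<in> carrier \<Gamma>"
    have "subgroup (\<V> x) (add_monoid V)" using D.part_subgroup[OF x] by (simp add: additive_subgroup_def)
    then have "subgroup (h ` \<V> x) (add_monoid W)" by (rule H.subgroup_img_is_subgroup)
    then show "additive_subgroup (\<W> x) W" using gr[OF x] by (simp add: additive_subgroup_def)
    show "(\<lambda>w. h (D.pr x (?k w))) \<in> add_hom W W"
      by (rule add_homI)
         (use x in \<open>simp_all add: add_hom_closed[OF hom] add_hom_closed[OF k] D.pr_closed add_hom_add[OF k]
           add_hom_add[OF D.pr_hom] add_hom_add[OF hom]\<close>)
    fix y w assume y: "y \<in> carrier \<Gamma>" and w: "w \<in> \<W> y"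
    obtain v where v: "v \<in> \<V> y" "v \<in> carrier V" "w = h v" using WE[OF y w] by blast
    show "h (D.pr x (?k w)) = (if x = y then w else \<zero>\<^bsub>W\<^esub>)"
      using v x y by (simp add: kh D.pr_part add_hom_zero[OF hom VA W])
  next
    have "carrier W = h ` add_span V (\<Union>x\<in>carrier \<Gamma>. \<V> x)"
      using bij D.parts_span by (simp add: bij_betw_def)
    also have "\<dots> = add_span W (h ` (\<Union>x\<in>carrier \<Gamma>. \<V> x))"
      by (rule add_hom_span_image[OF hom VA W]) (use V.comp_closed in auto)
    also have "h ` (\<Union>x\<in>carrier \<Gamma>. \<V> x) = (\<Union>x\<in>carrier \<Gamma>. \<W> x)"
      unfolding image_UN by (rule SUP_cong) (simp_all add: gr)
    finally show "carrier W \<subseteq> add_span W (\<Union>x\<in>carrier \<Gamma>. \<W> x)" by simp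
  qed
  moreover have "a \<odot>\<^bsub>W\<^esub> w \<in> \<W> (x \<otimes>\<^bsub>\<Gamma>\<^esub> y)"
    if m: "x \<in> carrier \<Gamma>" "y \<in> carrier \<Gamma>" "a \<in> \<A> x" "w \<in> \<W> y" for x y a w
  proof -
    obtain v where v: "v \<in> \<V> y" "v \<in> carrier V" "w = h v" using WE[OF m(2,4)] by blast
    have "a \<odot>\<^bsub>W\<^esub> w = h (a \<odot>\<^bsub>V\<^esub> v)" using v l V.GR.comp_closed[OF m(1,3)] by simp
    also have "\<dots> \<in> h ` \<V> (x \<otimes>\<^bsub>\<Gamma>\<^esub> y)" using V.smult_comp[OF m(1-3) v(1)] by (rule imageI)
    also have "\<dots> = \<W> (x \<otimes>\<^bsub>\<Gamma>\<^esub> y)" using m by (simp add: gr)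
    finally show ?thesis .
  qed
  moreover have "w \<odot>r\<^bsub>W\<^esub> a \<in> \<W> (x \<otimes>\<^bsub>\<Gamma>\<^esub> y)"
    if m: "x \<in> carrier \<Gamma>" "y \<in> carrier \<Gamma>" "w \<in> \<W> x" "a \<in> \<D> y" for x y a w
  proof -
    obtain v where v: "v \<in> \<V> x" "v \<in> carrier V" "w = h v" using WE[OF m(1,3)] by blast
    have "w \<odot>r\<^bsub>W\<^esub> a = h (v \<odot>r\<^bsub>V\<^esub> a)" using v r V.GS.comp_closed[OF m(2,4)] by simp
    also have "\<dots> \<in> h ` \<V> (x \<otimes>\<^bsub>\<Gamma>\<^esub> y)" using V.rsmult_comp[OF m(1,2) v(1) m(4)] by (rule imageI)
    also have "\<dots> = \<W> (x \<otimes>\<^bsub>\<Gamma>\<^esub> y)" using m by (simp add: gr)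
    finally show ?thesis .
  qed
  ultimately show ?thesis
    using bimod V.GR.graded_algebra_axioms V.GS.graded_algebra_axioms
    by (intro graded_bimodule.intro graded_bimodule_axioms.intro)
qed

lemma graded_bimodule_iso_comp:
  assumes h: "graded_bimodule_iso \<Gamma> R S V \<V> W \<W> h" and k: "graded_bimodule_iso \<Gamma> R S W \<W> U \<U> k"
  shows "graded_bimodule_iso \<Gamma> R S V \<V> U \<U> (\<lambda>x. k (h x))"
proof -
  have c: "h x \<in> carrier W" if "x \<in> carrier V" for x
    using h that by (auto simp: graded_bimodule_iso_def bimodule_iso_def bij_betw_def)
  have "bij_betw (k \<circ> h) (carrier V) (carrier U)"
    using h k by (intro bij_betw_trans[of h _ "carrier W"]) (simp_all add: graded_bimodule_iso_def bimodule_iso_def)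
  moreover have "(\<lambda>x. k (h x)) ` \<V> x = \<U> x" if "x \<in> carrier \<Gamma>" for x
    using h k that image_image[of k h "\<V> x"] by (simp add: graded_bimodule_iso_def)
  ultimately show ?thesis
    using h k c by (simp add: graded_bimodule_iso_def bimodule_iso_def comp_def)
qed

lemma graded_bimodule_iso_inv:
  assumes V: "graded_bimodule \<O> \<Gamma> R \<A> S \<D> V \<V>" and h: "graded_bimodule_iso \<Gamma> R S V \<V> W \<W> h"
  shows "graded_bimodule_iso \<Gamma> R S W \<W> V \<V> (inv_into (carrier V) h)"
proof -
  interpret V: graded_bimodule \<O> \<Gamma> R \<A> S \<D> V \<V> by fact
  have bij: "bij_betw h (carrier V) (carrier W)"
    and hom: "h \<in> add_hom V W"
    and l: "\<And>a x. \<lbrakk>a \<in> carrier R; x \<in> carrier V\<rbrakk> \<Longrightarrow> h (a \<odot>\<^bsub>V\<^esub> x) = a \<odot>\<^bsub>W\<^esub> h x"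
    and r: "\<And>x b. \<lbrakk>x \<in> carrier V; b \<in> carrier S\<rbrakk> \<Longrightarrow> h (x \<odot>r\<^bsub>V\<^esub> b) = h x \<odot>r\<^bsub>W\<^esub> b"
    and gr: "\<And>x. x \<in> carrier \<Gamma> \<Longrightarrow> h ` \<V> x = \<W> x"
    using h by (auto simp: graded_bimodule_iso_def bimodule_iso_def bij_betw_def intro!: add_homI)
  let ?k = "inv_into (carrier V) h"
  have k: "?k \<in> add_hom W V" by (rule add_hom_inv_into[OF hom bij V.M.abelian_group_axioms])
  have kh: "?k (h x) = x" if "x \<in> carrier V" for x using bij that by (rule bij_betw_inv_into_left)
  have hk: "h (?k w) = w" if "w \<in> carrier W" for w using bij that by (rule bij_betw_inv_into_right)
  note kc = add_hom_closed[OF k]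
  have "?k (a \<odot>\<^bsub>W\<^esub> w) = a \<odot>\<^bsub>V\<^esub> ?k w" if "a \<in> carrier R" "w \<in> carrier W" for a w
    using kh[of "a \<odot>\<^bsub>V\<^esub> ?k w"] that by (simp add: l kc hk V.smult_closed)
  moreover have "?k (w \<odot>r\<^bsub>W\<^esub> a) = ?k w \<odot>r\<^bsub>V\<^esub> a" if "a \<in> carrier S" "w \<in> carrier W" for a w
    using kh[of "?k w \<odot>r\<^bsub>V\<^esub> a"] that by (simp add: r kc hk V.rsmult_closed)
  moreover have "?k ` \<W> x = \<V> x" if x: "x \<in> carrier \<Gamma>" for x
  proof -
    have "?k ` \<W> x = ?k ` h ` \<V> x" using gr[OF x] by simp
    also have "\<dots> = \<V> x"
      using V.comp_closed[OF x] bij by (intro inv_into_image_cancel) (auto simp: bij_betw_def)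
    finally show ?thesis .
  qed
  ultimately show ?thesis
    using bij_betw_inv_into[OF bij] by (simp add: graded_bimodule_iso_def bimodule_iso_def add_hom_add[OF k])
qed


section \<open>The three descriptions of the induced bimodule\<close>

lemma right_induced_simps [simp]:
  "carrier (right_induced C' B' M l) = carrier (tensor B' M (regular C'))"
  "x \<oplus>\<^bsub>right_induced C' B' M l\<^esub> y = x \<oplus>\<^bsub>tensor B' M (regular C')\<^esub> y"
  "a \<odot>\<^bsub>right_induced C' B' M l\<^esub> x = l a x"
  "x \<odot>r\<^bsub>right_induced C' B' M l\<^esub> c = tensor_rsmult B' M (regular C') x c"
  by (simp_all add: right_induced_def)

section \<open>Comparison with the module induced from the right\<close>

context crossed_pair
begin

sublocale W: tensor_pair B' M "regular C'"
  by (intro tensor_pair.intro tensor_pair_axioms.intro M.M.abelian_group_axioms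
      abelian_group_regular[THEN iffD2] R.abelian_group_axioms)
     (simp_all add: R.B_closed M.rsmult_closed)

abbreviation TW where "TW \<equiv> tensor B' M (regular C')"
abbreviation qt where "qt m c \<equiv> pure_tensor B' M (regular C') m c"

lemmas WA = W.abelian_group_T
lemmas W_balancedI = W.balancedI[simplified]
lemmas W_universal = W.universal_ex[simplified]
lemmas W_hom_eq = W.hom_eq[simplified]

lemma qt_closed [simp]: "\<lbrakk>m \<in> carrier M; c \<in> carrier C'\<rbrakk> \<Longrightarrow> qt m c \<in> carrier TW"
  and qt_add_l: "\<lbrakk>m \<in> carrier M; n \<in> carrier M; c \<in> carrier C'\<rbrakk> \<Longrightarrow> qt (m \<oplus>\<^bsub>M\<^esub> n) c = qt m c \<oplus>\<^bsub>TW\<^esub> qt n c"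
  and qt_add_r: "\<lbrakk>m \<in> carrier M; c \<in> carrier C'; d \<in> carrier C'\<rbrakk> \<Longrightarrow> qt m (c \<oplus>\<^bsub>C'\<^esub> d) = qt m c \<oplus>\<^bsub>TW\<^esub> qt m d"
  and qt_move: "\<lbrakk>m \<in> carrier M; \<beta> \<in> carrier B'; c \<in> carrier C'\<rbrakk> \<Longrightarrow> qt (m \<odot>r\<^bsub>M\<^esub> \<beta>) c = qt m (\<beta> \<otimes>\<^bsub>C'\<^esub> c)"
  using W.pt_closed[of m c] W.pt_add_l[of m n c] W.pt_add_r[of m c d] W.pt_move[of m \<beta> c] by simp_all

abbreviation rW where "rW \<equiv> tensor_rsmult B' M (regular C')"

lemma rW_hom: "c \<in> carrier C' \<Longrightarrow> (\<lambda>t. rW t c) \<in> add_hom TW TW"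
  and rW_pt: "\<lbrakk>c \<in> carrier C'; m \<in> carrier M; d \<in> carrier C'\<rbrakk> \<Longrightarrow> rW (qt m d) c = qt m (d \<otimes>\<^bsub>C'\<^esub> c)"
proof -
  assume c: "c \<in> carrier C'"
  have 1: "(\<lambda>y. y \<odot>r\<^bsub>regular C'\<^esub> c) \<in> add_hom (regular C') (regular C')"
    by (rule add_homI) (use c in \<open>simp_all add: R.l_distr\<close>)
  have 2: "(r \<odot>\<^bsub>regular C'\<^esub> y) \<odot>r\<^bsub>regular C'\<^esub> c = r \<odot>\<^bsub>regular C'\<^esub> (y \<odot>r\<^bsub>regular C'\<^esub> c)"
    if "r \<in> carrier B'" "y \<in> carrier (regular C')" for r y
    using c that by (simp add: R.m_assoc R.B_closed)
  show "(\<lambda>t. rW t c) \<in> add_hom TW TW" by (rule tensor_rsmult_hom[OF W.tensor_pair_axioms 1 2])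
  show "rW (qt m d) c = qt m (d \<otimes>\<^bsub>C'\<^esub> c)" if "m \<in> carrier M" "d \<in> carrier C'"
    using tensor_rsmult_pt[OF W.tensor_pair_axioms 1 2, of m d] that by simp
qed

lemma ract_u: "\<lbrakk>c \<in> carrier C; m \<in> carrier M; g \<in> carrier H\<rbrakk> \<Longrightarrow> ract (c \<otimes>\<otimes> m) (u' g) = (c \<otimes>\<^bsub>C\<^esub> u g) \<otimes>\<otimes> m"
  using ract_unit_pt[of c m "\<one>\<^bsub>B'\<^esub>" g] M.rsmult_one[of m] by (simp add: R.B_one R.u_closed R.B.one_closed[unfolded R.B_one])

text \<open>The copy \<open>j m\<close> of \<open>M\<close> is multiplied by \<open>C'\<close>
  inside the first description. Balancedness holds because \<open>B'\<close> acts on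
  \<open>j m\<close> through its action on \<open>m\<close>.\<close>

lemma ex_from_W:
  "\<exists>h. h \<in> add_hom TW TV \<and> (\<forall>m\<in>carrier M. \<forall>c\<in>carrier C'. h (qt m c) = ract (j m) c)"
proof (rule W_universal[OF TA], rule W_balancedI, goal_cases)
  case (4 m \<beta> c)
  then show ?case using ract_B[of "\<one>\<^bsub>C\<^esub>" m \<beta>, symmetric] by (simp add: ract_assoc R.B_closed)
qed (simp_all add: ract_closed pt_add_r ract_add ract_add_r)

definition from_W where
  "from_W = (SOME h. h \<in> add_hom TW TV \<and> (\<forall>m\<in>carrier M. \<forall>c\<in>carrier C'. h (qt m c) = ract (j m) c))"

lemma from_W_hom: "from_W \<in> add_hom TW TV"
  and from_W_pt: "\<lbrakk>m \<in> carrier M; c \<in> carrier C'\<rbrakk> \<Longrightarrow> from_W (qt m c) = ract (j m) c"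
  using someI_ex[OF ex_from_W] unfolding from_W_def by simp_all

text \<open>The inverse comparison for a fixed \<open>m\<close>. Like the right action, it has to be
  prescribed through one representative per degree, and \<open>central\<close> then gives the
  formula for every \<open>g\<close>.\<close>

lemma ex_to_W_aux:
  assumes m: "m \<in> carrier M"
  shows "\<exists>k. k \<in> add_hom C TW \<and> (\<forall>\<gamma>\<in>carrier B. \<forall>g\<in>carrier H. k (\<gamma> \<otimes>\<^bsub>C\<^esub> u g) = qt (\<gamma> \<odot>\<^bsub>M\<^esub> m) (u' g))"
proof -
  have cl: "c \<otimes>\<^bsub>C\<^esub> u (inv\<^bsub>H\<^esub> rep x) \<in> carrier B" if "x \<in> carrier \<Gamma>" "c \<in> \<C> x" for x c
    using L.comp_u_inv[of "rep x" c] rep[OF that(1)] that(2) by simp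
  have "\<exists>k. k \<in> add_hom C TW \<and>
    (\<forall>x\<in>carrier \<Gamma>. \<forall>c\<in>\<C> x. k c = qt ((c \<otimes>\<^bsub>C\<^esub> u (inv\<^bsub>H\<^esub> rep x)) \<odot>\<^bsub>M\<^esub> m) (u' (rep x)))"
  proof (rule L.dec.parts_universal[OF WA])
    fix x c assume xc: "x \<in> carrier \<Gamma>" "c \<in> \<C> x"
    show "qt ((c \<otimes>\<^bsub>C\<^esub> u (inv\<^bsub>H\<^esub> rep x)) \<odot>\<^bsub>M\<^esub> m) (u' (rep x)) \<in> carrier TW"
      using rep[OF xc(1)] cl[OF xc] m by (simp add: M.smult_closed R.u_closed)
    fix d assume d: "d \<in> \<C> x"
    have "(c \<oplus>\<^bsub>C\<^esub> d) \<otimes>\<^bsub>C\<^esub> u (inv\<^bsub>H\<^esub> rep x) =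
        c \<otimes>\<^bsub>C\<^esub> u (inv\<^bsub>H\<^esub> rep x) \<oplus>\<^bsub>B\<^esub> d \<otimes>\<^bsub>C\<^esub> u (inv\<^bsub>H\<^esub> rep x)"
      using rep[OF xc(1)] L.comp_closed[OF xc] L.comp_closed[OF xc(1) d] cl[OF xc] cl[OF xc(1) d]
      by (simp add: L.B_add L.l_distr L.u_closed)
    then show "qt (((c \<oplus>\<^bsub>C\<^esub> d) \<otimes>\<^bsub>C\<^esub> u (inv\<^bsub>H\<^esub> rep x)) \<odot>\<^bsub>M\<^esub> m) (u' (rep x)) =
        qt ((c \<otimes>\<^bsub>C\<^esub> u (inv\<^bsub>H\<^esub> rep x)) \<odot>\<^bsub>M\<^esub> m) (u' (rep x)) \<oplus>\<^bsub>TW\<^esub>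
        qt ((d \<otimes>\<^bsub>C\<^esub> u (inv\<^bsub>H\<^esub> rep x)) \<odot>\<^bsub>M\<^esub> m) (u' (rep x))"
      using rep[OF xc(1)] cl[OF xc] cl[OF xc(1) d] m
      by (simp add: M.smult_l_distr qt_add_l M.smult_closed R.u_closed)
  qed
  then obtain k where k: "k \<in> add_hom C TW"
    "\<forall>x\<in>carrier \<Gamma>. \<forall>c\<in>\<C> x. k c = qt ((c \<otimes>\<^bsub>C\<^esub> u (inv\<^bsub>H\<^esub> rep x)) \<odot>\<^bsub>M\<^esub> m) (u' (rep x))"
    by blast
  have "k (\<gamma> \<otimes>\<^bsub>C\<^esub> u g) = qt (\<gamma> \<odot>\<^bsub>M\<^esub> m) (u' g)" if \<gamma>: "\<gamma> \<in> carrier B" and g: "g \<in> carrier H" for \<gamma> g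
  proof -
    let ?h = "rep (deg g)"
    have h: "?h \<in> carrier H" "deg ?h = deg g" using rep[OF L.deg_closed[OF g]] by simp_all
    \<comment> \<open>The given \<open>g\<close> and the representative of its degree differ by
      \<open>z\<close> of degree one. Dividing by the representative leaves the factor
      \<open>u z\<close> on \<open>m\<close>; it acts as \<open>u' z\<close> from the right, crosses
      the tensor sign and completes the representative to \<open>u' g\<close>.\<close>
    define z where "z = g \<otimes>\<^bsub>H\<^esub> inv\<^bsub>H\<^esub> ?h"
    have z: "z \<in> carrier H" "deg z = \<one>\<^bsub>\<Gamma>\<^esub>" "z \<otimes>\<^bsub>H\<^esub> ?h = g"
      using g h L.deg_closed[OF g] by (simp_all add: z_def L.deg_mult L.deg_inv L.H.m_assoc)
    have uz: "u z \<in> carrier B" "u' z \<in> carrier B'" using z L.u_kernel R.u_kernel by simp_all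
    have "\<gamma> \<otimes>\<^bsub>C\<^esub> u g \<otimes>\<^bsub>C\<^esub> u (inv\<^bsub>H\<^esub> ?h) = \<gamma> \<otimes>\<^bsub>B\<^esub> u z"
      using g h \<gamma> uz L.u_mult[OF g L.H.inv_closed[OF h(1)]]
      by (simp add: z_def L.m_assoc L.u_closed L.B_closed L.B_mult)
    then have "(\<gamma> \<otimes>\<^bsub>C\<^esub> u g \<otimes>\<^bsub>C\<^esub> u (inv\<^bsub>H\<^esub> ?h)) \<odot>\<^bsub>M\<^esub> m = (\<gamma> \<odot>\<^bsub>M\<^esub> m) \<odot>r\<^bsub>M\<^esub> u' z"
      using \<gamma> uz m z by (simp add: M.smult_assoc central M.smult_rsmult_assoc)
    then have "k (\<gamma> \<otimes>\<^bsub>C\<^esub> u g) = qt (\<gamma> \<odot>\<^bsub>M\<^esub> m) (u' z \<otimes>\<^bsub>C'\<^esub> u' ?h)"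
      using k(2) L.deg_closed[OF g] L.B_u_comp[OF \<gamma> g] m \<gamma> h uz
      by (simp add: qt_move M.smult_closed R.u_closed)
    also have "u' z \<otimes>\<^bsub>C'\<^esub> u' ?h = u' g" using R.u_mult[OF z(1) h(1)] z(3) by simp
    finally show ?thesis .
  qed
  then show ?thesis using k(1) by blast
qed

definition to_W_aux where
  "to_W_aux m = (SOME k. k \<in> add_hom C TW \<and>
    (\<forall>\<gamma>\<in>carrier B. \<forall>g\<in>carrier H. k (\<gamma> \<otimes>\<^bsub>C\<^esub> u g) = qt (\<gamma> \<odot>\<^bsub>M\<^esub> m) (u' g)))"

lemma to_W_aux_hom: "m \<in> carrier M \<Longrightarrow> to_W_aux m \<in> add_hom C TW"
  and to_W_aux_unit: "\<lbrakk>m \<in> carrier M; \<gamma> \<in> carrier B; g \<in> carrier H\<rbrakk>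
    \<Longrightarrow> to_W_aux m (\<gamma> \<otimes>\<^bsub>C\<^esub> u g) = qt (\<gamma> \<odot>\<^bsub>M\<^esub> m) (u' g)"
  using someI_ex[OF ex_to_W_aux[of m]] unfolding to_W_aux_def by simp_all

text \<open>Additivity in \<open>m\<close> and balancedness compare maps chosen independently for
  different elements of \<open>M\<close>; they agree because they do so on all
  \<open>\<gamma>\<close> times \<open>u g\<close>.\<close>

lemma ex_to_W:
  "\<exists>h. h \<in> add_hom TV TW \<and> (\<forall>c\<in>carrier C. \<forall>m\<in>carrier M. h (c \<otimes>\<otimes> m) = to_W_aux m c)"
proof (rule V_universal[OF WA], rule V_balancedI, goal_cases)
  case (3 c m n)
  show ?case
    by (rule L.C_hom_eq[where f = "to_W_aux (m \<oplus>\<^bsub>M\<^esub> n)" and f' = "\<lambda>c. to_W_aux m c \<oplus>\<^bsub>TW\<^esub> to_W_aux n c",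
          OF to_W_aux_hom add_homI WA _ 3(1)])
       (use 3 in \<open>simp_all add: add_hom_closed[OF to_W_aux_hom] add_hom_add[OF to_W_aux_hom] W.T.a_ac
         to_W_aux_unit M.smult_r_distr qt_add_l M.smult_closed R.u_closed\<close>)
next
  case (4 c \<beta> m)
  show ?case
  proof (rule L.C_hom_eq[where f = "\<lambda>c. to_W_aux m (c \<otimes>\<^bsub>C\<^esub> \<beta>)" and f' = "to_W_aux (\<beta> \<odot>\<^bsub>M\<^esub> m)",
          OF add_homI to_W_aux_hom WA _ 4(1)])
    fix \<gamma> g assume g: "\<gamma> \<in> carrier B" "g \<in> carrier H"
    have "\<gamma> \<otimes>\<^bsub>C\<^esub> u g \<otimes>\<^bsub>C\<^esub> \<beta> = (\<gamma> \<otimes>\<^bsub>B\<^esub> \<beta>) \<otimes>\<^bsub>C\<^esub> u g"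
      using g 4 by (simp add: L.m_assoc L.B_closed L.u_closed L.u_comm L.B_mult)
    then show "to_W_aux m (\<gamma> \<otimes>\<^bsub>C\<^esub> u g \<otimes>\<^bsub>C\<^esub> \<beta>) = to_W_aux (\<beta> \<odot>\<^bsub>M\<^esub> m) (\<gamma> \<otimes>\<^bsub>C\<^esub> u g)"
      using g 4 by (simp add: to_W_aux_unit M.smult_closed M.smult_assoc)
  qed (use 4 in \<open>simp_all add: add_hom_closed[OF to_W_aux_hom] add_hom_add[OF to_W_aux_hom] L.B_closed L.l_distr M.smult_closed\<close>)
qed (simp_all add: add_hom_closed[OF to_W_aux_hom] add_hom_add[OF to_W_aux_hom])

definition to_W where
  "to_W = (SOME h. h \<in> add_hom TV TW \<and> (\<forall>c\<in>carrier C. \<forall>m\<in>carrier M. h (c \<otimes>\<otimes> m) = to_W_aux m c))"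

lemma to_W_hom: "to_W \<in> add_hom TV TW"
  and to_W_pt: "\<lbrakk>c \<in> carrier C; m \<in> carrier M\<rbrakk> \<Longrightarrow> to_W (c \<otimes>\<otimes> m) = to_W_aux m c"
  using someI_ex[OF ex_to_W] unfolding to_W_def by simp_all

lemma to_W_unit: "\<lbrakk>m \<in> carrier M; \<gamma> \<in> carrier B; g \<in> carrier H\<rbrakk>
    \<Longrightarrow> to_W ((\<gamma> \<otimes>\<^bsub>C\<^esub> u g) \<otimes>\<otimes> m) = qt (\<gamma> \<odot>\<^bsub>M\<^esub> m) (u' g)"
  by (simp add: to_W_pt to_W_aux_unit L.B_closed L.u_closed)

lemma to_W_u: "\<lbrakk>m \<in> carrier M; g \<in> carrier H\<rbrakk> \<Longrightarrow> to_W (u g \<otimes>\<otimes> m) = qt m (u' g)"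
  using to_W_unit[OF _ L.B.one_closed, of m g] M.smult_one[of m] by (simp add: L.B_one L.u_closed)

lemma to_W_from_W: "t \<in> carrier TW \<Longrightarrow> to_W (from_W t) = t"
proof (rule W_hom_eq[where f = "\<lambda>t. to_W (from_W t)" and g = "\<lambda>t. t", OF add_homI add_hom_id WA])
  fix m c assume m: "m \<in> carrier M" "c \<in> carrier C'"
  show "to_W (from_W (qt m c)) = qt m c"
    unfolding from_W_pt[OF m]
    by (rule R.C_hom_eq[where f = "\<lambda>c. to_W (ract (j m) c)" and f' = "qt m", OF add_homI add_homI WA _ m(2)])
       (use m in \<open>simp_all add: add_hom_closed[OF to_W_hom] ract_closed ract_add_r add_hom_add[OF to_W_hom] qt_add_r
         ract_unit_pt L.u_closed M.rsmult_closed to_W_u qt_move R.u_closed\<close>)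
qed (simp_all add: add_hom_closed[OF to_W_hom] add_hom_closed[OF from_W_hom] add_hom_add[OF to_W_hom] add_hom_add[OF from_W_hom])

lemma from_W_to_W: "t \<in> carrier TV \<Longrightarrow> from_W (to_W t) = t"
proof (rule V_hom_eq[where f = "\<lambda>t. from_W (to_W t)" and g = "\<lambda>t. t", OF add_homI add_hom_id TA])
  fix c m assume m: "c \<in> carrier C" "m \<in> carrier M"
  show "from_W (to_W (c \<otimes>\<otimes> m)) = c \<otimes>\<otimes> m"
    by (rule L.C_hom_eq[where f = "\<lambda>c. from_W (to_W (c \<otimes>\<otimes> m))" and f' = "\<lambda>c. c \<otimes>\<otimes> m", OF add_homI add_homI TA _ m(1)])
       (use m in \<open>simp_all add: add_hom_closed[OF to_W_hom] add_hom_closed[OF from_W_hom] pt_add_l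
         add_hom_add[OF to_W_hom] add_hom_add[OF from_W_hom] to_W_unit to_W_u from_W_pt M.smult_closed R.u_closed ract_u pt_unit L.u_closed\<close>)
qed (simp_all add: add_hom_closed[OF to_W_hom] add_hom_closed[OF from_W_hom] add_hom_add[OF to_W_hom] add_hom_add[OF from_W_hom])

lemma to_W_bij: "bij_betw to_W (carrier TV) (carrier TW)"
  by (rule bij_betw_byWitness[where f' = from_W])
     (auto simp: from_W_to_W to_W_from_W add_hom_closed[OF to_W_hom] add_hom_closed[OF from_W_hom])

text \<open>Linearity is checked for the inverse, which is itself defined by the right action, and
  then inverted.\<close>

lemma to_W_right:
  assumes t: "t \<in> carrier TV" and c: "c \<in> carrier C'"
  shows "to_W (ract t c) = rW (to_W t) c"
proof -
  have "from_W (rW w c) = ract (from_W w) c" if w: "w \<in> carrier TW" for w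
    by (rule W_hom_eq[where f = "\<lambda>w. from_W (rW w c)" and g = "\<lambda>w. ract (from_W w) c", OF add_homI add_homI TA _ w])
       (use c in \<open>simp_all add: add_hom_closed[OF from_W_hom] add_hom_closed[OF rW_hom] add_hom_add[OF from_W_hom]
         add_hom_add[OF rW_hom] ract_closed ract_add from_W_pt rW_pt ract_assoc\<close>)
  from this[of "to_W t"] have "ract t c = from_W (rW (to_W t) c)"
    using t by (simp add: from_W_to_W add_hom_closed[OF to_W_hom])
  then show ?thesis
    using t c by (simp add: to_W_from_W add_hom_closed[OF to_W_hom] add_hom_closed[OF rW_hom])
qed

text \<open>The given left action on \<open>M\<close> is one of \<open>B\<close>, not of
  \<open>C\<close>, so the action of \<open>C\<close> is transported from the first description
  instead of being induced by the left factor.\<close>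

definition lW where "lW a w = to_W (lact a (from_W w))"

abbreviation WW where "WW \<equiv> right_induced C' B' M lW"
abbreviation \<W> where "\<W> \<equiv> right_induced_grading C' \<C>' B' M"

lemma to_W_grade:
  assumes x: "x \<in> carrier \<Gamma>" shows "to_W ` \<V> x = \<W> x"
proof -
  let ?P = "{c \<otimes>\<otimes> m | c m. c \<in> \<C> x \<and> m \<in> carrier M}"
  let ?Q = "{qt m c | m c. m \<in> carrier M \<and> c \<in> \<C>' x}"
  have "to_W ` \<V> x = add_span TW (to_W ` ?P)"
    unfolding left_induced_grading_def by (rule add_hom_span_image[OF to_W_hom TA WA \<V>_gens[OF x]])
  also have "to_W ` ?P = ?Q"
  proof (intro equalityI subsetI)
    fix w assume "w \<in> to_W ` ?P"
    then obtain c m where cm: "c \<in> \<C> x" "m \<in> carrier M" "w = to_W (c \<otimes>\<otimes> m)" by blast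
    obtain \<gamma> g where g: "\<gamma> \<in> carrier B" "g \<in> carrier H" "deg g = x" "c = \<gamma> \<otimes>\<^bsub>C\<^esub> u g"
      by (rule L.compE[OF x cm(1)])
    have "w = qt (\<gamma> \<odot>\<^bsub>M\<^esub> m) (u' g)" using cm g by (simp add: to_W_unit)
    moreover have "\<gamma> \<odot>\<^bsub>M\<^esub> m \<in> carrier M" "u' g \<in> \<C>' x" using cm g R.u_deg[of g] by (simp_all add: M.smult_closed)
    ultimately show "w \<in> ?Q" by blast
  next
    fix w assume "w \<in> ?Q"
    then obtain c m where cm: "c \<in> \<C>' x" "m \<in> carrier M" "w = qt m c" by blast
    obtain \<beta> g where g: "\<beta> \<in> carrier B'" "g \<in> carrier H" "deg g = x" "c = \<beta> \<otimes>\<^bsub>C'\<^esub> u' g"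
      by (rule R.compE[OF x cm(1)])
    have "w = to_W (u g \<otimes>\<otimes> (m \<odot>r\<^bsub>M\<^esub> \<beta>))" using cm g by (simp add: to_W_u M.rsmult_closed qt_move R.u_closed)
    moreover have "m \<odot>r\<^bsub>M\<^esub> \<beta> \<in> carrier M" "u g \<in> \<C> x" using cm g L.u_deg[of g] by (simp_all add: M.rsmult_closed)
    ultimately show "w \<in> to_W ` ?P" by blast
  qed
  finally show ?thesis by (simp only: right_induced_grading_def)
qed

lemma to_W_iso: "graded_bimodule_iso \<Gamma> C C' VV \<V> WW \<W> to_W"
  unfolding graded_bimodule_iso_def bimodule_iso_def
  by (simp add: to_W_bij add_hom_add[OF to_W_hom] to_W_right to_W_grade lW_def from_W_to_W)

lemma WW_graded: "graded_bimodule \<O> \<Gamma> C \<C> C' \<C>' WW \<W>"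
  by (rule graded_bimodule_transport[OF VV_graded to_W_iso])
     (simp add: right_induced_def abelian_group_bimodule_of WA)

end


section \<open>The diagonal subalgebra and the third description\<close>

context crossed_pair
begin

sublocale A: algebra_pair \<O> C "opposite C'"
  by (intro algebra_pair.intro L.assoc_algebra_axioms R.opposite)

abbreviation AT where "AT \<equiv> tensor_algebra \<O> C (opposite C')"
abbreviation ct where "ct c c' \<equiv> alg_tensor \<O> C (opposite C') c c'"
abbreviation \<Delta> where "\<Delta> \<equiv> diagonal \<O> \<Gamma> C \<C> C' \<C>'"

lemmas AA = A.abelian_group_AT

lemma at_mult: "\<lbrakk>c \<in> carrier C; c' \<in> carrier C'; e \<in> carrier C; e' \<in> carrier C'\<rbrakk>
  \<Longrightarrow> ct c c' \<otimes>\<^bsub>AT\<^esub> ct e e' = ct (c \<otimes>\<^bsub>C\<^esub> e) (e' \<otimes>\<^bsub>C'\<^esub> c')"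
  using A.at_mult[of c c' e e'] by simp

lemma at_add_l: "\<lbrakk>c \<in> carrier C; e \<in> carrier C; c' \<in> carrier C'\<rbrakk> \<Longrightarrow> ct (c \<oplus>\<^bsub>C\<^esub> e) c' = ct c c' \<oplus>\<^bsub>AT\<^esub> ct e c'"
  and at_add_r: "\<lbrakk>c \<in> carrier C; c' \<in> carrier C'; e' \<in> carrier C'\<rbrakk> \<Longrightarrow> ct c (c' \<oplus>\<^bsub>C'\<^esub> e') = ct c c' \<oplus>\<^bsub>AT\<^esub> ct c e'"
  using A.P.pt_add_l[of c e c'] A.P.pt_add_r[of c c' e'] by (simp_all add: alg_tensor_def A.AT_simps)

lemma AT_one: "\<one>\<^bsub>AT\<^esub> = ct \<one>\<^bsub>C\<^esub> \<one>\<^bsub>C'\<^esub>"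
  using A.AT_simps(4) by simp

lemma ex_act:
  "\<exists>act. left_module AT (module_of VV act) \<and>
    (\<forall>c\<in>carrier C. \<forall>c'\<in>carrier C'. \<forall>v\<in>carrier TV. act (ct c c') v = ract (lact c v) c')"
proof (rule bimodule_tensor_module[OF VV_bimodule])
  fix act assume "left_module AT (module_of VV act)"
    "\<And>c c' v. \<lbrakk>c \<in> carrier C; c' \<in> carrier C'; v \<in> carrier VV\<rbrakk> \<Longrightarrow> act (ct c c') v = (c \<odot>\<^bsub>VV\<^esub> v) \<odot>r\<^bsub>VV\<^esub> c'"
  then show ?thesis by (intro exI[of _ act]) simp
qed

definition act where
  "act = (SOME act. left_module AT (module_of VV act) \<and>
    (\<forall>c\<in>carrier C. \<forall>c'\<in>carrier C'. \<forall>v\<in>carrier TV. act (ct c c') v = ract (lact c v) c'))"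

lemma act_module: "left_module AT (module_of VV act)"
  and act_at: "\<lbrakk>c \<in> carrier C; c' \<in> carrier C'; v \<in> carrier TV\<rbrakk> \<Longrightarrow> act (ct c c') v = ract (lact c v) c'"
  using someI_ex[OF ex_act] unfolding act_def by simp_all

lemmas act_closed = left_module.smult_closed[OF act_module, simplified]
  and act_add_l = left_module.smult_l_distr[OF act_module, simplified]
  and act_add_r = left_module.smult_r_distr[OF act_module, simplified]
  and act_assoc = left_module.smult_assoc[OF act_module, simplified]
  and act_one = left_module.smult_one[OF act_module, simplified]

lemma act_hom: "v \<in> carrier TV \<Longrightarrow> (\<lambda>t. act t v) \<in> add_hom AT TV"
  by (rule add_homI) (simp_all add: act_closed act_add_l)

lemma \<Delta>_eq:
  "\<Delta> = AT\<lparr>carrier := add_span AT {ct c c' | x c c'. x \<in> carrier \<Gamma> \<and> c \<in> \<C> x \<and> c' \<in> \<C>' (inv\<^bsub>\<Gamma>\<^esub> x)}\<rparr>"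
  by (simp add: diagonal_def Let_def)

lemma \<Delta>_simps [simp]:
  "\<zero>\<^bsub>\<Delta>\<^esub> = \<zero>\<^bsub>AT\<^esub>" "\<one>\<^bsub>\<Delta>\<^esub> = \<one>\<^bsub>AT\<^esub>" "x \<oplus>\<^bsub>\<Delta>\<^esub> y = x \<oplus>\<^bsub>AT\<^esub> y" "x \<otimes>\<^bsub>\<Delta>\<^esub> y = x \<otimes>\<^bsub>AT\<^esub> y"
  by (simp_all add: \<Delta>_eq)

abbreviation \<Delta>_gens where
  "\<Delta>_gens \<equiv> {ct c c' | x c c'. x \<in> carrier \<Gamma> \<and> c \<in> \<C> x \<and> c' \<in> \<C>' (inv\<^bsub>\<Gamma>\<^esub> x)}"

lemma \<Delta>_carrier: "carrier \<Delta> = add_span AT \<Delta>_gens"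
  by (simp add: \<Delta>_eq)

lemma \<Delta>_gens: "\<Delta>_gens \<subseteq> carrier AT"
proof clarify
  fix x c c' assume "x \<in> carrier \<Gamma>" "c \<in> \<C> x" "c' \<in> \<C>' (inv\<^bsub>\<Gamma>\<^esub> x)"
  then show "ct c c' \<in> carrier AT"
    using L.comp_closed[of x c] R.comp_closed[of "inv\<^bsub>\<Gamma>\<^esub> x" c'] by simp
qed

interpretation AR: ring AT by (rule A.AT_ring)

lemma \<Delta>_sub: "t \<in> carrier \<Delta> \<Longrightarrow> t \<in> carrier AT"
  using AR.add_span_closed[OF \<Delta>_gens] unfolding \<Delta>_carrier by blast

lemma \<Delta>_gen: "\<lbrakk>x \<in> carrier \<Gamma>; c \<in> \<C> x; c' \<in> \<C>' (inv\<^bsub>\<Gamma>\<^esub> x)\<rbrakk> \<Longrightarrow> ct c c' \<in> carrier \<Delta>"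
  unfolding \<Delta>_carrier by (rule add_span_incl) blast

lemma \<Delta>_induct [consumes 1, case_names gen add minus zero]:
  assumes t: "t \<in> carrier \<Delta>"
    and gen: "\<And>x c c'. \<lbrakk>x \<in> carrier \<Gamma>; c \<in> \<C> x; c \<in> carrier C; c' \<in> \<C>' (inv\<^bsub>\<Gamma>\<^esub> x); c' \<in> carrier C'\<rbrakk> \<Longrightarrow> P (ct c c')"
    and "\<And>s t. \<lbrakk>s \<in> carrier AT; t \<in> carrier AT; P s; P t\<rbrakk> \<Longrightarrow> P (s \<oplus>\<^bsub>AT\<^esub> t)"
    and "\<And>t. \<lbrakk>t \<in> carrier AT; P t\<rbrakk> \<Longrightarrow> P (\<ominus>\<^bsub>AT\<^esub> t)" and "P \<zero>\<^bsub>AT\<^esub>"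
  shows "P t"
proof (rule AR.add_span_induct[OF _ \<Delta>_gens])
  show "t \<in> add_span AT \<Delta>_gens" using t unfolding \<Delta>_carrier .
  fix s assume "s \<in> \<Delta>_gens"
  then obtain x c c' where s: "s = ct c c'" "x \<in> carrier \<Gamma>" "c \<in> \<C> x" "c' \<in> \<C>' (inv\<^bsub>\<Gamma>\<^esub> x)" by blast
  then show "P s" using gen[of x c c'] L.comp_closed[of x c] R.comp_closed[of "inv\<^bsub>\<Gamma>\<^esub> x" c'] by simp
qed (use assms in simp_all)

text \<open>The second factors multiply in the opposite order, so their product has degree the
  inverse of \<open>y\<close> times the inverse of \<open>x\<close>, that is, the inverse of
  \<open>x y\<close>.\<close>

lemma \<Delta>_mult_closed:
  assumes s: "s \<in> carrier \<Delta>" and t: "t \<in> carrier \<Delta>" shows "s \<otimes>\<^bsub>AT\<^esub> t \<in> carrier \<Delta>"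
proof -
  interpret S: additive_subgroup "carrier \<Delta>" AT
    unfolding \<Delta>_carrier by (intro additive_subgroup.intro AR.add_span_subgroup \<Delta>_gens)
  have 1: "ct c c' \<otimes>\<^bsub>AT\<^esub> t \<in> carrier \<Delta>"
    if c: "x \<in> carrier \<Gamma>" "c \<in> \<C> x" "c \<in> carrier C" "c' \<in> \<C>' (inv\<^bsub>\<Gamma>\<^esub> x)" "c' \<in> carrier C'" for x c c'
    using t
  proof (induction t rule: \<Delta>_induct)
    case (gen y e e')
    have "c \<otimes>\<^bsub>C\<^esub> e \<in> \<C> (x \<otimes>\<^bsub>\<Gamma>\<^esub> y)" using c gen by (simp add: L.mult_comp)
    moreover have "e' \<otimes>\<^bsub>C'\<^esub> c' \<in> \<C>' (inv\<^bsub>\<Gamma>\<^esub> (x \<otimes>\<^bsub>\<Gamma>\<^esub> y))"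
      using c gen by (simp add: R.mult_comp L.\<Gamma>.inv_mult_group)
    ultimately show ?case using c gen \<Delta>_gen[of "x \<otimes>\<^bsub>\<Gamma>\<^esub> y"] by (simp add: at_mult)
  qed (use c in \<open>simp_all add: AR.r_distr AR.r_minus\<close>)
  show ?thesis using s
  proof (induction s rule: \<Delta>_induct)
    case (gen x c c')
    then show ?case using 1 by blast
  qed (use \<Delta>_sub[OF t] in \<open>simp_all add: AR.l_distr AR.l_minus\<close>)
qed

lemma one_grade: "\<one>\<^bsub>C\<^esub> \<in> \<C> \<one>\<^bsub>\<Gamma>\<^esub>" "\<one>\<^bsub>C'\<^esub> \<in> \<C>' \<one>\<^bsub>\<Gamma>\<^esub>"
  using L.B.one_closed R.B.one_closed by (simp_all add: L.B_one R.B_one L.B_carrier R.B_carrier)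

lemma \<Delta>_B: "\<lbrakk>\<beta> \<in> carrier B; \<beta>' \<in> carrier B'\<rbrakk> \<Longrightarrow> ct \<beta> \<beta>' \<in> carrier \<Delta>"
  by (rule \<Delta>_gen[of "\<one>\<^bsub>\<Gamma>\<^esub>"]) (simp_all add: L.B_carrier R.B_carrier)

lemma \<Delta>_ring: "ring \<Delta>"
proof -
  interpret S: additive_subgroup "carrier \<Delta>" AT
    unfolding \<Delta>_carrier by (intro additive_subgroup.intro AR.add_span_subgroup \<Delta>_gens)
  have "subring (carrier \<Delta>) AT"
  proof (rule AR.subringI)
    show "carrier \<Delta> \<subseteq> carrier AT" using \<Delta>_sub by blast
    show "\<one>\<^bsub>AT\<^esub> \<in> carrier \<Delta>" using \<Delta>_gen[of "\<one>\<^bsub>\<Gamma>\<^esub>"] one_grade by (simp add: AT_one)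
  qed (simp_all add: \<Delta>_mult_closed)
  from AR.subring_is_ring[OF this] show ?thesis
    unfolding \<Delta>_eq by simp
qed

text \<open>A generator raises the degree by \<open>x\<close> on the left and by the inverse of
  \<open>x\<close> on the right.\<close>

lemma act_\<Delta>:
  assumes t: "t \<in> carrier \<Delta>" and v: "v \<in> \<V> \<one>\<^bsub>\<Gamma>\<^esub>" shows "act t v \<in> \<V> \<one>\<^bsub>\<Gamma>\<^esub>"
  using t
proof (induction t rule: \<Delta>_induct)
  interpret S: additive_subgroup "\<V> \<one>\<^bsub>\<Gamma>\<^esub>" TV by (rule \<V>_subgroup_T) simp
  note vc = \<V>_closed[OF L.\<Gamma>.one_closed v]
  { case (gen x c c')
    have "lact c v \<in> \<V> x" using lact_grade[OF gen(1) L.\<Gamma>.one_closed gen(2) v] gen by simp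
    then have "ract (lact c v) c' \<in> \<V> (x \<otimes>\<^bsub>\<Gamma>\<^esub> inv\<^bsub>\<Gamma>\<^esub> x)" using gen by (intro ract_grade) simp_all
    then show ?case using gen vc by (simp add: act_at)
  next
    case (add s t)
    then show ?case using vc by (simp add: act_add_l)
  next
    case (minus t)
    then show ?case using vc by (simp add: add_hom_minus[OF act_hom AA TA])
  next
    case zero
    then show ?case using vc by (simp add: add_hom_zero[OF act_hom AA TA]) }
qed

text \<open>The $\Delta$-module structure of \<open>M\<close>, as the identity component of $C\otimes_BM$.\<close>

definition dact where "dact t m = inv_into (carrier M) j (act t (j m))"

lemma dact:
  assumes "t \<in> carrier \<Delta>" "m \<in> carrier M"
  shows dact_closed: "dact t m \<in> carrier M" and j_dact: "j (dact t m) = act t (j m)"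
proof -
  have "act t (j m) \<in> j ` carrier M"
    using act_\<Delta>[OF assms(1) j_grade[OF assms(2)]] j_bij by (simp add: bij_betw_def)
  then show "dact t m \<in> carrier M" "j (dact t m) = act t (j m)"
    unfolding dact_def by (simp_all add: inv_into_into f_inv_into_f)
qed

text \<open>Since \<open>j\<close> is injective, the laws for \<open>dact\<close> are verified on
  the image of \<open>M\<close>, where they are those of \<open>act\<close>.\<close>

lemma dact_eqI: "\<lbrakk>t \<in> carrier \<Delta>; m \<in> carrier M; n \<in> carrier M; act t (j m) = j n\<rbrakk> \<Longrightarrow> dact t m = n"
  using j_inj[of "dact t m" n] by (simp add: dact)

lemma \<Delta>_add_closed: "\<lbrakk>s \<in> carrier \<Delta>; t \<in> carrier \<Delta>\<rbrakk> \<Longrightarrow> s \<oplus>\<^bsub>AT\<^esub> t \<in> carrier \<Delta>"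
  unfolding \<Delta>_carrier by (rule AR.add_span_add)

lemma dact_add_r: "\<lbrakk>t \<in> carrier \<Delta>; m \<in> carrier M; n \<in> carrier M\<rbrakk> \<Longrightarrow> dact t (m \<oplus>\<^bsub>M\<^esub> n) = dact t m \<oplus>\<^bsub>M\<^esub> dact t n"
  by (rule dact_eqI) (simp_all add: dact pt_add_r act_add_r \<Delta>_sub)

lemma dact_module: "left_module \<Delta> (module_of M dact)"
proof (intro left_module.intro \<Delta>_ring abelian_group_module_of[THEN iffD2] MA left_module_axioms.intro, goal_cases)
  case (2 s t m)
  then show ?case by (simp, intro dact_eqI) (simp_all add: dact \<Delta>_add_closed act_add_l \<Delta>_sub pt_add_r)
next
  case (4 s t m)
  then show ?case by (simp, intro dact_eqI) (simp_all add: dact \<Delta>_mult_closed act_assoc \<Delta>_sub)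
next
  case (5 m)
  moreover have "\<one>\<^bsub>AT\<^esub> \<in> carrier \<Delta>" using ring.ring_simprules(6)[OF \<Delta>_ring] by simp
  ultimately show ?case by (simp, intro dact_eqI) (simp_all add: act_one)
qed (simp_all add: dact_closed dact_add_r)

lemma dact_B:
  assumes "\<beta> \<in> carrier B" "\<beta>' \<in> carrier B'" "m \<in> carrier M"
  shows "dact (ct \<beta> \<beta>') m = (\<beta> \<odot>\<^bsub>M\<^esub> m) \<odot>r\<^bsub>M\<^esub> \<beta>'"
proof (rule dact_eqI[OF \<Delta>_B])
  show "act (ct \<beta> \<beta>') (j m) = j ((\<beta> \<odot>\<^bsub>M\<^esub> m) \<odot>r\<^bsub>M\<^esub> \<beta>')"
    using assms pt_B[OF assms(1,3)]
    by (simp add: act_at L.B_closed R.B_closed lact_pt ract_B M.smult_closed)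
qed (use assms in \<open>simp_all add: M.smult_closed M.rsmult_closed\<close>)

lemma dact_extension: "diagonal_extension \<O> \<Gamma> C \<C> C' \<C>' B B' M dact"
  unfolding diagonal_extension_def by (simp add: dact_module dact_B)

lemma VV_identity: "identity_component \<O> \<Gamma> C \<C> C' \<C>' M dact VV \<V> j"
  unfolding identity_component_def
proof (intro conjI ballI j_bij)
  fix x c c' m assume m: "x \<in> carrier \<Gamma>" "c \<in> \<C> x" "c' \<in> \<C>' (inv\<^bsub>\<Gamma>\<^esub> x)" "m \<in> carrier M"
  then show "(c \<odot>\<^bsub>VV\<^esub> j m) \<odot>r\<^bsub>VV\<^esub> c' = j (dact (ct c c') m)"
    using L.comp_closed[of x c] R.comp_closed[of "inv\<^bsub>\<Gamma>\<^esub> x" c'] \<Delta>_gen[of x c c']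
    by (simp add: dact act_at)
qed (simp add: pt_add_r)

lemma to_W_j: "m \<in> carrier M \<Longrightarrow> to_W (j m) = qt m \<one>\<^bsub>C'\<^esub>"
  using to_W_u[of m "\<one>\<^bsub>H\<^esub>"] by (simp add: L.u_one R.u_one)

text \<open>The identity component of the first description is carried along \<open>to_W\<close>,
  which takes \<open>j m\<close> to \<open>m\<close> tensor one.\<close>

lemma WW_identity: "identity_component \<O> \<Gamma> C \<C> C' \<C>' M dact WW \<W> (\<lambda>m. qt m \<one>\<^bsub>C'\<^esub>)"
  unfolding identity_component_def
proof (intro conjI ballI)
  have "bij_betw to_W (\<V> \<one>\<^bsub>\<Gamma>\<^esub>) (\<W> \<one>\<^bsub>\<Gamma>\<^esub>)"
    using bij_betw_subset[OF to_W_bij, of "\<V> \<one>\<^bsub>\<Gamma>\<^esub>"] \<V>_closed[OF L.\<Gamma>.one_closed]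
      to_W_grade[OF L.\<Gamma>.one_closed] by auto
  from bij_betw_trans[OF j_bij this] have "bij_betw (to_W \<circ> j) (carrier M) (\<W> \<one>\<^bsub>\<Gamma>\<^esub>)" .
  then show "bij_betw (\<lambda>m. qt m \<one>\<^bsub>C'\<^esub>) (carrier M) (\<W> \<one>\<^bsub>\<Gamma>\<^esub>)"
    by (rule bij_betw_cong[THEN iffD1, rotated]) (simp add: to_W_j)
next
  fix x c c' m assume m: "x \<in> carrier \<Gamma>" "c \<in> \<C> x" "c' \<in> \<C>' (inv\<^bsub>\<Gamma>\<^esub> x)" "m \<in> carrier M"
  note cl = L.comp_closed[OF m(1,2)] R.comp_closed[OF L.\<Gamma>.inv_closed[OF m(1)] m(3)] \<Delta>_gen[OF m(1-3)]
  have "(c \<odot>\<^bsub>WW\<^esub> qt m \<one>\<^bsub>C'\<^esub>) \<odot>r\<^bsub>WW\<^esub> c' = to_W (ract (lact c (j m)) c')"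
    using m(4) cl by (simp add: lW_def to_W_j[symmetric] from_W_to_W to_W_right lact_closed)
  also have "\<dots> = to_W (j (dact (ct c c') m))" using m(4) cl by (simp add: dact act_at)
  also have "\<dots> = qt (dact (ct c c') m) \<one>\<^bsub>C'\<^esub>" using m(4) cl by (simp add: to_W_j dact_closed)
  finally show "(c \<odot>\<^bsub>WW\<^esub> qt m \<one>\<^bsub>C'\<^esub>) \<odot>r\<^bsub>WW\<^esub> c' = qt (dact (ct c c') m) \<one>\<^bsub>C'\<^esub>" .
qed (simp add: qt_add_l)

sublocale X: tensor_pair \<Delta> "regular AT" "module_of M dact"
  by (intro tensor_pair.intro tensor_pair_axioms.intro abelian_group_regular[THEN iffD2] AA
      abelian_group_module_of[THEN iffD2] MA)
     (simp_all add: A.AT_mult_closed \<Delta>_sub dact_closed)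

abbreviation TX where "TX \<equiv> tensor \<Delta> (regular AT) (module_of M dact)"
abbreviation tt where "tt t m \<equiv> pure_tensor \<Delta> (regular AT) (module_of M dact) t m"
abbreviation lX where "lX \<equiv> tensor_lsmult \<Delta> (regular AT) (module_of M dact)"

lemmas XA = X.abelian_group_T
lemmas X_balancedI = X.balancedI[simplified]
lemmas X_universal = X.universal_ex[simplified]
lemmas X_hom_eq = X.hom_eq[simplified]

lemma tt_closed [simp]: "\<lbrakk>t \<in> carrier AT; m \<in> carrier M\<rbrakk> \<Longrightarrow> tt t m \<in> carrier TX"
  and tt_add_l: "\<lbrakk>s \<in> carrier AT; t \<in> carrier AT; m \<in> carrier M\<rbrakk> \<Longrightarrow> tt (s \<oplus>\<^bsub>AT\<^esub> t) m = tt s m \<oplus>\<^bsub>TX\<^esub> tt t m"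
  and tt_add_r: "\<lbrakk>t \<in> carrier AT; m \<in> carrier M; n \<in> carrier M\<rbrakk> \<Longrightarrow> tt t (m \<oplus>\<^bsub>M\<^esub> n) = tt t m \<oplus>\<^bsub>TX\<^esub> tt t n"
  and tt_move: "\<lbrakk>t \<in> carrier AT; s \<in> carrier \<Delta>; m \<in> carrier M\<rbrakk> \<Longrightarrow> tt (t \<otimes>\<^bsub>AT\<^esub> s) m = tt t (dact s m)"
  using X.pt_closed[of t m] X.pt_add_l[of s t m] X.pt_add_r[of t m n] X.pt_move[of t s m] by simp_all

lemma lX_hom: "a \<in> carrier AT \<Longrightarrow> lX a \<in> add_hom TX TX"
  and lX_pt: "\<lbrakk>a \<in> carrier AT; t \<in> carrier AT; m \<in> carrier M\<rbrakk> \<Longrightarrow> lX a (tt t m) = tt (a \<otimes>\<^bsub>AT\<^esub> t) m"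
proof -
  assume a: "a \<in> carrier AT"
  have 1: "(\<lambda>x. a \<odot>\<^bsub>regular AT\<^esub> x) \<in> add_hom (regular AT) (regular AT)"
    by (rule add_homI) (use a in \<open>simp_all add: A.AT_mult_closed AR.r_distr\<close>)
  have 2: "a \<odot>\<^bsub>regular AT\<^esub> (x \<odot>r\<^bsub>regular AT\<^esub> r) = (a \<odot>\<^bsub>regular AT\<^esub> x) \<odot>r\<^bsub>regular AT\<^esub> r"
    if "x \<in> carrier (regular AT)" "r \<in> carrier \<Delta>" for x r
    using a that by (simp add: AR.m_assoc \<Delta>_sub)
  show "lX a \<in> add_hom TX TX" by (rule X.lsmult(1)[OF 1 2])
  show "lX a (tt t m) = tt (a \<otimes>\<^bsub>AT\<^esub> t) m" if "t \<in> carrier AT" "m \<in> carrier M"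
    using X.lsmult(2)[OF 1 2, of t m] that by simp
qed

text \<open>The action map; it is balanced over the diagonal subalgebra because \<open>dact\<close>
  is by construction the restriction of \<open>act\<close> along \<open>j\<close>.\<close>

lemma ex_from_X:
  "\<exists>h. h \<in> add_hom TX TV \<and> (\<forall>t\<in>carrier AT. \<forall>m\<in>carrier M. h (tt t m) = act t (j m))"
  by (rule X_universal[OF TA], rule X_balancedI)
     (simp_all add: act_closed act_add_l act_add_r pt_add_r act_assoc \<Delta>_sub j_dact)

definition from_X where
  "from_X = (SOME h. h \<in> add_hom TX TV \<and> (\<forall>t\<in>carrier AT. \<forall>m\<in>carrier M. h (tt t m) = act t (j m)))"

lemma from_X_hom: "from_X \<in> add_hom TX TV"
  and from_X_pt: "\<lbrakk>t \<in> carrier AT; m \<in> carrier M\<rbrakk> \<Longrightarrow> from_X (tt t m) = act t (j m)"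
  using someI_ex[OF ex_from_X] unfolding from_X_def by simp_all

text \<open>Balanced over \<open>B\<close>, since \<open>\<beta>\<close> tensor one is diagonal and
  acts on \<open>M\<close> as \<open>\<beta>\<close>.\<close>

lemma ex_to_X:
  "\<exists>h. h \<in> add_hom TV TX \<and> (\<forall>c\<in>carrier C. \<forall>m\<in>carrier M. h (c \<otimes>\<otimes> m) = tt (ct c \<one>\<^bsub>C'\<^esub>) m)"
proof (rule V_universal[OF XA], rule V_balancedI, goal_cases)
  case (4 c \<beta> m)
  have \<beta>: "ct \<beta> \<one>\<^bsub>C'\<^esub> \<in> carrier \<Delta>" using \<Delta>_B[OF 4(2) R.B.one_closed] by (simp add: R.B_one)
  have "ct (c \<otimes>\<^bsub>C\<^esub> \<beta>) \<one>\<^bsub>C'\<^esub> = ct c \<one>\<^bsub>C'\<^esub> \<otimes>\<^bsub>AT\<^esub> ct \<beta> \<one>\<^bsub>C'\<^esub>"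
    using 4 by (simp add: at_mult L.B_closed)
  moreover have "dact (ct \<beta> \<one>\<^bsub>C'\<^esub>) m = \<beta> \<odot>\<^bsub>M\<^esub> m"
    using dact_B[OF 4(2) R.B.one_closed 4(3)] 4 M.rsmult_one[of "\<beta> \<odot>\<^bsub>M\<^esub> m"] by (simp add: R.B_one M.smult_closed)
  ultimately show ?case using 4 \<beta> by (simp add: tt_move)
qed (simp_all add: tt_add_r at_add_l tt_add_l)

definition to_X where
  "to_X = (SOME h. h \<in> add_hom TV TX \<and> (\<forall>c\<in>carrier C. \<forall>m\<in>carrier M. h (c \<otimes>\<otimes> m) = tt (ct c \<one>\<^bsub>C'\<^esub>) m))"

lemma to_X_hom: "to_X \<in> add_hom TV TX"
  and to_X_pt: "\<lbrakk>c \<in> carrier C; m \<in> carrier M\<rbrakk> \<Longrightarrow> to_X (c \<otimes>\<otimes> m) = tt (ct c \<one>\<^bsub>C'\<^esub>) m"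
  using someI_ex[OF ex_to_X] unfolding to_X_def by simp_all

lemmas X_hom_simps = add_hom_closed[OF to_X_hom] add_hom_closed[OF from_X_hom]
  add_hom_add[OF to_X_hom] add_hom_add[OF from_X_hom]

lemma from_X_to_X: "v \<in> carrier TV \<Longrightarrow> from_X (to_X v) = v"
  by (rule V_hom_eq[where f = "\<lambda>v. from_X (to_X v)" and g = "\<lambda>v. v", OF add_homI add_hom_id TA])
     (simp_all add: X_hom_simps to_X_pt from_X_pt act_at lact_pt ract_one)

text \<open>The point is to bring every generator into the form \<open>c\<close> tensor one. The
  pure tensor of \<open>c\<close> with \<open>\<beta>\<close> times \<open>u' g\<close> is the
  product of \<open>c\<close> times \<open>u g\<close>, tensored with one, and the diagonal element
  formed by the inverse of \<open>u g\<close> and by \<open>\<beta>\<close> times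
  \<open>u' g\<close>. The latter acts on \<open>M\<close> as right multiplication by
  \<open>\<beta>\<close>, the two units having cancelled.\<close>

lemma to_X_from_X: "t \<in> carrier TX \<Longrightarrow> to_X (from_X t) = t"
proof (rule X_hom_eq[where f = "\<lambda>t. to_X (from_X t)" and g = "\<lambda>t. t", OF add_homI add_hom_id XA])
  fix t m assume t: "t \<in> carrier AT" and m: "m \<in> carrier M"
  have "to_X (act t (j m)) = tt t m"
  proof (rule A.AT_hom_eq[where f = "\<lambda>t. to_X (act t (j m))" and g = "\<lambda>t. tt t m", OF add_homI add_homI XA _ t])
    fix c c' assume c: "c \<in> carrier C" and "c' \<in> carrier (opposite C')"
    then have c': "c' \<in> carrier C'" by simp
    show "to_X (act (ct c c') (j m)) = tt (ct c c') m"
    proof (rule R.C_hom_eq[where f = "\<lambda>c'. to_X (act (ct c c') (j m))" and f' = "\<lambda>c'. tt (ct c c') m",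
          OF add_homI add_homI XA _ c'])
      fix \<beta> g assume g: "\<beta> \<in> carrier B'" "g \<in> carrier H"
      let ?h = "inv\<^bsub>H\<^esub> g" and ?c' = "\<beta> \<otimes>\<^bsub>C'\<^esub> u' g"
      have c'c: "?c' \<in> carrier C'" using g by (simp add: R.B_closed R.u_closed)
      have d: "ct (u ?h) ?c' \<in> carrier \<Delta>"
        using g R.B_u_comp[OF g] L.u_deg[of ?h] L.deg_closed[OF g(2)]
        by (intro \<Delta>_gen[of "deg ?h"]) (simp_all add: L.deg_inv)
      have dm: "dact (ct (u ?h) ?c') m = m \<odot>r\<^bsub>M\<^esub> \<beta>"
        by (rule dact_eqI[OF d])
           (use g m c'c in \<open>simp_all add: act_at L.u_closed lact_pt ract_unit_pt L.u_inv M.rsmult_closed\<close>)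
      have "ct (c \<otimes>\<^bsub>C\<^esub> u g) \<one>\<^bsub>C'\<^esub> \<otimes>\<^bsub>AT\<^esub> ct (u ?h) ?c' = ct c ?c'"
        using c g c'c by (simp add: at_mult L.u_closed L.m_assoc L.u_inv)
      then have "tt (ct c ?c') m = tt (ct (c \<otimes>\<^bsub>C\<^esub> u g) \<one>\<^bsub>C'\<^esub>) (m \<odot>r\<^bsub>M\<^esub> \<beta>)"
        using tt_move[of "ct (c \<otimes>\<^bsub>C\<^esub> u g) \<one>\<^bsub>C'\<^esub>", OF _ d m] c g by (simp add: dm L.u_closed)
      then show "to_X (act (ct c ?c') (j m)) = tt (ct c ?c') m"
        using c g m c'c by (simp add: act_at lact_pt ract_unit_pt to_X_pt L.u_closed M.rsmult_closed)
    qed (use c m in \<open>simp_all add: X_hom_simps act_closed at_add_r act_add_l tt_add_l\<close>)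
  qed (use m in \<open>simp_all add: X_hom_simps act_closed act_add_l tt_add_l\<close>)
  then show "to_X (from_X (tt t m)) = tt t m" using t m by (simp add: from_X_pt)
qed (simp_all add: X_hom_simps)

abbreviation XX where "XX \<equiv> diagonal_induced \<O> \<Gamma> C \<C> C' \<C>' M dact"
abbreviation \<T> where "\<T> \<equiv> diagonal_induced_grading \<O> \<Gamma> C \<C> C' \<C>' M dact"

lemma XX_eq: "XX = bimodule_of TX (\<lambda>c. lX (ct c \<one>\<^bsub>C'\<^esub>)) (\<lambda>t c'. lX (ct \<one>\<^bsub>C\<^esub> c') t)"
  by (simp add: diagonal_induced_def Let_def)

lemma \<T>_eq: "\<T> z = add_span TX {tt (ct c c') m | x y c c' m.
    x \<in> carrier \<Gamma> \<and> y \<in> carrier \<Gamma> \<and> x \<otimes>\<^bsub>\<Gamma>\<^esub> y = z \<and> c \<in> \<C> x \<and> c' \<in> \<C>' y \<and> m \<in> carrier M}"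
  by (simp add: diagonal_induced_grading_def Let_def)

lemma from_X_lX:
  assumes a: "a \<in> carrier AT" and t: "t \<in> carrier TX"
  shows "from_X (lX a t) = act a (from_X t)"
  by (rule X_hom_eq[where f = "\<lambda>t. from_X (lX a t)" and g = "\<lambda>t. act a (from_X t)", OF add_homI add_homI TA _ t])
     (use a in \<open>simp_all add: X_hom_simps add_hom_closed[OF lX_hom] add_hom_add[OF lX_hom] act_closed act_add_r
       lX_pt from_X_pt A.AT_mult_closed act_assoc\<close>)

lemma to_X_act:
  assumes a: "a \<in> carrier AT" and v: "v \<in> carrier TV"
  shows "to_X (act a v) = lX a (to_X v)"
  using from_X_lX[OF a, of "to_X v"] v to_X_from_X[of "lX a (to_X v)"] a
  by (simp add: X_hom_simps from_X_to_X add_hom_closed[OF lX_hom])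

lemma to_X_bij: "bij_betw to_X (carrier TV) (carrier TX)"
  by (rule bij_betw_byWitness[where f' = from_X]) (auto simp: from_X_to_X to_X_from_X X_hom_simps)

text \<open>One inclusion is the case of \<open>c'\<close> equal to one. For the other, a generator
  is the image of \<open>c\<close> times \<open>j m\<close> times \<open>c'\<close>, whose degree is
  that of \<open>c\<close> times that of \<open>c'\<close>.\<close>

lemma to_X_grade:
  assumes z: "z \<in> carrier \<Gamma>" shows "to_X ` \<V> z = \<T> z"
proof
  let ?P = "{c \<otimes>\<otimes> m | c m. c \<in> \<C> z \<and> m \<in> carrier M}"
  let ?Q = "{tt (ct c c') m | x y c c' m.
    x \<in> carrier \<Gamma> \<and> y \<in> carrier \<Gamma> \<and> x \<otimes>\<^bsub>\<Gamma>\<^esub> y = z \<and> c \<in> \<C> x \<and> c' \<in> \<C>' y \<and> m \<in> carrier M}"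
  have "to_X ` \<V> z = add_span TX (to_X ` ?P)"
    unfolding left_induced_grading_def by (rule add_hom_span_image[OF to_X_hom TA XA \<V>_gens[OF z]])
  also have "\<dots> \<subseteq> add_span TX ?Q"
  proof (rule add_span_mono, clarify)
    fix c m assume "c \<in> \<C> z" "m \<in> carrier M"
    then show "\<exists>x y d d' n. to_X (c \<otimes>\<otimes> m) = tt (ct d d') n \<and> x \<in> carrier \<Gamma> \<and> y \<in> carrier \<Gamma> \<and> x \<otimes>\<^bsub>\<Gamma>\<^esub> y = z \<and>
        d \<in> \<C> x \<and> d' \<in> \<C>' y \<and> n \<in> carrier M"
      using z L.comp_closed[OF z] one_grade
      by (intro exI[of _ z] exI[of _ "\<one>\<^bsub>\<Gamma>\<^esub>"] exI[of _ c] exI[of _ "\<one>\<^bsub>C'\<^esub>"] exI[of _ m]) (simp add: to_X_pt)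
  qed
  finally show "to_X ` \<V> z \<subseteq> \<T> z" by (simp only: \<T>_eq)
  have "additive_subgroup (to_X ` \<V> z) TX"
    using group_hom.subgroup_img_is_subgroup[OF add_hom_group_hom[OF to_X_hom TA XA], of "\<V> z"]
      \<V>_subgroup_T[OF z] by (simp add: additive_subgroup_def)
  moreover have "?Q \<subseteq> to_X ` \<V> z"
  proof clarify
    fix x y c c' m assume m: "x \<in> carrier \<Gamma>" "y \<in> carrier \<Gamma>" "z = x \<otimes>\<^bsub>\<Gamma>\<^esub> y" "c \<in> \<C> x" "c' \<in> \<C>' y" "m \<in> carrier M"
    note cl = L.comp_closed[OF m(1,4)] R.comp_closed[OF m(2,5)]
    have "lact c (j m) \<in> \<V> x" using lact_grade[OF m(1) L.\<Gamma>.one_closed m(4) j_grade[OF m(6)]] m by simp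
    then have "act (ct c c') (j m) \<in> \<V> (x \<otimes>\<^bsub>\<Gamma>\<^esub> y)"
      using ract_grade[OF m(1,2) _ m(5)] m cl by (simp add: act_at)
    moreover have "tt (ct c c') m = to_X (act (ct c c') (j m))"
      using to_X_from_X[of "tt (ct c c') m"] cl m by (simp add: from_X_pt)
    ultimately show "tt (ct c c') m \<in> to_X ` \<V> (x \<otimes>\<^bsub>\<Gamma>\<^esub> y)" by (simp only: imageI)
  qed
  ultimately show "\<T> z \<subseteq> to_X ` \<V> z"
    unfolding \<T>_eq by (rule abelian_group.add_span_subset[OF XA])
qed

lemma to_X_iso: "graded_bimodule_iso \<Gamma> C C' VV \<V> XX \<T> to_X"
proof -
  have "to_X (lact c v) = lX (ct c \<one>\<^bsub>C'\<^esub>) (to_X v)" if "c \<in> carrier C" "v \<in> carrier TV" for c v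
    using to_X_act[of "ct c \<one>\<^bsub>C'\<^esub>" v] that by (simp add: act_at ract_one lact_closed)
  moreover have "to_X (ract v c) = lX (ct \<one>\<^bsub>C\<^esub> c) (to_X v)" if "c \<in> carrier C'" "v \<in> carrier TV" for c v
    using to_X_act[of "ct \<one>\<^bsub>C\<^esub> c" v] that by (simp add: act_at lact_one)
  ultimately show ?thesis
    unfolding graded_bimodule_iso_def bimodule_iso_def
    by (simp add: XX_eq to_X_bij X_hom_simps to_X_grade)
qed

lemma XX_graded: "graded_bimodule \<O> \<Gamma> C \<C> C' \<C>' XX \<T>"
  by (rule graded_bimodule_transport[OF VV_graded to_X_iso])
     (simp add: XX_eq abelian_group_bimodule_of XA)

lemma W_X_iso: "\<exists>h. graded_bimodule_iso \<Gamma> C C' WW \<W> XX \<T> h"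
  using graded_bimodule_iso_comp[OF graded_bimodule_iso_inv[OF VV_graded to_W_iso] to_X_iso] by blast

end


section \<open>The graded Morita equivalence\<close>

context crossed_pair
begin

section \<open>Functionals on the induced bimodule and its projections\<close>

interpretation G: graded_bimodule \<O> \<Gamma> C \<C> C' \<C>' VV \<V> by (rule VV_graded)

lemma ex_extend:
  assumes f: "f \<in> carrier (dual B M)"
  shows "\<exists>h. h \<in> add_hom TV C \<and> (\<forall>c\<in>carrier C. \<forall>m\<in>carrier M. h (c \<otimes>\<otimes> m) = c \<otimes>\<^bsub>C\<^esub> f m)"
  by (rule V_universal[OF L.abelian_group_axioms], rule V_balancedI)
     (use f in \<open>simp_all add: M.dual_closed L.B_closed L.l_distr M.dual_add L.B_add L.r_distr M.dual_smult
       L.B_mult L.m_assoc\<close>)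

text \<open>The restriction to the carrier makes this an element of the dual, whose members are
  extensional.\<close>

definition extend where
  "extend f = restrict (SOME h. h \<in> add_hom TV C \<and> (\<forall>c\<in>carrier C. \<forall>m\<in>carrier M. h (c \<otimes>\<otimes> m) = c \<otimes>\<^bsub>C\<^esub> f m)) (carrier TV)"

lemma extend:
  assumes f: "f \<in> carrier (dual B M)"
  shows extend_pt: "\<And>c m. \<lbrakk>c \<in> carrier C; m \<in> carrier M\<rbrakk> \<Longrightarrow> extend f (c \<otimes>\<otimes> m) = c \<otimes>\<^bsub>C\<^esub> f m"
    and extend_hom: "extend f \<in> add_hom TV C"
    and extend_dg: "extend f \<in> dual_grading \<Gamma> C \<C> VV \<V> \<one>\<^bsub>\<Gamma>\<^esub>"
proof -
  define h where "h = (SOME h. h \<in> add_hom TV C \<and> (\<forall>c\<in>carrier C. \<forall>m\<in>carrier M. h (c \<otimes>\<otimes> m) = c \<otimes>\<^bsub>C\<^esub> f m))"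
  have h: "h \<in> add_hom TV C" "\<And>c m. \<lbrakk>c \<in> carrier C; m \<in> carrier M\<rbrakk> \<Longrightarrow> h (c \<otimes>\<otimes> m) = c \<otimes>\<^bsub>C\<^esub> f m"
    using someI_ex[OF ex_extend[OF f]] by (simp_all add: h_def)
  have eq: "extend f = restrict h (carrier TV)" by (simp add: extend_def h_def)
  show pt: "extend f (c \<otimes>\<otimes> m) = c \<otimes>\<^bsub>C\<^esub> f m" if "c \<in> carrier C" "m \<in> carrier M" for c m
    using that h(2) by (simp add: eq)
  show hom: "extend f \<in> add_hom TV C"
    by (rule add_homI) (simp_all add: eq add_hom_closed[OF h(1)] add_hom_add[OF h(1)])
  have lin: "h (lact a v) = a \<otimes>\<^bsub>C\<^esub> h v" if "a \<in> carrier C" "v \<in> carrier TV" for a v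
    by (rule V_hom_eq[where f = "\<lambda>v. h (lact a v)" and g = "\<lambda>v. a \<otimes>\<^bsub>C\<^esub> h v", OF add_homI add_homI
          L.abelian_group_axioms _ that(2)])
       (use that(1) f in \<open>simp_all add: add_hom_closed[OF h(1)] add_hom_add[OF h(1)] lact_closed lact_add L.r_distr
         h(2) lact_pt L.m_assoc M.dual_closed L.B_closed\<close>)
  have "restrict h (carrier VV) \<in> carrier (dual C VV)"
    by (rule G.dualI) (simp_all add: add_hom_closed[OF h(1)] add_hom_add[OF h(1)] lin)
  moreover have "extend f v \<in> \<C> (y \<otimes>\<^bsub>\<Gamma>\<^esub> \<one>\<^bsub>\<Gamma>\<^esub>)" if y: "y \<in> carrier \<Gamma>" and v: "v \<in> \<V> y" for y v
    using y v
  proof (induction v rule: \<V>_induct)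
    interpret S: additive_subgroup "\<C> y" C by (rule L.dec.part_subgroup[OF y])
    { case (pure c m)
      have "f m \<in> \<C> \<one>\<^bsub>\<Gamma>\<^esub>" using M.dual_closed[OF f pure(2)] by (simp add: L.B_carrier)
      then have "c \<otimes>\<^bsub>C\<^esub> f m \<in> \<C> (y \<otimes>\<^bsub>\<Gamma>\<^esub> \<one>\<^bsub>\<Gamma>\<^esub>)" using y pure by (intro L.mult_comp) simp_all
      then show ?case using pure L.comp_closed[OF y pure(1)] by (simp add: pt)
    next
      case (add s t)
      then show ?case using y by (simp add: add_hom_add[OF hom])
    next
      case (minus t)
      then show ?case using y by (simp add: add_hom_minus[OF hom TA L.abelian_group_axioms])
    next
      case zero
      then show ?case using y by (simp add: add_hom_zero[OF hom TA L.abelian_group_axioms]) }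
  qed
  ultimately show "extend f \<in> dual_grading \<Gamma> C \<C> VV \<V> \<one>\<^bsub>\<Gamma>\<^esub>"
    by (simp add: dual_grading_def eq)
qed

lemma proj_sum:
  assumes v: "v \<in> carrier TV" shows "(\<Oplus>\<^bsub>TV\<^esub>x\<in>carrier \<Gamma>. proj x v) = v"
proof (rule V_hom_eq[where f = "\<lambda>v. \<Oplus>\<^bsub>TV\<^esub>x\<in>carrier \<Gamma>. proj x v" and g = "\<lambda>v. v",
      OF add_hom_finsum_hom[OF TA proj_hom] add_hom_id TA _ v])
  fix c m assume m: "c \<in> carrier C" "m \<in> carrier M"
  have hom: "(\<lambda>c. c \<otimes>\<otimes> m) \<in> add_hom C TV" by (rule add_homI) (use m in \<open>simp_all add: pt_add_l\<close>)
  have "(\<Oplus>\<^bsub>TV\<^esub>x\<in>carrier \<Gamma>. proj x (c \<otimes>\<otimes> m)) = (\<Oplus>\<^bsub>TV\<^esub>x\<in>carrier \<Gamma>. L.dec.pr x c \<otimes>\<otimes> m)"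
    by (rule V.T.finsum_cong') (use m in \<open>simp_all add: proj_pt L.dec.pr_closed Pi_iff\<close>)
  also have "\<dots> = (\<Oplus>\<^bsub>C\<^esub>x\<in>carrier \<Gamma>. L.dec.pr x c) \<otimes>\<otimes> m"
    by (rule add_hom_finsum[OF hom L.abelian_group_axioms TA L.finite_grading, symmetric])
       (use m in \<open>simp add: L.dec.pr_closed Pi_iff\<close>)
  finally show "(\<Oplus>\<^bsub>TV\<^esub>x\<in>carrier \<Gamma>. proj x (c \<otimes>\<otimes> m)) = c \<otimes>\<otimes> m" using m by (simp add: L.dec.pr_sum)
qed

lemma proj_in:
  assumes x: "x \<in> carrier \<Gamma>" and v: "v \<in> carrier TV" shows "proj x v \<in> \<V> x"
proof -
  interpret S: additive_subgroup "\<V> x" TV by (rule \<V>_subgroup_T[OF x])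
  show ?thesis using v
  proof (induction v rule: V_induct)
    case (pure c m)
    then show ?case using x L.dec.pr_in[OF x pure(1)] by (simp add: proj_pt \<V>_pt)
  qed (use x in \<open>simp_all add: add_hom_add[OF proj_hom] add_hom_minus[OF proj_hom TA TA]\<close>)
qed

lemma proj_lact_B:
  assumes "x \<in> carrier \<Gamma>" "\<beta> \<in> carrier B" "v \<in> carrier TV"
  shows "proj x (lact \<beta> v) = lact \<beta> (proj x v)"
  by (rule V_hom_eq[where f = "\<lambda>v. proj x (lact \<beta> v)" and g = "\<lambda>v. lact \<beta> (proj x v)", OF add_homI add_homI TA _ assms(3)])
     (use assms in \<open>simp_all add: proj_closed add_hom_add[OF proj_hom] lact_closed lact_add L.B_closed proj_pt lact_pt
       L.pr_B_mult L.dec.pr_closed\<close>)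

text \<open>As \<open>j m\<close> has degree one, the homogeneous parts of its product with
  \<open>s\<close> come from those of \<open>s\<close>.\<close>

lemma proj_ract_j:
  assumes x: "x \<in> carrier \<Gamma>" and s: "s \<in> carrier C'" and m: "m \<in> carrier M"
  shows "proj x (ract (j m) s) = ract (j m) (R.dec.pr x s)"
proof (rule R.dec.parts_hom_eq[where f = "\<lambda>s. proj x (ract (j m) s)" and g = "\<lambda>s. ract (j m) (R.dec.pr x s)",
      OF add_homI add_homI TA _ s])
  fix y c assume y: "y \<in> carrier \<Gamma>" and c: "c \<in> \<C>' y"
  have "ract (j m) c \<in> \<V> y" using ract_grade[OF L.\<Gamma>.one_closed y j_grade[OF m] c] y by simp
  then show "proj x (ract (j m) c) = ract (j m) (R.dec.pr x c)"
    using x y c m by (simp add: proj_part R.dec.pr_part add_hom_zero[OF ract_hom R.abelian_group_axioms TA])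
qed (use x m in \<open>simp_all add: proj_closed ract_closed ract_add_r add_hom_add[OF proj_hom] R.dec.pr_closed
    add_hom_add[OF R.dec.pr_hom]\<close>)

lemma j_lact: "\<lbrakk>\<beta> \<in> carrier B; m \<in> carrier M\<rbrakk> \<Longrightarrow> j (\<beta> \<odot>\<^bsub>M\<^esub> m) = lact \<beta> (j m)"
  by (simp add: lact_pt L.B_closed pt_B[symmetric])

lemma lact_j: "\<lbrakk>c \<in> carrier C; m \<in> carrier M\<rbrakk> \<Longrightarrow> lact c (j m) = c \<otimes>\<otimes> m"
  by (simp add: lact_pt)

section \<open>Passage from the Morita equivalence of \<open>B\<close> and \<open>B'\<close> to the
  graded one\<close>

context
  assumes Morita: "induces_Morita_equivalence \<O> B B' M"
begin

text \<open>These four facts are the form in which the Morita hypothesis enters; the isomorphisms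
  behind it do not appear again.\<close>

lemma M_one_B: "\<one>\<^bsub>B\<^esub> \<in> add_span B {f x | f x. f \<in> carrier (dual B M) \<and> x \<in> carrier M}"
  and M_one_B': "\<one>\<^bsub>B'\<^esub> \<in> add_span B' {s \<in> carrier B'. \<exists>f\<in>carrier (dual B M). \<exists>y\<in>carrier M.
    \<forall>x\<in>carrier M. x \<odot>r\<^bsub>M\<^esub> s = f x \<odot>\<^bsub>M\<^esub> y}"
  and M_full: "\<lbrakk>e \<in> add_hom M M; \<And>a x. \<lbrakk>a \<in> carrier B; x \<in> carrier M\<rbrakk> \<Longrightarrow> e (a \<odot>\<^bsub>M\<^esub> x) = a \<odot>\<^bsub>M\<^esub> e x\<rbrakk>
    \<Longrightarrow> \<exists>s\<in>carrier B'. \<forall>x\<in>carrier M. e x = x \<odot>r\<^bsub>M\<^esub> s"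
  and M_faithful: "\<lbrakk>s \<in> carrier B'; \<And>x. x \<in> carrier M \<Longrightarrow> x \<odot>r\<^bsub>M\<^esub> s = \<zero>\<^bsub>M\<^esub>\<rbrakk> \<Longrightarrow> s = \<zero>\<^bsub>B'\<^esub>"
proof -
  obtain \<alpha> \<beta> where a: "bimodule_iso B B (tensor_bimodule B' M (dual B M)) (regular B) \<alpha>"
    and b: "bimodule_iso B' B' (tensor_bimodule B (dual B M) M) (regular B') \<beta>"
    using Morita by (auto simp: induces_Morita_equivalence_def)
  show "\<one>\<^bsub>B\<^esub> \<in> add_span B {f x | f x. f \<in> carrier (dual B M) \<and> x \<in> carrier M}"
    by (rule M.one_R_span[OF a b])
  show "\<one>\<^bsub>B'\<^esub> \<in> add_span B' {s \<in> carrier B'. \<exists>f\<in>carrier (dual B M). \<exists>y\<in>carrier M.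
    \<forall>x\<in>carrier M. x \<odot>r\<^bsub>M\<^esub> s = f x \<odot>\<^bsub>M\<^esub> y}"
    by (rule M.Morita_one_S[OF a b])
  show "\<exists>s\<in>carrier B'. \<forall>x\<in>carrier M. e x = x \<odot>r\<^bsub>M\<^esub> s"
    if "e \<in> add_hom M M" "\<And>a x. \<lbrakk>a \<in> carrier B; x \<in> carrier M\<rbrakk> \<Longrightarrow> e (a \<odot>\<^bsub>M\<^esub> x) = a \<odot>\<^bsub>M\<^esub> e x"
    by (rule M.Morita_full[OF a b that])
  show "s = \<zero>\<^bsub>B'\<^esub>" if "s \<in> carrier B'" "\<And>x. x \<in> carrier M \<Longrightarrow> x \<odot>r\<^bsub>M\<^esub> s = \<zero>\<^bsub>M\<^esub>"
    by (rule M.Morita_faithful[OF a b that])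
qed

lemma V_one_C:
  "\<one>\<^bsub>C\<^esub> \<in> add_span C {f x | f x. f \<in> dual_grading \<Gamma> C \<C> VV \<V> \<one>\<^bsub>\<Gamma>\<^esub> \<and> x \<in> \<V> \<one>\<^bsub>\<Gamma>\<^esub>}" (is "_ \<in> add_span C ?Q")
proof -
  let ?P = "{f x | f x. f \<in> carrier (dual B M) \<and> x \<in> carrier M}"
  have P: "?P \<subseteq> carrier B" by (auto simp: M.dual_closed)
  have "\<one>\<^bsub>C\<^esub> \<in> (\<lambda>x. x) ` add_span B ?P" using M_one_B by (simp add: L.B_one)
  also have "\<dots> = add_span C ((\<lambda>x. x) ` ?P)"
    by (rule add_hom_span_image[OF L.B_hom L.B.abelian_group_axioms L.abelian_group_axioms P])
  also have "\<dots> \<subseteq> add_span C ?Q"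
  proof (rule add_span_mono, clarify)
    fix f x assume fx: "f \<in> carrier (dual B M)" "x \<in> carrier M"
    then have "f x = extend f (j x)" using M.dual_closed[OF fx] by (simp add: extend_pt L.B_closed)
    then show "\<exists>g y. f x = g y \<and> g \<in> dual_grading \<Gamma> C \<C> VV \<V> \<one>\<^bsub>\<Gamma>\<^esub> \<and> y \<in> \<V> \<one>\<^bsub>\<Gamma>\<^esub>"
      using extend_dg[OF fx(1)] j_grade[OF fx(2)] by blast
  qed
  finally show ?thesis .
qed

text \<open>If \<open>s\<close> acts on \<open>M\<close> with functional \<open>f\<close> and vector
  \<open>y\<close>, then it sends \<open>c\<close> tensor \<open>m\<close> to \<open>c\<close>
  tensor \<open>f m\<close> times \<open>y\<close>. As \<open>f m\<close> lies in \<open>B\<close>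
  it crosses to \<open>c\<close>, so \<open>s\<close> acts with functional \<open>extend f\<close>
  and vector \<open>j y\<close>.\<close>

lemma V_one_C':
  "\<one>\<^bsub>C'\<^esub> \<in> add_span C' {s \<in> carrier C'. \<exists>f\<in>dual_grading \<Gamma> C \<C> VV \<V> \<one>\<^bsub>\<Gamma>\<^esub>. \<exists>y\<in>\<V> \<one>\<^bsub>\<Gamma>\<^esub>.
    \<forall>x\<in>carrier VV. x \<odot>r\<^bsub>VV\<^esub> s = f x \<odot>\<^bsub>VV\<^esub> y}" (is "_ \<in> add_span C' ?Q")
proof -
  let ?P = "{s \<in> carrier B'. \<exists>f\<in>carrier (dual B M). \<exists>y\<in>carrier M. \<forall>x\<in>carrier M. x \<odot>r\<^bsub>M\<^esub> s = f x \<odot>\<^bsub>M\<^esub> y}"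
  have "\<one>\<^bsub>C'\<^esub> \<in> (\<lambda>x. x) ` add_span B' ?P" using M_one_B' by (simp add: R.B_one)
  also have "\<dots> = add_span C' ((\<lambda>x. x) ` ?P)"
    by (rule add_hom_span_image[OF R.B_hom R.B.abelian_group_axioms R.abelian_group_axioms]) blast
  also have "\<dots> \<subseteq> add_span C' ?Q"
  proof (rule add_span_mono, rule subsetI)
    fix s assume "s \<in> (\<lambda>x. x) ` ?P"
    then obtain f y where s: "s \<in> carrier B'" "f \<in> carrier (dual B M)" "y \<in> carrier M"
      "\<forall>x\<in>carrier M. x \<odot>r\<^bsub>M\<^esub> s = f x \<odot>\<^bsub>M\<^esub> y" by auto
    have "ract v s = lact (extend f v) (j y)" if v: "v \<in> carrier TV" for v
      by (rule V_hom_eq[where f = "\<lambda>v. ract v s" and g = "\<lambda>v. lact (extend f v) (j y)", OF ract_hom_l add_homI TA _ v])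
         (use s in \<open>simp_all add: R.B_closed lact_closed add_hom_closed[OF extend_hom] add_hom_add[OF extend_hom]
           add_hom_add[OF lact_hom_l] extend_pt ract_B lact_pt L.B_closed M.dual_closed pt_move pt_add_l\<close>)
    then show "s \<in> ?Q" using extend_dg[OF s(2)] j_grade[OF s(3)] s(1) by (auto simp: R.B_closed)
  qed
  finally show ?thesis .
qed

text \<open>The map in question is linear over \<open>C\<close>, so it is determined by its
  restriction \<open>e\<close> to the copy of \<open>M\<close>. That restriction is only linear over
  \<open>B\<close> and may spread over all degrees; each homogeneous part is reduced to an
  endomorphism of \<open>M\<close>, for which \<open>M_full\<close> is available.\<close>

lemma V_rank_one:
  assumes f: "f \<in> carrier (dual C VV)" and y: "y \<in> carrier VV"
  shows "\<exists>s\<in>carrier C'. \<forall>x\<in>carrier VV. x \<odot>r\<^bsub>VV\<^esub> s = f x \<odot>\<^bsub>VV\<^esub> y"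
proof -
  note fc = G.dual_closed[OF f, simplified] and fadd = G.dual_add[OF f, simplified]
    and fl = G.dual_smult[OF f, simplified]
  have yc: "y \<in> carrier TV" using y by simp
  define e where "e m = lact (f (j m)) y" for m
  have ec: "e m \<in> carrier TV" if "m \<in> carrier M" for m
    using that yc by (simp add: e_def lact_closed fc)
  have eadd: "e (m \<oplus>\<^bsub>M\<^esub> n) = e m \<oplus>\<^bsub>TV\<^esub> e n" if "m \<in> carrier M" "n \<in> carrier M" for m n
    using that yc by (simp add: e_def pt_add_r fadd fc add_hom_add[OF lact_hom_l])
  have el: "e (\<beta> \<odot>\<^bsub>M\<^esub> m) = lact \<beta> (e m)" if "\<beta> \<in> carrier B" "m \<in> carrier M" for \<beta> m
    using that yc by (simp add: e_def j_lact fl fc L.B_closed lact_assoc)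
  have "\<forall>x\<in>carrier \<Gamma>. \<exists>s. s \<in> carrier B' \<and> (\<forall>m\<in>carrier M. ract (j (m \<odot>r\<^bsub>M\<^esub> s)) (u' (rep x)) = proj x (e m))"
  proof
    fix x assume x: "x \<in> carrier \<Gamma>"
    let ?g = "rep x" and ?h = "inv\<^bsub>H\<^esub> rep x"
    have g: "?g \<in> carrier H" "deg ?g = x" "?h \<in> carrier H" using rep[OF x] by simp_all
    \<comment> \<open>The unit of inverse degree brings the part of degree \<open>x\<close> into
      degree one, which is the image of \<open>M\<close> under \<open>j\<close>; there it is read
      back as the endomorphism \<open>n\<close>.\<close>
    define w where "w m = ract (proj x (e m)) (u' ?h)" for m
    have pe: "proj x (e m) \<in> \<V> x" if "m \<in> carrier M" for m
      using proj_in[OF x ec[OF that]] .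
    have w1: "w m \<in> \<V> \<one>\<^bsub>\<Gamma>\<^esub>" if "m \<in> carrier M" for m
      using ract_grade[OF x L.deg_closed[OF g(3)] pe[OF that] R.u_deg[OF g(3)]] x g
      by (simp add: w_def L.deg_inv)
    define n where "n m = inv_into (carrier M) j (w m)" for m
    have nj: "n m \<in> carrier M" "j (n m) = w m" if "m \<in> carrier M" for m
    proof -
      have "w m \<in> j ` carrier M" using w1[OF that] j_bij by (simp add: bij_betw_def)
      then show "n m \<in> carrier M" "j (n m) = w m" unfolding n_def by (simp_all add: inv_into_into f_inv_into_f)
    qed
    have pec: "proj x (e m) \<in> carrier TV" if "m \<in> carrier M" for m using x ec[OF that] by (rule proj_closed)
    note uc = R.u_closed[OF g(3)]
    have "n \<in> add_hom M M"
    proof (rule add_homI[OF nj(1)])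
      fix m m' assume m: "m \<in> carrier M" "m' \<in> carrier M"
      show "n (m \<oplus>\<^bsub>M\<^esub> m') = n m \<oplus>\<^bsub>M\<^esub> n m'"
        by (rule j_inj) (use m nj x uc pec in \<open>simp_all add: pt_add_r w_def eadd add_hom_add[OF proj_hom] ec ract_add\<close>)
    qed
    \<comment> \<open>Projections commute with \<open>B\<close>, which has degree one, and right
      multiplication commutes with the left action.\<close>
    moreover have "n (\<beta> \<odot>\<^bsub>M\<^esub> m) = \<beta> \<odot>\<^bsub>M\<^esub> n m" if "\<beta> \<in> carrier B" "m \<in> carrier M" for \<beta> m
      by (rule j_inj)
         (use that nj x uc pec in \<open>simp_all add: M.smult_closed j_lact w_def el proj_lact_B ec lact_ract L.B_closed\<close>)
    ultimately obtain s where s: "s \<in> carrier B'" "\<forall>m\<in>carrier M. n m = m \<odot>r\<^bsub>M\<^esub> s"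
      using M_full[of n] by blast
    have "ract (j (m \<odot>r\<^bsub>M\<^esub> s)) (u' ?g) = proj x (e m)" if m: "m \<in> carrier M" for m
    proof -
      have "j (m \<odot>r\<^bsub>M\<^esub> s) = w m" using s(2) nj(2)[OF m] m by simp
      then have "ract (j (m \<odot>r\<^bsub>M\<^esub> s)) (u' ?g) = ract (proj x (e m)) (u' ?h \<otimes>\<^bsub>C'\<^esub> u' ?g)"
        using pec[OF m] uc R.u_closed[OF g(1)] by (simp add: w_def ract_assoc)
      then show ?thesis using g pec[OF m] by (simp add: R.u_inv ract_one)
    qed
    then show "\<exists>s. s \<in> carrier B' \<and> (\<forall>m\<in>carrier M. ract (j (m \<odot>r\<^bsub>M\<^esub> s)) (u' ?g) = proj x (e m))"
      using s(1) by blast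
  qed
  from bchoice[OF this] obtain s where
    "\<forall>x\<in>carrier \<Gamma>. s x \<in> carrier B' \<and> (\<forall>m\<in>carrier M. ract (j (m \<odot>r\<^bsub>M\<^esub> s x)) (u' (rep x)) = proj x (e m))" by blast
  then have s: "\<And>x. x \<in> carrier \<Gamma> \<Longrightarrow> s x \<in> carrier B'"
    "\<And>x m. \<lbrakk>x \<in> carrier \<Gamma>; m \<in> carrier M\<rbrakk> \<Longrightarrow> ract (j (m \<odot>r\<^bsub>M\<^esub> s x)) (u' (rep x)) = proj x (e m)"
    by simp_all
  \<comment> \<open>Each coefficient \<open>s x\<close> gets back the unit that was divided out; the
    sum then reproduces all homogeneous parts of \<open>e\<close>.\<close>
  let ?s = "\<Oplus>\<^bsub>C'\<^esub>x\<in>carrier \<Gamma>. s x \<otimes>\<^bsub>C'\<^esub> u' (rep x)"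
  have sc: "s x \<otimes>\<^bsub>C'\<^esub> u' (rep x) \<in> carrier C'" if "x \<in> carrier \<Gamma>" for x
    using that s(1) rep by (simp add: R.B_closed R.u_closed)
  have ssc: "?s \<in> carrier C'" by (rule R.finsum_closed) (use sc in auto)
  have key: "ract (j m) ?s = e m" if m: "m \<in> carrier M" for m
  proof -
    have "ract (j m) ?s = (\<Oplus>\<^bsub>TV\<^esub>x\<in>carrier \<Gamma>. ract (j m) (s x \<otimes>\<^bsub>C'\<^esub> u' (rep x)))"
      by (rule add_hom_finsum[OF ract_hom[OF j_closed[OF m]] R.abelian_group_axioms TA L.finite_grading])
         (use sc in auto)
    also have "\<dots> = (\<Oplus>\<^bsub>TV\<^esub>x\<in>carrier \<Gamma>. proj x (e m))"
    proof (rule V.T.finsum_cong')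
      show "(\<lambda>x. proj x (e m)) \<in> carrier \<Gamma> \<rightarrow> carrier TV" using ec[OF m] by (auto intro: proj_closed)
      fix x assume x: "x \<in> carrier \<Gamma>"
      have "ract (j m) (s x \<otimes>\<^bsub>C'\<^esub> u' (rep x)) = ract (j (m \<odot>r\<^bsub>M\<^esub> s x)) (u' (rep x))"
        using m s(1)[OF x] rep[OF x] by (simp add: ract_assoc R.B_closed R.u_closed ract_B)
      then show "ract (j m) (s x \<otimes>\<^bsub>C'\<^esub> u' (rep x)) = proj x (e m)" using s(2)[OF x m] by simp
    qed simp
    also have "\<dots> = e m" by (rule proj_sum[OF ec[OF m]])
    finally show ?thesis .
  qed
  \<comment> \<open>Both sides commute with the left action of \<open>C\<close>, and
    \<open>C\<close> generates the induced module from the copy of \<open>M\<close>.\<close>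
  have "ract v ?s = lact (f v) y" if v: "v \<in> carrier TV" for v
  proof (rule V_hom_eq[where f = "\<lambda>v. ract v ?s" and g = "\<lambda>v. lact (f v) y", OF ract_hom_l[OF ssc] add_homI TA _ v])
    fix c m assume m: "c \<in> carrier C" "m \<in> carrier M"
    have "ract (c \<otimes>\<otimes> m) ?s = lact c (ract (j m) ?s)"
      using m ssc lact_ract[of c "j m" ?s] by (simp add: lact_j)
    also have "\<dots> = lact c (lact (f (j m)) y)" using m by (simp add: key e_def)
    also have "\<dots> = lact (f (lact c (j m))) y" using m yc by (simp add: fl fc lact_assoc)
    finally show "ract (c \<otimes>\<otimes> m) ?s = lact (f (c \<otimes>\<otimes> m)) y" using m by (simp add: lact_j)
  qed (use yc in \<open>simp_all add: lact_closed fc fadd add_hom_add[OF lact_hom_l]\<close>)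
  then show ?thesis using ssc by (intro bexI[of _ ?s]) simp_all
qed

text \<open>A homogeneous element is \<open>\<beta>\<close> times a unit; cancelling the unit leaves
  \<open>\<beta>\<close>, which kills \<open>M\<close> and vanishes because \<open>B'\<close> acts
  faithfully.\<close>

lemma pr_eq_zero:
  assumes x: "x \<in> carrier \<Gamma>" and s: "s \<in> carrier C'"
    and z: "\<And>m. m \<in> carrier M \<Longrightarrow> ract (j m) (R.dec.pr x s) = \<zero>\<^bsub>TV\<^esub>"
  shows "R.dec.pr x s = \<zero>\<^bsub>C'\<^esub>"
proof -
  obtain \<beta> g where g: "\<beta> \<in> carrier B'" "g \<in> carrier H" "R.dec.pr x s = \<beta> \<otimes>\<^bsub>C'\<^esub> u' g"
    using R.compE[OF x R.dec.pr_in[OF x s]] by metis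
  have "\<beta> = \<zero>\<^bsub>B'\<^esub>"
  proof (rule M_faithful[OF g(1)])
    fix m assume m: "m \<in> carrier M"
    have "ract (ract (j m) (\<beta> \<otimes>\<^bsub>C'\<^esub> u' g)) (u' (inv\<^bsub>H\<^esub> g)) = j (m \<odot>r\<^bsub>M\<^esub> \<beta>)"
      using m g by (simp add: ract_unit_pt ract_u L.u_closed M.rsmult_closed L.u_inv)
    moreover have "ract (j m) (\<beta> \<otimes>\<^bsub>C'\<^esub> u' g) = \<zero>\<^bsub>TV\<^esub>" using z[OF m] g by simp
    moreover have "ract \<zero>\<^bsub>TV\<^esub> (u' (inv\<^bsub>H\<^esub> g)) = j \<zero>\<^bsub>M\<^esub>"
      using g by (simp add: add_hom_zero[OF ract_hom_l TA TA] R.u_closed add_hom_zero[OF j_hom MA TA])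
    ultimately have "j (m \<odot>r\<^bsub>M\<^esub> \<beta>) = j \<zero>\<^bsub>M\<^esub>" by simp
    then show "m \<odot>r\<^bsub>M\<^esub> \<beta> = \<zero>\<^bsub>M\<^esub>" using j_inj m g by (simp add: M.rsmult_closed)
  qed
  then show ?thesis using g by (simp add: R.B_zero R.u_closed)
qed

lemma V_faithful:
  assumes s: "s \<in> carrier C'" and z: "\<forall>x\<in>carrier VV. x \<odot>r\<^bsub>VV\<^esub> s = \<zero>\<^bsub>VV\<^esub>" shows "s = \<zero>\<^bsub>C'\<^esub>"
proof -
  have p: "R.dec.pr x s = \<zero>\<^bsub>C'\<^esub>" if x: "x \<in> carrier \<Gamma>" for x
  proof (rule pr_eq_zero[OF x s])
    fix m assume m: "m \<in> carrier M"
    then show "ract (j m) (R.dec.pr x s) = \<zero>\<^bsub>TV\<^esub>"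
      using z x s by (simp add: proj_ract_j[symmetric] add_hom_zero[OF proj_hom TA TA])
  qed
  have "s = (\<Oplus>\<^bsub>C'\<^esub>x\<in>carrier \<Gamma>. R.dec.pr x s)" using s by (simp add: R.dec.pr_sum)
  also have "\<dots> = (\<Oplus>\<^bsub>C'\<^esub>x\<in>carrier \<Gamma>. \<zero>\<^bsub>C'\<^esub>)" by (rule R.finsum_cong') (simp_all add: p)
  finally show ?thesis by simp
qed

text \<open>On \<open>j m\<close> the element \<open>s\<close> produces something of degree
  \<open>a b\<close>. Thus its parts of any other degree kill \<open>M\<close> and are zero.\<close>

lemma V_rank_one_grade:
  assumes a: "a \<in> carrier \<Gamma>" and b: "b \<in> carrier \<Gamma>" and f: "f \<in> dual_grading \<Gamma> C \<C> VV \<V> a"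
    and y: "y \<in> \<V> b" and s: "s \<in> carrier C'"
    and eq: "\<forall>x\<in>carrier VV. x \<odot>r\<^bsub>VV\<^esub> s = f x \<odot>\<^bsub>VV\<^esub> y"
  shows "s \<in> \<C>' (a \<otimes>\<^bsub>\<Gamma>\<^esub> b)"
proof -
  let ?ab = "a \<otimes>\<^bsub>\<Gamma>\<^esub> b"
  have ab: "?ab \<in> carrier \<Gamma>" using a b by simp
  have p: "R.dec.pr x s = \<zero>\<^bsub>C'\<^esub>" if x: "x \<in> carrier \<Gamma>" "x \<noteq> ?ab" for x
  proof (rule pr_eq_zero[OF x(1) s])
    fix m assume m: "m \<in> carrier M"
    have "f (j m) \<in> \<C> a" using G.dg_apply[OF f L.\<Gamma>.one_closed j_grade[OF m]] a by simp
    then have "lact (f (j m)) y \<in> \<V> ?ab" by (rule lact_grade[OF a b _ y])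
    then have "ract (j m) s \<in> \<V> ?ab" using eq m by simp
    then show "ract (j m) (R.dec.pr x s) = \<zero>\<^bsub>TV\<^esub>"
      using x ab m s by (simp add: proj_ract_j[symmetric] proj_part)
  qed
  have "s = (\<Oplus>\<^bsub>C'\<^esub>x\<in>carrier \<Gamma>. R.dec.pr x s)" using s by (simp add: R.dec.pr_sum)
  also have "\<dots> = (\<Oplus>\<^bsub>C'\<^esub>x\<in>carrier \<Gamma>. if ?ab = x then R.dec.pr ?ab s else \<zero>\<^bsub>C'\<^esub>)"
    by (rule R.finsum_cong') (use p ab s in \<open>auto simp: R.dec.pr_closed\<close>)
  also have "\<dots> = R.dec.pr ?ab s"
    using R.finsum_singleton[OF ab L.finite_grading, of "\<lambda>_. R.dec.pr ?ab s"] ab s by (simp add: R.dec.pr_closed)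
  finally show ?thesis using R.dec.pr_in[OF ab s] by simp
qed

lemma VV_Morita: "induces_graded_Morita_equivalence \<O> \<Gamma> C \<C> C' \<C>' VV \<V>"
  unfolding induces_graded_Morita_equivalence_def Let_def
  by (intro conjI L.strongly_graded R.strongly_graded VV_graded
      G.evaluation_iso[OF V_one_C V_rank_one] G.coevaluation_iso[OF V_one_C' V_rank_one V_rank_one_grade V_faithful])

text \<open>All three descriptions with the equivalence, for any pair of crossed products; it
  remains for blocks to supply such a pair.\<close>

theorem crossed_pair_Morita:
  "\<exists>d r l.
    let V = left_induced C B M r; \<V> = left_induced_grading C \<C> B M;
        W = right_induced C' B' M l; \<W> = right_induced_grading C' \<C>' B' M;
        T = diagonal_induced \<O> \<Gamma> C \<C> C' \<C>' M d;
        \<T> = diagonal_induced_grading \<O> \<Gamma> C \<C> C' \<C>' M d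
    in diagonal_extension \<O> \<Gamma> C \<C> C' \<C>' B B' M d \<and>
       graded_bimodule \<O> \<Gamma> C \<C> C' \<C>' V \<V> \<and>
       identity_component \<O> \<Gamma> C \<C> C' \<C>' M d V \<V>
         (\<lambda>m. pure_tensor B (regular C) M \<one>\<^bsub>C\<^esub> m) \<and>
       graded_bimodule \<O> \<Gamma> C \<C> C' \<C>' W \<W> \<and>
       identity_component \<O> \<Gamma> C \<C> C' \<C>' M d W \<W>
         (\<lambda>m. pure_tensor B' M (regular C') m \<one>\<^bsub>C'\<^esub>) \<and>
       graded_bimodule \<O> \<Gamma> C \<C> C' \<C>' T \<T> \<and>
       (\<exists>h. graded_bimodule_iso \<Gamma> C C' V \<V> W \<W> h) \<and>
       (\<exists>h. graded_bimodule_iso \<Gamma> C C' W \<W> T \<T> h) \<and>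
       induces_graded_Morita_equivalence \<O> \<Gamma> C \<C> C' \<C>' V \<V>"
  unfolding Let_def
  by (intro exI[of _ dact] exI[of _ ract] exI[of _ lW] conjI dact_extension VV_graded VV_identity
      WW_graded WW_identity XX_graded exI[of _ to_W] to_W_iso W_X_iso VV_Morita)

end

end


section \<open>Group algebras\<close>

lemma group_algebra_simps [simp]:
  "carrier (group_algebra \<O> G) =
    {f. (\<forall>x\<in>carrier G. f x \<in> carrier \<O>) \<and> (\<forall>x. x \<notin> carrier G \<longrightarrow> f x = \<zero>\<^bsub>\<O>\<^esub>)}"
  "\<zero>\<^bsub>group_algebra \<O> G\<^esub> = (\<lambda>x. \<zero>\<^bsub>\<O>\<^esub>)"
  "f \<oplus>\<^bsub>group_algebra \<O> G\<^esub> g = (\<lambda>x. f x \<oplus>\<^bsub>\<O>\<^esub> g x)"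
  "r \<odot>\<^bsub>group_algebra \<O> G\<^esub> f = (\<lambda>x. r \<otimes>\<^bsub>\<O>\<^esub> f x)"
  "\<one>\<^bsub>group_algebra \<O> G\<^esub> = (\<lambda>x. if x = \<one>\<^bsub>G\<^esub> then \<one>\<^bsub>\<O>\<^esub> else \<zero>\<^bsub>\<O>\<^esub>)"
  by (simp_all add: group_algebra_def)

lemma corner_simps [simp]:
  "x \<oplus>\<^bsub>corner e A\<^esub> y = x \<oplus>\<^bsub>A\<^esub> y" "x \<otimes>\<^bsub>corner e A\<^esub> y = x \<otimes>\<^bsub>A\<^esub> y"
  "\<zero>\<^bsub>corner e A\<^esub> = \<zero>\<^bsub>A\<^esub>" "\<one>\<^bsub>corner e A\<^esub> = e" "r \<odot>\<^bsub>corner e A\<^esub> x = r \<odot>\<^bsub>A\<^esub> x"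
  by (simp_all add: corner_def)

text \<open>An idempotent fixes exactly its own multiples; the equation is easier to compute with
  than the existential description.\<close>

lemma corner_carrier:
  fixes A :: "('o, 'a) module"
  assumes A: "assoc_algebra R A" and e: "e \<in> carrier A" "e \<otimes>\<^bsub>A\<^esub> e = e"
  shows "x \<in> carrier (corner e A) \<longleftrightarrow> x \<in> carrier A \<and> e \<otimes>\<^bsub>A\<^esub> x = x"
proof
  interpret assoc_algebra R A by fact
  assume "x \<in> carrier (corner e A)"
  then obtain a where "a \<in> carrier A" "x = e \<otimes>\<^bsub>A\<^esub> a" by (auto simp: corner_def)
  then show "x \<in> carrier A \<and> e \<otimes>\<^bsub>A\<^esub> x = x" using e by (simp add: m_assoc[symmetric])
next
  assume "x \<in> carrier A \<and> e \<otimes>\<^bsub>A\<^esub> x = x"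
  then show "x \<in> carrier (corner e A)" by (auto simp: corner_def intro!: exI[of _ x])
qed

lemma corner_algebra:
  fixes A :: "('o, 'a) module"
  assumes A: "assoc_algebra R A" and e: "e \<in> carrier A" "e \<otimes>\<^bsub>A\<^esub> e = e"
    and c: "\<And>x. x \<in> carrier A \<Longrightarrow> x \<otimes>\<^bsub>A\<^esub> e = e \<otimes>\<^bsub>A\<^esub> x"
  shows "assoc_algebra R (corner e A)"
proof -
  interpret assoc_algebra R A by fact
  note cc = corner_carrier[OF A e]
  have ag: "abelian_group (corner e A)"
  proof (rule abelian_groupI)
    fix x assume x: "x \<in> carrier (corner e A)"
    show "\<exists>y\<in>carrier (corner e A). y \<oplus>\<^bsub>corner e A\<^esub> x = \<zero>\<^bsub>corner e A\<^esub>"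
      using x e by (intro bexI[of _ "\<ominus>\<^bsub>A\<^esub> x"]) (simp_all add: cc l_neg r_minus)
  qed (use e in \<open>simp_all add: cc r_distr a_ac\<close>)
  have mult: "e \<otimes>\<^bsub>A\<^esub> (x \<otimes>\<^bsub>A\<^esub> y) = x \<otimes>\<^bsub>A\<^esub> y"
    if "x \<in> carrier A" "y \<in> carrier A" "e \<otimes>\<^bsub>A\<^esub> x = x" for x y
    using that e by (simp add: m_assoc[symmetric])
  have re: "x \<otimes>\<^bsub>A\<^esub> e = x" if "x \<in> carrier A" "e \<otimes>\<^bsub>A\<^esub> x = x" for x
    using c[OF that(1)] that(2) by simp
  have "Group.monoid (corner e A)"
    by (rule monoidI) (use e in \<open>simp_all add: cc mult m_assoc re\<close>)
  then have "ring (corner e A)"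
    by (intro ringI ag) (simp_all add: cc l_distr r_distr)
  moreover have "module R (corner e A)"
    by (intro module.intro R.is_cring ag module_axioms.intro)
       (use e in \<open>simp_all add: cc smult_mult_right smult_l_distr smult_r_distr smult_assoc1\<close>)
  ultimately show ?thesis
    by (intro assoc_algebra.intro assoc_algebra_axioms.intro)
       (simp_all add: cc smult_mult_left smult_mult_right)
qed

text \<open>As the two subgroups commute elementwise, products and inverses are formed factor by
  factor.\<close>

lemma (in group) commuting_subgroup:
  assumes N: "subgroup N G" and H: "subgroup H G"
    and NH_comm: "\<And>n h. \<lbrakk>n \<in> N; h \<in> H\<rbrakk> \<Longrightarrow> n \<otimes> h = h \<otimes> n"
  shows "subgroup (N <#> H) G"
proof (rule subgroupI)
  have K_mem: "k \<in> N <#> H \<longleftrightarrow> (\<exists>n\<in>N. \<exists>h\<in>H. k = n \<otimes> h)" for k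
    by (auto simp: set_mult_def)
  note N_sub = subgroup.mem_carrier[OF N] and H_sub = subgroup.mem_carrier[OF H]
  show "N <#> H \<subseteq> carrier G" using N_sub H_sub by (auto simp: K_mem)
  have 1: "\<one> \<in> N" "\<one> \<in> H" using N H by (auto intro: subgroup.one_closed)
  then show "N <#> H \<noteq> {}" using K_mem by blast
  fix a assume "a \<in> N <#> H"
  then obtain n h where a: "n \<in> N" "h \<in> H" "a = n \<otimes> h" by (auto simp: K_mem)
  have i: "inv n \<in> N" "inv h \<in> H" using N H a by (simp_all add: subgroup.m_inv_closed)
  have "inv a = inv n \<otimes> inv h"
    using a N_sub H_sub NH_comm[OF i] by (simp add: inv_mult_group)
  then show "inv a \<in> N <#> H" using i K_mem by blast
  fix b assume "b \<in> N <#> H"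
  then obtain m k where b: "m \<in> N" "k \<in> H" "b = m \<otimes> k" by (auto simp: K_mem)
  have "h \<otimes> (m \<otimes> k) = m \<otimes> (h \<otimes> k)"
    using NH_comm[OF b(1) a(2)] N_sub[OF b(1)] H_sub[OF a(2)] H_sub[OF b(2)] by (simp add: m_assoc[symmetric])
  then have "a \<otimes> b = (n \<otimes> m) \<otimes> (h \<otimes> k)"
    using a b N_sub H_sub by (simp add: m_assoc)
  moreover have "n \<otimes> m \<in> N" "h \<otimes> k \<in> H"
    using N H a b by (simp_all add: subgroup.m_closed)
  ultimately show "a \<otimes> b \<in> N <#> H" using K_mem by blast
qed

section \<open>Convolution on a finite group and the group algebras of its subgroups\<close>

locale finite_group_algebra = G: group G + O: cring \<O>
  for G :: "('g, 'h) monoid_scheme" (structure) and \<O> :: "('o, 'x) ring_scheme" (structure) +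
  assumes fin: "finite (carrier G)"
begin

abbreviation GA :: "'g set \<Rightarrow> ('o, 'g \<Rightarrow> 'o) module"
  where "GA U \<equiv> group_algebra \<O> (G\<lparr>carrier := U\<rparr>)"

text \<open>One convolution over the whole of \<open>G\<close> serves all subgroups: by
  \<open>GA_mult\<close> it restricts to the product of each subgroup algebra, so that elements of
  different subgroup algebras can be multiplied with each other.\<close>

definition conv where
  "conv f g = (\<lambda>x. if x \<in> carrier G
     then (\<Oplus>\<^bsub>\<O>\<^esub>y\<in>carrier G. f y \<otimes>\<^bsub>\<O>\<^esub> g (inv\<^bsub>G\<^esub> y \<otimes>\<^bsub>G\<^esub> x)) else \<zero>\<^bsub>\<O>\<^esub>)"

definition delta where "delta r g = (\<lambda>x. if x = g then r else \<zero>\<^bsub>\<O>\<^esub>)"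

lemma GA_closed: "f \<in> carrier (GA U) \<Longrightarrow> f x \<in> carrier \<O>"
  by (cases "x \<in> U") auto

lemma GA_outside: "f \<in> carrier (GA U) \<Longrightarrow> x \<notin> U \<Longrightarrow> f x = \<zero>\<^bsub>\<O>\<^esub>"
  by auto

lemma GA_I: "(\<And>x. x \<in> U \<Longrightarrow> f x \<in> carrier \<O>) \<Longrightarrow> (\<And>x. x \<notin> U \<Longrightarrow> f x = \<zero>\<^bsub>\<O>\<^esub>) \<Longrightarrow> f \<in> carrier (GA U)"
  by auto

lemma GA_mono:
  assumes "U \<subseteq> Y" "f \<in> carrier (GA U)" shows "f \<in> carrier (GA Y)"
proof (rule GA_I)
  show "f x \<in> carrier \<O>" for x using assms(2) by (rule GA_closed)
  show "f x = \<zero>\<^bsub>\<O>\<^esub>" if "x \<notin> Y" for x using assms that by (intro GA_outside[OF assms(2)]) auto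
qed

lemma GA_abelian: "abelian_group (GA U)"
proof (rule abelian_groupI)
  fix f assume f: "f \<in> carrier (GA U)"
  show "\<exists>g\<in>carrier (GA U). g \<oplus>\<^bsub>GA U\<^esub> f = \<zero>\<^bsub>GA U\<^esub>"
    by (rule bexI[of _ "\<lambda>x. \<ominus>\<^bsub>\<O>\<^esub> f x"]) (use f GA_closed[OF f] in \<open>simp_all add: O.l_neg\<close>)
  show "\<zero>\<^bsub>GA U\<^esub> \<oplus>\<^bsub>GA U\<^esub> f = f" using GA_closed[OF f] by simp
next
  fix f g h assume "f \<in> carrier (GA U)" "g \<in> carrier (GA U)" "h \<in> carrier (GA U)"
  note c = this[THEN GA_closed]
  show "f \<oplus>\<^bsub>GA U\<^esub> g \<oplus>\<^bsub>GA U\<^esub> h = f \<oplus>\<^bsub>GA U\<^esub> (g \<oplus>\<^bsub>GA U\<^esub> h)" using c by (simp add: O.a_assoc)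
next
  fix f g assume "f \<in> carrier (GA U)" "g \<in> carrier (GA U)"
  note c = this[THEN GA_closed]
  show "f \<oplus>\<^bsub>GA U\<^esub> g = g \<oplus>\<^bsub>GA U\<^esub> f" using c by (simp add: O.a_comm)
qed simp_all

lemma GA_module: "module \<O> (GA U)"
proof (intro module.intro O.is_cring GA_abelian module_axioms.intro)
  fix r s f g assume r: "r \<in> carrier \<O>" and f: "f \<in> carrier (GA U)"
  note c = f[THEN GA_closed]
  show "r \<odot>\<^bsub>GA U\<^esub> f \<in> carrier (GA U)" using r f by simp
  show "(r \<oplus>\<^bsub>\<O>\<^esub> s) \<odot>\<^bsub>GA U\<^esub> f = r \<odot>\<^bsub>GA U\<^esub> f \<oplus>\<^bsub>GA U\<^esub> s \<odot>\<^bsub>GA U\<^esub> f" if "s \<in> carrier \<O>"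
    using r c that by (simp add: O.l_distr)
  show "(r \<otimes>\<^bsub>\<O>\<^esub> s) \<odot>\<^bsub>GA U\<^esub> f = r \<odot>\<^bsub>GA U\<^esub> (s \<odot>\<^bsub>GA U\<^esub> f)" if "s \<in> carrier \<O>"
    using r c that by (simp add: O.m_assoc)
  show "r \<odot>\<^bsub>GA U\<^esub> (f \<oplus>\<^bsub>GA U\<^esub> g) = r \<odot>\<^bsub>GA U\<^esub> f \<oplus>\<^bsub>GA U\<^esub> r \<odot>\<^bsub>GA U\<^esub> g" if g: "g \<in> carrier (GA U)"
    using r c g[THEN GA_closed] by (simp add: O.r_distr)
next
  fix f assume "f \<in> carrier (GA U)"
  then show "\<one>\<^bsub>\<O>\<^esub> \<odot>\<^bsub>GA U\<^esub> f = f" using GA_closed[of f U] by simp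
qed

lemma delta_GA: "\<lbrakk>r \<in> carrier \<O>; g \<in> U\<rbrakk> \<Longrightarrow> delta r g \<in> carrier (GA U)"
  by (simp add: delta_def)

abbreviation "GG \<equiv> GA (carrier G)"

lemma conv_closed:
  assumes "f \<in> carrier GG" "g \<in> carrier GG" shows "conv f g \<in> carrier GG"
  using assms[THEN GA_closed] by (intro GA_I) (simp_all add: conv_def O.finsum_closed Pi_iff)

lemma conv_add_l:
  assumes "f \<in> carrier GG" "g \<in> carrier GG" "h \<in> carrier GG"
  shows "conv (f \<oplus>\<^bsub>GG\<^esub> g) h = conv f h \<oplus>\<^bsub>GG\<^esub> conv g h"
proof
  note c = assms[THEN GA_closed]
  fix x show "conv (f \<oplus>\<^bsub>GG\<^esub> g) h x = (conv f h \<oplus>\<^bsub>GG\<^esub> conv g h) x"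
    using c by (simp add: conv_def O.l_distr O.finsum_addf Pi_iff)
qed

lemma conv_add_r:
  assumes "f \<in> carrier GG" "g \<in> carrier GG" "h \<in> carrier GG"
  shows "conv h (f \<oplus>\<^bsub>GG\<^esub> g) = conv h f \<oplus>\<^bsub>GG\<^esub> conv h g"
proof
  note c = assms[THEN GA_closed]
  fix x show "conv h (f \<oplus>\<^bsub>GG\<^esub> g) x = (conv h f \<oplus>\<^bsub>GG\<^esub> conv h g) x"
    using c by (simp add: conv_def O.r_distr O.finsum_addf Pi_iff)
qed

lemma conv_delta_l:
  assumes r: "r \<in> carrier \<O>" and g: "g \<in> carrier G" and f: "f \<in> carrier GG"
  shows "conv (delta r g) f = (\<lambda>x. if x \<in> carrier G then r \<otimes>\<^bsub>\<O>\<^esub> f (inv\<^bsub>G\<^esub> g \<otimes>\<^bsub>G\<^esub> x) else \<zero>\<^bsub>\<O>\<^esub>)"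
proof
  note c = GA_closed[OF f]
  fix x
  have "(\<Oplus>\<^bsub>\<O>\<^esub>y\<in>carrier G. delta r g y \<otimes>\<^bsub>\<O>\<^esub> f (inv\<^bsub>G\<^esub> y \<otimes>\<^bsub>G\<^esub> x)) =
      (\<Oplus>\<^bsub>\<O>\<^esub>y\<in>carrier G. if g = y then r \<otimes>\<^bsub>\<O>\<^esub> f (inv\<^bsub>G\<^esub> y \<otimes>\<^bsub>G\<^esub> x) else \<zero>\<^bsub>\<O>\<^esub>)"
    by (rule O.finsum_cong') (use r c in \<open>auto simp: delta_def\<close>)
  also have "\<dots> = r \<otimes>\<^bsub>\<O>\<^esub> f (inv\<^bsub>G\<^esub> g \<otimes>\<^bsub>G\<^esub> x)"
    by (rule O.finsum_singleton[OF g fin]) (use r c in auto)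
  finally show "conv (delta r g) f x = (if x \<in> carrier G then r \<otimes>\<^bsub>\<O>\<^esub> f (inv\<^bsub>G\<^esub> g \<otimes>\<^bsub>G\<^esub> x) else \<zero>\<^bsub>\<O>\<^esub>)"
    by (simp add: conv_def)
qed

lemma conv_delta_r:
  assumes r: "r \<in> carrier \<O>" and g: "g \<in> carrier G" and f: "f \<in> carrier GG"
  shows "conv f (delta r g) = (\<lambda>x. if x \<in> carrier G then f (x \<otimes>\<^bsub>G\<^esub> inv\<^bsub>G\<^esub> g) \<otimes>\<^bsub>\<O>\<^esub> r else \<zero>\<^bsub>\<O>\<^esub>)"
proof
  note c = GA_closed[OF f]
  fix x
  have "(\<Oplus>\<^bsub>\<O>\<^esub>y\<in>carrier G. f y \<otimes>\<^bsub>\<O>\<^esub> delta r g (inv\<^bsub>G\<^esub> y \<otimes>\<^bsub>G\<^esub> x)) = f (x \<otimes>\<^bsub>G\<^esub> inv\<^bsub>G\<^esub> g) \<otimes>\<^bsub>\<O>\<^esub> r"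
    if x: "x \<in> carrier G"
  proof -
    have "inv\<^bsub>G\<^esub> y \<otimes>\<^bsub>G\<^esub> x = g \<longleftrightarrow> x \<otimes>\<^bsub>G\<^esub> inv\<^bsub>G\<^esub> g = y" if "y \<in> carrier G" for y
      using x g that by (metis G.inv_closed G.inv_solve_left G.inv_solve_right G.m_closed)
    then have "(\<Oplus>\<^bsub>\<O>\<^esub>y\<in>carrier G. f y \<otimes>\<^bsub>\<O>\<^esub> delta r g (inv\<^bsub>G\<^esub> y \<otimes>\<^bsub>G\<^esub> x)) =
        (\<Oplus>\<^bsub>\<O>\<^esub>y\<in>carrier G. if x \<otimes>\<^bsub>G\<^esub> inv\<^bsub>G\<^esub> g = y then f y \<otimes>\<^bsub>\<O>\<^esub> r else \<zero>\<^bsub>\<O>\<^esub>)"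
      by (intro O.finsum_cong') (use r c in \<open>auto simp: delta_def\<close>)
    also have "\<dots> = f (x \<otimes>\<^bsub>G\<^esub> inv\<^bsub>G\<^esub> g) \<otimes>\<^bsub>\<O>\<^esub> r"
      by (rule O.finsum_singleton[OF _ fin]) (use r c x g in auto)
    finally show ?thesis .
  qed
  then show "conv f (delta r g) x = (if x \<in> carrier G then f (x \<otimes>\<^bsub>G\<^esub> inv\<^bsub>G\<^esub> g) \<otimes>\<^bsub>\<O>\<^esub> r else \<zero>\<^bsub>\<O>\<^esub>)"
    by (simp add: conv_def)
qed

lemma delta_mult:
  assumes "r \<in> carrier \<O>" "s \<in> carrier \<O>" "g \<in> carrier G" "h \<in> carrier G"
  shows "conv (delta r g) (delta s h) = delta (r \<otimes>\<^bsub>\<O>\<^esub> s) (g \<otimes>\<^bsub>G\<^esub> h)"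
proof
  fix x
  have "inv\<^bsub>G\<^esub> g \<otimes>\<^bsub>G\<^esub> x = h \<longleftrightarrow> x = g \<otimes>\<^bsub>G\<^esub> h" if "x \<in> carrier G"
    using assms that by (metis G.inv_closed G.inv_solve_left G.m_closed)
  then show "conv (delta r g) (delta s h) x = delta (r \<otimes>\<^bsub>\<O>\<^esub> s) (g \<otimes>\<^bsub>G\<^esub> h) x"
    using assms conv_delta_l[OF assms(1,3) delta_GA[OF assms(2,4)]] by (auto simp: delta_def)
qed

lemma GA_span:
  assumes U: "U \<subseteq> carrier G"
  shows "carrier (GA U) = add_span (GA U) {delta r g | r g. r \<in> carrier \<O> \<and> g \<in> U}" (is "_ = add_span _ ?D")
proof
  interpret A: abelian_group "GA U" by (rule GA_abelian)
  have D: "?D \<subseteq> carrier (GA U)" using delta_GA by blast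
  show "add_span (GA U) ?D \<subseteq> carrier (GA U)" using A.add_span_closed[OF D] .
  \<comment> \<open>Induction over a finite set outside which \<open>f\<close> vanishes: the value
    at one point is split off as a \<open>delta\<close>.\<close>
  have "f \<in> add_span (GA U) ?D" if "finite S" "f \<in> carrier (GA U)" "S \<subseteq> U" "\<And>x. x \<notin> S \<Longrightarrow> f x = \<zero>\<^bsub>\<O>\<^esub>" for f S
    using that
  proof (induction S arbitrary: f rule: finite_induct)
    case empty
    then have "f = \<zero>\<^bsub>GA U\<^esub>" by auto
    then show ?case using A.add_span_zero by (simp only:)
  next
    case (insert a S)
    let ?f = "\<lambda>x. if x = a then \<zero>\<^bsub>\<O>\<^esub> else f x"
    note c = GA_closed[OF insert.prems(1)]
    have fc: "?f \<in> carrier (GA U)"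
      by (rule GA_I) (use c GA_outside[OF insert.prems(1)] in auto)
    have "?f \<in> add_span (GA U) ?D"
      by (rule insert.IH[OF fc]) (use insert.prems in auto)
    moreover have "delta (f a) a \<in> add_span (GA U) ?D"
      by (rule add_span_incl) (use c insert.prems in auto)
    ultimately have "?f \<oplus>\<^bsub>GA U\<^esub> delta (f a) a \<in> add_span (GA U) ?D" by (rule A.add_span_add)
    also have "?f \<oplus>\<^bsub>GA U\<^esub> delta (f a) a = f" using c by (auto simp: delta_def)
    finally show ?case .
  qed
  from this[OF finite_subset[OF U fin]] show "carrier (GA U) \<subseteq> add_span (GA U) ?D"
    using GA_outside by blast
qed

lemma GA_hom_eq:
  assumes "U \<subseteq> carrier G" "f \<in> add_hom (GA U) A" "f' \<in> add_hom (GA U) A" "abelian_group A"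
    and "\<And>r g. \<lbrakk>r \<in> carrier \<O>; g \<in> U\<rbrakk> \<Longrightarrow> f (delta r g) = f' (delta r g)" and "t \<in> carrier (GA U)"
  shows "f t = f' t"
  by (rule add_hom_eq_on_span[OF assms(2,3) GA_abelian assms(4), where
        S = "{delta r g | r g. r \<in> carrier \<O> \<and> g \<in> U}"])
     (use assms(5,6) GA_span[OF assms(1)] delta_GA in blast)+

lemma conv_hom_l: "h \<in> carrier GG \<Longrightarrow> (\<lambda>f. conv f h) \<in> add_hom GG GG"
  and conv_hom_r: "h \<in> carrier GG \<Longrightarrow> (\<lambda>f. conv h f) \<in> add_hom GG GG"
  by (intro add_homI conv_closed conv_add_l conv_add_r; assumption)+

lemma delta_GG: "\<lbrakk>r \<in> carrier \<O>; g \<in> carrier G\<rbrakk> \<Longrightarrow> delta r g \<in> carrier GG"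
  by (rule delta_GA)

text \<open>With point masses as outer factors, both sides translate \<open>g\<close> from the left
  and from the right, and these translations commute. Additivity in the third and then in the first
  factor gives the general case, without rearranging double sums.\<close>

lemma conv_assoc:
  assumes f: "f \<in> carrier GG" and g: "g \<in> carrier GG" and h: "h \<in> carrier GG"
  shows "conv (conv f g) h = conv f (conv g h)"
proof -
  have 1: "conv (conv (delta r x) g) (delta s y) = conv (delta r x) (conv g (delta s y))"
    if "r \<in> carrier \<O>" "s \<in> carrier \<O>" "x \<in> carrier G" "y \<in> carrier G" for r s x y
  proof -
    have "conv (delta r x) g \<in> carrier GG" "conv g (delta s y) \<in> carrier GG"
      using that g by (simp_all only: conv_closed delta_GG)
    then show ?thesis
      using that g GA_closed[OF g]
      by (simp add: conv_delta_l[OF that(1,3) g] conv_delta_r[OF that(2,4) g] conv_delta_l[OF that(1,3)]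
          conv_delta_r[OF that(2,4)] fun_eq_iff O.m_assoc G.m_assoc del: group_algebra_simps)
  qed
  have 2: "conv (conv (delta r x) g) h = conv (delta r x) (conv g h)" if "r \<in> carrier \<O>" "x \<in> carrier G" for r x
  proof (rule GA_hom_eq[where f = "\<lambda>h. conv (conv (delta r x) g) h" and f' = "\<lambda>h. conv (delta r x) (conv g h)",
        OF subset_refl _ _ GA_abelian _ h])
    show "(\<lambda>h. conv (conv (delta r x) g) h) \<in> add_hom GG GG"
      by (rule conv_hom_r[OF conv_closed[OF delta_GG[OF that] g]])
    show "(\<lambda>h. conv (delta r x) (conv g h)) \<in> add_hom GG GG"
      by (rule add_homI) (simp_all only: conv_closed delta_GG that g conv_add_r)
  qed (rule 1[OF that(1) _ that(2)])
  show ?thesis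
  proof (rule GA_hom_eq[where f = "\<lambda>f. conv (conv f g) h" and f' = "\<lambda>f. conv f (conv g h)",
        OF subset_refl _ _ GA_abelian _ f])
    show "(\<lambda>f. conv f (conv g h)) \<in> add_hom GG GG"
      by (rule conv_hom_l[OF conv_closed[OF g h]])
    show "(\<lambda>f. conv (conv f g) h) \<in> add_hom GG GG"
      by (rule add_homI) (simp_all only: conv_closed g h conv_add_l)
  qed (rule 2)
qed

lemma conv_one:
  assumes f: "f \<in> carrier GG"
  shows "conv (delta \<one>\<^bsub>\<O>\<^esub> \<one>\<^bsub>G\<^esub>) f = f" "conv f (delta \<one>\<^bsub>\<O>\<^esub> \<one>\<^bsub>G\<^esub>) = f"
  using GA_closed[OF f] GA_outside[OF f]
  by (auto simp: conv_delta_l[OF _ _ f] conv_delta_r[OF _ _ f] simp del: group_algebra_simps)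

lemma conv_smult:
  assumes r: "r \<in> carrier \<O>" and f: "f \<in> carrier GG" and g: "g \<in> carrier GG"
  shows "conv (\<lambda>x. r \<otimes>\<^bsub>\<O>\<^esub> f x) g = (\<lambda>x. r \<otimes>\<^bsub>\<O>\<^esub> conv f g x)"
    and "conv f (\<lambda>x. r \<otimes>\<^bsub>\<O>\<^esub> g x) = (\<lambda>x. r \<otimes>\<^bsub>\<O>\<^esub> conv f g x)"
proof -
  note c = GA_closed[OF f] GA_closed[OF g]
  have "r \<otimes>\<^bsub>\<O>\<^esub> (\<Oplus>\<^bsub>\<O>\<^esub>y\<in>carrier G. f y \<otimes>\<^bsub>\<O>\<^esub> g (inv\<^bsub>G\<^esub> y \<otimes>\<^bsub>G\<^esub> x)) =
      (\<Oplus>\<^bsub>\<O>\<^esub>y\<in>carrier G. r \<otimes>\<^bsub>\<O>\<^esub> (f y \<otimes>\<^bsub>\<O>\<^esub> g (inv\<^bsub>G\<^esub> y \<otimes>\<^bsub>G\<^esub> x)))" for x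
    by (rule O.finsum_rdistr[OF fin r]) (use c in auto)
  then show "conv (\<lambda>x. r \<otimes>\<^bsub>\<O>\<^esub> f x) g = (\<lambda>x. r \<otimes>\<^bsub>\<O>\<^esub> conv f g x)"
    "conv f (\<lambda>x. r \<otimes>\<^bsub>\<O>\<^esub> g x) = (\<lambda>x. r \<otimes>\<^bsub>\<O>\<^esub> conv f g x)"
    using r c by (simp_all add: conv_def fun_eq_iff O.m_assoc O.m_lcomm)
qed

text \<open>Terms with \<open>y\<close> outside \<open>K\<close> vanish. If \<open>x\<close> lies
  outside \<open>K\<close>, all terms do, since \<open>y\<close> and the quotient of
  \<open>x\<close> by \<open>y\<close> cannot both lie in \<open>K\<close>.\<close>

lemma GA_mult:
  assumes K: "subgroup K G" and f: "f \<in> carrier (GA K)" and g: "g \<in> carrier (GA K)"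
  shows "f \<otimes>\<^bsub>GA K\<^esub> g = conv f g"
proof
  interpret K: subgroup K G by fact
  note c = GA_closed[OF f] GA_closed[OF g]
  note z = GA_outside[OF f] GA_outside[OF g]
  have inv: "inv\<^bsub>G\<lparr>carrier := K\<rparr>\<^esub> y = inv\<^bsub>G\<^esub> y" if "y \<in> K" for y
    using G.m_inv_consistent[OF K that] .
  fix x
  show "(f \<otimes>\<^bsub>GA K\<^esub> g) x = conv f g x"
  proof (cases "x \<in> K")
    case True
    have "(\<Oplus>\<^bsub>\<O>\<^esub>y\<in>K. f y \<otimes>\<^bsub>\<O>\<^esub> g (inv\<^bsub>G\<lparr>carrier := K\<rparr>\<^esub> y \<otimes>\<^bsub>G\<^esub> x)) =
        (\<Oplus>\<^bsub>\<O>\<^esub>y\<in>carrier G. f y \<otimes>\<^bsub>\<O>\<^esub> g (inv\<^bsub>G\<^esub> y \<otimes>\<^bsub>G\<^esub> x))"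
      by (rule O.add.finprod_mono_neutral_cong_left[OF fin K.subset]) (use c z inv in auto)
    then show ?thesis using True K.subset by (auto simp: group_algebra_def conv_def)
  next
    case False
    have "f y \<otimes>\<^bsub>\<O>\<^esub> g (inv\<^bsub>G\<^esub> y \<otimes>\<^bsub>G\<^esub> x) = \<zero>\<^bsub>\<O>\<^esub>" if x: "x \<in> carrier G" and y: "y \<in> carrier G" for y
    proof (cases "y \<in> K")
      case True
      have "inv\<^bsub>G\<^esub> y \<otimes>\<^bsub>G\<^esub> x \<notin> K"
      proof
        assume "inv\<^bsub>G\<^esub> y \<otimes>\<^bsub>G\<^esub> x \<in> K"
        then have "y \<otimes>\<^bsub>G\<^esub> (inv\<^bsub>G\<^esub> y \<otimes>\<^bsub>G\<^esub> x) \<in> K" using True by simp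
        then show False using False x y by (simp add: G.m_assoc[symmetric])
      qed
      then show ?thesis using c z(2) by simp
    qed (use c z(1) in simp)
    then have "conv f g x = \<zero>\<^bsub>\<O>\<^esub>" by (auto simp: conv_def intro: O.add.finprod_one_eqI)
    then show ?thesis using False by (simp add: group_algebra_def)
  qed
qed

lemma GA_conv_closed:
  assumes K: "subgroup K G" and f: "f \<in> carrier (GA K)" and g: "g \<in> carrier (GA K)"
  shows "conv f g \<in> carrier (GA K)"
proof (rule GA_I)
  have sub: "K \<subseteq> carrier G" using K by (rule subgroup.subset)
  have "conv f g \<in> carrier GG" by (rule conv_closed; rule GA_mono[OF sub]; fact)
  then show "conv f g x \<in> carrier \<O>" for x by (rule GA_closed)
  show "conv f g x = \<zero>\<^bsub>\<O>\<^esub>" if "x \<notin> K" for x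
    unfolding GA_mult[OF assms, symmetric] using that by (simp add: group_algebra_def)
qed

lemma GA_one: "\<one>\<^bsub>GA K\<^esub> = delta \<one>\<^bsub>\<O>\<^esub> \<one>\<^bsub>G\<^esub>"
  by (simp add: delta_def)

lemma GA_algebra:
  assumes K: "subgroup K G" shows "assoc_algebra \<O> (GA K)"
proof -
  have sub: "K \<subseteq> carrier G" using K by (rule subgroup.subset)
  note m = GA_mono[OF sub] and mult = GA_mult[OF K] and cl = GA_conv_closed[OF K]
  have add: "f \<oplus>\<^bsub>GA K\<^esub> g = f \<oplus>\<^bsub>GG\<^esub> g" for f g by simp
  have one: "delta \<one>\<^bsub>\<O>\<^esub> \<one>\<^bsub>G\<^esub> \<in> carrier (GA K)" by (rule delta_GA) (use K subgroup.one_closed in auto)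
  have addc: "f \<oplus>\<^bsub>GA K\<^esub> g \<in> carrier (GA K)" if "f \<in> carrier (GA K)" "g \<in> carrier (GA K)" for f g
    using that by simp
  have smc: "r \<odot>\<^bsub>GA K\<^esub> f \<in> carrier (GA K)" if "r \<in> carrier \<O>" "f \<in> carrier (GA K)" for r f
    using that by simp
  have "Group.monoid (GA K)"
  proof (rule monoidI)
    fix f g h assume f: "f \<in> carrier (GA K)" and g: "g \<in> carrier (GA K)" and h: "h \<in> carrier (GA K)"
    show "f \<otimes>\<^bsub>GA K\<^esub> g \<in> carrier (GA K)" unfolding mult[OF f g] by (rule cl[OF f g])
    show "f \<otimes>\<^bsub>GA K\<^esub> g \<otimes>\<^bsub>GA K\<^esub> h = f \<otimes>\<^bsub>GA K\<^esub> (g \<otimes>\<^bsub>GA K\<^esub> h)"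
      unfolding mult[OF f g] mult[OF g h] mult[OF cl[OF f g] h] mult[OF f cl[OF g h]]
      by (rule conv_assoc[OF m[OF f] m[OF g] m[OF h]])
    show "\<one>\<^bsub>GA K\<^esub> \<otimes>\<^bsub>GA K\<^esub> f = f" "f \<otimes>\<^bsub>GA K\<^esub> \<one>\<^bsub>GA K\<^esub> = f"
      unfolding GA_one mult[OF one f] mult[OF f one] by (rule conv_one[OF m[OF f]])+
  next
    show "\<one>\<^bsub>GA K\<^esub> \<in> carrier (GA K)" unfolding GA_one by (rule one)
  qed
  moreover have "(f \<oplus>\<^bsub>GA K\<^esub> g) \<otimes>\<^bsub>GA K\<^esub> h = f \<otimes>\<^bsub>GA K\<^esub> h \<oplus>\<^bsub>GA K\<^esub> g \<otimes>\<^bsub>GA K\<^esub> h"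
    "h \<otimes>\<^bsub>GA K\<^esub> (f \<oplus>\<^bsub>GA K\<^esub> g) = h \<otimes>\<^bsub>GA K\<^esub> f \<oplus>\<^bsub>GA K\<^esub> h \<otimes>\<^bsub>GA K\<^esub> g"
    if f: "f \<in> carrier (GA K)" and g: "g \<in> carrier (GA K)" and h: "h \<in> carrier (GA K)" for f g h
    unfolding mult[OF addc[OF f g] h] mult[OF h addc[OF f g]] mult[OF f h] mult[OF g h] mult[OF h f] mult[OF h g]
    unfolding add by (rule conv_add_l[OF m[OF f] m[OF g] m[OF h]] conv_add_r[OF m[OF f] m[OF g] m[OF h]])+
  ultimately have "ring (GA K)" by (intro ringI GA_abelian)
  moreover have "(r \<odot>\<^bsub>GA K\<^esub> f) \<otimes>\<^bsub>GA K\<^esub> g = r \<odot>\<^bsub>GA K\<^esub> (f \<otimes>\<^bsub>GA K\<^esub> g)"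
    "f \<otimes>\<^bsub>GA K\<^esub> (r \<odot>\<^bsub>GA K\<^esub> g) = r \<odot>\<^bsub>GA K\<^esub> (f \<otimes>\<^bsub>GA K\<^esub> g)"
    if r: "r \<in> carrier \<O>" and f: "f \<in> carrier (GA K)" and g: "g \<in> carrier (GA K)" for r f g
    unfolding mult[OF smc[OF r f] g] mult[OF f smc[OF r g]] mult[OF f g]
    unfolding group_algebra_simps(4) by (rule conv_smult[OF r m[OF f] m[OF g]])+
  ultimately show ?thesis
    by (intro assoc_algebra.intro assoc_algebra_axioms.intro GA_module)
qed


end

text \<open>This is instantiated with \<open>N\<close> and \<open>b\<close> as well as with
  \<open>N'\<close> and \<open>b'\<close>, always with the centraliser of \<open>N\<close> for
  \<open>H\<close>. The map \<open>\<phi>\<close> turns a degree into the coset that supports its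
  component: for \<open>N\<close> it is the identity, for \<open>N'\<close> the intersection with
  \<open>G'\<close>.\<close>

locale block_extension = finite_group_algebra + D: group \<Gamma>
  for \<Gamma> :: "('i, 'w) monoid_scheme" +
  fixes N H :: "'a set" and e :: "'a \<Rightarrow> 'c" and deg :: "'a \<Rightarrow> 'i" and \<phi> :: "'i \<Rightarrow> 'a set"
  assumes N: "subgroup N G" and H: "subgroup H G"
    and NH_comm: "\<lbrakk>n \<in> N; h \<in> H\<rbrakk> \<Longrightarrow> n \<otimes>\<^bsub>G\<^esub> h = h \<otimes>\<^bsub>G\<^esub> n"
    and e_closed: "e \<in> carrier (GA N)" and e_idem: "conv e e = e"
    and e_comm: "f \<in> carrier (GA N) \<Longrightarrow> conv e f = conv f e"
    and deg_hom: "deg \<in> hom (G\<lparr>carrier := H\<rparr>) \<Gamma>" and deg_surj: "deg ` H = carrier \<Gamma>"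
    and deg_coset: "h \<in> H \<Longrightarrow> \<phi> (deg h) = N #>\<^bsub>G\<^esub> h"
    and deg_inj: "\<lbrakk>h \<in> H; k \<in> H; N #>\<^bsub>G\<^esub> h = N #>\<^bsub>G\<^esub> k\<rbrakk> \<Longrightarrow> deg h = deg k"
begin

definition K where "K = N <#>\<^bsub>G\<^esub> H"

abbreviation "C \<equiv> corner e (GA K)"
abbreviation "B \<equiv> corner e (GA N)"
abbreviation \<C> where "\<C> x \<equiv> supported_on \<O> C (\<phi> x)"

lemma N_sub: "n \<in> N \<Longrightarrow> n \<in> carrier G" and H_sub: "h \<in> H \<Longrightarrow> h \<in> carrier G"
  using N H by (auto dest: subgroup.subset)

lemma K_mem: "k \<in> K \<longleftrightarrow> (\<exists>n\<in>N. \<exists>h\<in>H. k = n \<otimes>\<^bsub>G\<^esub> h)"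
  by (auto simp: K_def set_mult_def)

lemma coset_mem: "h \<in> H \<Longrightarrow> x \<in> \<phi> (deg h) \<longleftrightarrow> (\<exists>n\<in>N. x = n \<otimes>\<^bsub>G\<^esub> h)"
  by (auto simp: deg_coset r_coset_def)

lemma K_subgroup: "subgroup K G"
  unfolding K_def by (rule G.commuting_subgroup[OF N H NH_comm])

lemma K_sub: "k \<in> K \<Longrightarrow> k \<in> carrier G"
  using K_subgroup by (auto dest: subgroup.subset)

lemma N_K: "N \<subseteq> K" and H_K: "H \<subseteq> K"
proof -
  have "\<one>\<^bsub>G\<^esub> \<in> N" "\<one>\<^bsub>G\<^esub> \<in> H" using N H by (auto intro: subgroup.one_closed)
  then show "N \<subseteq> K" "H \<subseteq> K" unfolding subset_iff K_mem using N_sub H_sub by (metis G.r_one, metis G.l_one)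
qed

lemma GG_K: "f \<in> carrier (GA K) \<Longrightarrow> f \<in> carrier GG"
  by (rule GA_mono[OF subsetI[OF K_sub]])

lemma GK_N: "f \<in> carrier (GA N) \<Longrightarrow> f \<in> carrier (GA K)"
  by (rule GA_mono[OF N_K])

lemma GG_N: "f \<in> carrier (GA N) \<Longrightarrow> f \<in> carrier GG"
  by (rule GG_K[OF GK_N])

lemmas K_mult = GA_mult[OF K_subgroup] and N_mult = GA_mult[OF N]
lemmas K_conv_closed = GA_conv_closed[OF K_subgroup]

lemma \<phi>_sub: assumes "x \<in> carrier \<Gamma>" shows "\<phi> x \<subseteq> K"
proof -
  obtain h where "h \<in> H" "x = deg h" using assms deg_surj by blast
  then show ?thesis by (metis coset_mem K_mem subsetI)
qed

lemma \<phi>_one: "\<phi> \<one>\<^bsub>\<Gamma>\<^esub> = N"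
proof -
  have 1: "\<one>\<^bsub>G\<^esub> \<in> H" using H by (rule subgroup.one_closed)
  have "group_hom (G\<lparr>carrier := H\<rparr>) \<Gamma> deg"
    using H deg_hom by (intro group_hom.intro group_hom_axioms.intro G.subgroup_imp_group D.group_axioms)
  then have "deg \<one>\<^bsub>G\<^esub> = \<one>\<^bsub>\<Gamma>\<^esub>" using group_hom.hom_one by fastforce
  then show ?thesis using deg_coset[OF 1] G.coset_mult_one[OF subsetI[OF N_sub]] by simp
qed

lemma \<phi>_disjoint:
  assumes "x \<in> carrier \<Gamma>" "y \<in> carrier \<Gamma>" "g \<in> \<phi> x" "g \<in> \<phi> y" shows "x = y"
proof -
  obtain h k where hk: "h \<in> H" "x = deg h" "k \<in> H" "y = deg k" using assms deg_surj by blast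
  have "N #>\<^bsub>G\<^esub> h = N #>\<^bsub>G\<^esub> g" by (rule G.repr_independence[OF _ H_sub N]) (use hk assms in \<open>simp_all add: deg_coset\<close>)
  moreover have "N #>\<^bsub>G\<^esub> k = N #>\<^bsub>G\<^esub> g" by (rule G.repr_independence[OF _ H_sub N]) (use hk assms in \<open>simp_all add: deg_coset\<close>)
  ultimately have "N #>\<^bsub>G\<^esub> h = N #>\<^bsub>G\<^esub> k" by simp
  then show ?thesis using hk deg_inj[of h k] by simp
qed

lemma \<phi>_mult:
  assumes "x \<in> carrier \<Gamma>" "y \<in> carrier \<Gamma>" "g \<in> \<phi> x" "g' \<in> \<phi> y"
  shows "g \<otimes>\<^bsub>G\<^esub> g' \<in> \<phi> (x \<otimes>\<^bsub>\<Gamma>\<^esub> y)"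
proof -
  obtain h k where hk: "h \<in> H" "x = deg h" "k \<in> H" "y = deg k" using assms deg_surj by blast
  then obtain n m where nm: "n \<in> N" "g = n \<otimes>\<^bsub>G\<^esub> h" "m \<in> N" "g' = m \<otimes>\<^bsub>G\<^esub> k"
    using assms(3,4) by (auto simp: coset_mem)
  have "h \<otimes>\<^bsub>G\<^esub> (m \<otimes>\<^bsub>G\<^esub> k) = m \<otimes>\<^bsub>G\<^esub> (h \<otimes>\<^bsub>G\<^esub> k)"
    using NH_comm[OF nm(3) hk(1)] N_sub[OF nm(3)] H_sub[OF hk(1)] H_sub[OF hk(3)]
    by (simp add: G.m_assoc[symmetric])
  then have "g \<otimes>\<^bsub>G\<^esub> g' = (n \<otimes>\<^bsub>G\<^esub> m) \<otimes>\<^bsub>G\<^esub> (h \<otimes>\<^bsub>G\<^esub> k)"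
    using nm hk N_sub H_sub by (simp add: G.m_assoc)
  moreover have "n \<otimes>\<^bsub>G\<^esub> m \<in> N" "h \<otimes>\<^bsub>G\<^esub> k \<in> H"
    using N H nm hk by (simp_all add: subgroup.m_closed)
  moreover have "deg (h \<otimes>\<^bsub>G\<^esub> k) = x \<otimes>\<^bsub>\<Gamma>\<^esub> y" using deg_hom hk by (auto simp: hom_def)
  ultimately show ?thesis using coset_mem[of "h \<otimes>\<^bsub>G\<^esub> k"] by auto
qed

text \<open>The two convolutions evaluate \<open>f\<close> at \<open>x\<close> divided by
  \<open>h\<close> from the left and from the right. If one of these points lies in
  \<open>N\<close>, it commutes with \<open>h\<close> and the two coincide; otherwise
  \<open>f\<close> vanishes at both.\<close>

lemma delta_H_comm:
  assumes f: "f \<in> carrier (GA N)" and h: "h \<in> H"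
  shows "conv (delta \<one>\<^bsub>\<O>\<^esub> h) f = conv f (delta \<one>\<^bsub>\<O>\<^esub> h)"
proof -
  have eq: "f (inv\<^bsub>G\<^esub> h \<otimes>\<^bsub>G\<^esub> x) = f (x \<otimes>\<^bsub>G\<^esub> inv\<^bsub>G\<^esub> h)" if x: "x \<in> carrier G" for x
  proof -
    have h': "inv\<^bsub>G\<^esub> h \<in> H" using H h by (simp add: subgroup.m_inv_closed)
    have 1: "inv\<^bsub>G\<^esub> h \<otimes>\<^bsub>G\<^esub> x = x \<otimes>\<^bsub>G\<^esub> inv\<^bsub>G\<^esub> h" if n: "x \<otimes>\<^bsub>G\<^esub> inv\<^bsub>G\<^esub> h \<in> N"
    proof -
      have "h \<otimes>\<^bsub>G\<^esub> (x \<otimes>\<^bsub>G\<^esub> inv\<^bsub>G\<^esub> h) = x"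
        using NH_comm[OF n h] x H_sub[OF h] by (simp add: G.m_assoc)
      then show ?thesis using x H_sub[OF h] by (metis G.inv_solve_left G.inv_closed G.m_closed)
    qed
    have 2: "inv\<^bsub>G\<^esub> h \<otimes>\<^bsub>G\<^esub> x = x \<otimes>\<^bsub>G\<^esub> inv\<^bsub>G\<^esub> h" if n: "inv\<^bsub>G\<^esub> h \<otimes>\<^bsub>G\<^esub> x \<in> N"
    proof -
      have "(inv\<^bsub>G\<^esub> h \<otimes>\<^bsub>G\<^esub> x) \<otimes>\<^bsub>G\<^esub> h = x"
        using NH_comm[OF n h] x H_sub[OF h] by (simp add: G.m_assoc[symmetric])
      then show ?thesis using x H_sub[OF h] by (metis G.inv_solve_right G.inv_closed G.m_closed)
    qed
    show ?thesis using 1 2 GA_outside[OF f] by metis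
  qed
  show ?thesis
    using eq GA_closed[OF f]
    by (simp add: conv_delta_l[OF _ H_sub[OF h] GG_N[OF f]] conv_delta_r[OF _ H_sub[OF h] GG_N[OF f]] fun_eq_iff
        del: group_algebra_simps)
qed

lemma delta_K:
  assumes "r \<in> carrier \<O>" "n \<in> N" "h \<in> H"
  shows "delta r (n \<otimes>\<^bsub>G\<^esub> h) = conv (delta r n) (delta \<one>\<^bsub>\<O>\<^esub> h)"
  using assms N_sub H_sub by (simp add: delta_mult)

text \<open>A point mass on \<open>K\<close> is the product of one on \<open>N\<close>, which
  commutes with \<open>e\<close> because \<open>e\<close> is central there, and of one on
  \<open>H\<close>, which commutes with everything supported on \<open>N\<close>.\<close>

lemma e_central:
  assumes f: "f \<in> carrier (GA K)" shows "conv e f = conv f e"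
proof (rule GA_hom_eq[where f = "conv e" and f' = "\<lambda>f. conv f e", OF subsetI[OF K_sub] _ _ GA_abelian _ f])
  have add: "f \<oplus>\<^bsub>GA K\<^esub> g = f \<oplus>\<^bsub>GG\<^esub> g" for f g by simp
  show "conv e \<in> add_hom (GA K) GG" "(\<lambda>f. conv f e) \<in> add_hom (GA K) GG"
    by (rule add_homI; simp only: add GG_K GG_N e_closed conv_closed conv_add_l conv_add_r)+
  fix r g assume r: "r \<in> carrier \<O>" and "g \<in> K"
  then obtain n h where nh: "n \<in> N" "h \<in> H" "g = n \<otimes>\<^bsub>G\<^esub> h" by (auto simp: K_mem)
  let ?d = "delta r n" and ?k = "delta \<one>\<^bsub>\<O>\<^esub> h"
  have d: "?d \<in> carrier (GA N)" "?k \<in> carrier GG"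
    using r nh H_sub by (simp_all only: delta_GA O.one_closed)
  note c = GG_N[OF e_closed] GG_N[OF d(1)] d(2)
  have "conv e (conv ?d ?k) = conv (conv ?d e) ?k" by (simp only: conv_assoc[OF c(1,2,3), symmetric] e_comm[OF d(1)])
  also have "\<dots> = conv (conv ?d ?k) e"
    by (simp only: conv_assoc[OF c(2,1,3)] conv_assoc[OF c(2,3,1)] delta_H_comm[OF e_closed nh(2)])
  finally show "conv e (delta r g) = conv (delta r g) e" using nh r by (simp only: delta_K)
qed

lemma e_K: "e \<in> carrier (GA K)" and e_GG: "e \<in> carrier GG"
  using GK_N GG_N e_closed by blast+

lemma e_idem_K: "e \<otimes>\<^bsub>GA K\<^esub> e = e" and e_idem_N: "e \<otimes>\<^bsub>GA N\<^esub> e = e"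
  by (simp_all only: K_mult[OF e_K e_K] N_mult[OF e_closed e_closed] e_idem)

lemma C_mem: "f \<in> carrier C \<longleftrightarrow> f \<in> carrier (GA K) \<and> conv e f = f"
  unfolding corner_carrier[OF GA_algebra[OF K_subgroup] e_K e_idem_K]
  using K_mult[OF e_K] by (auto simp del: group_algebra_simps)

lemma B_mem: "f \<in> carrier B \<longleftrightarrow> f \<in> carrier (GA N) \<and> conv e f = f"
  unfolding corner_carrier[OF GA_algebra[OF N] e_closed e_idem_N]
  using N_mult[OF e_closed] by (auto simp del: group_algebra_simps)

lemma C_algebra: "assoc_algebra \<O> C"
  by (rule corner_algebra[OF GA_algebra[OF K_subgroup] e_K e_idem_K])
     (simp only: K_mult e_K e_central)

lemma B_algebra: "assoc_algebra \<O> B"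
  by (rule corner_algebra[OF GA_algebra[OF N] e_closed e_idem_N])
     (simp only: N_mult e_closed e_comm)

lemma C_mult: "\<lbrakk>f \<in> carrier C; g \<in> carrier C\<rbrakk> \<Longrightarrow> f \<otimes>\<^bsub>C\<^esub> g = conv f g"
  by (simp only: corner_simps C_mem K_mult)

lemma B_mult: "\<lbrakk>f \<in> carrier B; g \<in> carrier B\<rbrakk> \<Longrightarrow> f \<otimes>\<^bsub>B\<^esub> g = conv f g"
  by (simp only: corner_simps B_mem N_mult)

section \<open>The grading of the corner algebra by cosets\<close>

lemma supported_mem: "f \<in> supported_on \<O> A U \<longleftrightarrow> f \<in> carrier A \<and> (\<forall>x. x \<notin> U \<longrightarrow> f x = \<zero>\<^bsub>\<O>\<^esub>)"
  by (simp add: supported_on_def)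

lemma comp_mem:
  assumes x: "x \<in> carrier \<Gamma>"
  shows "f \<in> \<C> x \<longleftrightarrow> f \<in> carrier (GA (\<phi> x)) \<and> conv e f = f"
proof
  assume "f \<in> \<C> x"
  then have f: "f \<in> carrier (GA K)" "conv e f = f" and z: "\<And>g. g \<notin> \<phi> x \<Longrightarrow> f g = \<zero>\<^bsub>\<O>\<^esub>"
    unfolding supported_mem C_mem by blast+
  show "f \<in> carrier (GA (\<phi> x)) \<and> conv e f = f"
    by (intro conjI f(2) GA_I GA_closed[OF f(1)] z)
next
  assume f: "f \<in> carrier (GA (\<phi> x)) \<and> conv e f = f"
  show "f \<in> \<C> x"
    unfolding supported_mem C_mem
    using f GA_mono[OF \<phi>_sub[OF x]] GA_outside by blast
qed

lemma conv_grade: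
  assumes x: "x \<in> carrier \<Gamma>" and y: "y \<in> carrier \<Gamma>" and f: "f \<in> carrier (GA (\<phi> x))" and g: "g \<in> carrier (GA (\<phi> y))"
  shows "conv f g \<in> carrier (GA (\<phi> (x \<otimes>\<^bsub>\<Gamma>\<^esub> y)))"
proof (rule GA_I)
  have "f \<in> carrier GG" "g \<in> carrier GG"
    using GG_K GA_mono[OF \<phi>_sub[OF x] f] GA_mono[OF \<phi>_sub[OF y] g] by blast+
  then show "conv f g z \<in> carrier \<O>" for z using conv_closed GA_closed by blast
  fix z assume z: "z \<notin> \<phi> (x \<otimes>\<^bsub>\<Gamma>\<^esub> y)"
  have "f k \<otimes>\<^bsub>\<O>\<^esub> g (inv\<^bsub>G\<^esub> k \<otimes>\<^bsub>G\<^esub> z) = \<zero>\<^bsub>\<O>\<^esub>" if k: "k \<in> carrier G" and zG: "z \<in> carrier G" for k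
  proof (cases "k \<in> \<phi> x")
    case True
    have "inv\<^bsub>G\<^esub> k \<otimes>\<^bsub>G\<^esub> z \<notin> \<phi> y"
    proof
      assume "inv\<^bsub>G\<^esub> k \<otimes>\<^bsub>G\<^esub> z \<in> \<phi> y"
      then have "k \<otimes>\<^bsub>G\<^esub> (inv\<^bsub>G\<^esub> k \<otimes>\<^bsub>G\<^esub> z) \<in> \<phi> (x \<otimes>\<^bsub>\<Gamma>\<^esub> y)" by (rule \<phi>_mult[OF x y True])
      then show False using z k zG by (simp add: G.m_assoc[symmetric])
    qed
    then show ?thesis using GA_closed[OF f] GA_outside[OF g] by simp
  qed (use GA_closed[OF g] GA_outside[OF f] in simp)
  then show "conv f g z = \<zero>\<^bsub>\<O>\<^esub>" by (auto simp: conv_def intro: O.add.finprod_one_eqI)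
qed

lemma conv_e_comp:
  assumes x: "x \<in> carrier \<Gamma>" and f: "f \<in> carrier (GA (\<phi> x))" shows "conv e f \<in> \<C> x"
proof -
  have "conv e f \<in> carrier (GA (\<phi> x))"
    using conv_grade[OF D.one_closed x _ f, of e] e_closed x by (simp only: \<phi>_one D.l_one)
  moreover have "conv e (conv e f) = conv e f"
    using conv_assoc[OF e_GG e_GG GG_K[OF GA_mono[OF \<phi>_sub[OF x] f]]] by (simp only: e_idem)
  ultimately show ?thesis using comp_mem[OF x] by blast
qed

text \<open>The projection onto the component of degree \<open>x\<close>, as required by
  \<open>direct_sumI\<close>.\<close>

definition cut where "cut x f = (\<lambda>g. if g \<in> \<phi> x then f g else \<zero>\<^bsub>\<O>\<^esub>)"

lemma cut_GA: "f \<in> carrier (GA K) \<Longrightarrow> cut x f \<in> carrier (GA (\<phi> x))"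
  using GA_closed[of f K] by (intro GA_I) (simp_all add: cut_def del: group_algebra_simps)

text \<open>\<open>e\<close> is supported on \<open>N\<close>, and translation by an element of
  \<open>N\<close> maps the coset \<open>\<phi> x\<close> to itself. Hence cutting preserves the
  corner.\<close>

lemma conv_e_cut:
  assumes x: "x \<in> carrier \<Gamma>" and f: "f \<in> carrier (GA K)"
  shows "conv e (cut x f) = cut x (conv e f)"
proof
  fix g
  obtain h where h: "h \<in> H" "x = deg h" using x deg_surj by blast
  have *: "inv\<^bsub>G\<^esub> n \<otimes>\<^bsub>G\<^esub> g \<in> \<phi> x \<longleftrightarrow> g \<in> \<phi> x" if g: "g \<in> carrier G" and n: "n \<in> N" for n
  proof -
    have 1: "n \<in> \<phi> \<one>\<^bsub>\<Gamma>\<^esub>" "inv\<^bsub>G\<^esub> n \<in> \<phi> \<one>\<^bsub>\<Gamma>\<^esub>" using n N by (simp_all add: \<phi>_one subgroup.m_inv_closed)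
    have "n \<otimes>\<^bsub>G\<^esub> (inv\<^bsub>G\<^esub> n \<otimes>\<^bsub>G\<^esub> g) = g" using g N_sub[OF n] by (simp add: G.m_assoc[symmetric])
    then show ?thesis using \<phi>_mult[OF D.one_closed x 1(1)] \<phi>_mult[OF D.one_closed x 1(2)] x by (metis D.l_one)
  qed
  have "e n \<otimes>\<^bsub>\<O>\<^esub> cut x f (inv\<^bsub>G\<^esub> n \<otimes>\<^bsub>G\<^esub> g) = (if g \<in> \<phi> x then e n \<otimes>\<^bsub>\<O>\<^esub> f (inv\<^bsub>G\<^esub> n \<otimes>\<^bsub>G\<^esub> g) else \<zero>\<^bsub>\<O>\<^esub>)"
    if g: "g \<in> carrier G" for n
  proof (cases "n \<in> N")
    case True
    then show ?thesis using *[OF g True] GA_closed[OF e_closed] by (simp add: cut_def)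
  next
    case False
    then show ?thesis using GA_outside[OF e_closed False] GA_closed[OF f] by (simp add: cut_def)
  qed
  moreover have "g \<in> carrier G" if "g \<in> \<phi> x" using that \<phi>_sub[OF x] K_sub by blast
  ultimately show "conv e (cut x f) g = cut x (conv e f) g"
    by (cases "g \<in> carrier G") (auto simp: conv_def cut_def[of x "conv e f"] cut_def[of x "\<lambda>x. if _ x then _ x else _"])
qed

lemma C_abelian: "abelian_group C"
proof -
  interpret assoc_algebra \<O> C by (rule C_algebra)
  show ?thesis by (rule abelian_group_axioms)
qed

lemma comp_subset: "f \<in> \<C> x \<Longrightarrow> f \<in> carrier C"
  by (simp only: supported_mem)

lemma cut_comp: "\<lbrakk>x \<in> carrier \<Gamma>; f \<in> carrier C\<rbrakk> \<Longrightarrow> cut x f \<in> \<C> x"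
  by (simp only: comp_mem C_mem cut_GA conv_e_cut simp_thms)

lemma cut_hom: assumes x: "x \<in> carrier \<Gamma>" shows "cut x \<in> add_hom C C"
proof (rule add_homI)
  show "cut x f \<in> carrier C" if "f \<in> carrier C" for f
    using cut_comp[OF x that] by (rule comp_subset)
  show "cut x (f \<oplus>\<^bsub>C\<^esub> g) = cut x f \<oplus>\<^bsub>C\<^esub> cut x g" for f g
    by (auto simp: cut_def)
qed

lemma cut_part:
  assumes x: "x \<in> carrier \<Gamma>" and y: "y \<in> carrier \<Gamma>" and f: "f \<in> \<C> y"
  shows "cut x f = (if x = y then f else \<zero>\<^bsub>C\<^esub>)"
proof
  fix g
  have "f g = \<zero>\<^bsub>\<O>\<^esub>" if "g \<notin> \<phi> y" using f that unfolding supported_mem by blast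
  then show "cut x f g = (if x = y then f else \<zero>\<^bsub>C\<^esub>) g"
    using \<phi>_disjoint[OF x y, of g] by (auto simp: cut_def)
qed

lemma comp_subgroup: assumes x: "x \<in> carrier \<Gamma>" shows "additive_subgroup (\<C> x) C"
proof -
  have "\<C> x = cut x ` carrier C"
  proof (intro equalityI subsetI)
    fix f assume f: "f \<in> \<C> x"
    then show "f \<in> cut x ` carrier C" using cut_part[OF x x f] comp_subset by force
  qed (use cut_comp[OF x] in blast)
  then show ?thesis
    using group_hom.img_is_subgroup[OF add_hom_group_hom[OF cut_hom[OF x] C_abelian C_abelian]]
    by (simp add: additive_subgroup_def)
qed

lemma conv_e_hom: "conv e \<in> add_hom (GA K) C"
proof (rule add_homI)
  fix f assume f: "f \<in> carrier (GA K)"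
  have "conv e (conv e f) = conv e f"
    using conv_assoc[OF e_GG e_GG GG_K[OF f]] by (simp only: e_idem)
  then show "conv e f \<in> carrier C" using K_conv_closed[OF e_K f] by (simp only: C_mem)
next
  fix f g assume "f \<in> carrier (GA K)" "g \<in> carrier (GA K)"
  note fg = this[THEN GG_K]
  have "f \<oplus>\<^bsub>GA K\<^esub> g = f \<oplus>\<^bsub>GG\<^esub> g" by simp
  moreover have "conv e f \<oplus>\<^bsub>C\<^esub> conv e g = conv e f \<oplus>\<^bsub>GG\<^esub> conv e g" by simp
  ultimately show "conv e (f \<oplus>\<^bsub>GA K\<^esub> g) = conv e f \<oplus>\<^bsub>C\<^esub> conv e g"
    by (simp only: conv_add_r[OF fg e_GG])
qed

text \<open>The corner is the image of the group algebra under multiplication by \<open>e\<close>,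
  and a point mass is sent into the component of its coset.\<close>

lemma C_span: "carrier C \<subseteq> add_span C (\<Union>x\<in>carrier \<Gamma>. \<C> x)"
proof
  interpret abelian_group C by (rule C_abelian)
  let ?D = "{delta r g | r g. r \<in> carrier \<O> \<and> g \<in> K}"
  have D: "?D \<subseteq> carrier (GA K)" using delta_GA by blast
  have sub: "conv e ` ?D \<subseteq> (\<Union>x\<in>carrier \<Gamma>. \<C> x)"
  proof
    fix t assume "t \<in> conv e ` ?D"
    then obtain r n h where r: "r \<in> carrier \<O>" and nh: "n \<in> N" "h \<in> H" and t: "t = conv e (delta r (n \<otimes>\<^bsub>G\<^esub> h))"
      by (auto simp only: K_mem)
    have x: "deg h \<in> carrier \<Gamma>" using deg_surj nh by blast
    have "n \<otimes>\<^bsub>G\<^esub> h \<in> \<phi> (deg h)" using nh by (auto simp: coset_mem)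
    then have "t \<in> \<C> (deg h)" unfolding t by (intro conv_e_comp x delta_GA r)
    then show "t \<in> (\<Union>x\<in>carrier \<Gamma>. \<C> x)" using x by blast
  qed
  fix f assume "f \<in> carrier C"
  then have f: "f \<in> carrier (GA K)" "conv e f = f" by (simp_all only: C_mem)
  have sp: "carrier (GA K) = add_span (GA K) ?D" by (rule GA_span[OF subsetI[OF K_sub]])
  have "f \<in> conv e ` carrier (GA K)" by (rule image_eqI[where x = f]) (simp_all only: f)
  also have "\<dots> = add_span C (conv e ` ?D)"
    by (subst sp) (rule add_hom_span_image[OF conv_e_hom GA_abelian C_abelian D])
  also have "\<dots> \<subseteq> add_span C (\<Union>x\<in>carrier \<Gamma>. \<C> x)"
    by (rule group.mono_generate[OF a_group sub])
  finally show "f \<in> add_span C (\<Union>x\<in>carrier \<Gamma>. \<C> x)" .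
qed

lemma finite_\<Gamma>: "finite (carrier \<Gamma>)"
  unfolding deg_surj[symmetric] using finite_subset[OF subsetI[OF H_sub] fin] by simp

lemma C_graded: "graded_algebra \<O> \<Gamma> C \<C>"
proof (intro graded_algebra.intro graded_algebra_axioms.intro C_algebra D.group_axioms finite_\<Gamma>)
  show "direct_sum C (carrier \<Gamma>) \<C>"
    by (rule direct_sumI[OF C_abelian finite_\<Gamma> comp_subgroup C_span cut_hom cut_part])
next
  interpret assoc_algebra \<O> C by (rule C_algebra)
  fix x r f assume "x \<in> carrier \<Gamma>" and r: "r \<in> carrier \<O>" and f: "f \<in> \<C> x"
  have "r \<odot>\<^bsub>C\<^esub> f \<in> carrier C" using r comp_subset[OF f] by (rule smult_closed)
  moreover have "(r \<odot>\<^bsub>C\<^esub> f) g = \<zero>\<^bsub>\<O>\<^esub>" if "g \<notin> \<phi> x" for g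
    using f r that by (simp add: supported_mem del: group_algebra_simps(1))
  ultimately show "r \<odot>\<^bsub>C\<^esub> f \<in> \<C> x" unfolding supported_mem by blast
next
  fix x y f g assume x: "x \<in> carrier \<Gamma>" and y: "y \<in> carrier \<Gamma>" and f: "f \<in> \<C> x" and g: "g \<in> \<C> y"
  have "conv f g \<in> carrier (GA (\<phi> (x \<otimes>\<^bsub>\<Gamma>\<^esub> y)))"
    using f g by (intro conv_grade x y) (simp_all only: comp_mem x y)
  moreover have "f \<in> carrier GG" "g \<in> carrier GG" "conv e f = f"
    using comp_subset[OF f] comp_subset[OF g] by (simp_all only: C_mem GG_K)
  then have "conv e (conv f g) = conv f g" by (simp only: conv_assoc[OF e_GG, symmetric])
  ultimately show "f \<otimes>\<^bsub>C\<^esub> g \<in> \<C> (x \<otimes>\<^bsub>\<Gamma>\<^esub> y)"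
    using comp_mem[OF D.m_closed[OF x y]] C_mult[OF comp_subset[OF f] comp_subset[OF g]] by simp
qed

abbreviation unit where "unit h \<equiv> conv e (delta \<one>\<^bsub>\<O>\<^esub> h)"

lemma unit_comp: "h \<in> H \<Longrightarrow> unit h \<in> \<C> (deg h)"
proof -
  assume h: "h \<in> H"
  have "\<one>\<^bsub>G\<^esub> \<in> N" using N by (rule subgroup.one_closed)
  then have "h \<in> \<phi> (deg h)" using h H_sub by (auto simp: coset_mem intro!: bexI[of _ "\<one>\<^bsub>G\<^esub>"])
  then show "unit h \<in> \<C> (deg h)" using h deg_surj by (intro conv_e_comp delta_GA) auto
qed

text \<open>The factor \<open>e\<close> of the unit is absorbed by \<open>f\<close>, which
  \<open>e\<close> fixes from either side.\<close>

lemma unit_conv: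
  assumes f: "f \<in> carrier GG" "conv e f = f" and c: "conv e f = conv f e" and h: "h \<in> H"
  shows "conv f (unit h) = conv f (delta \<one>\<^bsub>\<O>\<^esub> h)"
proof -
  have d: "delta \<one>\<^bsub>\<O>\<^esub> h \<in> carrier GG" using H_sub[OF h] by (simp only: delta_GA O.one_closed)
  show ?thesis using conv_assoc[OF f(1) e_GG d] f(2) c by simp
qed

theorem crossed_product_C: "crossed_product \<O> \<Gamma> C \<C> B (G\<lparr>carrier := H\<rparr>) unit deg"
proof (intro crossed_product.intro crossed_product_axioms.intro C_graded B_algebra G.subgroup_imp_group[OF H] deg_hom)
  show B: "carrier B = \<C> \<one>\<^bsub>\<Gamma>\<^esub>"
    by (rule Set.set_eqI) (simp only: B_mem comp_mem[OF D.one_closed, unfolded \<phi>_one] \<phi>_one)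
  show "f \<otimes>\<^bsub>B\<^esub> g = f \<otimes>\<^bsub>C\<^esub> g" if "f \<in> carrier B" "g \<in> carrier B" for f g
    using that comp_subset B by (simp only: B_mult C_mult)
  show "deg ` carrier (G\<lparr>carrier := H\<rparr>) = carrier \<Gamma>" by (simp add: deg_surj)
  show "unit h \<in> \<C> (deg h)" if "h \<in> carrier (G\<lparr>carrier := H\<rparr>)" for h
    using that by (simp add: unit_comp del: group_algebra_simps corner_simps)
  have uC: "unit h \<in> carrier C" if "h \<in> H" for h using unit_comp[OF that] by (rule comp_subset)
  have d: "delta \<one>\<^bsub>\<O>\<^esub> h \<in> carrier GG" if "h \<in> H" for h using H_sub[OF that] by (simp only: delta_GA O.one_closed)
  show "unit (g \<otimes>\<^bsub>G\<lparr>carrier := H\<rparr>\<^esub> h) = unit g \<otimes>\<^bsub>C\<^esub> unit h"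
    if "g \<in> carrier (G\<lparr>carrier := H\<rparr>)" "h \<in> carrier (G\<lparr>carrier := H\<rparr>)" for g h
  proof -
    have gh: "g \<in> H" "h \<in> H" using that by simp_all
    have u: "unit g \<in> carrier (GA K)" "conv e (unit g) = unit g" using uC[OF gh(1)] by (simp_all only: C_mem)
    have "unit g \<otimes>\<^bsub>C\<^esub> unit h = conv (unit g) (delta \<one>\<^bsub>\<O>\<^esub> h)"
      unfolding C_mult[OF uC[OF gh(1)] uC[OF gh(2)]]
      by (rule unit_conv[OF GG_K[OF u(1)] u(2) e_central[OF u(1)] gh(2)])
    also have "\<dots> = conv e (conv (delta \<one>\<^bsub>\<O>\<^esub> g) (delta \<one>\<^bsub>\<O>\<^esub> h))"
      by (rule conv_assoc[OF e_GG d[OF gh(1)] d[OF gh(2)]])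
    also have "\<dots> = unit (g \<otimes>\<^bsub>G\<^esub> h)" using gh by (simp add: delta_mult H_sub)
    finally show ?thesis by simp
  qed
  show "unit \<one>\<^bsub>G\<lparr>carrier := H\<rparr>\<^esub> = \<one>\<^bsub>C\<^esub>" using conv_one(2)[OF e_GG] by simp
  show "unit h \<otimes>\<^bsub>C\<^esub> f = f \<otimes>\<^bsub>C\<^esub> unit h" if "h \<in> carrier (G\<lparr>carrier := H\<rparr>)" "f \<in> carrier B" for h f
  proof -
    have h: "h \<in> H" using that(1) by simp
    have f: "f \<in> carrier (GA N)" "conv e f = f" using that(2) by (simp_all only: B_mem)
    have fC: "f \<in> carrier C" using that(2) unfolding B by (rule comp_subset)
    have "unit h \<otimes>\<^bsub>C\<^esub> f = conv e (conv (delta \<one>\<^bsub>\<O>\<^esub> h) f)"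
      unfolding C_mult[OF uC[OF h] fC] by (rule conv_assoc[OF e_GG d[OF h] GG_N[OF f(1)]])
    also have "\<dots> = conv (conv e f) (delta \<one>\<^bsub>\<O>\<^esub> h)"
      unfolding delta_H_comm[OF f(1) h] by (rule conv_assoc[OF e_GG GG_N[OF f(1)] d[OF h], symmetric])
    also have "\<dots> = conv f (unit h)"
      using unit_conv[OF GG_N[OF f(1)] f(2) e_comm[OF f(1)] h] f(2) by simp
    finally show ?thesis by (simp only: C_mult[OF fC uC[OF h]])
  qed
qed simp_all

end

section \<open>The centraliser as a group of degrees\<close>

lemma (in group) centralizer_subgroup:
  assumes "N \<subseteq> carrier G" shows "subgroup (centralizer G N) G"
proof (rule subgroupI)
  have "\<one> \<in> centralizer G N" using assms by (auto simp: centralizer_def)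
  then show "centralizer G N \<noteq> {}" by blast
  fix a assume a: "a \<in> centralizer G N"
  then have ac: "a \<in> carrier G" by (simp add: centralizer_def)
  have "inv a \<otimes> n = n \<otimes> inv a" if "n \<in> N" for n
  proof -
    have n: "n \<in> carrier G" "a \<otimes> n = n \<otimes> a" using assms a that by (auto simp: centralizer_def)
    have "inv a \<otimes> n = inv a \<otimes> (n \<otimes> a) \<otimes> inv a" using n(1) ac by (simp add: m_assoc)
    also have "\<dots> = n \<otimes> inv a" using n(1) ac by (simp add: n(2)[symmetric] m_assoc[symmetric])
    finally show ?thesis .
  qed
  then show "inv a \<in> centralizer G N" using ac by (simp add: centralizer_def)
  fix b assume b: "b \<in> centralizer G N"
  have "a \<otimes> b \<otimes> n = n \<otimes> (a \<otimes> b)" if "n \<in> N" for n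
  proof -
    have n: "n \<in> carrier G" "a \<otimes> n = n \<otimes> a" "b \<otimes> n = n \<otimes> b" "b \<in> carrier G"
      using assms a b that by (auto simp: centralizer_def)
    have "a \<otimes> b \<otimes> n = a \<otimes> (n \<otimes> b)" using n(1,4) ac by (simp add: m_assoc n(3))
    also have "\<dots> = (n \<otimes> a) \<otimes> b" using n(1,4) ac by (simp add: m_assoc[symmetric] n(2))
    also have "\<dots> = n \<otimes> (a \<otimes> b)" using n(1,4) ac by (simp add: m_assoc)
    finally show ?thesis .
  qed
  then show "a \<otimes> b \<in> centralizer G N" using ac b by (simp add: centralizer_def)
qed (simp add: centralizer_def subset_iff)

text \<open>A coset absorbs its factor from \<open>N\<close>, so every class of the quotient
  contains an element of the centraliser. This gives the surjective degree map that a crossed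
  product asks for.\<close>

lemma (in group) centralizer_quotient:
  assumes N: "N \<lhd> G"
  shows "group (centralizer_quotient G N)"
    and "(\<lambda>g. N #> g) \<in> hom (G\<lparr>carrier := centralizer G N\<rparr>) (centralizer_quotient G N)"
    and "(\<lambda>g. N #> g) ` centralizer G N = carrier (centralizer_quotient G N)"
    and "\<one>\<^bsub>centralizer_quotient G N\<^esub> = N"
proof -
  interpret N: normal N G by fact
  let ?H = "centralizer G N"
  have H: "subgroup ?H G" by (rule centralizer_subgroup[OF N.subset])
  have H_sub: "h \<in> carrier G" if "h \<in> ?H" for h using that by (simp add: centralizer_def)
  have K: "subgroup (N <#> ?H) G"
    by (rule commuting_subgroup[OF N.subgroup_axioms H]) (simp add: centralizer_def)
  have NK: "N \<subseteq> N <#> ?H"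
  proof
    fix n assume n: "n \<in> N"
    then have "n = n \<otimes> \<one>" by (simp add: N.mem_carrier)
    then show "n \<in> N <#> ?H" using n subgroup.one_closed[OF H] unfolding set_mult_def by blast
  qed
  show "group (centralizer_quotient G N)"
    unfolding centralizer_quotient_def by (rule normal.factorgroup_is_group[OF normal_restrict_supergroup[OF K N NK]])
  have absorb: "N #> (n \<otimes> h) = N #> h" if "n \<in> N" "h \<in> ?H" for n h
    using that H_sub by (simp add: coset_mult_assoc[symmetric] N.subset N.subgroup_axioms coset_join2)
  have HK: "h \<in> N <#> ?H" if h: "h \<in> ?H" for h
  proof -
    have "h = \<one> \<otimes> h" using H_sub[OF h] by simp
    then show ?thesis using h N.one_closed unfolding set_mult_def by blast
  qed
  have "(\<lambda>g. N #> g) ` (N <#> ?H) = (\<lambda>g. N #> g) ` ?H"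
  proof (intro equalityI image_subsetI)
    fix g assume "g \<in> N <#> ?H"
    then obtain n h where "n \<in> N" "h \<in> ?H" "g = n \<otimes> h" by (auto simp: set_mult_def)
    then show "N #> g \<in> (\<lambda>g. N #> g) ` ?H" using absorb by blast
  qed (use HK in blast)
  moreover have "carrier (centralizer_quotient G N) = (\<lambda>g. N #> g) ` (N <#> ?H)"
    by (auto simp: centralizer_quotient_def FactGroup_def RCOSETS_def r_coset_def)
  ultimately show img: "(\<lambda>g. N #> g) ` ?H = carrier (centralizer_quotient G N)" by (simp only:)
  have mult: "monoid.mult (centralizer_quotient G N) = (<#>)"
    by (auto simp: centralizer_quotient_def FactGroup_def set_mult_def fun_eq_iff)
  show "(\<lambda>g. N #> g) \<in> hom (G\<lparr>carrier := ?H\<rparr>) (centralizer_quotient G N)"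
    by (rule homI) (use img H_sub in \<open>auto simp: mult N.rcos_sum\<close>)
  show "\<one>\<^bsub>centralizer_quotient G N\<^esub> = N"
    by (simp add: centralizer_quotient_def FactGroup_def)
qed

lemma (in finite_group_algebra) block_idempotent_conv:
  assumes N: "subgroup N G" and b: "block_idempotent (GA N) b"
  shows "b \<in> carrier (GA N)" and "conv b b = b" and "f \<in> carrier (GA N) \<Longrightarrow> conv b f = conv f b"
proof -
  have b': "b \<in> carrier (GA N)" "b \<otimes>\<^bsub>GA N\<^esub> b = b" "\<And>f. f \<in> carrier (GA N) \<Longrightarrow> b \<otimes>\<^bsub>GA N\<^esub> f = f \<otimes>\<^bsub>GA N\<^esub> b"
    using b unfolding block_idempotent_def central_idempotent_def center_def by blast+
  show "b \<in> carrier (GA N)" by (rule b'(1))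
  show "conv b b = b" using b'(2) by (simp only: GA_mult[OF N b'(1) b'(1)])
  show "conv b f = conv f b" if f: "f \<in> carrier (GA N)"
    unfolding GA_mult[OF N b'(1) f, symmetric] GA_mult[OF N f b'(1), symmetric] by (rule b'(3)[OF f])
qed

theorem proposition4p2:
  fixes p :: nat
    and K :: "('K, 'kk) ring_scheme" and \<O> :: "('o, 'oo) ring_scheme" and k :: "('r, 'rr) ring_scheme"
    and G :: "('g, 'gg) monoid_scheme" and N G' N' :: "'g set"
    and b b' :: "'g \<Rightarrow> 'o"
    and B B' C C' :: "('o, 'g \<Rightarrow> 'o) module"
    and \<Gamma> :: "'g set monoid" and \<C> \<C>' :: "'g set \<Rightarrow> ('g \<Rightarrow> 'o) set"
    and M :: "('g \<Rightarrow> 'o, 'g \<Rightarrow> 'o, 'm, 'mm) bimodule_scheme"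
  assumes "p_modular_system p K \<O> k"
    and "group G" and "finite (carrier G)"
    and "N \<lhd> G" and "subgroup G' G" and "N' \<lhd> G\<lparr>carrier := G'\<rparr>"
    and "N' = G' \<inter> N" and "carrier G = G' <#>\<^bsub>G\<^esub> N"
    and "block_idempotent (group_algebra \<O> (G\<lparr>carrier := N\<rparr>)) b"
    and "conj_invariant G b"
    and "block_idempotent (group_algebra \<O> (G\<lparr>carrier := N'\<rparr>)) b'"
    and "conj_invariant (G\<lparr>carrier := G'\<rparr>) b'"
    and "B = corner b (group_algebra \<O> (G\<lparr>carrier := N\<rparr>))"
    and "B' = corner b' (group_algebra \<O> (G\<lparr>carrier := N'\<rparr>))"
    and "C = corner b (group_algebra \<O> (G\<lparr>carrier := N <#>\<^bsub>G\<^esub> centralizer G N\<rparr>))"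
    and "C' = corner b' (group_algebra \<O> (G\<lparr>carrier := N' <#>\<^bsub>G\<^esub> centralizer G N\<rparr>))"
    and "\<Gamma> = centralizer_quotient G N"
    and "\<C> = (\<lambda>U. supported_on \<O> C U)"
    and "\<C>' = (\<lambda>U. supported_on \<O> C' (U \<inter> G'))"
    and "bimodule \<O> B B' M"
    and "centralizer G N \<subseteq> G'"
    and "induces_Morita_equivalence \<O> B B' M"
    and "\<forall>m\<in>carrier M. \<forall>z\<in>center (G\<lparr>carrier := N\<rparr>).
      (b \<otimes>\<^bsub>B\<^esub> group_element \<O> z) \<odot>\<^bsub>M\<^esub> m = m \<odot>r\<^bsub>M\<^esub> (b' \<otimes>\<^bsub>B'\<^esub> group_element \<O> z)"
  shows "\<exists>d r l.
    let V = left_induced C B M r; \<V> = left_induced_grading C \<C> B M;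
        W = right_induced C' B' M l; \<W> = right_induced_grading C' \<C>' B' M;
        T = diagonal_induced \<O> \<Gamma> C \<C> C' \<C>' M d;
        \<T> = diagonal_induced_grading \<O> \<Gamma> C \<C> C' \<C>' M d
    in diagonal_extension \<O> \<Gamma> C \<C> C' \<C>' B B' M d \<and>
       graded_bimodule \<O> \<Gamma> C \<C> C' \<C>' V \<V> \<and>
       identity_component \<O> \<Gamma> C \<C> C' \<C>' M d V \<V>
         (\<lambda>m. pure_tensor B (regular C) M \<one>\<^bsub>C\<^esub> m) \<and>
       graded_bimodule \<O> \<Gamma> C \<C> C' \<C>' W \<W> \<and>
       identity_component \<O> \<Gamma> C \<C> C' \<C>' M d W \<W>
         (\<lambda>m. pure_tensor B' M (regular C') m \<one>\<^bsub>C'\<^esub>) \<and>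
       graded_bimodule \<O> \<Gamma> C \<C> C' \<C>' T \<T> \<and>
       (\<exists>h. graded_bimodule_iso \<Gamma> C C' V \<V> W \<W> h) \<and>
       (\<exists>h. graded_bimodule_iso \<Gamma> C C' W \<W> T \<T> h) \<and>
       induces_graded_Morita_equivalence \<O> \<Gamma> C \<C> C' \<C>' V \<V>"
proof -
  interpret G: group G by fact
  interpret N: normal N G by fact
  interpret G': subgroup G' G by fact
  interpret N': normal N' "G\<lparr>carrier := G'\<rparr>" by fact
  have "cring \<O>"
  proof -
    interpret p_modular_system p K \<O> k by fact
    show ?thesis by (rule is_cring)
  qed
  then interpret A: finite_group_algebra G \<O>
    by (intro finite_group_algebra.intro finite_group_algebra_axioms.intro assms)
  \<comment> \<open>Degrees on both sides are cosets of \<open>N\<close>; a coset of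
    \<open>N'\<close> is reached from them by intersecting with \<open>G'\<close>.\<close>
  let ?H = "centralizer G N" and ?deg = "\<lambda>g. N #>\<^bsub>G\<^esub> g"
  have N'_def: "N' = G' \<inter> N" by fact
  have N': "subgroup N' G" using G.incl_subgroup G'.subgroup_axioms N'.subgroup_axioms by blast
  have H: "subgroup ?H G" by (rule G.centralizer_subgroup[OF N.subset])
  have H_sub: "h \<in> carrier G" "h \<in> G'" if "h \<in> ?H" for h
    using that \<open>?H \<subseteq> G'\<close> by (auto simp: centralizer_def)
  note Q = G.centralizer_quotient[OF \<open>N \<lhd> G\<close>]
  interpret D: group \<Gamma> unfolding \<open>\<Gamma> = _\<close> by (rule Q(1))
  have restr: "(N #>\<^bsub>G\<^esub> h) \<inter> G' = N' #>\<^bsub>G\<^esub> h" if h: "h \<in> ?H" for h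
  proof (intro equalityI subsetI)
    fix x assume "x \<in> (N #>\<^bsub>G\<^esub> h) \<inter> G'"
    then obtain n where n: "n \<in> N" "x = n \<otimes>\<^bsub>G\<^esub> h" "x \<in> G'" by (auto simp: r_coset_def)
    then have "x \<otimes>\<^bsub>G\<^esub> inv\<^bsub>G\<^esub> h = n" using H_sub[OF h] N.mem_carrier by (simp add: G.m_assoc)
    moreover have "x \<otimes>\<^bsub>G\<^esub> inv\<^bsub>G\<^esub> h \<in> G'"
      using n(3) H_sub[OF h] by (simp add: G'.m_closed G'.m_inv_closed)
    ultimately show "x \<in> N' #>\<^bsub>G\<^esub> h" using n by (auto simp: N'_def r_coset_def)
  next
    fix x assume "x \<in> N' #>\<^bsub>G\<^esub> h"
    then show "x \<in> (N #>\<^bsub>G\<^esub> h) \<inter> G'" using H_sub[OF h] by (auto simp: N'_def r_coset_def)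
  qed
  \<comment> \<open>A coset of \<open>N'\<close> meeting the centraliser lies in a single coset of
    \<open>N\<close>, so the components of \<open>C'\<close> in different degrees have disjoint
    supports.\<close>
  have inj: "?deg h = ?deg k" if "h \<in> ?H" "k \<in> ?H" "N' #>\<^bsub>G\<^esub> h = N' #>\<^bsub>G\<^esub> k" for h k
  proof -
    have "h \<in> N' #>\<^bsub>G\<^esub> h" using H_sub(1)[OF that(1)] N' by (rule G.rcos_self)
    then have "h \<in> N #>\<^bsub>G\<^esub> k" unfolding that(3) by (auto simp: N'_def r_coset_def)
    then show ?thesis using G.repr_independence[OF _ H_sub(1)[OF that(2)] N.subgroup_axioms] by simp
  qed
  note bN = A.block_idempotent_conv[OF N.subgroup_axioms \<open>block_idempotent _ b\<close>]
  note bN' = A.block_idempotent_conv[OF N' \<open>block_idempotent _ b'\<close>]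
  interpret L: block_extension G \<O> \<Gamma> N ?H b ?deg "\<lambda>U. U"
    by (intro block_extension.intro block_extension_axioms.intro A.finite_group_algebra_axioms D.group_axioms
        N.subgroup_axioms H bN) (use Q in \<open>simp_all add: \<open>\<Gamma> = _\<close> centralizer_def\<close>)
  \<comment> \<open>The degree is still the coset of \<open>N\<close>; \<open>restr\<close>
    identifies the support of the corresponding component as a coset of \<open>N'\<close>, since the
    centraliser lies in \<open>G'\<close>.\<close>
  interpret R: block_extension G \<O> \<Gamma> N' ?H b' ?deg "\<lambda>U. U \<inter> G'"
    by (intro block_extension.intro block_extension_axioms.intro A.finite_group_algebra_axioms D.group_axioms
        N' H bN' restr inj) (use Q in \<open>simp_all add: \<open>\<Gamma> = _\<close> centralizer_def N'_def\<close>)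
  have central: "L.unit z \<odot>\<^bsub>M\<^esub> m = m \<odot>r\<^bsub>M\<^esub> R.unit z" if z: "z \<in> ?H" "?deg z = \<one>\<^bsub>\<Gamma>\<^esub>" and m: "m \<in> carrier M" for z m
  proof -
    \<comment> \<open>A trivial degree places \<open>z\<close> in \<open>N\<close>; as it also
      centralises \<open>N\<close> and lies in \<open>G'\<close>, it belongs to Z(N) and to
      \<open>N'\<close>, so that the hypothesis on central elements applies.\<close>
    have zN: "z \<in> N" using G.rcos_self[OF H_sub(1)[OF z(1)] N.subgroup_axioms] z(2) Q(4) \<open>\<Gamma> = _\<close> by simp
    then have zN': "z \<in> N'" using H_sub[OF z(1)] by (simp add: N'_def)
    have "z \<in> center (G\<lparr>carrier := N\<rparr>)" using zN z(1) by (simp add: center_def centralizer_def)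
    then have "(b \<otimes>\<^bsub>B\<^esub> group_element \<O> z) \<odot>\<^bsub>M\<^esub> m = m \<odot>r\<^bsub>M\<^esub> (b' \<otimes>\<^bsub>B'\<^esub> group_element \<O> z)"
      using assms(23) m by blast
    moreover have "group_element \<O> z = A.delta \<one>\<^bsub>\<O>\<^esub> z" by (simp add: group_element_def A.delta_def)
    moreover have "b \<otimes>\<^bsub>B\<^esub> A.delta \<one>\<^bsub>\<O>\<^esub> z = L.unit z"
      unfolding \<open>B = _\<close> corner_simps by (intro L.N_mult bN A.delta_GA zN A.O.one_closed)
    moreover have "b' \<otimes>\<^bsub>B'\<^esub> A.delta \<one>\<^bsub>\<O>\<^esub> z = R.unit z"
      unfolding \<open>B' = _\<close> corner_simps by (intro R.N_mult bN' A.delta_GA zN' A.O.one_closed)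
    ultimately show ?thesis by (simp only:)
  qed
  have "crossed_product \<O> \<Gamma> C \<C> B (G\<lparr>carrier := ?H\<rparr>) L.unit ?deg"
    using L.crossed_product_C unfolding L.K_def by (simp only: \<open>B = _\<close> \<open>C = _\<close> \<open>\<C> = _\<close>)
  moreover have "crossed_product \<O> \<Gamma> C' \<C>' B' (G\<lparr>carrier := ?H\<rparr>) R.unit ?deg"
    using R.crossed_product_C unfolding R.K_def by (simp only: \<open>B' = _\<close> \<open>C' = _\<close> \<open>\<C>' = _\<close>)
  ultimately have "crossed_pair \<O> \<Gamma> C \<C> B (G\<lparr>carrier := ?H\<rparr>) L.unit ?deg C' \<C>' B' R.unit M"
    by (intro crossed_pair.intro crossed_pair_axioms.intro \<open>bimodule \<O> B B' M\<close> central) simp_all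
  then show ?thesis
    by (rule crossed_pair.crossed_pair_Morita) fact
qed

end
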